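(* Let $u'$ be a regular feedback control that is a functional stop-gradient critical point of the expected lean mean-field adjoint matching loss $\mathbb E[\mathcal L_{\rm L\text{-}MFAM}(w;u)]|_{u=w}$, and assume that $\widetilde b^{u'}(t,x,\mu)=b(t,x,\mu)+\sigma_tu'(t,x,\mu)$ is continuously differentiable in $x$ and Lions differentiable in $\mu$ with $|\nabla_x\widetilde b^{u'}(t,x,\mu)|\le L_x$ and $|D_\mu\widetilde b^{u'}(t,x,\mu)(y)|\le L_\mu$ for all $t,x,\mu,y$ and some constants $L_x,L_\mu$. Then $u'$ is also a functional stop-gradient critical point of the expected basic mean-field adjoint matching loss, i.e. $$u'(t,X^{u'}_t,\mu^{u'}_t)=-\sigma_t^T\,\mathbb E\big[a(t;\mathbb X^{u'},u')\mid X^{u'}_t\big]\qquad dt\otimes d\mathbb P\text{-a.e.}$$ Consequently, if in addition $g$ is L-convex in $(x,\mu)$ and $(x,\mu,a)\mapsto H(t,x,\mu,Y^{u'}_t,Z^{u'}_t,a)$ is jointly L-convex for $dt\otimes d\mathbb P$-a.e. $(t,\omega)$, where $(Y^{u'},Z^{u'})$ are the adjoint processes associated with $u'$, then $u'$ coincides with the optimal feedback control $u^*$ of the mean-field control problem: the process $u'(t,X^{u'}_t,\mu^{u'}_t)$ is the unique (up to $dt\otimes d\mathbb P$-null sets) minimizer of $J$ over admissible controls.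
   Context: Problem. $W$ is an $m$-dimensional Brownian motion, $X_0\sim\mu_0\in\mathcal P_2(\mathbb R^d)$ (finite second moment) is independent of $W$, and $(\mathcal F_t)$ is the (completed) filtration generated by $X_0$ and $W$. Admissible controls are the $\mathbb R^m$-valued progressively measurable processes $\alpha$ with $\mathbb E\int_0^T|\alpha_t|^2dt<\infty$. Minimize $$J(\alpha)=\mathbb E\Big[\int_0^T\big(f(t,X_t,\mu_t)+\tfrac12|\alpha_t|^2\big)dt+g(X_T,\mu_T)\Big],\quad dX_t=\big(b(t,X_t,\mu_t)+\sigma_t\alpha_t\big)dt+\sigma_t\,dW_t,\quad \mu_t=\mathcal L_{X_t},$$ with $\sigma_t\in\mathbb R^{d\times m}$ deterministic. $D_\mu$ is the Lions derivative ($D_\mu h(\mathcal L_X)(X)$ represents the Fréchet derivative of the lift $X\mapsto h(\mathcal L_X)$ on $L^2(\Omega;\mathbb R^d)$; matrix-valued, row by row, for vector-valued $h$). Regularity assumptions. $\sigma$ is bounded and continuous; $\int_0^T|b(t,x,\mu)|^2dt<\infty$ for all $(x,\mu)$; $b$ is Lipschitz in $(x,\mu)$ (with the Wasserstein distance $W_2$) uniformly in $t$; $b,f$ are continuously differentiable in $x$ and Lions differentiable in $\mu$, and so is $g$; $\nabla_xb,D_\mu b$ are continuous and bounded; $\nabla_xf,D_\mu f,\nabla_xg,D_\mu g$ are continuous with at most linear growth; $f,g$ have at most quadratic growth in $x$ and the second moment of $\mu$. Regular feedback control: a continuous $u:[0,T]\times\mathbb R^d\times\mathcal P_2(\mathbb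 R^d)\to\mathbb R^m$, continuously differentiable in $x$ and Lions differentiable in $\mu$ with continuous bounded derivatives. $X^u$ is the state under $\alpha_t=u(t,X^u_t,\mu^u_t)$, $\mu^u_t=\mathcal L_{X^u_t}$, and $\mathbb X^u$ its whole path. Put $\widetilde b^u=b+\sigma_tu$ and $\widetilde f^u=f+\frac12|u|^2$ as functions of $(t,x,\mu)$. Hats denote (joint) independent copies and $\widehat{\mathbb E}$ is expectation over the copy only. Basic adjoint $a_t=a(t;\mathbb X^u,u)$: unique solution of the pathwise (non-adapted) backward ODE $$\tfrac{d}{dt}a_t=-\nabla_x\widetilde b^u(t,X^u_t,\mu^u_t)^Ta_t-\nabla_x\widetilde f^u(t,X^u_t,\mu^u_t)-\widehat{\mathbb E}\big[D_\mu\widetilde b^u(t,\widehat X^u_t,\mu^u_t)(X^u_t)^T\widehat a_t\big]-\widehat{\mathbb E}\big[D_\mu\widetilde f^u(t,\widehat X^u_t,\mu^u_t)(X^u_t)\big].$$ Lean adjoint $\widetilde a_t=\widetilde a(t;\mathbb X^u,u)$: unique solution of $$\tfrac{d}{dt}\widetilde a_t=-\nabla_xb(t,X^u_t,\mu^u_t)^T\widetilde a_t-\nabla_xf(t,X^u_t,\mu^u_t)-\widehat{\mathbb E}\big[D_\mu b(t,\widehat X^u_t,\mu^u_t)(X^u_t)^T\widehat{\widetilde a}_t\big]-\widehat{\mathbb E}\big[D_\mu f(t,\widehat X^u_t,\mu^u_t)(X^u_t)\big].$$ Both have terminal value $\nabla_xg(X^u_T,\mu^u_T)+\widehat{\mathbb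 E}[D_\mu g(\widehat X^u_T,\mu^u_T)(X^u_T)]$. Losses: $\mathcal L_{\rm B\text{-}MFAM}(w;u)=\frac12\int_0^T|w(t,X^u_t,\mu^u_t)+\sigma_t^Ta(t;\mathbb X^u,u)|^2dt$ (basic) and $\mathcal L_{\rm L\text{-}MFAM}(w;u)=\frac12\int_0^T|w(t,X^u_t,\mu^u_t)+\sigma_t^T\widetilde a(t;\mathbb X^u,u)|^2dt$ (lean). A functional stop-gradient critical point of the expected loss is a feedback $u$ such that the first variation of $w\mapsto\mathbb E[\mathcal L(w;u)]$, with the reference argument $u$ (hence $X^u$ and the adjoint) frozen, vanishes at $w=u$ in all directions that are square-integrable along $(t,X^u_t)$; equivalently $u(t,X^u_t,\mu^u_t)=-\sigma_t^T\mathbb E[\text{adjoint}_t\mid X^u_t]$ $dt\otimes d\mathbb P$-a.e., with adjoint $=a$ in the basic case and $=\widetilde a$ in the lean case. Hamiltonian: $H(t,x,\mu,y,z,a)=f(t,x,\mu)+\frac12|a|^2+(b(t,x,\mu)+\sigma_ta)^Ty+\mathrm{Tr}(\sigma_t^Tz)$. The adjoint processes $(Y^u,Z^u)$ are the square-integrable adapted solution of $$dY_t=-\Big(\nabla_xb(t,X^u_t,\mu^u_t)^TY_t+\nabla_xf(t,X^u_t,\mu^u_t)+\widehat{\mathbb E}\big[D_\mu b(t,\widehat X^u_t,\mu^u_t)(X^u_t)^T\widehat Y_t+D_\mu f(t,\widehat X^u_t,\mu^u_t)(X^u_t)\big]\Big)dt+Z_t\,dW_t,$$ $Y_T=\nabla_xg(X^u_T,\mu^u_T)+\widehat{\mathbb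 E}[D_\mu g(\widehat X^u_T,\mu^u_T)(X^u_T)]$. L-convexity of $h(x,\mu,a)$: for all $(x,\mu,a),(x',\mu',a')$ and all square-integrable $\widehat X\sim\mu$, $\widehat X'\sim\mu'$ on a common probability space, $h(x',\mu',a')\ge h(x,\mu,a)+\partial_xh(x,\mu,a)\cdot(x'-x)+\partial_ah(x,\mu,a)\cdot(a'-a)+\widehat{\mathbb E}[D_\mu h(x,\mu,a)(\widehat X)\cdot(\widehat X'-\widehat X)]$; similarly for $g(x,\mu)$ without the $a$-term. *)

theory Defs
  imports "HOL-Probability.Probability"
begin

section \<open>Square-integrable random variables, Wasserstein space\<close>

definition sq_integrable :: "'w measure \<Rightarrow> ('w \<Rightarrow> 'a::euclidean_space) \<Rightarrow> bool" where
  "sq_integrable M X \<longleftrightarrow> X \<in> borel_measurable M \<and> integrable M (\<lambda>\<omega>. (norm (X \<omega>))\<^sup>2)"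

definition L2norm :: "'w measure \<Rightarrow> ('w \<Rightarrow> 'a::euclidean_space) \<Rightarrow> real" where
  "L2norm M X = sqrt (LINT \<omega>|M. (norm (X \<omega>))\<^sup>2)"

abbreviation law :: "'w measure \<Rightarrow> ('w \<Rightarrow> 'a::euclidean_space) \<Rightarrow> 'a measure" where
  "law M X \<equiv> distr M borel X"

definition P2 :: "'a::euclidean_space measure set" where
  "P2 = {\<mu>. sets \<mu> = sets borel \<and> prob_space \<mu> \<and> integrable \<mu> (\<lambda>x. (norm x)\<^sup>2)}"

definition moment2 :: "'a::euclidean_space measure \<Rightarrow> real" where
  "moment2 \<mu> = (LINT x|\<mu>. (norm x)\<^sup>2)"

definition couplings :: "'a::euclidean_space measure \<Rightarrow> 'a measure \<Rightarrow> ('a \<times> 'a) measure set" where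
  "couplings \<mu> \<nu> =
     {\<pi>. sets \<pi> = sets borel \<and> prob_space \<pi> \<and> distr \<pi> borel fst = \<mu> \<and> distr \<pi> borel snd = \<nu>}"

text \<open>The \<open>2\<close>-Wasserstein distance; meaningful on \<open>P2\<close>, where all the integrals are finite.\<close>

definition W2 :: "'a::euclidean_space measure \<Rightarrow> 'a measure \<Rightarrow> real" where
  "W2 \<mu> \<nu> = sqrt (INF \<pi>\<in>couplings \<mu> \<nu>. LINT z|\<pi>. (norm (fst z - snd z))\<^sup>2)"

text \<open>Joint continuity on \<open>[0,T] \<times> 'p \<times> P2\<close>; the parameter \<open>'p\<close> is the state space, or the
  product of two copies of it for a Lions derivative \<open>(t, x, \<mu>, y) \<mapsto> D\<^sub>\<mu>h(t, x, \<mu>)(y)\<close>.\<close>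

definition jointly_continuous ::
    "real \<Rightarrow> (real \<Rightarrow> 'p::metric_space \<Rightarrow> 'a::euclidean_space measure \<Rightarrow> 'q::metric_space) \<Rightarrow> bool" where
  "jointly_continuous T h \<longleftrightarrow>
     (\<forall>t\<in>{0..T}. \<forall>p. \<forall>\<mu>\<in>P2. \<forall>e>0. \<exists>\<delta>>0. \<forall>t'\<in>{0..T}. \<forall>p'. \<forall>\<mu>'\<in>P2.
        dist t t' < \<delta> \<longrightarrow> dist p p' < \<delta> \<longrightarrow> W2 \<mu> \<mu>' < \<delta> \<longrightarrow>
        dist (h t p \<mu>) (h t' p' \<mu>') < e)"

section \<open>Lions derivative\<close>

text \<open>\<open>D\<close> represents the Frechet derivative of the lift \<open>X \<mapsto> h (law M X)\<close> on \<open>L\<^sup>2(M)\<close> at every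
  \<open>X\<close> with law \<open>\<mu>\<close>. The space \<open>M\<close> has to be atomless for this to be the Lions derivative; below
  \<open>M\<close> always carries a Brownian motion.\<close>

definition has_lions_derivative ::
    "'w measure \<Rightarrow> ((real^'d) measure \<Rightarrow> real) \<Rightarrow> (real^'d \<Rightarrow> real^'d) \<Rightarrow> (real^'d) measure \<Rightarrow> bool" where
  "has_lions_derivative M h D \<mu> \<longleftrightarrow>
     sq_integrable \<mu> D \<and>
     (\<forall>X. sq_integrable M X \<and> law M X = \<mu> \<longrightarrow>
        (\<forall>e>0. \<exists>\<delta>>0. \<forall>V. sq_integrable M V \<and> L2norm M V < \<delta> \<longrightarrow>
           \<bar>h (law M (\<lambda>\<omega>. X \<omega> + V \<omega>)) - h \<mu> - (LINT \<omega>|M. D (X \<omega>) \<bullet> V \<omega>)\<bar> \<le> e * L2norm M V))"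

text \<open>Vector-valued functions: one row of the matrix for each component.\<close>

definition has_lions_derivative_vec ::
    "'w measure \<Rightarrow> ((real^'d) measure \<Rightarrow> real^'k) \<Rightarrow> (real^'d \<Rightarrow> real^'d^'k) \<Rightarrow> (real^'d) measure \<Rightarrow> bool"
  where
  "has_lions_derivative_vec M h D \<mu> \<longleftrightarrow>
     (\<forall>i. has_lions_derivative M (\<lambda>\<nu>. h \<nu> $ i) (\<lambda>y. D y $ i) \<mu>)"

text \<open>\<open>hx\<close> and \<open>hm\<close> are continuous versions of \<open>\<nabla>\<^sub>xh\<close> and \<open>D\<^sub>\<mu>h\<close>. A Lions derivative at \<open>\<mu>\<close> is
  determined only \<open>\<mu>\<close>-a.e.; joint continuity singles out one version.\<close>

definition C1_scalar ::
    "'w measure \<Rightarrow> real \<Rightarrow> (real \<Rightarrow> real^'d \<Rightarrow> (real^'d) measure \<Rightarrow> real) \<Rightarrow>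
     (real \<Rightarrow> real^'d \<Rightarrow> (real^'d) measure \<Rightarrow> real^'d) \<Rightarrow>
     (real \<Rightarrow> real^'d \<Rightarrow> (real^'d) measure \<Rightarrow> real^'d \<Rightarrow> real^'d) \<Rightarrow> bool" where
  "C1_scalar M T h hx hm \<longleftrightarrow>
     (\<forall>t\<in>{0..T}. \<forall>x. \<forall>\<mu>\<in>P2.
        GDERIV (\<lambda>x'. h t x' \<mu>) x :> hx t x \<mu> \<and> has_lions_derivative M (h t x) (hm t x \<mu>) \<mu>) \<and>
     jointly_continuous T hx \<and> jointly_continuous T (\<lambda>t (x, y) \<mu>. hm t x \<mu> y)"

definition C1_vec ::
    "'w measure \<Rightarrow> real \<Rightarrow> (real \<Rightarrow> real^'d \<Rightarrow> (real^'d) measure \<Rightarrow> real^'k) \<Rightarrow>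
     (real \<Rightarrow> real^'d \<Rightarrow> (real^'d) measure \<Rightarrow> real^'d^'k) \<Rightarrow>
     (real \<Rightarrow> real^'d \<Rightarrow> (real^'d) measure \<Rightarrow> real^'d \<Rightarrow> real^'d^'k) \<Rightarrow> bool" where
  "C1_vec M T h hx hm \<longleftrightarrow>
     (\<forall>t\<in>{0..T}. \<forall>x. \<forall>\<mu>\<in>P2.
        ((\<lambda>x'. h t x' \<mu>) has_derivative (\<lambda>v. hx t x \<mu> *v v)) (at x) \<and>
        has_lions_derivative_vec M (h t x) (hm t x \<mu>) \<mu>) \<and>
     jointly_continuous T hx \<and> jointly_continuous T (\<lambda>t (x, y) \<mu>. hm t x \<mu> y)"

definition bounded_derivs ::
    "real \<Rightarrow> real \<Rightarrow> real \<Rightarrow> (real \<Rightarrow> real^'d \<Rightarrow> (real^'d) measure \<Rightarrow> real^'d^'k) \<Rightarrow>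
     (real \<Rightarrow> real^'d \<Rightarrow> (real^'d) measure \<Rightarrow> real^'d \<Rightarrow> real^'d^'k) \<Rightarrow> bool" where
  "bounded_derivs T Lx Lm hx hm \<longleftrightarrow>
     (\<forall>t\<in>{0..T}. \<forall>x. \<forall>\<mu>\<in>P2. norm (hx t x \<mu>) \<le> Lx \<and> (\<forall>y. norm (hm t x \<mu> y) \<le> Lm))"

definition linear_growth_derivs ::
    "real \<Rightarrow> (real \<Rightarrow> real^'d \<Rightarrow> (real^'d) measure \<Rightarrow> real^'d) \<Rightarrow>
     (real \<Rightarrow> real^'d \<Rightarrow> (real^'d) measure \<Rightarrow> real^'d \<Rightarrow> real^'d) \<Rightarrow> bool" where
  "linear_growth_derivs T hx hm \<longleftrightarrow>
     (\<exists>C. \<forall>t\<in>{0..T}. \<forall>x. \<forall>\<mu>\<in>P2.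
        norm (hx t x \<mu>) \<le> C * (1 + norm x + sqrt (moment2 \<mu>)) \<and>
        (\<forall>y. norm (hm t x \<mu> y) \<le> C * (1 + norm x + sqrt (moment2 \<mu>) + norm y)))"

definition quadratic_growth ::
    "real \<Rightarrow> (real \<Rightarrow> real^'d \<Rightarrow> (real^'d) measure \<Rightarrow> real) \<Rightarrow> bool" where
  "quadratic_growth T h \<longleftrightarrow>
     (\<exists>C. \<forall>t\<in>{0..T}. \<forall>x. \<forall>\<mu>\<in>P2. \<bar>h t x \<mu>\<bar> \<le> C * (1 + (norm x)\<^sup>2 + moment2 \<mu>))"

section \<open>Brownian motion, filtration, Ito integral\<close>

definition brownian_motion :: "'w measure \<Rightarrow> real \<Rightarrow> (real \<Rightarrow> 'w \<Rightarrow> real^'m) \<Rightarrow> bool" where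
  "brownian_motion M T W \<longleftrightarrow>
     (\<forall>t\<in>{0..T}. W t \<in> borel_measurable M) \<and>
     (AE \<omega> in M. W 0 \<omega> = 0) \<and>
     (AE \<omega> in M. continuous_on {0..T} (\<lambda>t. W t \<omega>)) \<and>
     (\<forall>s t i. 0 \<le> s \<and> s < t \<and> t \<le> T \<longrightarrow>
        distributed M lborel (\<lambda>\<omega>. W t \<omega> $ i - W s \<omega> $ i) (normal_density 0 (sqrt (t - s)))) \<and>
     (\<forall>(n::nat) \<tau>. (\<forall>k\<le>n. \<tau> k \<in> {0..T}) \<and> (\<forall>k<n. \<tau> k < \<tau> (Suc k)) \<longrightarrow>
        prob_space.indep_vars M (\<lambda>_. borel) (\<lambda>(k, i) \<omega>. W (\<tau> (Suc k)) \<omega> $ i - W (\<tau> k) \<omega> $ i)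
          ({..<n} \<times> UNIV))"

definition mf_space ::
    "'w measure \<Rightarrow> real \<Rightarrow> (real \<Rightarrow> 'w \<Rightarrow> real^'m) \<Rightarrow> ('w \<Rightarrow> real^'d) \<Rightarrow> (real^'d) measure \<Rightarrow> bool" where
  "mf_space M T W X0 \<mu>0 \<longleftrightarrow>
     prob_space M \<and> 0 < T \<and> brownian_motion M T W \<and>
     X0 \<in> borel_measurable M \<and> law M X0 = \<mu>0 \<and> \<mu>0 \<in> P2 \<and>
     prob_space.indep_set M
       {X0 -` A \<inter> space M | A. A \<in> sets borel}
       (sigma_sets (space M) {W s -` A \<inter> space M | s A. s \<in> {0..T} \<and> A \<in> sets borel})"

text \<open>The filtration generated by \<open>X0\<close> and \<open>W\<close>, augmented by the null sets of \<open>M\<close>; for complete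
  \<open>M\<close> this is the usual completed filtration.\<close>

definition filt :: "'w measure \<Rightarrow> (real \<Rightarrow> 'w \<Rightarrow> real^'m) \<Rightarrow> ('w \<Rightarrow> real^'d) \<Rightarrow> real \<Rightarrow> 'w measure" where
  "filt M W X0 t = sigma (space M)
     ({X0 -` A \<inter> space M | A. A \<in> sets borel} \<union>
      {W s -` A \<inter> space M | s A. s \<in> {0..t} \<and> A \<in> sets borel} \<union> null_sets M)"

definition prog_measurable ::
    "(real \<Rightarrow> 'w measure) \<Rightarrow> real \<Rightarrow> (real \<Rightarrow> 'w \<Rightarrow> 'a::euclidean_space) \<Rightarrow> bool" where
  "prog_measurable F T A \<longleftrightarrow>
     (\<forall>t\<in>{0..T}. (\<lambda>(s, \<omega>). A s \<omega>) \<in> borel_measurable (restrict_space borel {0..t} \<Otimes>\<^sub>M F t))"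

text \<open>The measure \<open>dt \<otimes> dP\<close> on \<open>[0,T] \<times> \<Omega>\<close>.\<close>

definition dtP :: "'w measure \<Rightarrow> real \<Rightarrow> (real \<times> 'w) measure" where
  "dtP M T = restrict_space lborel {0..T} \<Otimes>\<^sub>M M"

text \<open>Progressively measurable and in \<open>L\<^sup>2(dt \<otimes> dP)\<close>; for \<open>\<real>\<^sup>m\<close>-valued processes these are the
  admissible controls.\<close>

definition prog_sq_integrable ::
    "'w measure \<Rightarrow> (real \<Rightarrow> 'w measure) \<Rightarrow> real \<Rightarrow> (real \<Rightarrow> 'w \<Rightarrow> 'a::euclidean_space) \<Rightarrow> bool" where
  "prog_sq_integrable M F T A \<longleftrightarrow>
     prog_measurable F T A \<and>
     (\<integral>\<^sup>+\<omega>. (\<integral>\<^sup>+t\<in>{0..T}. ennreal ((norm (A t \<omega>))\<^sup>2) \<partial>lborel) \<partial>M) < \<infinity>"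

text \<open>\<open>I = \<integral>\<^sub>s\<^sup>t Z\<^sub>r dW\<^sub>r\<close>: the \<open>L\<^sup>2\<close>-limit of the integrals of bounded simple processes
  \<open>\<Sum>\<^sub>i \<xi>\<^sub>i 1\<^bsub>(\<tau>\<^sub>i, \<tau>\<^sub>i\<^sub>+\<^sub>1]\<^esub>\<close> converging to \<open>Z\<close> in \<open>L\<^sup>2(dt \<otimes> dP)\<close>. It is determined up to null sets.\<close>

definition simple_proc ::
    "nat \<Rightarrow> (nat \<Rightarrow> real) \<Rightarrow> (nat \<Rightarrow> 'w \<Rightarrow> real^'m^'d) \<Rightarrow> real \<Rightarrow> 'w \<Rightarrow> real^'m^'d" where
  "simple_proc n \<tau> \<xi> r \<omega> = (\<Sum>i<n. indicator {\<tau> i<..\<tau> (Suc i)} r *\<^sub>R \<xi> i \<omega>)"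

definition simple_integral ::
    "(real \<Rightarrow> 'w \<Rightarrow> real^'m) \<Rightarrow> nat \<Rightarrow> (nat \<Rightarrow> real) \<Rightarrow> (nat \<Rightarrow> 'w \<Rightarrow> real^'m^'d) \<Rightarrow> 'w \<Rightarrow> real^'d" where
  "simple_integral W n \<tau> \<xi> \<omega> = (\<Sum>i<n. \<xi> i \<omega> *v (W (\<tau> (Suc i)) \<omega> - W (\<tau> i) \<omega>))"

definition has_ito_integral ::
    "'w measure \<Rightarrow> (real \<Rightarrow> 'w measure) \<Rightarrow> (real \<Rightarrow> 'w \<Rightarrow> real^'m) \<Rightarrow> real \<Rightarrow> real \<Rightarrow>
     (real \<Rightarrow> 'w \<Rightarrow> real^'m^'d) \<Rightarrow> ('w \<Rightarrow> real^'d) \<Rightarrow> bool" where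
  "has_ito_integral M F W s t Z I \<longleftrightarrow>
     I \<in> borel_measurable M \<and>
     (\<exists>n \<tau> \<xi>.
        (\<forall>k::nat. (\<forall>i\<le>n k. \<tau> k i \<in> {s..t}) \<and> (\<forall>i<n k. \<tau> k i \<le> \<tau> k (Suc i)) \<and>
           (\<forall>i<n k. \<xi> k i \<in> borel_measurable (F (\<tau> k i)) \<and>
              (\<exists>C. \<forall>\<omega>\<in>space M. norm (\<xi> k i \<omega>) \<le> C))) \<and>
        (\<lambda>k. \<integral>\<^sup>+\<omega>. (\<integral>\<^sup>+r\<in>{s..t}. ennreal ((norm (simple_proc (n k) (\<tau> k) (\<xi> k) r \<omega> - Z r \<omega>))\<^sup>2)
           \<partial>lborel) \<partial>M) \<longlonglongrightarrow> 0 \<and>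
        (\<lambda>k. \<integral>\<^sup>+\<omega>. ennreal ((norm (simple_integral W (n k) (\<tau> k) (\<xi> k) \<omega> - I \<omega>))\<^sup>2) \<partial>M) \<longlonglongrightarrow> 0)"

section \<open>The mean-field control problem\<close>

text \<open>Regularity assumptions; \<open>bx, bm, fx, fm, gx, gm\<close> are the derivatives \<open>\<nabla>\<^sub>x\<close> and \<open>D\<^sub>\<mu>\<close> of
  \<open>b, f, g\<close>. In \<open>t\<close> alone, \<open>b\<close> and \<open>f\<close> need only be measurable.\<close>

definition mf_coefficients ::
    "'w measure \<Rightarrow> real \<Rightarrow> (real \<Rightarrow> real^'m^'d) \<Rightarrow>
     (real \<Rightarrow> real^'d \<Rightarrow> (real^'d) measure \<Rightarrow> real^'d) \<Rightarrow>
     (real \<Rightarrow> real^'d \<Rightarrow> (real^'d) measure \<Rightarrow> real^'d^'d) \<Rightarrow>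
     (real \<Rightarrow> real^'d \<Rightarrow> (real^'d) measure \<Rightarrow> real^'d \<Rightarrow> real^'d^'d) \<Rightarrow>
     (real \<Rightarrow> real^'d \<Rightarrow> (real^'d) measure \<Rightarrow> real) \<Rightarrow>
     (real \<Rightarrow> real^'d \<Rightarrow> (real^'d) measure \<Rightarrow> real^'d) \<Rightarrow>
     (real \<Rightarrow> real^'d \<Rightarrow> (real^'d) measure \<Rightarrow> real^'d \<Rightarrow> real^'d) \<Rightarrow>
     (real^'d \<Rightarrow> (real^'d) measure \<Rightarrow> real) \<Rightarrow>
     (real^'d \<Rightarrow> (real^'d) measure \<Rightarrow> real^'d) \<Rightarrow>
     (real^'d \<Rightarrow> (real^'d) measure \<Rightarrow> real^'d \<Rightarrow> real^'d) \<Rightarrow> bool" where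
  "mf_coefficients M T \<sigma> b bx bm f fx fm g gx gm \<longleftrightarrow>
     continuous_on {0..T} \<sigma> \<and> bounded (\<sigma> ` {0..T}) \<and>
     (\<forall>x. \<forall>\<mu>\<in>P2. set_borel_measurable lborel {0..T} (\<lambda>t. b t x \<mu>) \<and>
        set_integrable lborel {0..T} (\<lambda>t. (norm (b t x \<mu>))\<^sup>2)) \<and>
     (\<exists>L. \<forall>t\<in>{0..T}. \<forall>x x'. \<forall>\<mu>\<in>P2. \<forall>\<mu>'\<in>P2.
        norm (b t x \<mu> - b t x' \<mu>') \<le> L * (norm (x - x') + W2 \<mu> \<mu>')) \<and>
     C1_vec M T b bx bm \<and> (\<exists>Lx Lm. bounded_derivs T Lx Lm bx bm) \<and>
     (\<forall>x. \<forall>\<mu>\<in>P2. set_borel_measurable lborel {0..T} (\<lambda>t. f t x \<mu>)) \<and>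
     C1_scalar M T f fx fm \<and> linear_growth_derivs T fx fm \<and> quadratic_growth T f \<and>
     C1_scalar M T (\<lambda>_. g) (\<lambda>_. gx) (\<lambda>_. gm) \<and> linear_growth_derivs T (\<lambda>_. gx) (\<lambda>_. gm) \<and>
     quadratic_growth T (\<lambda>_. g)"

definition regular_feedback ::
    "'w measure \<Rightarrow> real \<Rightarrow> (real \<Rightarrow> real^'d \<Rightarrow> (real^'d) measure \<Rightarrow> real^'m) \<Rightarrow> bool" where
  "regular_feedback M T u \<longleftrightarrow>
     jointly_continuous T u \<and>
     (\<exists>ux um Lx Lm. C1_vec M T u ux um \<and> bounded_derivs T Lx Lm ux um)"

definition is_state ::
    "'w measure \<Rightarrow> real \<Rightarrow> (real \<Rightarrow> 'w \<Rightarrow> real^'m) \<Rightarrow> ('w \<Rightarrow> real^'d) \<Rightarrow>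
     (real \<Rightarrow> real^'d \<Rightarrow> (real^'d) measure \<Rightarrow> real^'d) \<Rightarrow> (real \<Rightarrow> real^'m^'d) \<Rightarrow>
     (real \<Rightarrow> 'w \<Rightarrow> real^'m) \<Rightarrow> (real \<Rightarrow> 'w \<Rightarrow> real^'d) \<Rightarrow> bool" where
  "is_state M T W X0 b \<sigma> \<alpha> X \<longleftrightarrow>
     (\<forall>t\<in>{0..T}. X t \<in> borel_measurable (filt M W X0 t)) \<and>
     (\<forall>\<omega>\<in>space M. continuous_on {0..T} (\<lambda>t. X t \<omega>)) \<and>
     (\<exists>C. \<forall>t\<in>{0..T}. sq_integrable M (X t) \<and> L2norm M (X t) \<le> C) \<and>
     (\<forall>t\<in>{0..T}. \<exists>I. has_ito_integral M (filt M W X0) W 0 t (\<lambda>r _. \<sigma> r) I \<and>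
        (AE \<omega> in M. X t \<omega> =
           X0 \<omega> + (LINT s:{0..t}|lborel. b s (X s \<omega>) (law M (X s)) + \<sigma> s *v \<alpha> s \<omega>) + I \<omega>))"

definition feedback_process ::
    "'w measure \<Rightarrow> (real \<Rightarrow> real^'d \<Rightarrow> (real^'d) measure \<Rightarrow> real^'m) \<Rightarrow>
     (real \<Rightarrow> 'w \<Rightarrow> real^'d) \<Rightarrow> real \<Rightarrow> 'w \<Rightarrow> real^'m" where
  "feedback_process M u X t \<omega> = u t (X t \<omega>) (law M (X t))"

definition cost ::
    "'w measure \<Rightarrow> real \<Rightarrow> (real \<Rightarrow> real^'d \<Rightarrow> (real^'d) measure \<Rightarrow> real) \<Rightarrow>
     (real^'d \<Rightarrow> (real^'d) measure \<Rightarrow> real) \<Rightarrow>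
     (real \<Rightarrow> 'w \<Rightarrow> real^'m) \<Rightarrow> (real \<Rightarrow> 'w \<Rightarrow> real^'d) \<Rightarrow> real" where
  "cost M T f g \<alpha> X =
     (LINT \<omega>|M. (LINT t:{0..T}|lborel. f t (X t \<omega>) (law M (X t)) + (norm (\<alpha> t \<omega>))\<^sup>2 / 2)
        + g (X T \<omega>) (law M (X T)))"

text \<open>The state \<open>X'\<close> of an admissible control \<open>\<beta>\<close> exists and is unique up to indistinguishability, so
  quantifying over the pairs \<open>(\<beta>, X')\<close> is quantifying over \<open>\<beta>\<close>, with \<open>cost M T f g \<beta> X' = J(\<beta>)\<close>.\<close>

definition unique_minimizer ::
    "'w measure \<Rightarrow> real \<Rightarrow> (real \<Rightarrow> 'w \<Rightarrow> real^'m) \<Rightarrow> ('w \<Rightarrow> real^'d) \<Rightarrow>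
     (real \<Rightarrow> real^'d \<Rightarrow> (real^'d) measure \<Rightarrow> real^'d) \<Rightarrow> (real \<Rightarrow> real^'m^'d) \<Rightarrow>
     (real \<Rightarrow> real^'d \<Rightarrow> (real^'d) measure \<Rightarrow> real) \<Rightarrow> (real^'d \<Rightarrow> (real^'d) measure \<Rightarrow> real) \<Rightarrow>
     (real \<Rightarrow> 'w \<Rightarrow> real^'m) \<Rightarrow> (real \<Rightarrow> 'w \<Rightarrow> real^'d) \<Rightarrow> bool" where
  "unique_minimizer M T W X0 b \<sigma> f g \<alpha> X \<longleftrightarrow>
     prog_sq_integrable M (filt M W X0) T \<alpha> \<and> is_state M T W X0 b \<sigma> \<alpha> X \<and>
     (\<forall>\<beta> X'. prog_sq_integrable M (filt M W X0) T \<beta> \<and> is_state M T W X0 b \<sigma> \<beta> X' \<longrightarrow>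
        cost M T f g \<alpha> X \<le> cost M T f g \<beta> X' \<and>
        (cost M T f g \<beta> X' = cost M T f g \<alpha> X \<longrightarrow> (AE (t, \<omega>) in dtP M T. \<beta> t \<omega> = \<alpha> t \<omega>)))"

section \<open>Adjoint matching\<close>

definition btilde ::
    "(real \<Rightarrow> real^'d \<Rightarrow> (real^'d) measure \<Rightarrow> real^'d) \<Rightarrow> (real \<Rightarrow> real^'m^'d) \<Rightarrow>
     (real \<Rightarrow> real^'d \<Rightarrow> (real^'d) measure \<Rightarrow> real^'m) \<Rightarrow>
     real \<Rightarrow> real^'d \<Rightarrow> (real^'d) measure \<Rightarrow> real^'d" where
  "btilde b \<sigma> u t x \<mu> = b t x \<mu> + \<sigma> t *v u t x \<mu>"

definition ftilde ::
    "(real \<Rightarrow> real^'d \<Rightarrow> (real^'d) measure \<Rightarrow> real) \<Rightarrow>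
     (real \<Rightarrow> real^'d \<Rightarrow> (real^'d) measure \<Rightarrow> real^'m) \<Rightarrow>
     real \<Rightarrow> real^'d \<Rightarrow> (real^'d) measure \<Rightarrow> real" where
  "ftilde f u t x \<mu> = f t x \<mu> + (norm (u t x \<mu>))\<^sup>2 / 2"

text \<open>The pathwise backward ODE. With the derivatives of \<open>b, f\<close> it is the lean adjoint, with
  those of \<open>btilde b \<sigma> u, ftilde f u\<close> the basic one. The expectation over the independent copy is
  the integral over the second sample point \<open>\<omega>'\<close>, i.e. over the second factor of \<open>M \<otimes> M\<close>. The
  \<open>L\<^sup>2\<close>-bound is the class in which the equation is uniquely solvable.\<close>

definition is_adjoint ::
    "'w measure \<Rightarrow> real \<Rightarrow> (real \<Rightarrow> 'w \<Rightarrow> real^'d) \<Rightarrow>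
     (real \<Rightarrow> real^'d \<Rightarrow> (real^'d) measure \<Rightarrow> real^'d^'d) \<Rightarrow>
     (real \<Rightarrow> real^'d \<Rightarrow> (real^'d) measure \<Rightarrow> real^'d \<Rightarrow> real^'d^'d) \<Rightarrow>
     (real \<Rightarrow> real^'d \<Rightarrow> (real^'d) measure \<Rightarrow> real^'d) \<Rightarrow>
     (real \<Rightarrow> real^'d \<Rightarrow> (real^'d) measure \<Rightarrow> real^'d \<Rightarrow> real^'d) \<Rightarrow>
     (real^'d \<Rightarrow> (real^'d) measure \<Rightarrow> real^'d) \<Rightarrow>
     (real^'d \<Rightarrow> (real^'d) measure \<Rightarrow> real^'d \<Rightarrow> real^'d) \<Rightarrow>
     (real \<Rightarrow> 'w \<Rightarrow> real^'d) \<Rightarrow> bool" where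
  "is_adjoint M T X bx bm fx fm gx gm a \<longleftrightarrow>
     (\<exists>C. \<forall>t\<in>{0..T}. sq_integrable M (a t) \<and> L2norm M (a t) \<le> C) \<and>
     (\<forall>\<omega>\<in>space M.
        a T \<omega> = gx (X T \<omega>) (law M (X T)) + (LINT \<omega>'|M. gm (X T \<omega>') (law M (X T)) (X T \<omega>)) \<and>
        (\<forall>t\<in>{0..T}. ((\<lambda>s. a s \<omega>) has_vector_derivative
            (- (transpose (bx t (X t \<omega>) (law M (X t))) *v a t \<omega>)
             - fx t (X t \<omega>) (law M (X t))
             - (LINT \<omega>'|M. transpose (bm t (X t \<omega>') (law M (X t)) (X t \<omega>)) *v a t \<omega>')
             - (LINT \<omega>'|M. fm t (X t \<omega>') (law M (X t)) (X t \<omega>)))) (at t within {0..T})))"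

text \<open>The adjoint matching loss of \<open>w\<close>, with the state \<open>X\<close> and the adjoint \<open>a\<close> of the reference
  control frozen.\<close>

definition mfam_loss ::
    "'w measure \<Rightarrow> real \<Rightarrow> (real \<Rightarrow> real^'m^'d) \<Rightarrow> (real \<Rightarrow> 'w \<Rightarrow> real^'d) \<Rightarrow> (real \<Rightarrow> 'w \<Rightarrow> real^'d) \<Rightarrow>
     (real \<Rightarrow> real^'d \<Rightarrow> (real^'d) measure \<Rightarrow> real^'m) \<Rightarrow> 'w \<Rightarrow> real" where
  "mfam_loss M T \<sigma> X a w \<omega> =
     (LINT t:{0..T}|lborel. (norm (w t (X t \<omega>) (law M (X t)) + transpose (\<sigma> t) *v a t \<omega>))\<^sup>2) / 2"

text \<open>The measure argument of \<open>w\<close> is only ever evaluated at the frozen flow \<open>law M (X t)\<close>, so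
  directions are functions of \<open>(t, x)\<close>.\<close>

definition stop_gradient_critical ::
    "'w measure \<Rightarrow> real \<Rightarrow> (real \<Rightarrow> real^'m^'d) \<Rightarrow> (real \<Rightarrow> 'w \<Rightarrow> real^'d) \<Rightarrow> (real \<Rightarrow> 'w \<Rightarrow> real^'d) \<Rightarrow>
     (real \<Rightarrow> real^'d \<Rightarrow> (real^'d) measure \<Rightarrow> real^'m) \<Rightarrow> bool" where
  "stop_gradient_critical M T \<sigma> X a u \<longleftrightarrow>
     (\<forall>v :: real \<Rightarrow> real^'d \<Rightarrow> real^'m.
        (\<lambda>(t, x). v t x) \<in> borel_measurable (borel \<Otimes>\<^sub>M borel) \<longrightarrow>
        (\<integral>\<^sup>+\<omega>. (\<integral>\<^sup>+t\<in>{0..T}. ennreal ((norm (v t (X t \<omega>)))\<^sup>2) \<partial>lborel) \<partial>M) < \<infinity> \<longrightarrow>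
        ((\<lambda>e. LINT \<omega>|M. mfam_loss M T \<sigma> X a (\<lambda>t x \<mu>. u t x \<mu> + e *\<^sub>R v t x) \<omega>)
           has_real_derivative 0) (at 0))"

text \<open>Componentwise conditional expectation given \<open>\<sigma>(Y)\<close>. For a process \<open>t \<mapsto> A t\<close> the versions are
  chosen for each \<open>t\<close> separately, hence need not be jointly measurable in \<open>(t, \<omega>)\<close>: an identity
  \<open>dt \<otimes> dP\<close>-a.e. has to be read as \<open>dP\<close>-a.e. for \<open>dt\<close>-almost every \<open>t\<close>.\<close>

definition cond_exp_given ::
    "'w measure \<Rightarrow> ('w \<Rightarrow> real^'d) \<Rightarrow> ('w \<Rightarrow> real^'k) \<Rightarrow> 'w \<Rightarrow> real^'k" where
  "cond_exp_given M Y A \<omega> =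
     (\<chi> i. real_cond_exp M (vimage_algebra (space M) Y borel) (\<lambda>\<omega>'. A \<omega>' $ i) \<omega>)"

section \<open>Hamiltonian, adjoint processes, L-convexity\<close>

definition hamiltonian ::
    "(real \<Rightarrow> real^'d \<Rightarrow> (real^'d) measure \<Rightarrow> real^'d) \<Rightarrow> (real \<Rightarrow> real^'m^'d) \<Rightarrow>
     (real \<Rightarrow> real^'d \<Rightarrow> (real^'d) measure \<Rightarrow> real) \<Rightarrow>
     real \<Rightarrow> real^'d \<Rightarrow> (real^'d) measure \<Rightarrow> real^'d \<Rightarrow> real^'m^'d \<Rightarrow> real^'m \<Rightarrow> real" where
  "hamiltonian b \<sigma> f t x \<mu> y z a =
     f t x \<mu> + (norm a)\<^sup>2 / 2 + (b t x \<mu> + \<sigma> t *v a) \<bullet> y + trace (transpose (\<sigma> t) ** z)"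

text \<open>The backward SDE in integral form,
  \<open>Y\<^sub>t = Y\<^sub>T + \<integral>\<^sub>t\<^sup>T (driver) ds - \<integral>\<^sub>t\<^sup>T Z\<^sub>s dW\<^sub>s\<close> with the terminal value inserted.\<close>

definition adjoint_processes ::
    "'w measure \<Rightarrow> real \<Rightarrow> (real \<Rightarrow> 'w \<Rightarrow> real^'m) \<Rightarrow> ('w \<Rightarrow> real^'d) \<Rightarrow> (real \<Rightarrow> 'w \<Rightarrow> real^'d) \<Rightarrow>
     (real \<Rightarrow> real^'d \<Rightarrow> (real^'d) measure \<Rightarrow> real^'d^'d) \<Rightarrow>
     (real \<Rightarrow> real^'d \<Rightarrow> (real^'d) measure \<Rightarrow> real^'d \<Rightarrow> real^'d^'d) \<Rightarrow>
     (real \<Rightarrow> real^'d \<Rightarrow> (real^'d) measure \<Rightarrow> real^'d) \<Rightarrow>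
     (real \<Rightarrow> real^'d \<Rightarrow> (real^'d) measure \<Rightarrow> real^'d \<Rightarrow> real^'d) \<Rightarrow>
     (real^'d \<Rightarrow> (real^'d) measure \<Rightarrow> real^'d) \<Rightarrow>
     (real^'d \<Rightarrow> (real^'d) measure \<Rightarrow> real^'d \<Rightarrow> real^'d) \<Rightarrow>
     (real \<Rightarrow> 'w \<Rightarrow> real^'d) \<Rightarrow> (real \<Rightarrow> 'w \<Rightarrow> real^'m^'d) \<Rightarrow> bool" where
  "adjoint_processes M T W X0 X bx bm fx fm gx gm Y Z \<longleftrightarrow>
     prog_measurable (filt M W X0) T Y \<and>
     (\<exists>C. \<forall>t\<in>{0..T}. sq_integrable M (Y t) \<and> L2norm M (Y t) \<le> C) \<and>
     prog_sq_integrable M (filt M W X0) T Z \<and>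
     (\<forall>t\<in>{0..T}. \<exists>I. has_ito_integral M (filt M W X0) W t T Z I \<and>
        (AE \<omega> in M. Y t \<omega> =
           gx (X T \<omega>) (law M (X T)) + (LINT \<omega>'|M. gm (X T \<omega>') (law M (X T)) (X T \<omega>))
           + (LINT s:{t..T}|lborel.
                transpose (bx s (X s \<omega>) (law M (X s))) *v Y s \<omega> + fx s (X s \<omega>) (law M (X s))
                + (LINT \<omega>'|M. transpose (bm s (X s \<omega>') (law M (X s)) (X s \<omega>)) *v Y s \<omega>'
                     + fm s (X s \<omega>') (law M (X s)) (X s \<omega>)))
           - I \<omega>))"

text \<open>The probability space \<open>N\<close> carrying the two variables ranges over the measures on the product
  type, which realize every joint law.\<close>

definition L_convex ::
    "'w measure \<Rightarrow> (real^'d \<Rightarrow> (real^'d) measure \<Rightarrow> real^'m \<Rightarrow> real) \<Rightarrow> bool" where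
  "L_convex M h \<longleftrightarrow>
     (\<exists>hx hm ha.
        (\<forall>x. \<forall>\<mu>\<in>P2. \<forall>a.
           GDERIV (\<lambda>x'. h x' \<mu> a) x :> hx x \<mu> a \<and>
           GDERIV (\<lambda>a'. h x \<mu> a') a :> ha x \<mu> a \<and>
           has_lions_derivative M (\<lambda>\<nu>. h x \<nu> a) (hm x \<mu> a) \<mu>) \<and>
        (\<forall>x x' a a'. \<forall>\<mu>\<in>P2. \<forall>\<mu>'\<in>P2. \<forall>(N :: ((real^'d) \<times> (real^'d)) measure) V V'.
           prob_space N \<and> sq_integrable N V \<and> sq_integrable N V' \<and> law N V = \<mu> \<and> law N V' = \<mu>' \<longrightarrow>
           h x' \<mu>' a' \<ge> h x \<mu> a + hx x \<mu> a \<bullet> (x' - x) + ha x \<mu> a \<bullet> (a' - a)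
             + (LINT z|N. hm x \<mu> a (V z) \<bullet> (V' z - V z))))"

definition L_convex_terminal ::
    "'w measure \<Rightarrow> (real^'d \<Rightarrow> (real^'d) measure \<Rightarrow> real) \<Rightarrow> bool" where
  "L_convex_terminal M h \<longleftrightarrow>
     (\<exists>hx hm.
        (\<forall>x. \<forall>\<mu>\<in>P2.
           GDERIV (\<lambda>x'. h x' \<mu>) x :> hx x \<mu> \<and> has_lions_derivative M (h x) (hm x \<mu>) \<mu>) \<and>
        (\<forall>x x'. \<forall>\<mu>\<in>P2. \<forall>\<mu>'\<in>P2. \<forall>(N :: ((real^'d) \<times> (real^'d)) measure) V V'.
           prob_space N \<and> sq_integrable N V \<and> sq_integrable N V' \<and> law N V = \<mu> \<and> law N V' = \<mu>' \<longrightarrow>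
           h x' \<mu>' \<ge> h x \<mu> + hx x \<mu> \<bullet> (x' - x) + (LINT z|N. hm x \<mu> (V z) \<bullet> (V' z - V z))))"

end

theory Submission
  imports Defs
begin

text \<open>Write \<open>a'\<close> for the lean and \<open>a\<close> for the basic adjoint, \<open>p = u + \<sigma>\<^sup>T a'\<close>, and \<open>F t\<close> for the filtration.
  Criticality means \<open>E[p t | X t] = 0\<close>. Under a feedback control the state is Markov: \<open>X s\<close> for \<open>s \<ge> t\<close>, and
  hence \<open>a' t\<close>, is a function of \<open>X t\<close> and of the Brownian increments after \<open>t\<close>, which are independent of
  \<open>F t\<close>; therefore even \<open>E[p t | F t] = 0\<close>. The difference \<open>a - a'\<close> solves a linear backward equation with
  zero terminal value, whose source is \<open>(\<nabla>u)\<^sup>T p\<close> and its mean-field counterpart; conditioning on the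
  past removes the source, and Gronwall gives \<open>E[a t - a' t | F t] = 0\<close>. This is criticality for the basic
  loss. In the same way \<open>E[Y t - a' t | F t] = 0\<close>, so that in the convexity inequality of the Hamiltonian \<open>Y\<close> may
  be replaced by \<open>a'\<close>. As \<open>a'\<close> is differentiable in time, an ordinary integration by parts
  then yields \<open>J(\<beta>) - J(\<alpha>) \<ge> 1/2 E \<integral> |\<beta> - \<alpha>|\<^sup>2 dt\<close>.\<close>

text \<open>The obstacle is measurability. Conditional expectations are fixed at one time after
  another, so the norms in the Gronwall arguments need not be measurable in time and are never
  integrated. Every equation is used in weak form: it is tested with a random variable
  \<open>U\<close>, time and expectation are exchanged by Fubini for the process itself, and the
  unknown norm is only compared with continuous majorants.

  The Markov property does not come from a solution flow. Let \<open>G t\<close> be generated by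
  \<open>X t\<close>, the increments of \<open>W\<close> after \<open>t\<close> and the null sets.
  The distance of \<open>X s\<close> to L2(\<open>G t\<close>) satisfies a Gronwall inequality and
  vanishes; the same argument run backward from \<open>T\<close> covers the lean adjoint. The noise
  leaves the tested equation because the integral of the deterministic \<open>\<sigma>\<close> is an
  L2-limit of sums of increments.

  The constant 1/2 in the cost gap is that of the control cost: convexity of the Hamiltonian is
  evaluated at control \<open>0\<close>, and the quadratic control terms are expanded
  exactly.\<close>

type_synonym ('d, 'e) coeff = "real \<Rightarrow> real^'d \<Rightarrow> (real^'d) measure \<Rightarrow> 'e"

text \<open>The simplifier would turn \<open>transpose A *v x\<close> into \<open>x v* A\<close>;
  the adjoint drifts and the duality \<open>inner_matrix_transpose\<close> are written with
  \<open>transpose\<close>.\<close>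

declare transpose_matrix_vector [simp del]

section \<open>Square-integrable random variables\<close>

abbreviation L2 :: "'w measure \<Rightarrow> ('w \<Rightarrow> 'a::euclidean_space) \<Rightarrow> bool" where "L2 \<equiv> sq_integrable"

abbreviation (in prob_space) ip :: "('a \<Rightarrow> 'e::euclidean_space) \<Rightarrow> ('a \<Rightarrow> 'e) \<Rightarrow> real"
  where "ip U V \<equiv> (LINT w|M. U w \<bullet> V w)"

lemma L2_measurable [measurable_dest]: "L2 M X \<Longrightarrow> X \<in> borel_measurable M"
  by (simp add: sq_integrable_def)

lemma L2_norm_sq: "L2 M X \<Longrightarrow> integrable M (\<lambda>w. (norm (X w))\<^sup>2)"
  by (simp add: sq_integrable_def)

lemma L2_bound:
  assumes "L2 M X" and [measurable]: "Y \<in> borel_measurable M"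
    and "AE w in M. norm (Y w) \<le> C * norm (X w)"
  shows "L2 M Y"
proof -
  have "integrable M (\<lambda>w. (norm (Y w))\<^sup>2)"
  proof (rule Bochner_Integration.integrable_bound)
    show "integrable M (\<lambda>w. C\<^sup>2 * (norm (X w))\<^sup>2)"
      using L2_norm_sq[OF assms(1)] by simp
    show "AE w in M. norm ((norm (Y w))\<^sup>2) \<le> norm (C\<^sup>2 * (norm (X w))\<^sup>2)"
      using assms(3)
    proof eventually_elim
      case (elim w)
      then have "(norm (Y w))\<^sup>2 \<le> (C * norm (X w))\<^sup>2"
        by (intro power_mono) auto
      then show ?case by (simp add: power_mult_distrib)
    qed
  qed simp
  then show ?thesis by (simp add: sq_integrable_def)
qed

lemma L2_cong_AE:
  assumes "L2 M X" "Y \<in> borel_measurable M" "AE w in M. X w = Y w"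
  shows "L2 M Y"
  by (rule L2_bound[OF assms(1,2), of 1]) (use assms(3) in auto)

lemma L2_inner:
  assumes [measurable]: "L2 M X" "L2 M Y"
  shows "integrable M (\<lambda>w. X w \<bullet> Y w)"
proof (rule Bochner_Integration.integrable_bound)
  show "integrable M (\<lambda>w. (norm (X w))\<^sup>2 + (norm (Y w))\<^sup>2)"
    using assms by (auto simp: sq_integrable_def)
  show "AE w in M. norm (X w \<bullet> Y w) \<le> norm ((norm (X w))\<^sup>2 + (norm (Y w))\<^sup>2)"
  proof (intro AE_I2)
    fix w
    have "\<bar>X w \<bullet> Y w\<bar> \<le> norm (X w) * norm (Y w)" by (rule Cauchy_Schwarz_ineq2)
    also have "\<dots> \<le> (norm (X w))\<^sup>2 + (norm (Y w))\<^sup>2"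
      using sum_squares_bound[of "norm (X w)" "norm (Y w)"]
        mult_nonneg_nonneg[OF norm_ge_zero norm_ge_zero, of "X w" "Y w"] by linarith
    finally show "norm (X w \<bullet> Y w) \<le> norm ((norm (X w))\<^sup>2 + (norm (Y w))\<^sup>2)" by simp
  qed
qed measurable

lemma L2_add:
  assumes [measurable]: "L2 M X" "L2 M Y"
  shows "L2 M (\<lambda>w. X w + Y w)"
proof -
  have "integrable M (\<lambda>w. (norm (X w))\<^sup>2 + (norm (Y w))\<^sup>2 + 2 * (X w \<bullet> Y w))"
    using assms L2_inner[OF assms] by (auto simp: sq_integrable_def)
  then have "integrable M (\<lambda>w. (norm (X w + Y w))\<^sup>2)"
    by (simp add: power2_norm_eq_inner inner_add_left inner_add_right inner_commute algebra_simps)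
  moreover have "(\<lambda>w. X w + Y w) \<in> borel_measurable M" by measurable
  ultimately show ?thesis by (simp add: sq_integrable_def)
qed

lemma L2_scaleR: "L2 M X \<Longrightarrow> L2 M (\<lambda>w. c *\<^sub>R X w)"
  by (rule L2_bound[of M X _ "\<bar>c\<bar>"]) auto

lemma L2_uminus: "L2 M X \<Longrightarrow> L2 M (\<lambda>w. - X w)"
  by (rule L2_bound[of M X _ 1]) auto

lemma L2_diff:
  "L2 M X \<Longrightarrow> L2 M Y \<Longrightarrow> L2 M (\<lambda>w. X w - Y w)"
  using L2_add[of M X "\<lambda>w. - Y w"] L2_uminus[of M Y] by simp

lemma L2_zero [simp]: "L2 M (\<lambda>w. 0)"
  by (simp add: sq_integrable_def)

lemma (in finite_measure) L2_const: "L2 M (\<lambda>w. c)"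
  by (simp add: sq_integrable_def)

lemma (in finite_measure) L2_bounded:
  assumes "X \<in> borel_measurable M" "\<And>w. w \<in> space M \<Longrightarrow> norm (X w) \<le> C"
  shows "L2 M X"
  by (rule L2_bound[OF L2_const[of "1::real"] assms(1), of C]) (use assms(2) in auto)

lemma (in finite_measure) L2_integrable:
  assumes "L2 M X" shows "integrable M X"
proof -
  have [measurable]: "X \<in> borel_measurable M" using assms by measurable
  have "integrable M (\<lambda>w. norm (X w))"
  proof (rule Bochner_Integration.integrable_bound)
    show "integrable M (\<lambda>w. 1 + (norm (X w))\<^sup>2)"
      using L2_norm_sq[OF assms] by simp
    show "AE w in M. norm (norm (X w)) \<le> norm (1 + (norm (X w))\<^sup>2)"
    proof (intro AE_I2)
      fix w
      show "norm (norm (X w)) \<le> norm (1 + (norm (X w))\<^sup>2)"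
      proof -
        have "norm (X w) \<le> 2 * norm (X w)" by simp
        also have "\<dots> \<le> 1 + (norm (X w))\<^sup>2" using sum_squares_bound[of 1 "norm (X w)"] by simp
        finally show ?thesis by simp
      qed
    qed
  qed simp
  then show ?thesis by (simp add: integrable_norm_iff)
qed

lemma borel_measurable_vec_nth [measurable (raw)]:
  fixes X :: "'w \<Rightarrow> 'a::euclidean_space^'d"
  assumes "X \<in> borel_measurable M"
  shows "(\<lambda>w. X w $ i) \<in> borel_measurable M"
proof -
  have "(\<lambda>x::'a^'d. x $ i) \<in> borel_measurable borel"
    by (intro borel_measurable_continuous_onI continuous_on_component continuous_on_id)
  from measurable_compose[OF assms this] show ?thesis .
qed

lemma L2_component:
  fixes X :: "'w \<Rightarrow> real^'d"
  assumes "L2 M X" shows "L2 M (\<lambda>w. X w $ i)"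
  by (rule L2_bound[OF assms, of _ 1]) (use assms in \<open>auto simp: component_le_norm_cart sq_integrable_def\<close>)

lemma borel_measurable_vec_nthI:
  fixes X :: "'w \<Rightarrow> 'a::euclidean_space^'d"
  assumes "\<And>i. (\<lambda>w. X w $ i) \<in> borel_measurable M"
  shows "X \<in> borel_measurable M"
proof (rule borel_measurable_euclidean_space[THEN iffD2], intro ballI)
  fix e :: "'a^'d" assume "e \<in> Basis"
  then obtain b i where e: "e = axis i b" by (auto simp: Basis_vec_def)
  have "(\<lambda>w. X w \<bullet> e) = (\<lambda>w. X w $ i \<bullet> b)" by (simp add: e inner_axis)
  then show "(\<lambda>w. X w \<bullet> e) \<in> borel_measurable M" using assms by simp
qed

lemma L2norm_nonneg [simp]: "0 \<le> L2norm M X"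
  by (simp add: L2norm_def)

lemma L2norm_power2: "(L2norm M X)\<^sup>2 = (LINT w|M. (norm (X w))\<^sup>2)"
  by (simp add: L2norm_def)

lemma L2norm_power2_inner: "(L2norm M X)\<^sup>2 = (LINT w|M. X w \<bullet> X w)"
  by (simp add: L2norm_power2 power2_norm_eq_inner)

lemma L2norm_cong_AE:
  assumes "AE w in M. X w = Y w" "X \<in> borel_measurable M" "Y \<in> borel_measurable M"
  shows "L2norm M X = L2norm M Y"
proof -
  have [measurable]: "X \<in> borel_measurable M" "Y \<in> borel_measurable M" by fact+
  show ?thesis unfolding L2norm_def
    by (intro arg_cong[where f=sqrt] integral_cong_AE) (use assms(1) in auto)
qed

lemma L2norm_uminus [simp]: "L2norm M (\<lambda>w. - X w) = L2norm M X"
  by (simp add: L2norm_def)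

lemma L2norm_minus_commute: "L2norm M (\<lambda>w. X w - Y w) = L2norm M (\<lambda>w. Y w - X w)"
  by (simp add: L2norm_def norm_minus_commute)

lemma L2norm_scaleR: "L2norm M (\<lambda>w. c *\<^sub>R X w) = \<bar>c\<bar> * L2norm M X"
  by (simp add: L2norm_def power_mult_distrib real_sqrt_mult)

text \<open>A non-integrable \<open>h\<close> has integral \<open>0\<close>, which the nonnegative
  majorant still dominates; hence a pointwise bound is enough.\<close>

lemma norm_integral_le:
  fixes h :: "'w \<Rightarrow> 'e::{banach, second_countable_topology}"
  assumes q: "integrable M q" and le: "\<And>w. w \<in> space M \<Longrightarrow> norm (h w) \<le> q w"
  shows "norm (LINT w|M. h w) \<le> (LINT w|M. q w)"
proof (cases "integrable M h")
  case True
  have "norm (LINT w|M. h w) \<le> (LINT w|M. norm (h w))" by (rule integral_norm_bound)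
  also have "\<dots> \<le> (LINT w|M. q w)" using True q le by (intro integral_mono) auto
  finally show ?thesis .
next
  case False
  then have "norm (LINT w|M. h w) = 0" by (simp add: not_integrable_integral_eq)
  also have "0 \<le> (LINT w|M. q w)" using order_trans[OF norm_ge_zero le] by (intro integral_nonneg_AE AE_I2) auto
  finally show ?thesis .
qed

text \<open>The polynomial \<open>s \<mapsto> E |X - s Y|^2\<close> is nonnegative, so its
  discriminant is not positive.\<close>

lemma L2_Cauchy_Schwarz:
  assumes X: "L2 M X" and Y: "L2 M Y"
  shows "\<bar>LINT w|M. X w \<bullet> Y w\<bar> \<le> L2norm M X * L2norm M Y"
proof -
  define a b c where "a = (L2norm M X)\<^sup>2" and "b = (LINT w|M. X w \<bullet> Y w)" and "c = (L2norm M Y)\<^sup>2"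
  note int = L2_inner[OF X X] L2_inner[OF Y Y] L2_inner[OF X Y]
  have quad: "0 \<le> a - 2 * s * b + s\<^sup>2 * c" for s
  proof -
    have "0 \<le> (LINT w|M. (X w - s *\<^sub>R Y w) \<bullet> (X w - s *\<^sub>R Y w))"
      by (rule integral_nonneg_AE) simp
    also have "\<dots> = (LINT w|M. X w \<bullet> X w - 2 * s * (X w \<bullet> Y w) + s\<^sup>2 * (Y w \<bullet> Y w))"
      by (simp add: inner_diff_left inner_diff_right inner_commute algebra_simps power2_eq_square)
    also have "\<dots> = a - 2 * s * b + s\<^sup>2 * c"
      using int by (simp add: a_def b_def c_def L2norm_power2_inner)
    finally show ?thesis .
  qed
  have "b\<^sup>2 \<le> a * c"
  proof (cases "c = 0")
    case True
    have "b = 0"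
    proof (rule ccontr)
      assume "b \<noteq> 0"
      \<comment> \<open>With \<open>c = 0\<close> the polynomial is affine, and at this
        \<open>s\<close> its value is \<open>- 1\<close>.\<close>
      with quad[of "(a + 1) / (2 * b)"] True show False by simp
    qed
    then show ?thesis using True by simp
  next
    case False
    then have "c > 0" by (simp add: c_def)
    with quad[of "b / c"] show ?thesis by (simp add: power2_eq_square field_simps)
  qed
  then have "sqrt (b\<^sup>2) \<le> sqrt (a * c)" by (rule real_sqrt_le_mono)
  then show ?thesis by (simp add: a_def b_def c_def real_sqrt_mult)
qed

lemma L2norm_triangle:
  assumes X: "L2 M X" and Y: "L2 M Y"
  shows "L2norm M (\<lambda>w. X w + Y w) \<le> L2norm M X + L2norm M Y"
proof (rule power2_le_imp_le)
  note int = L2_inner[OF X X] L2_inner[OF Y Y] L2_inner[OF X Y]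
  have "(L2norm M (\<lambda>w. X w + Y w))\<^sup>2
      = (LINT w|M. X w \<bullet> X w + 2 * (X w \<bullet> Y w) + Y w \<bullet> Y w)"
    by (simp add: L2norm_power2_inner inner_add_left inner_add_right inner_commute algebra_simps)
  also have "\<dots> = (L2norm M X)\<^sup>2 + 2 * (LINT w|M. X w \<bullet> Y w) + (L2norm M Y)\<^sup>2"
    using int by (simp add: L2norm_power2_inner)
  also have "\<dots> \<le> (L2norm M X + L2norm M Y)\<^sup>2"
    using L2_Cauchy_Schwarz[OF X Y] by (simp add: power2_sum)
  finally show "(L2norm M (\<lambda>w. X w + Y w))\<^sup>2 \<le> (L2norm M X + L2norm M Y)\<^sup>2" .
qed simp

lemma L2norm_mono:
  assumes "L2 M X" "Y \<in> borel_measurable M" "AE w in M. norm (Y w) \<le> C * norm (X w)" "0 \<le> C"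
  shows "L2norm M Y \<le> C * L2norm M X"
proof -
  have "L2 M Y" by (rule L2_bound[OF assms(1-3)])
  then have "(LINT w|M. (norm (Y w))\<^sup>2) \<le> (LINT w|M. C\<^sup>2 * (norm (X w))\<^sup>2)"
  proof (intro integral_mono_AE)
    show "AE w in M. (norm (Y w))\<^sup>2 \<le> C\<^sup>2 * (norm (X w))\<^sup>2"
      using assms(3)
    proof eventually_elim
      case (elim w)
      then have "(norm (Y w))\<^sup>2 \<le> (C * norm (X w))\<^sup>2" by (intro power_mono) auto
      then show ?case by (simp add: power_mult_distrib)
    qed
  qed (use assms(1) in \<open>auto simp: sq_integrable_def\<close>)
  then have "(L2norm M Y)\<^sup>2 \<le> (C * L2norm M X)\<^sup>2" by (simp add: L2norm_power2 power_mult_distrib)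
  then show ?thesis by (rule power2_le_imp_le) (use assms(4) in simp)
qed

lemma L2norm_eq_0_AE:
  assumes "L2 M X" "L2norm M X = 0"
  shows "AE w in M. X w = 0"
proof -
  have "(LINT w|M. (norm (X w))\<^sup>2) = 0" using assms(2) L2norm_power2[of M X] by simp
  then have "AE w in M. (norm (X w))\<^sup>2 = 0"
    using integral_nonneg_eq_0_iff_AE[OF L2_norm_sq[OF assms(1)]] by simp
  then show ?thesis by simp
qed

lemma (in prob_space) L2norm_const: "L2norm M (\<lambda>w. c) = norm c"
  by (simp add: L2norm_def prob_space)

text \<open>Cauchy-Schwarz against the constant \<open>1\<close>, which has norm \<open>1\<close> on
  a probability space.\<close>

lemma (in prob_space) integral_norm_le_L2norm:
  assumes "L2 M X"
  shows "(LINT w|M. norm (X w)) \<le> L2norm M X"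
proof -
  have "L2 M (\<lambda>w. norm (X w))"
    by (rule L2_bound[OF assms, of _ 1]) (use assms in auto)
  then have "\<bar>LINT w|M. norm (X w) \<bullet> 1\<bar> \<le> L2norm M (\<lambda>w. norm (X w)) * L2norm M (\<lambda>w. 1::real)"
    by (rule L2_Cauchy_Schwarz) (rule L2_const)
  then show ?thesis using L2norm_const[of "1::real"] by (simp add: L2norm_def)
qed

lemma matrix_vector_mult_measurable [measurable (raw)]:
  fixes A :: "'w \<Rightarrow> real^'n^'k"
  assumes [measurable]: "A \<in> borel_measurable M" "x \<in> borel_measurable M"
  shows "(\<lambda>w. A w *v x w) \<in> borel_measurable M"
proof (rule borel_measurable_vec_nthI)
  fix i
  have "(\<lambda>w. (A w *v x w) $ i) = (\<lambda>w. A w $ i \<bullet> x w)"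
    by (simp add: matrix_vector_mul_component)
  then show "(\<lambda>w. (A w *v x w) $ i) \<in> borel_measurable M" by (simp add: borel_measurable_vec_nth)
qed

lemma transpose_measurable [measurable (raw)]:
  fixes A :: "'w \<Rightarrow> real^'n^'k"
  assumes [measurable]: "A \<in> borel_measurable M"
  shows "(\<lambda>w. transpose (A w)) \<in> borel_measurable M"
proof (intro borel_measurable_vec_nthI)
  fix i j
  have "(\<lambda>w. transpose (A w) $ i $ j) = (\<lambda>w. A w $ j $ i)" by (simp add: transpose_def)
  then show "(\<lambda>w. transpose (A w) $ i $ j) \<in> borel_measurable M" by (simp add: borel_measurable_vec_nth)
qed

text \<open>The norm on \<open>real^'n^'k\<close> is the Frobenius norm: the bound is Cauchy-Schwarz
  in each row, summed over the rows.\<close>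

lemma norm_matrix_vector_mult_le:
  fixes A :: "real^'n^'k"
  shows "norm (A *v x) \<le> norm A * norm x"
proof (rule power2_le_imp_le)
  have "(norm (A *v x))\<^sup>2 = (\<Sum>i\<in>UNIV. (A $ i \<bullet> x)\<^sup>2)"
    by (simp add: norm_vec_def L2_set_def sum_nonneg matrix_vector_mul_component)
  also have "\<dots> \<le> (\<Sum>i\<in>UNIV. (norm (A $ i))\<^sup>2 * (norm x)\<^sup>2)"
    by (intro sum_mono) (simp add: Cauchy_Schwarz_ineq power2_norm_eq_inner)
  also have "\<dots> = (norm A * norm x)\<^sup>2"
    by (simp add: norm_vec_def L2_set_def sum_nonneg sum_distrib_right power_mult_distrib)
  finally show "(norm (A *v x))\<^sup>2 \<le> (norm A * norm x)\<^sup>2" .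
qed simp

lemma norm_transpose [simp]: "norm (transpose (A :: real^'n^'k)) = norm A"
proof -
  have "(\<Sum>i\<in>UNIV. (norm (transpose A $ i))\<^sup>2) = (\<Sum>i\<in>UNIV. (norm (A $ i))\<^sup>2)"
    by (simp add: norm_vec_def L2_set_def sum_nonneg transpose_def) (rule sum.swap)
  then show ?thesis by (simp add: norm_vec_def L2_set_def)
qed

lemma inner_matrix_transpose: "(A *v x) \<bullet> y = x \<bullet> (transpose (A :: real^'n^'k) *v y)"
  by (metis dot_lmul_matrix transpose_matrix_vector inner_commute)

lemma L2_matrix_mult:
  fixes A :: "'w \<Rightarrow> real^'n^'k"
  assumes "L2 M X" "A \<in> borel_measurable M" "\<And>w. w \<in> space M \<Longrightarrow> norm (A w) \<le> K"
  shows "L2 M (\<lambda>w. A w *v X w)" "0 \<le> K \<Longrightarrow> L2norm M (\<lambda>w. A w *v X w) \<le> K * L2norm M X"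
proof -
  have m: "(\<lambda>w. A w *v X w) \<in> borel_measurable M" using assms by measurable
  have b: "AE w in M. norm (A w *v X w) \<le> K * norm (X w)"
    by (intro AE_I2 order_trans[OF norm_matrix_vector_mult_le] mult_right_mono assms) auto
  show "L2 M (\<lambda>w. A w *v X w)" by (rule L2_bound[OF assms(1) m b])
  show "0 \<le> K \<Longrightarrow> L2norm M (\<lambda>w. A w *v X w) \<le> K * L2norm M X"
    by (rule L2norm_mono[OF assms(1) m b])
qed

lemma (in prob_space) law_in_P2:
  assumes "L2 M X" shows "law M X \<in> P2"
proof -
  have [measurable]: "X \<in> borel_measurable M" using assms by measurable
  have "prob_space (law M X)" by (rule prob_space_distr) simp
  moreover have "integrable (law M X) (\<lambda>x. (norm x)\<^sup>2)"
    using L2_norm_sq[OF assms] by (subst integrable_distr_eq) auto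
  ultimately show ?thesis by (simp add: P2_def)
qed

lemma moment2_law:
  assumes "X \<in> borel_measurable M" shows "moment2 (law M X) = (L2norm M X)\<^sup>2"
  unfolding moment2_def L2norm_power2 using assms by (subst integral_distr) auto

lemma (in prob_space) joint_law_in_couplings:
  fixes X Y :: "'a \<Rightarrow> 'e::euclidean_space"
  assumes [measurable]: "X \<in> borel_measurable M" "Y \<in> borel_measurable M"
  shows "law M (\<lambda>w. (X w, Y w)) \<in> couplings (law M X) (law M Y)"
proof -
  have XY: "(\<lambda>w. (X w, Y w)) \<in> measurable M borel" by measurable
  have "fst \<in> measurable (borel :: ('e \<times> 'e) measure) borel" "snd \<in> measurable (borel :: ('e \<times> 'e) measure) borel"
    by (simp_all flip: borel_prod)
  from this[THEN distr_distr[OF _ XY]] show ?thesis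
    unfolding couplings_def using prob_space_distr[OF XY] by (simp add: comp_def)
qed

text \<open>The joint law of \<open>(X, Y)\<close> is one of the couplings over which the infimum is
  taken.\<close>

lemma (in prob_space) W2_law_le:
  assumes X: "L2 M X" and Y: "L2 M Y"
  shows "W2 (law M X) (law M Y) \<le> L2norm M (\<lambda>w. X w - Y w)"
proof -
  have [measurable]: "X \<in> borel_measurable M" "Y \<in> borel_measurable M" using X Y by measurable
  define \<pi> where "\<pi> = distr M borel (\<lambda>w. (X w, Y w))"
  have XY: "(\<lambda>w. (X w, Y w)) \<in> measurable M borel" by measurable
  have "\<pi> \<in> couplings (law M X) (law M Y)"
    unfolding \<pi>_def by (rule joint_law_in_couplings) measurable
  moreover have "(LINT z|\<pi>. (norm (fst z - snd z))\<^sup>2) = (LINT w|M. (norm (X w - Y w))\<^sup>2)"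
    unfolding \<pi>_def by (subst integral_distr[OF XY]) (auto simp flip: borel_prod)
  moreover have "bdd_below ((\<lambda>\<pi>. LINT z|\<pi>. (norm (fst z - snd z))\<^sup>2) ` couplings (law M X) (law M Y))"
    by (intro bdd_belowI[of _ 0]) auto
  ultimately show ?thesis
    unfolding W2_def L2norm_def by (metis (no_types, lifting) cINF_lower real_sqrt_le_mono)
qed

text \<open>An infimum over the empty set would be unspecified, so nonnegativity rests on the
  existence of the diagonal coupling; the upper bound is \<open>W2_law_le\<close>.\<close>

lemma (in prob_space) W2_law_self: "L2 M X \<Longrightarrow> W2 (law M X) (law M X) = 0"
proof -
  assume X: "L2 M X"
  have [measurable]: "X \<in> borel_measurable M" using X by measurable
  have "couplings (law M X) (law M X) \<noteq> {}"
    using joint_law_in_couplings[of X X] by auto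
  then have "0 \<le> W2 (law M X) (law M X)"
    unfolding W2_def by (intro real_sqrt_ge_zero cINF_greatest) auto
  with W2_law_le[OF X X] show ?thesis by (simp add: L2norm_def)
qed

section \<open>Lions derivatives along lifts\<close>

lemma L2_law_iff:
  assumes "X \<in> borel_measurable M" "L2 (law M X) D"
  shows "L2 M (\<lambda>w. D (X w))"
proof -
  have D: "D \<in> borel_measurable borel" using assms(2) by (simp add: sq_integrable_def)
  have "integrable M (\<lambda>w. (norm (D (X w)))\<^sup>2)"
    using assms D by (subst (asm) sq_integrable_def) (auto simp: integrable_distr_eq)
  then show ?thesis using D assms(1) by (simp add: sq_integrable_def)
qed

lemma has_lions_derivativeE:
  assumes "has_lions_derivative M h D \<mu>" "L2 M X" "law M X = \<mu>" "(e::real) > 0"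
  obtains \<delta> where "\<delta> > 0" "\<And>V. L2 M V \<Longrightarrow> L2norm M V < \<delta> \<Longrightarrow>
     \<bar>h (law M (\<lambda>w. X w + V w)) - h \<mu> - (LINT w|M. D (X w) \<bullet> V w)\<bar> \<le> e * L2norm M V"
proof -
  have "\<forall>e>0. \<exists>\<delta>>0. \<forall>V. L2 M V \<and> L2norm M V < \<delta> \<longrightarrow>
     \<bar>h (law M (\<lambda>w. X w + V w)) - h \<mu> - (LINT w|M. D (X w) \<bullet> V w)\<bar> \<le> e * L2norm M V"
    using assms(1-3) unfolding has_lions_derivative_def by blast
  with assms(4) obtain \<delta> where "\<delta> > 0" "\<forall>V. L2 M V \<and> L2norm M V < \<delta> \<longrightarrow>
     \<bar>h (law M (\<lambda>w. X w + V w)) - h \<mu> - (LINT w|M. D (X w) \<bullet> V w)\<bar> \<le> e * L2norm M V"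
    by auto
  then show ?thesis by (intro that) auto
qed

text \<open>Both derivatives expand the same function along the ray \<open>s V\<close> with
  \<open>V = D(X) - D'(X)\<close>. The difference of the two linear terms is
  \<open>s E |V|^2\<close>, and it is also \<open>o(s)\<close>; hence \<open>V\<close> vanishes
  a.e.\<close>

lemma lions_derivative_unique:
  fixes X :: "'w \<Rightarrow> real^'d"
  assumes X: "L2 M X"
    and D: "has_lions_derivative M h D (law M X)" and D': "has_lions_derivative M h D' (law M X)"
  shows "AE w in M. D (X w) = D' (X w)"
proof -
  have Xm: "X \<in> borel_measurable M" using X by measurable
  have sq: "L2 M (\<lambda>w. D (X w))" "L2 M (\<lambda>w. D' (X w))"
    using D D' by (auto intro!: L2_law_iff[OF Xm] simp: has_lions_derivative_def)
  define V where "V w = D (X w) - D' (X w)" for w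
  have V: "L2 M V" unfolding V_def by (rule L2_diff[OF sq])
  define n where "n = L2norm M V"
  have n2: "n\<^sup>2 = (LINT w|M. D (X w) \<bullet> V w) - (LINT w|M. D' (X w) \<bullet> V w)"
    unfolding n_def L2norm_power2_inner
    by (subst Bochner_Integration.integral_diff[symmetric])
      (auto simp: V_def inner_diff_left intro!: L2_inner sq L2_diff)
  have small: "n\<^sup>2 \<le> 2 * e * n" if "e > 0" for e
  proof -
    obtain \<delta> where \<delta>: "\<delta> > 0" "\<And>V. L2 M V \<Longrightarrow> L2norm M V < \<delta> \<Longrightarrow>
        \<bar>h (law M (\<lambda>w. X w + V w)) - h (law M X) - (LINT w|M. D (X w) \<bullet> V w)\<bar> \<le> e * L2norm M V"
      using has_lions_derivativeE[OF D X refl \<open>e > 0\<close>] by auto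
    obtain \<delta>' where \<delta>': "\<delta>' > 0" "\<And>V. L2 M V \<Longrightarrow> L2norm M V < \<delta>' \<Longrightarrow>
        \<bar>h (law M (\<lambda>w. X w + V w)) - h (law M X) - (LINT w|M. D' (X w) \<bullet> V w)\<bar> \<le> e * L2norm M V"
      using has_lions_derivativeE[OF D' X refl \<open>e > 0\<close>] by auto
    \<comment> \<open>Small enough for \<open>s V\<close> to lie within both radii;
      \<open>n + 1\<close> keeps the quotient meaningful when \<open>n = 0\<close>.\<close>
    define s where "s = min \<delta> \<delta>' / (2 * (n + 1))"
    have n0: "n \<ge> 0" by (simp add: n_def)
    have s: "s > 0" using \<delta>(1) \<delta>'(1) n0 by (simp add: s_def)
    have "s * n < min \<delta> \<delta>'"
    proof -
      have "s * n \<le> s * (n + 1)" using s by simp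
      also have "\<dots> = min \<delta> \<delta>' / 2" using n0 by (simp add: s_def field_simps)
      also have "\<dots> < min \<delta> \<delta>'" using \<delta>(1) \<delta>'(1) by (simp add: min_def)
      finally show ?thesis .
    qed
    then have lt: "L2norm M (\<lambda>w. s *\<^sub>R V w) < \<delta>" "L2norm M (\<lambda>w. s *\<^sub>R V w) < \<delta>'"
      using s by (auto simp: L2norm_scaleR n_def)
    note sV = L2_scaleR[OF V, of s]
    have "\<bar>(LINT w|M. D (X w) \<bullet> (s *\<^sub>R V w)) - (LINT w|M. D' (X w) \<bullet> (s *\<^sub>R V w))\<bar> \<le> 2 * (e * (s * n))"
      using \<delta>(2)[OF sV lt(1)] \<delta>'(2)[OF sV lt(2)] s by (simp add: L2norm_scaleR n_def)
    then have "\<bar>s * n\<^sup>2\<bar> \<le> s * (2 * e * n)"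
      unfolding n2 by (simp add: algebra_simps)
    then show ?thesis using s by (simp add: abs_mult)
  qed
  have "n = 0"
  proof (rule ccontr)
    assume "n \<noteq> 0"
    then have "n > 0" using L2norm_nonneg[of M V] unfolding n_def by linarith
    then show False using small[of "n / 4"] by (simp add: power2_eq_square)
  qed
  then have "AE w in M. V w = 0" using L2norm_eq_0_AE[OF V] by (simp add: n_def)
  then show ?thesis by (simp add: V_def)
qed

lemma has_lions_derivativeI:
  assumes "L2 \<mu> D"
    and "\<And>X e. L2 M X \<Longrightarrow> law M X = \<mu> \<Longrightarrow> e > 0 \<Longrightarrow>
       \<exists>\<delta>>0. \<forall>V. L2 M V \<and> L2norm M V < \<delta> \<longrightarrow>
           \<bar>h (law M (\<lambda>w. X w + V w)) - h \<mu> - (LINT w|M. D (X w) \<bullet> V w)\<bar> \<le> e * L2norm M V"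
  shows "has_lions_derivative M h D \<mu>"
  using assms unfolding has_lions_derivative_def by blast

lemma has_lions_derivative_sq: "has_lions_derivative M h D \<mu> \<Longrightarrow> L2 \<mu> D"
  by (simp add: has_lions_derivative_def)

lemma has_lions_derivative_const: "has_lions_derivative M (\<lambda>_. c) (\<lambda>_. 0) \<mu>"
  by (rule has_lions_derivativeI) (auto intro!: exI[of _ 1])

lemma has_lions_derivative_add:
  fixes D1 D2 :: "real^'d \<Rightarrow> real^'d"
  assumes 1: "has_lions_derivative M h1 D1 \<mu>" and 2: "has_lions_derivative M h2 D2 \<mu>"
  shows "has_lions_derivative M (\<lambda>\<nu>. h1 \<nu> + h2 \<nu>) (\<lambda>y. D1 y + D2 y) \<mu>"
proof (rule has_lions_derivativeI)
  show "L2 \<mu> (\<lambda>y. D1 y + D2 y)"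
    by (intro L2_add has_lions_derivative_sq[OF 1] has_lions_derivative_sq[OF 2])
  fix X :: "_ \<Rightarrow> real^'d" and e :: real
  assume X: "L2 M X" "law M X = \<mu>" and e: "e > 0"
  have Xm: "X \<in> borel_measurable M" using X by measurable
  have sq: "L2 M (\<lambda>w. D1 (X w))" "L2 M (\<lambda>w. D2 (X w))"
    using has_lions_derivative_sq[OF 1] has_lions_derivative_sq[OF 2] X(2)
    by (auto intro!: L2_law_iff[OF Xm])
  obtain \<delta>1 where \<delta>1: "\<delta>1 > 0" "\<And>V. L2 M V \<Longrightarrow> L2norm M V < \<delta>1 \<Longrightarrow>
     \<bar>h1 (law M (\<lambda>w. X w + V w)) - h1 \<mu> - (LINT w|M. D1 (X w) \<bullet> V w)\<bar> \<le> e / 2 * L2norm M V"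
    using has_lions_derivativeE[OF 1 X, of "e / 2"] e by auto
  obtain \<delta>2 where \<delta>2: "\<delta>2 > 0" "\<And>V. L2 M V \<Longrightarrow> L2norm M V < \<delta>2 \<Longrightarrow>
     \<bar>h2 (law M (\<lambda>w. X w + V w)) - h2 \<mu> - (LINT w|M. D2 (X w) \<bullet> V w)\<bar> \<le> e / 2 * L2norm M V"
    using has_lions_derivativeE[OF 2 X, of "e / 2"] e by auto
  show "\<exists>\<delta>>0. \<forall>V. L2 M V \<and> L2norm M V < \<delta> \<longrightarrow>
     \<bar>h1 (law M (\<lambda>w. X w + V w)) + h2 (law M (\<lambda>w. X w + V w)) - (h1 \<mu> + h2 \<mu>)
        - (LINT w|M. (D1 (X w) + D2 (X w)) \<bullet> V w)\<bar> \<le> e * L2norm M V"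
  proof (intro exI[of _ "min \<delta>1 \<delta>2"] conjI allI impI)
    fix V :: "_ \<Rightarrow> real^'d"
    assume V: "L2 M V \<and> L2norm M V < min \<delta>1 \<delta>2"
    have "(LINT w|M. (D1 (X w) + D2 (X w)) \<bullet> V w) = (LINT w|M. D1 (X w) \<bullet> V w) + (LINT w|M. D2 (X w) \<bullet> V w)"
      using V by (simp add: inner_add_left L2_inner sq)
    moreover have "\<bar>(a::real) + b - (c + d) - (i + j)\<bar> \<le> r" if "\<bar>a - c - i\<bar> \<le> r / 2" "\<bar>b - d - j\<bar> \<le> r / 2"
      for a b c d i j r using that by linarith
    ultimately show "\<bar>h1 (law M (\<lambda>w. X w + V w)) + h2 (law M (\<lambda>w. X w + V w)) - (h1 \<mu> + h2 \<mu>)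
        - (LINT w|M. (D1 (X w) + D2 (X w)) \<bullet> V w)\<bar> \<le> e * L2norm M V"
      using \<delta>1(2)[of V] \<delta>2(2)[of V] V by auto
  qed (use \<delta>1 \<delta>2 in auto)
qed

lemma has_lions_derivative_cmult:
  fixes D :: "real^'d \<Rightarrow> real^'d"
  assumes D: "has_lions_derivative M h D \<mu>"
  shows "has_lions_derivative M (\<lambda>\<nu>. c * h \<nu>) (\<lambda>y. c *\<^sub>R D y) \<mu>"
proof (rule has_lions_derivativeI)
  show "L2 \<mu> (\<lambda>y. c *\<^sub>R D y)"
    by (intro L2_scaleR has_lions_derivative_sq[OF D])
  fix X :: "_ \<Rightarrow> real^'d" and e :: real
  assume X: "L2 M X" "law M X = \<mu>" and e: "e > 0"
  obtain \<delta> where \<delta>: "\<delta> > 0" "\<And>V. L2 M V \<Longrightarrow> L2norm M V < \<delta> \<Longrightarrow>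
     \<bar>h (law M (\<lambda>w. X w + V w)) - h \<mu> - (LINT w|M. D (X w) \<bullet> V w)\<bar> \<le> e / (\<bar>c\<bar> + 1) * L2norm M V"
    using has_lions_derivativeE[OF D X, of "e / (\<bar>c\<bar> + 1)"] e by auto
  show "\<exists>\<delta>>0. \<forall>V. L2 M V \<and> L2norm M V < \<delta> \<longrightarrow>
     \<bar>c * h (law M (\<lambda>w. X w + V w)) - c * h \<mu> - (LINT w|M. c *\<^sub>R D (X w) \<bullet> V w)\<bar> \<le> e * L2norm M V"
  proof (intro exI[of _ \<delta>] conjI allI impI)
    fix V :: "_ \<Rightarrow> real^'d"
    assume V: "L2 M V \<and> L2norm M V < \<delta>"
    have "\<bar>c * h (law M (\<lambda>w. X w + V w)) - c * h \<mu> - (LINT w|M. c *\<^sub>R D (X w) \<bullet> V w)\<bar>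
        = \<bar>c\<bar> * \<bar>h (law M (\<lambda>w. X w + V w)) - h \<mu> - (LINT w|M. D (X w) \<bullet> V w)\<bar>"
      by (simp add: abs_mult[symmetric] right_diff_distrib)
    also have "\<dots> \<le> \<bar>c\<bar> * (e / (\<bar>c\<bar> + 1) * L2norm M V)"
      using \<delta>(2)[of V] V by (intro mult_left_mono) auto
    also have "\<dots> \<le> (\<bar>c\<bar> + 1) * (e / (\<bar>c\<bar> + 1) * L2norm M V)"
      using e by (intro mult_right_mono) auto
    also have "\<dots> = e * L2norm M V" by (simp add: field_simps)
    finally show "\<bar>c * h (law M (\<lambda>w. X w + V w)) - c * h \<mu> - (LINT w|M. c *\<^sub>R D (X w) \<bullet> V w)\<bar>
        \<le> e * L2norm M V" .
  qed (rule \<delta>)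
qed

lemma has_lions_derivative_sum:
  fixes D :: "'i \<Rightarrow> real^'d \<Rightarrow> real^'d"
  assumes "finite I" "\<And>i. i \<in> I \<Longrightarrow> has_lions_derivative M (h i) (D i) \<mu>"
  shows "has_lions_derivative M (\<lambda>\<nu>. \<Sum>i\<in>I. h i \<nu>) (\<lambda>y. \<Sum>i\<in>I. D i y) \<mu>"
  using assms by (induction I rule: finite_induct)
    (auto intro: has_lions_derivative_add has_lions_derivative_const)

text \<open>The expansion with error constant \<open>1\<close>, together with Cauchy-Schwarz for the
  linear term, gives the Lipschitz constant one plus the L2 norm of \<open>D (X w)\<close>.\<close>

lemma has_lions_derivative_lipschitz_at:
  fixes X :: "'w \<Rightarrow> real^'d"
  assumes D: "has_lions_derivative M h D (law M X)" and X: "L2 M X"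
  obtains \<delta> K where "\<delta> > 0" "K \<ge> 0" "\<And>V. L2 M V \<Longrightarrow> L2norm M V < \<delta> \<Longrightarrow>
     \<bar>h (law M (\<lambda>w. X w + V w)) - h (law M X)\<bar> \<le> K * L2norm M V"
proof -
  have Xm: "X \<in> borel_measurable M" using X by measurable
  have sq: "L2 M (\<lambda>w. D (X w))"
    using has_lions_derivative_sq[OF D] by (auto intro!: L2_law_iff[OF Xm])
  obtain \<delta> where \<delta>: "\<delta> > 0" "\<And>V. L2 M V \<Longrightarrow> L2norm M V < \<delta> \<Longrightarrow>
     \<bar>h (law M (\<lambda>w. X w + V w)) - h (law M X) - (LINT w|M. D (X w) \<bullet> V w)\<bar> \<le> 1 * L2norm M V"
    using has_lions_derivativeE[OF D X refl, of 1] by auto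
  show ?thesis
  proof (rule that[OF \<delta>(1), of "1 + L2norm M (\<lambda>w. D (X w))"])
    fix V :: "'w \<Rightarrow> real^'d"
    assume V: "L2 M V" "L2norm M V < \<delta>"
    show "\<bar>h (law M (\<lambda>w. X w + V w)) - h (law M X)\<bar> \<le> (1 + L2norm M (\<lambda>w. D (X w))) * L2norm M V"
      using \<delta>(2)[OF V] L2_Cauchy_Schwarz[OF sq V(1)] by (simp add: algebra_simps)
  qed simp
qed

text \<open>With \<open>h0\<close> the value at \<open>\<mu>\<close> and \<open>d\<close> the
  increment of \<open>h\<close>, the increment of the half square is \<open>h0 d + d^2 / 2\<close>.
  The first term is covered by the derivative of the multiple \<open>h0 h\<close>, and local
  Lipschitz continuity makes the second one quadratic in the perturbation. Summing over components
  covers the control cost \<open>|u|^2 / 2\<close>.\<close>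

lemma has_lions_derivative_half_square:
  fixes D :: "real^'d \<Rightarrow> real^'d"
  assumes D: "has_lions_derivative M h D \<mu>"
  shows "has_lions_derivative M (\<lambda>\<nu>. (h \<nu>)\<^sup>2 / 2) (\<lambda>y. h \<mu> *\<^sub>R D y) \<mu>"
proof (rule has_lions_derivativeI)
  note cD = has_lions_derivative_cmult[OF D, of "h \<mu>"]
  show "L2 \<mu> (\<lambda>y. h \<mu> *\<^sub>R D y)" by (rule has_lions_derivative_sq[OF cD])
  fix X :: "_ \<Rightarrow> real^'d" and e :: real
  assume X: "L2 M X" "law M X = \<mu>" and e: "e > 0"
  obtain \<delta>1 where \<delta>1: "\<delta>1 > 0" "\<And>V. L2 M V \<Longrightarrow> L2norm M V < \<delta>1 \<Longrightarrow>
     \<bar>h \<mu> * h (law M (\<lambda>w. X w + V w)) - h \<mu> * h \<mu> - (LINT w|M. (h \<mu> *\<^sub>R D (X w)) \<bullet> V w)\<bar> \<le> e / 2 * L2norm M V"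
    using has_lions_derivativeE[OF cD X, of "e / 2"] e by auto
  obtain \<delta>2 K where \<delta>2: "\<delta>2 > 0" "K \<ge> 0" "\<And>V. L2 M V \<Longrightarrow> L2norm M V < \<delta>2 \<Longrightarrow>
     \<bar>h (law M (\<lambda>w. X w + V w)) - h \<mu>\<bar> \<le> K * L2norm M V"
    using has_lions_derivative_lipschitz_at[of M h D X] D X by auto
  \<comment> \<open>The third radius turns \<open>d^2 \<le> K^2 |V|^2\<close> into
    \<open>d^2 \<le> e |V|\<close>.\<close>
  define \<delta> where "\<delta> = min (min \<delta>1 \<delta>2) (e / (K\<^sup>2 + 1))"
  show "\<exists>\<delta>>0. \<forall>V. L2 M V \<and> L2norm M V < \<delta> \<longrightarrow>
     \<bar>(h (law M (\<lambda>w. X w + V w)))\<^sup>2 / 2 - (h \<mu>)\<^sup>2 / 2 - (LINT w|M. (h \<mu> *\<^sub>R D (X w)) \<bullet> V w)\<bar> \<le> e * L2norm M V"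
  proof (intro exI[of _ \<delta>] conjI allI impI)
    have "K\<^sup>2 + 1 > 0" by (intro add_nonneg_pos) auto
    then show "\<delta> > 0" using \<delta>1 \<delta>2 e by (simp add: \<delta>_def)
    fix V :: "_ \<Rightarrow> real^'d"
    assume V: "L2 M V \<and> L2norm M V < \<delta>"
    define l where "l = L2norm M V"
    define d where "d = h (law M (\<lambda>w. X w + V w)) - h \<mu>"
    have l: "l \<ge> 0" "l < \<delta>1" "l < \<delta>2" "l < e / (K\<^sup>2 + 1)" using V by (auto simp: l_def \<delta>_def)
    have "\<bar>d\<bar> \<le> K * l" using \<delta>2(3)[of V] V l by (simp add: d_def l_def)
    then have "\<bar>d\<bar>\<^sup>2 \<le> (K * l)\<^sup>2" by (rule power_mono) simp
    then have "d\<^sup>2 \<le> K\<^sup>2 * l * l" by (simp add: power2_eq_square algebra_simps)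
    also have "\<dots> \<le> (K\<^sup>2 + 1) * l * l" using l by (intro mult_right_mono) auto
    also have "\<dots> \<le> e * l"
      using l \<open>K\<^sup>2 + 1 > 0\<close> by (intro mult_right_mono) (auto simp: field_simps)
    finally have d2: "d\<^sup>2 / 2 \<le> e / 2 * l" by simp
    define I where "I = (LINT w|M. (h \<mu> *\<^sub>R D (X w)) \<bullet> V w)"
    have "\<bar>h \<mu> * h (law M (\<lambda>w. X w + V w)) - h \<mu> * h \<mu> - I\<bar> \<le> e / 2 * l"
      unfolding I_def using \<delta>1(2)[of V] V l by (simp add: l_def)
    then have "\<bar>h \<mu> * d - I\<bar> \<le> e / 2 * l" by (simp add: d_def right_diff_distrib)
    moreover have "(h (law M (\<lambda>w. X w + V w)))\<^sup>2 / 2 - (h \<mu>)\<^sup>2 / 2 = h \<mu> * d + d\<^sup>2 / 2"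
      by (simp add: d_def power2_eq_square field_simps)
    moreover have "0 \<le> d\<^sup>2 / 2" by simp
    ultimately show "\<bar>(h (law M (\<lambda>w. X w + V w)))\<^sup>2 / 2 - (h \<mu>)\<^sup>2 / 2 - (LINT w|M. (h \<mu> *\<^sub>R D (X w)) \<bullet> V w)\<bar>
        \<le> e * L2norm M V"
      using d2 unfolding I_def[symmetric] l_def[symmetric] by linarith
  qed
qed

lemma transpose_mult_vec_sum: "transpose (A :: real^'d^'k) *v y = (\<Sum>i\<in>UNIV. y $ i *\<^sub>R A $ i)"
  by (simp add: vec_eq_iff matrix_vector_mult_def transpose_def mult.commute)

lemma has_lions_derivative_inner:
  fixes D :: "real^'d \<Rightarrow> real^'d^'k"
  assumes "has_lions_derivative_vec M h D \<mu>"
  shows "has_lions_derivative M (\<lambda>\<nu>. h \<nu> \<bullet> y) (\<lambda>v. transpose (D v) *v y) \<mu>"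
proof -
  have "has_lions_derivative M (\<lambda>\<nu>. \<Sum>i\<in>UNIV. y $ i * h \<nu> $ i) (\<lambda>v. \<Sum>i\<in>UNIV. y $ i *\<^sub>R D v $ i) \<mu>"
    using assms by (intro has_lions_derivative_sum has_lions_derivative_cmult)
      (auto simp: has_lions_derivative_vec_def)
  then show ?thesis unfolding transpose_mult_vec_sum by (simp add: inner_vec_def mult.commute)
qed

lemma has_lions_derivative_norm_square:
  fixes D :: "real^'d \<Rightarrow> real^'d^'k"
  assumes "has_lions_derivative_vec M h D \<mu>"
  shows "has_lions_derivative M (\<lambda>\<nu>. (norm (h \<nu>))\<^sup>2 / 2) (\<lambda>v. transpose (D v) *v h \<mu>) \<mu>"
proof -
  have "has_lions_derivative M (\<lambda>\<nu>. \<Sum>i\<in>UNIV. (h \<nu> $ i)\<^sup>2 / 2) (\<lambda>v. \<Sum>i\<in>UNIV. h \<mu> $ i *\<^sub>R D v $ i) \<mu>"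
    using assms by (intro has_lions_derivative_sum has_lions_derivative_half_square)
      (auto simp: has_lions_derivative_vec_def)
  then show ?thesis unfolding transpose_mult_vec_sum
    by (simp add: norm_vec_def L2_set_def sum_nonneg sum_divide_distrib)
qed

lemma has_lions_derivative_vec_add:
  fixes D1 D2 :: "real^'d \<Rightarrow> real^'d^'k"
  assumes "has_lions_derivative_vec M h1 D1 \<mu>" "has_lions_derivative_vec M h2 D2 \<mu>"
  shows "has_lions_derivative_vec M (\<lambda>\<nu>. h1 \<nu> + h2 \<nu>) (\<lambda>y. D1 y + D2 y) \<mu>"
  using assms by (auto simp: has_lions_derivative_vec_def intro!: has_lions_derivative_add)

lemma has_lions_derivative_vec_matrix_mult:
  fixes D :: "real^'d \<Rightarrow> real^'d^'k" and A :: "real^'k^'l"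
  assumes "has_lions_derivative_vec M h D \<mu>"
  shows "has_lions_derivative_vec M (\<lambda>\<nu>. A *v h \<nu>) (\<lambda>y. A ** D y) \<mu>"
  unfolding has_lions_derivative_vec_def
proof
  fix i
  have "has_lions_derivative M (\<lambda>\<nu>. h \<nu> \<bullet> A $ i) (\<lambda>v. transpose (D v) *v A $ i) \<mu>"
    by (rule has_lions_derivative_inner[OF assms])
  moreover have "transpose (D v) *v A $ i = (A ** D v) $ i" for v
    by (simp add: vec_eq_iff matrix_vector_mult_def transpose_def matrix_matrix_mult_def mult.commute)
  ultimately show "has_lions_derivative M (\<lambda>\<nu>. (A *v h \<nu>) $ i) (\<lambda>y. (A ** D y) $ i) \<mu>"
    by (simp add: matrix_vector_mul_component inner_commute)
qed

lemma lions_derivative_vec_unique: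
  fixes X :: "'w \<Rightarrow> real^'d" and D D' :: "real^'d \<Rightarrow> real^'d^'k"
  assumes X: "L2 M X"
    and "has_lions_derivative_vec M h D (law M X)" "has_lions_derivative_vec M h D' (law M X)"
  shows "AE w in M. D (X w) = D' (X w)"
proof -
  have "AE w in M. \<forall>i. D (X w) $ i = D' (X w) $ i"
    unfolding AE_all_countable using assms(2,3)
    by (auto intro!: lions_derivative_unique[OF X] simp: has_lions_derivative_vec_def)
  then show ?thesis by (simp add: vec_eq_iff)
qed

text \<open>Mean value theorem along the ray \<open>\<theta> \<mapsto> \<theta> X\<close>.\<close>

lemma (in prob_space) lions_derivative_bound:
  fixes X :: "'a \<Rightarrow> real^'d"
  assumes X: "L2 M X"
    and D: "\<And>\<mu>. \<mu> \<in> P2 \<Longrightarrow> has_lions_derivative M h (D \<mu>) \<mu>"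
    and K: "\<And>\<mu> y. \<mu> \<in> P2 \<Longrightarrow> norm (D \<mu> y) \<le> K"
  shows "\<bar>h (law M X) - h (law M (\<lambda>_. 0))\<bar> \<le> K * L2norm M X"
proof -
  define \<phi> where "\<phi> \<theta> = h (law M (\<lambda>w. \<theta> *\<^sub>R X w))" for \<theta>
  define c where "c \<theta> = (LINT w|M. D (law M (\<lambda>w. \<theta> *\<^sub>R X w)) (\<theta> *\<^sub>R X w) \<bullet> X w)" for \<theta>
  note sX = L2_scaleR[OF X]
  have P: "law M (\<lambda>w. \<theta> *\<^sub>R X w) \<in> P2" for \<theta> by (rule law_in_P2[OF sX])
  have K0: "K \<ge> 0" using K[OF P, of 0 0] norm_ge_zero order_trans by blast
  have "(\<phi> has_real_derivative c \<theta>) (at \<theta>)" for \<theta>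
    unfolding has_field_derivative_def has_derivative_at_alt
  proof (intro conjI allI impI bounded_linear_mult_right)
    fix e :: real assume e: "e > 0"
    define l where "l = L2norm M X"
    have l: "l \<ge> 0" by (simp add: l_def)
    obtain \<delta> where \<delta>: "\<delta> > 0" "\<And>V. L2 M V \<Longrightarrow> L2norm M V < \<delta> \<Longrightarrow>
       \<bar>h (law M (\<lambda>w. \<theta> *\<^sub>R X w + V w)) - h (law M (\<lambda>w. \<theta> *\<^sub>R X w))
        - (LINT w|M. D (law M (\<lambda>w. \<theta> *\<^sub>R X w)) (\<theta> *\<^sub>R X w) \<bullet> V w)\<bar> \<le> e / (l + 1) * L2norm M V"
      using has_lions_derivativeE[OF D[OF P] sX refl, of "e / (l + 1)"] e l by auto
    show "\<exists>d>0. \<forall>y. norm (y - \<theta>) < d \<longrightarrow> norm (\<phi> y - \<phi> \<theta> - c \<theta> * (y - \<theta>)) \<le> e * norm (y - \<theta>)"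
    proof (intro exI[of _ "\<delta> / (l + 1)"] conjI allI impI)
      show "\<delta> / (l + 1) > 0" using \<delta> l by simp
      fix y assume y: "norm (y - \<theta>) < \<delta> / (l + 1)"
      have "\<bar>y - \<theta>\<bar> * l \<le> \<bar>y - \<theta>\<bar> * (l + 1)" by (intro mult_left_mono) auto
      also have "\<dots> < \<delta>" using y l by (simp add: field_simps)
      finally have "L2norm M (\<lambda>w. (y - \<theta>) *\<^sub>R X w) < \<delta>" by (simp add: L2norm_scaleR l_def)
      note \<delta>(2)[OF sX this]
      moreover have "(\<lambda>w. \<theta> *\<^sub>R X w + (y - \<theta>) *\<^sub>R X w) = (\<lambda>w. y *\<^sub>R X w)"
        by (simp add: scaleR_left_diff_distrib)
      ultimately have "\<bar>\<phi> y - \<phi> \<theta> - c \<theta> * (y - \<theta>)\<bar> \<le> e / (l + 1) * (\<bar>y - \<theta>\<bar> * l)"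
        by (simp add: \<phi>_def c_def L2norm_scaleR l_def mult.commute)
      also have "\<dots> \<le> e / (l + 1) * (\<bar>y - \<theta>\<bar> * (l + 1))"
        using e l by (intro mult_left_mono) auto
      also have "\<dots> = e * \<bar>y - \<theta>\<bar>" using l by (simp add: field_simps)
      finally show "norm (\<phi> y - \<phi> \<theta> - c \<theta> * (y - \<theta>)) \<le> e * norm (y - \<theta>)" by simp
    qed
  qed
  \<comment> \<open>The derivative along the ray is \<open>E D(\<theta> X) . X\<close>, at most
    \<open>K\<close> times the L2 norm of \<open>X\<close> by Cauchy-Schwarz.\<close>
  then have "norm (\<phi> 1 - \<phi> 0) \<le> (K * L2norm M X) * norm (1 - 0 :: real)"
  proof (intro field_differentiable_bound[of UNIV \<phi> c])
    fix \<theta> :: real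
    have m: "(\<lambda>w. D (law M (\<lambda>w. \<theta> *\<^sub>R X w)) (\<theta> *\<^sub>R X w)) \<in> borel_measurable M"
      using L2_law_iff[OF _ has_lions_derivative_sq[OF D[OF P]], of \<theta>] sX[of \<theta>] by (auto simp: sq_integrable_def)
    have sD: "L2 M (\<lambda>w. D (law M (\<lambda>w. \<theta> *\<^sub>R X w)) (\<theta> *\<^sub>R X w))"
      by (rule L2_bounded[OF m K[OF P]])
    have "L2norm M (\<lambda>w. D (law M (\<lambda>w. \<theta> *\<^sub>R X w)) (\<theta> *\<^sub>R X w)) \<le> K * L2norm M (\<lambda>w. 1::real)"
      by (rule L2norm_mono[OF L2_const m]) (use K[OF P] K0 in auto)
    then have "L2norm M (\<lambda>w. D (law M (\<lambda>w. \<theta> *\<^sub>R X w)) (\<theta> *\<^sub>R X w)) \<le> K" by (simp add: L2norm_const)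
    then show "norm (c \<theta>) \<le> K * L2norm M X"
      using L2_Cauchy_Schwarz[OF sD X] mult_right_mono[OF _ L2norm_nonneg[of M X]]
      unfolding c_def by fastforce
  qed auto
  then show ?thesis by (simp add: \<phi>_def)
qed

section \<open>Joint measurability\<close>

text \<open>Sequential continuity of the lift \<open>X \<mapsto> h (law M X)\<close> on
  L2(\<open>M\<close>). Lions differentiability gives continuity in this form, and joint continuity
  gives it through \<open>W2_law_le\<close>; so it serves \<open>b\<close>, \<open>f\<close>,
  \<open>g\<close> and all the derivatives alike.\<close>

definition lift_continuous :: "'w measure \<Rightarrow> ('a::euclidean_space measure \<Rightarrow> 'q::metric_space) \<Rightarrow> bool" where
  "lift_continuous M h \<longleftrightarrow>
     (\<forall>X Xn. L2 M X \<and> (\<forall>n::nat. L2 M (Xn n)) \<and>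
        (\<lambda>n. L2norm M (\<lambda>w. Xn n w - X w)) \<longlonglongrightarrow> 0 \<longrightarrow> (\<lambda>n. h (law M (Xn n))) \<longlonglongrightarrow> h (law M X))"

lemma lift_continuousD:
  assumes "lift_continuous M h" "L2 M X" "\<And>n. L2 M (Xn n)"
    and "(\<lambda>n. L2norm M (\<lambda>w. Xn n w - X w)) \<longlonglongrightarrow> 0"
  shows "(\<lambda>n. h (law M (Xn n))) \<longlonglongrightarrow> h (law M X)"
  using assms unfolding lift_continuous_def by simp

lemma (in prob_space) lions_lift_continuous:
  fixes h :: "(real^'d) measure \<Rightarrow> real"
  assumes D: "\<And>\<mu>. \<mu> \<in> P2 \<Longrightarrow> has_lions_derivative M h (D \<mu>) \<mu>"
  shows "lift_continuous M h"
  unfolding lift_continuous_def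
proof (intro allI impI, elim conjE)
  fix X :: "'a \<Rightarrow> real^'d" and Xn
  assume X: "L2 M X" and Xn: "\<forall>n::nat. L2 M (Xn n)"
    and lim: "(\<lambda>n. L2norm M (\<lambda>w. Xn n w - X w)) \<longlonglongrightarrow> 0"
  obtain \<delta> K where \<delta>: "\<delta> > 0" "K \<ge> 0" "\<And>V. L2 M V \<Longrightarrow> L2norm M V < \<delta> \<Longrightarrow>
     \<bar>h (law M (\<lambda>w. X w + V w)) - h (law M X)\<bar> \<le> K * L2norm M V"
    using has_lions_derivative_lipschitz_at[OF D[OF law_in_P2[OF X]] X] by blast
  have "(\<lambda>n. h (law M (Xn n)) - h (law M X)) \<longlonglongrightarrow> 0"
  proof (rule Lim_null_comparison)
    show "(\<lambda>n. K * L2norm M (\<lambda>w. Xn n w - X w)) \<longlonglongrightarrow> 0"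
      using tendsto_mult_right_zero[OF lim] by simp
    have "eventually (\<lambda>n. L2norm M (\<lambda>w. Xn n w - X w) < \<delta>) sequentially"
      using order_tendstoD(2)[OF lim \<delta>(1)] .
    then show "eventually (\<lambda>n. norm (h (law M (Xn n)) - h (law M X)) \<le> K * L2norm M (\<lambda>w. Xn n w - X w)) sequentially"
    proof eventually_elim
      case (elim n)
      have "L2 M (\<lambda>w. Xn n w - X w)" by (rule L2_diff[OF Xn[rule_format] X])
      from \<delta>(3)[OF this elim] show ?case by simp
    qed
  qed
  then show "(\<lambda>n. h (law M (Xn n))) \<longlonglongrightarrow> h (law M X)" by (simp add: LIM_zero_iff)
qed

lemma (in prob_space) W2_lift_continuous:
  assumes h: "\<And>\<mu> e. \<mu> \<in> P2 \<Longrightarrow> e > 0 \<Longrightarrow> \<exists>\<delta>>0. \<forall>\<mu>'\<in>P2. W2 \<mu> \<mu>' < \<delta> \<longrightarrow> dist (h \<mu>) (h \<mu>') < e"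
  shows "lift_continuous M h"
  unfolding lift_continuous_def
proof (intro allI impI, elim conjE)
  fix X :: "'a \<Rightarrow> 'b" and Xn
  assume X: "L2 M X" and Xn: "\<forall>n::nat. L2 M (Xn n)"
    and lim: "(\<lambda>n. L2norm M (\<lambda>w. Xn n w - X w)) \<longlonglongrightarrow> 0"
  show "(\<lambda>n. h (law M (Xn n))) \<longlonglongrightarrow> h (law M X)"
  proof (rule tendstoI)
    fix e :: real assume "e > 0"
    then obtain \<delta> where \<delta>: "\<delta> > 0" "\<And>\<mu>'. \<mu>' \<in> P2 \<Longrightarrow> W2 (law M X) \<mu>' < \<delta> \<Longrightarrow> dist (h (law M X)) (h \<mu>') < e"
      using h[OF law_in_P2[OF X]] by meson
    from order_tendstoD(2)[OF lim \<delta>(1)]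
    show "eventually (\<lambda>n. dist (h (law M (Xn n))) (h (law M X)) < e) sequentially"
    proof eventually_elim
      case (elim n)
      have "W2 (law M X) (law M (Xn n)) < \<delta>"
        using W2_law_le[OF X Xn[rule_format], of n] elim by (simp add: L2norm_minus_commute)
      from \<delta>(2)[OF law_in_P2[OF Xn[rule_format]] this] show ?case by (simp add: dist_commute)
    qed
  qed
qed

lemma W2_self: "\<mu> \<in> P2 \<Longrightarrow> W2 \<mu> \<mu> = 0"
proof -
  assume \<mu>: "\<mu> \<in> P2"
  interpret prob_space \<mu> using \<mu> by (simp add: P2_def)
  have s: "sets \<mu> = sets borel" using \<mu> by (simp add: P2_def)
  have "law \<mu> (\<lambda>x. x) = \<mu>" by (rule distr_id2) (simp add: s)
  moreover have "L2 \<mu> (\<lambda>x. x)"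
    using \<mu> by (simp add: sq_integrable_def P2_def measurable_ident_sets)
  ultimately show ?thesis using W2_law_self[of "\<lambda>x. x"] by simp
qed

text \<open>\<open>F\<close> is approximated by \<open>F (d (k n x))\<close>, where
  \<open>d (k n x)\<close> is the earliest point, in an enumeration of a countable dense subset of
  \<open>S\<close>, at distance less than \<open>1 / Suc n\<close> from \<open>x\<close>. These
  approximations have countably many pieces, hence are jointly measurable, and continuity in
  \<open>x\<close> gives the limit.\<close>

lemma caratheodory_measurable:
  fixes F :: "'a::{second_countable_topology,metric_space} \<Rightarrow> 'w \<Rightarrow> 'q::metric_space"
  assumes c: "\<And>w. w \<in> space N \<Longrightarrow> continuous_on S (\<lambda>x. F x w)"
    and m: "\<And>x. x \<in> S \<Longrightarrow> F x \<in> borel_measurable N"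
  shows "(\<lambda>(x, w). F x w) \<in> borel_measurable (restrict_space borel S \<Otimes>\<^sub>M N)"
proof (cases "S = {}")
  case True
  then have "space (restrict_space borel S \<Otimes>\<^sub>M N) = {}" by (simp add: space_pair_measure space_restrict_space)
  then show ?thesis by (auto simp: measurable_def)
next
  case False
  obtain D where D: "countable D" "D \<subseteq> S" "S \<subseteq> closure D"
    using separable by blast
  have "D \<noteq> {}" using False D by auto
  define d where "d = from_nat_into D"
  have d: "d k \<in> S" for k using from_nat_into[OF \<open>D \<noteq> {}\<close>] D(2) by (auto simp: d_def)
  have dense: "\<exists>k. dist x (d k) < e" if "x \<in> S" "e > 0" for x e
  proof -
    have "x \<in> closure D" using that D(3) by auto
    then obtain y where "y \<in> D" "dist y x < e" using \<open>e > 0\<close> closure_approachable[of x D] by blast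
    then show ?thesis using from_nat_into_surj[OF D(1)] by (metis d_def dist_commute)
  qed
  define k where "k n x = (LEAST k. dist x (d k) < 1 / Suc n)" for n x
  have k: "dist x (d (k n x)) < 1 / Suc n" if "x \<in> S" for n x
    unfolding k_def using dense[OF that, of "1 / Suc n"] by (auto intro: LeastI_ex)
  have [measurable]: "fst \<in> borel_measurable (restrict_space borel S \<Otimes>\<^sub>M N)"
    using measurable_compose[OF measurable_fst measurable_restrict_space1[OF measurable_ident]] by (simp add: id_def)
  show ?thesis
  proof (rule borel_measurable_LIMSEQ_metric)
    fix n
    have [measurable]: "F (d i) \<in> borel_measurable N" for i by (rule m[OF d])
    have "(\<lambda>z. F (d (k n (fst z))) (snd z)) \<in> borel_measurable (restrict_space borel S \<Otimes>\<^sub>M N)"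
      by (rule measurable_compose_countable[where f = "\<lambda>i z. F (d i) (snd z)"])
        (unfold k_def, measurable)
    then show "(\<lambda>(x, w). F (d (k n x)) w) \<in> borel_measurable (restrict_space borel S \<Otimes>\<^sub>M N)"
      by (simp add: case_prod_beta')
  next
    fix z assume "z \<in> space (restrict_space borel S \<Otimes>\<^sub>M N)"
    then obtain x w where z: "z = (x, w)" "x \<in> S" "w \<in> space N"
      by (auto simp: space_pair_measure space_restrict_space)
    have "(\<lambda>n. d (k n x)) \<longlonglongrightarrow> x"
    proof (rule metric_LIMSEQ_I)
      fix r :: real assume "r > 0"
      then obtain n0 where n0: "1 / Suc n0 < r" using nat_approx_posE by blast
      show "\<exists>n0. \<forall>n\<ge>n0. dist (d (k n x)) x < r"
      proof (intro exI allI impI)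
        fix n assume "n \<ge> n0"
        then have "1 / Suc n \<le> 1 / Suc n0" by (simp add: field_simps)
        then show "dist (d (k n x)) x < r" using k[OF z(2), of n] n0 by (simp add: dist_commute)
      qed
    qed
    then have "(\<lambda>n. F (d (k n x)) w) \<longlonglongrightarrow> F x w"
      using c[OF z(3)] z(2) d by (auto simp: continuous_on_sequentially comp_def)
    then show "(\<lambda>n. case z of (x, w) \<Rightarrow> F (d (k n x)) w) \<longlonglongrightarrow> (case z of (x, w) \<Rightarrow> F x w)"
      using z by simp
  qed
qed

text \<open>Square-integrability is asked for at each time separately, without a bound on the
  supremum of a path; so L2-continuity in time does not follow.\<close>

definition continuous_process :: "'w measure \<Rightarrow> real \<Rightarrow> (real \<Rightarrow> 'w \<Rightarrow> 'a::euclidean_space) \<Rightarrow> bool" where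
  "continuous_process M T X \<longleftrightarrow>
     (\<forall>t\<in>{0..T}. L2 M (X t)) \<and> (\<forall>w\<in>space M. continuous_on {0..T} (\<lambda>t. X t w))"

lemma L2norm_dominated_convergence:
  assumes "\<And>n. Y n \<in> borel_measurable M" "integrable M (\<lambda>w. (g w)\<^sup>2)"
    and "\<And>w. w \<in> space M \<Longrightarrow> (\<lambda>n. Y n w) \<longlonglongrightarrow> 0"
    and "\<And>n w. w \<in> space M \<Longrightarrow> norm (Y n w) \<le> g w"
  shows "(\<lambda>n. L2norm M (Y n)) \<longlonglongrightarrow> 0"
proof -
  have [measurable]: "Y n \<in> borel_measurable M" for n by (rule assms)
  have "(\<lambda>n. LINT w|M. (norm (Y n w))\<^sup>2) \<longlonglongrightarrow> (LINT w|M. 0)"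
  proof (rule integral_dominated_convergence)
    show "AE w in M. (\<lambda>n. (norm (Y n w))\<^sup>2) \<longlonglongrightarrow> 0"
      using tendsto_power[OF tendsto_norm[OF assms(3)], of _ 2] by (intro AE_I2) simp
    show "AE w in M. norm ((norm (Y n w))\<^sup>2) \<le> (g w)\<^sup>2" for n
      using power_mono[OF assms(4), of _ n 2] by (intro AE_I2) simp
  qed (use assms(2) in auto)
  from tendsto_real_sqrt[OF this] show ?thesis by (simp add: L2norm_def)
qed

text \<open>Truncation makes the process \<open>L\<^sup>2\<close>-continuous, so that its law can be approximated by the
  laws on a time grid; an \<open>L\<^sup>2\<close>-bounded process with continuous paths need not be \<open>L\<^sup>2\<close>-continuous.\<close>

lemma (in prob_space) law_flow_measurable:
  fixes X :: "real \<Rightarrow> 'a \<Rightarrow> 'b::euclidean_space" and h :: "real \<Rightarrow> 'b measure \<Rightarrow> 'q::metric_space"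
  assumes X: "continuous_process M T X"
    and hc: "\<And>t. t \<in> {0..T} \<Longrightarrow> lift_continuous M (h t)"
    and hm: "\<And>\<mu>. \<mu> \<in> P2 \<Longrightarrow> (\<lambda>t. h t \<mu>) \<in> borel_measurable (restrict_space borel {0..T})"
  shows "(\<lambda>t. h t (law M (X t))) \<in> borel_measurable (restrict_space borel {0..T})"
proof -
  have Xs: "L2 M (X t)" if "t \<in> {0..T}" for t using X that by (simp add: continuous_process_def)
  have Xm: "X t \<in> borel_measurable M" if "t \<in> {0..T}" for t using Xs[OF that] by measurable
  \<comment> \<open>A continuous truncation with values of norm at most \<open>Suc n\<close>, never
    longer than \<open>x\<close>, and convergent to \<open>x\<close>. Its boundedness lets dominated
    convergence turn continuity of paths into L2-continuity.\<close>
  define \<phi> where "\<phi> n x = x /\<^sub>R (1 + norm x / Suc n)" for n and x :: 'b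
  have pos: "0 < 1 + norm x / Suc n" for n and x :: 'b by (intro add_pos_nonneg) auto
  have \<phi>m [measurable]: "\<phi> n \<in> borel_measurable borel" for n unfolding \<phi>_def by measurable
  have \<phi>c: "continuous_on UNIV (\<phi> n)" for n
  proof -
    have "1 + norm x / real (Suc n) \<noteq> 0" for x :: 'b using pos[of x n] by linarith
    then show ?thesis unfolding \<phi>_def by (intro continuous_intros) auto
  qed
  have \<phi>le: "norm (\<phi> n x) \<le> norm x" for n x
    unfolding \<phi>_def using pos[of x n] divide_left_mono[of 1 "1 + norm x / Suc n" "norm x"]
    by (simp add: field_simps)
  have \<phi>b: "norm (\<phi> n x) \<le> Suc n" for n x
    unfolding \<phi>_def using pos[of x n] by (simp add: field_simps)
  have \<phi>l: "(\<lambda>n. \<phi> n x) \<longlonglongrightarrow> x" for x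
  proof -
    have "(\<lambda>n. x /\<^sub>R (1 + norm x / Suc n)) \<longlonglongrightarrow> x /\<^sub>R (1 + 0)"
      by (intro tendsto_intros LIMSEQ_Suc[OF lim_const_over_n]) auto
    then show ?thesis by (simp add: \<phi>_def)
  qed
  have \<phi>s: "L2 M (\<lambda>w. \<phi> n (X t w))" if "t \<in> {0..T}" for n t
    by (rule L2_bound[OF Xs[OF that], of _ 1]) (use \<phi>le Xm[OF that] in auto)
  \<comment> \<open>The grid point of mesh \<open>1 / Suc m\<close> just below \<open>t\<close>;
    rounding down keeps it in \<open>[0,T]\<close>.\<close>
  define s where "s m t = real (nat \<lfloor>t * Suc m\<rfloor>) / Suc m" for m and t :: real
  have s_le: "s m t \<le> t \<and> t < s m t + 1 / Suc m \<and> 0 \<le> s m t" if "0 \<le> t" for m t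
  proof -
    have "real (nat \<lfloor>t * Suc m\<rfloor>) \<le> t * Suc m" "t * Suc m < real (nat \<lfloor>t * Suc m\<rfloor>) + 1"
      using that by (auto simp: of_nat_nat)
    then show ?thesis unfolding s_def by (auto simp: field_simps)
  qed
  have s_lim: "(\<lambda>m. s m t) \<longlonglongrightarrow> t" if "0 \<le> t" for t
  proof (rule LIMSEQ_I)
    fix r :: real assume "r > 0"
    then obtain n0 where n0: "1 / Suc n0 < r" using nat_approx_posE by blast
    show "\<exists>n0. \<forall>n\<ge>n0. norm (s n t - t) < r"
    proof (intro exI allI impI)
      fix n assume "n \<ge> n0"
      then have "1 / Suc n \<le> 1 / Suc n0" by (simp add: field_simps)
      then show "norm (s n t - t) < r" using s_le[OF that, of n] n0 by auto
    qed
  qed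
  have step1: "(\<lambda>t. h t (law M (\<lambda>w. \<phi> n (X t w)))) \<in> borel_measurable (restrict_space borel {0..T})" for n
  proof (rule borel_measurable_LIMSEQ_metric)
    fix m
    have [measurable]: "(\<lambda>t. t) \<in> borel_measurable (restrict_space borel {0..T})"
      by (rule measurable_restrict_space1) simp
    \<comment> \<open>The grid index takes countably many values, and for a fixed index the law is
      fixed, so \<open>hm\<close> applies. The second branch is never reached from a time in
      \<open>[0,T]\<close>; it only keeps every piece measurable.\<close>
    define G where "G i t = (if real i / Suc m \<in> {0..T} then h t (law M (\<lambda>w. \<phi> n (X (real i / Suc m) w))) else h t (law M (\<lambda>w. 0)))" for i t
    have "(\<lambda>t. G (nat \<lfloor>t * Suc m\<rfloor>) t) \<in> borel_measurable (restrict_space borel {0..T})"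
    proof (rule measurable_compose_countable)
      show "G i \<in> borel_measurable (restrict_space borel {0..T})" for i
        unfolding G_def by (cases "real i / Suc m \<in> {0..T}") (auto simp del: distr_const intro!: hm law_in_P2 \<phi>s)
    qed measurable
    also have "?this \<longleftrightarrow> (\<lambda>t. h t (law M (\<lambda>w. \<phi> n (X (s m t) w)))) \<in> borel_measurable (restrict_space borel {0..T})"
    proof (rule measurable_cong)
      fix t assume "t \<in> space (restrict_space borel {0..T})"
      then have "s m t \<in> {0..T}" using s_le[of t m] by (auto simp: space_restrict_space)
      then show "G (nat \<lfloor>t * Suc m\<rfloor>) t = h t (law M (\<lambda>w. \<phi> n (X (s m t) w)))"
        by (simp add: G_def s_def)
    qed
    finally show "(\<lambda>t. h t (law M (\<lambda>w. \<phi> n (X (s m t) w)))) \<in> borel_measurable (restrict_space borel {0..T})" .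
  next
    fix t assume "t \<in> space (restrict_space borel {0..T})"
    then have t: "t \<in> {0..T}" by (simp add: space_restrict_space)
    have sT: "s m t \<in> {0..T}" for m using s_le[of t m] t by auto
    have "(\<lambda>m. L2norm M (\<lambda>w. \<phi> n (X (s m t) w) - \<phi> n (X t w))) \<longlonglongrightarrow> 0"
    proof (rule L2norm_dominated_convergence[where g = "\<lambda>_. real (Suc n) + real (Suc n)"])
      have [measurable]: "X t \<in> borel_measurable M" "X (s m t) \<in> borel_measurable M" for m
        using Xm t sT by auto
      show "(\<lambda>w. \<phi> n (X (s m t) w) - \<phi> n (X t w)) \<in> borel_measurable M" for m by measurable
      fix w assume w: "w \<in> space M"
      have "(\<lambda>m. X (s m t) w) \<longlonglongrightarrow> X t w"
        using X w t sT s_lim[of t] by (auto simp: continuous_process_def continuous_on_sequentially comp_def)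
      then have "(\<lambda>m. \<phi> n (X (s m t) w)) \<longlonglongrightarrow> \<phi> n (X t w)"
        using \<phi>c[of n] by (auto simp: continuous_on_sequentially comp_def)
      then show "(\<lambda>m. \<phi> n (X (s m t) w) - \<phi> n (X t w)) \<longlonglongrightarrow> 0" by (simp add: LIM_zero)
      show "norm (\<phi> n (X (s m t) w) - \<phi> n (X t w)) \<le> real (Suc n) + real (Suc n)" for m
        by (rule order_trans[OF norm_triangle_ineq4 add_mono[OF \<phi>b \<phi>b]])
    qed simp
    then show "(\<lambda>m. h t (law M (\<lambda>w. \<phi> n (X (s m t) w)))) \<longlonglongrightarrow> h t (law M (\<lambda>w. \<phi> n (X t w)))"
      by (rule lift_continuousD[OF hc[OF t] \<phi>s[OF t] \<phi>s[OF sT]])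
  qed
  show ?thesis
  proof (rule borel_measurable_LIMSEQ_metric[OF step1])
    fix t assume "t \<in> space (restrict_space borel {0..T})"
    then have t: "t \<in> {0..T}" by (simp add: space_restrict_space)
    have [measurable]: "X t \<in> borel_measurable M" using Xm t by auto
    \<comment> \<open>The truncation is removed at each fixed time: the error is at most
      \<open>2 |X t|\<close>, so dominated convergence applies.\<close>
    have "(\<lambda>n. L2norm M (\<lambda>w. \<phi> n (X t w) - X t w)) \<longlonglongrightarrow> 0"
    proof (rule L2norm_dominated_convergence[where g = "\<lambda>w. 2 * norm (X t w)"])
      show "(\<lambda>w. \<phi> n (X t w) - X t w) \<in> borel_measurable M" for n by measurable
      show "(\<lambda>n. \<phi> n (X t w) - X t w) \<longlonglongrightarrow> 0" for w using \<phi>l by (simp add: LIM_zero)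
      show "norm (\<phi> n (X t w) - X t w) \<le> 2 * norm (X t w)" for n w
        using norm_triangle_ineq4[of "\<phi> n (X t w)" "X t w"] \<phi>le[of n "X t w"] by linarith
    qed (use Xs[OF t] in \<open>simp add: sq_integrable_def power_mult_distrib\<close>)
    then show "(\<lambda>n. h t (law M (\<lambda>w. \<phi> n (X t w)))) \<longlonglongrightarrow> h t (law M (X t))"
      by (rule lift_continuousD[OF hc[OF t] Xs[OF t] \<phi>s[OF t]])
  qed
qed

text \<open>Conditions of Caratheodory type: continuity in \<open>p\<close>, measurability in
  \<open>t\<close>, lift continuity in the measure. They are met by \<open>b\<close> and
  \<open>f\<close>, which are merely measurable in time, as well as by everything jointly
  continuous.\<close>

definition flow_regular ::
    "'w measure \<Rightarrow> real \<Rightarrow> (real \<Rightarrow> 'p::{second_countable_topology,metric_space} \<Rightarrow> 'a::euclidean_space measure \<Rightarrow> 'q::metric_space) \<Rightarrow> bool" where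
  "flow_regular M T h \<longleftrightarrow>
     (\<forall>t\<in>{0..T}. \<forall>p. lift_continuous M (h t p)) \<and>
     (\<forall>p. \<forall>\<mu>\<in>P2. (\<lambda>t. h t p \<mu>) \<in> borel_measurable (restrict_space borel {0..T})) \<and>
     (\<forall>t\<in>{0..T}. \<forall>\<mu>\<in>P2. continuous_on UNIV (\<lambda>p. h t p \<mu>))"

abbreviation flow_regular_pair where "flow_regular_pair M T B \<equiv> flow_regular M T (\<lambda>t (x, y) \<mu>. B t x \<mu> y)"

text \<open>The law enters through the time variable only: \<open>law_flow_measurable\<close>
  handles each fixed \<open>p\<close>, and continuity in \<open>p\<close> makes the function jointly
  measurable.\<close>

lemma (in prob_space) flow_regular_measurable:
  assumes h: "flow_regular M T h" and X: "continuous_process M T X"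
  shows "(\<lambda>(t, p). h t p (law M (X t))) \<in> borel_measurable (restrict_space borel {0..T} \<Otimes>\<^sub>M borel)"
proof -
  have U: "restrict_space borel UNIV = (borel :: 'b measure)"
    by (rule measure_eqI) (auto simp: sets_restrict_space emeasure_restrict_space)
  have "(\<lambda>(p, t). h t p (law M (X t))) \<in> borel_measurable (restrict_space borel UNIV \<Otimes>\<^sub>M restrict_space borel {0..T})"
  proof (rule caratheodory_measurable)
    fix p show "(\<lambda>t. h t p (law M (X t))) \<in> borel_measurable (restrict_space borel {0..T})"
      using h by (intro law_flow_measurable[OF X, of "\<lambda>t. h t p"]) (auto simp: flow_regular_def)
  next
    fix t assume "t \<in> space (restrict_space borel {0..T})"
    then have "t \<in> {0..T}" by (simp add: space_restrict_space)
    moreover from this have "law M (X t) \<in> P2" using X by (auto simp: continuous_process_def intro: law_in_P2)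
    ultimately show "continuous_on UNIV (\<lambda>p. h t p (law M (X t)))"
      using h by (auto simp: flow_regular_def)
  qed
  then have "(\<lambda>(p, t). h t p (law M (X t))) \<in> borel_measurable (borel \<Otimes>\<^sub>M restrict_space borel {0..T})"
    by (simp add: U)
  from measurable_pair_swap[OF this] show ?thesis by (simp add: case_prod_beta')
qed

lemma jointly_continuousE:
  assumes "jointly_continuous T h" "t \<in> {0..T}" "\<mu> \<in> P2" "(e::real) > 0"
  obtains \<delta> where "\<delta> > 0" "\<And>t' p' \<mu>'. t' \<in> {0..T} \<Longrightarrow> \<mu>' \<in> P2 \<Longrightarrow> dist t t' < \<delta> \<Longrightarrow> dist p p' < \<delta> \<Longrightarrow>
     W2 \<mu> \<mu>' < \<delta> \<Longrightarrow> dist (h t p \<mu>) (h t' p' \<mu>') < e"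
proof -
  have "\<forall>e>0. \<exists>\<delta>>0. \<forall>t'\<in>{0..T}. \<forall>p'. \<forall>\<mu>'\<in>P2.
        dist t t' < \<delta> \<longrightarrow> dist p p' < \<delta> \<longrightarrow> W2 \<mu> \<mu>' < \<delta> \<longrightarrow> dist (h t p \<mu>) (h t' p' \<mu>') < e"
    using assms(1-3) unfolding jointly_continuous_def by blast
  with assms(4) obtain \<delta> where "\<delta> > 0" "\<forall>t'\<in>{0..T}. \<forall>p'. \<forall>\<mu>'\<in>P2.
        dist t t' < \<delta> \<longrightarrow> dist p p' < \<delta> \<longrightarrow> W2 \<mu> \<mu>' < \<delta> \<longrightarrow> dist (h t p \<mu>) (h t' p' \<mu>') < e"
    by auto
  then show ?thesis by (intro that) auto
qed

lemma (in prob_space) jointly_continuous_flow_regular: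
  fixes h :: "real \<Rightarrow> 'p::{second_countable_topology,metric_space} \<Rightarrow> 'c::euclidean_space measure \<Rightarrow> 'q::metric_space"
  assumes h: "jointly_continuous T h"
  shows "flow_regular M T h"
  unfolding flow_regular_def
proof (intro conjI allI ballI)
  fix t p assume t: "t \<in> {0..T}"
  show "lift_continuous M (h t p)"
  proof (rule W2_lift_continuous)
    fix \<mu> :: "'c measure" and e :: real assume \<mu>: "\<mu> \<in> P2" and e: "e > 0"
    obtain \<delta> where "\<delta> > 0" "\<And>t' p' \<mu>'. t' \<in> {0..T} \<Longrightarrow> \<mu>' \<in> P2 \<Longrightarrow> dist t t' < \<delta> \<Longrightarrow>
        dist p p' < \<delta> \<Longrightarrow> W2 \<mu> \<mu>' < \<delta> \<Longrightarrow> dist (h t p \<mu>) (h t' p' \<mu>') < e"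
      using jointly_continuousE[OF h t \<mu> e] by blast
    then show "\<exists>\<delta>>0. \<forall>\<mu>'\<in>P2. W2 \<mu> \<mu>' < \<delta> \<longrightarrow> dist (h t p \<mu>) (h t p \<mu>') < e"
      using t by (intro exI[of _ \<delta>]) auto
  qed
next
  fix p and \<mu> :: "'c measure" assume \<mu>: "\<mu> \<in> P2"
  have "continuous_on {0..T} (\<lambda>t. h t p \<mu>)"
    unfolding continuous_on_iff
  proof (intro ballI allI impI)
    fix t and e :: real assume t: "t \<in> {0..T}" and e: "e > 0"
    obtain \<delta> where "\<delta> > 0" "\<And>t' p' \<mu>'. t' \<in> {0..T} \<Longrightarrow> \<mu>' \<in> P2 \<Longrightarrow> dist t t' < \<delta> \<Longrightarrow>
        dist p p' < \<delta> \<Longrightarrow> W2 \<mu> \<mu>' < \<delta> \<Longrightarrow> dist (h t p \<mu>) (h t' p' \<mu>') < e"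
      using jointly_continuousE[OF h t \<mu> e] by blast
    then show "\<exists>d>0. \<forall>t'\<in>{0..T}. dist t' t < d \<longrightarrow> dist (h t' p \<mu>) (h t p \<mu>) < e"
      using \<mu> W2_self[OF \<mu>] by (intro exI[of _ \<delta>]) (auto simp: dist_commute)
  qed
  then show "(\<lambda>t. h t p \<mu>) \<in> borel_measurable (restrict_space borel {0..T})"
    by (rule borel_measurable_continuous_on_restrict)
next
  fix t and \<mu> :: "'c measure" assume t: "t \<in> {0..T}" and \<mu>: "\<mu> \<in> P2"
  show "continuous_on UNIV (\<lambda>p. h t p \<mu>)"
    unfolding continuous_on_iff
  proof (intro ballI allI impI)
    fix p and e :: real assume e: "e > 0"
    obtain \<delta> where "\<delta> > 0" "\<And>t' p' \<mu>'. t' \<in> {0..T} \<Longrightarrow> \<mu>' \<in> P2 \<Longrightarrow> dist t t' < \<delta> \<Longrightarrow>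
        dist p p' < \<delta> \<Longrightarrow> W2 \<mu> \<mu>' < \<delta> \<Longrightarrow> dist (h t p \<mu>) (h t' p' \<mu>') < e"
      using jointly_continuousE[OF h t \<mu> e] by blast
    then show "\<exists>d>0. \<forall>p'\<in>UNIV. dist p' p < d \<longrightarrow> dist (h t p' \<mu>) (h t p \<mu>) < e"
      using \<mu> t W2_self[OF \<mu>] by (intro exI[of _ \<delta>]) (auto simp: dist_commute)
  qed
qed

section \<open>The filtration and the Brownian increments\<close>

text \<open>The set where \<open>Y\<close> and \<open>Y'\<close> differ lies in a null set
  \<open>N\<close>; both \<open>N\<close> and the part of a preimage inside \<open>N\<close> are
  null sets and hence belong to \<open>G\<close>.\<close>

lemma measurable_cong_null_sets:
  fixes Y Y' :: "'w \<Rightarrow> 'a::second_countable_topology"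
  assumes G: "space G = space M" "sets G \<subseteq> sets M" "null_sets M \<subseteq> sets G"
    and Y: "Y \<in> borel_measurable G" and Y': "Y' \<in> borel_measurable M" and eq: "AE w in M. Y w = Y' w"
  shows "Y' \<in> borel_measurable G"
proof (rule measurableI)
  fix A :: "'a set" assume A: "A \<in> sets borel"
  obtain N where N: "N \<in> null_sets M" "{w \<in> space M. Y w \<noteq> Y' w} \<subseteq> N"
    using eq by (auto simp: eventually_ae_filter)
  have 1: "Y -` A \<inter> space M \<in> sets G" using measurable_sets[OF Y A] G(1) by simp
  have 2: "Y' -` A \<inter> space M \<in> sets M" using measurable_sets[OF Y' A] by simp
  have "Y' -` A \<inter> space M \<inter> N \<in> null_sets M"
    using N(1) 2 by (intro null_set_Int1) auto
  moreover have "Y' -` A \<inter> space M = (Y -` A \<inter> space M - N) \<union> (Y' -` A \<inter> space M \<inter> N)"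
    using N(2) by auto
  ultimately show "Y' -` A \<inter> space G \<in> sets G"
    using 1 N(1) G by (metis sets.Diff sets.Un subsetD)
qed (simp)

text \<open>The sets that agree a.e. with a member of \<open>S\<close> form a sigma-algebra, so
  generators suffice. This serves to strip the null sets from the completed filtration.\<close>

lemma sigma_sets_AE_approx:
  assumes S: "sigma_algebra (space M) S"
    and G: "\<And>A. A \<in> G \<Longrightarrow> \<exists>B\<in>S. AE w in M. w \<in> A \<longleftrightarrow> w \<in> B"
    and A: "A \<in> sigma_sets (space M) G"
  shows "\<exists>B\<in>S. AE w in M. w \<in> A \<longleftrightarrow> w \<in> B"
  using A
proof (induction A)
  case (Basic a) then show ?case by (rule G)
next
  case Empty
  interpret sigma_algebra "space M" S by fact
  show ?case by (intro bexI[of _ "{}"]) auto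
next
  case (Compl a)
  interpret sigma_algebra "space M" S by fact
  from Compl obtain B where "B \<in> S" "AE w in M. w \<in> a \<longleftrightarrow> w \<in> B" by auto
  then show ?case by (intro bexI[of _ "space M - B"]) auto
next
  case (Union a)
  interpret sigma_algebra "space M" S by fact
  from Union obtain B where B: "\<And>i. B i \<in> S" "\<And>i. AE w in M. w \<in> a i \<longleftrightarrow> w \<in> B i" by metis
  have "AE w in M. \<forall>i. w \<in> a i \<longleftrightarrow> w \<in> B i" using B(2) by (simp add: AE_all_countable)
  then have "AE w in M. w \<in> (\<Union>i. a i) \<longleftrightarrow> w \<in> (\<Union>i. B i)" by eventually_elim auto
  moreover have "(\<Union>i. B i) \<in> S" using B(1) by blast
  ultimately show ?case by blast
qed

text \<open>All increments start at the same time \<open>t\<close>. For \<open>t = 0\<close> they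
  represent the past of \<open>W\<close> up to null sets, as \<open>W 0 = 0\<close> holds only a.s.;
  for \<open>S = {t..T}\<close> they form the Brownian future after \<open>t\<close>.\<close>

definition increment_sigma :: "'w measure \<Rightarrow> (real \<Rightarrow> 'w \<Rightarrow> real^'m) \<Rightarrow> real \<Rightarrow> real set \<Rightarrow> 'w measure" where
  "increment_sigma M W t S =
     sigma (space M) {(\<lambda>w. W s w - W t w) -` A \<inter> space M | s A. s \<in> S \<and> A \<in> sets borel}"

lemma space_increment_sigma [simp]: "space (increment_sigma M W t S) = space M"
  by (simp add: increment_sigma_def space_measure_of_conv)

lemma sets_increment_sigma:
  "sets (increment_sigma M W t S) =
     sigma_sets (space M) {(\<lambda>w. W s w - W t w) -` A \<inter> space M | s A. s \<in> S \<and> A \<in> sets borel}"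
  unfolding increment_sigma_def by (rule sets_measure_of) auto

lemma sets_increment_sigma_mono: "S \<subseteq> S' \<Longrightarrow> sets (increment_sigma M W t S) \<subseteq> sets (increment_sigma M W t S')"
  unfolding sets_increment_sigma by (rule sigma_sets_mono') auto

lemma increment_measurable:
  "s \<in> S \<Longrightarrow> (\<lambda>w. W s w - W t w) \<in> borel_measurable (increment_sigma M W t S)"
  by (rule measurableI) (auto simp: sets_increment_sigma intro!: sigma_sets.Basic)

lemma increment_sigma_leI:
  fixes W :: "real \<Rightarrow> 'a \<Rightarrow> real^'b"
  assumes "\<And>s. s \<in> S \<Longrightarrow> (\<lambda>w. W s w - W t w) \<in> borel_measurable N" "space N = space M"
  shows "sets (increment_sigma M W t S) \<subseteq> sets N"
  unfolding sets_increment_sigma assms(2)[symmetric]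
proof (rule sets.sigma_sets_subset, safe)
  fix s A assume s: "s \<in> S" "A \<in> sets (borel :: (real^'b) measure)"
  show "(\<lambda>w. W s w - W t w) -` A \<inter> space N \<in> sets N"
    by (rule measurable_sets[OF assms(1)[OF s(1)] s(2)])
qed

locale mean_field_space = prob_space M
  for M :: "'w measure" and T :: real and W :: "real \<Rightarrow> 'w \<Rightarrow> real^'m"
    and X0 :: "'w \<Rightarrow> real^'d" and \<mu>0 :: "(real^'d) measure" +
  assumes mf_space: "mf_space M T W X0 \<mu>0"
begin

abbreviation L2_dtP :: "(real \<Rightarrow> 'w \<Rightarrow> 'e::euclidean_space) \<Rightarrow> bool"
  where "L2_dtP A \<equiv> L2 (dtP M T) (\<lambda>(t, w). A t w)"

abbreviation measurable_dtP :: "(real \<Rightarrow> 'w \<Rightarrow> 'e::topological_space) \<Rightarrow> bool"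
  where "measurable_dtP A \<equiv> (\<lambda>(t, w). A t w) \<in> borel_measurable (dtP M T)"

abbreviation F :: "real \<Rightarrow> 'w measure" where "F \<equiv> filt M W X0"

lemma T_pos: "0 < T" and brownian: "brownian_motion M T W"
  and X0_measurable: "X0 \<in> borel_measurable M"
  using mf_space by (auto simp: mf_space_def)

lemma W_measurable: "t \<in> {0..T} \<Longrightarrow> W t \<in> borel_measurable M"
  using brownian by (simp add: brownian_motion_def)

lemma W_zero: "AE w in M. W 0 w = 0"
  using brownian by (simp add: brownian_motion_def)

lemma space_F [simp]: "space (F t) = space M"
  by (simp add: filt_def space_measure_of_conv)

lemma sets_F: "sets (F t) = sigma_sets (space M) ({X0 -` A \<inter> space M | A. A \<in> sets borel} \<union>
      {W s -` A \<inter> space M | s A. s \<in> {0..t} \<and> A \<in> sets borel} \<union> null_sets M)"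
  unfolding filt_def by (rule sets_measure_of) (auto dest: sets.sets_into_space)

lemma sets_F_mono: assumes "s \<le> t" shows "sets (F s) \<subseteq> sets (F t)"
  unfolding sets_F
proof (rule sigma_sets_mono', intro Un_mono subset_refl)
  have "{0..s} \<subseteq> {0..t}" using assms by auto
  then show "{W r -` A \<inter> space M | r A. r \<in> {0..s} \<and> A \<in> sets borel}
      \<subseteq> {W r -` A \<inter> space M | r A. r \<in> {0..t} \<and> A \<in> sets borel}"
    by blast
qed

lemma sets_F_subset: assumes "t \<le> T" shows "sets (F t) \<subseteq> sets M"
  unfolding sets_F
proof (rule sets.sigma_sets_subset, safe)
  fix A assume "A \<in> sets (borel :: (real^'d) measure)"
  from measurable_sets[OF X0_measurable this] show "X0 -` A \<inter> space M \<in> sets M" .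
next
  fix s A assume "s \<in> {0..t}" "A \<in> sets (borel :: (real^'m) measure)"
  then show "W s -` A \<inter> space M \<in> sets M"
    using assms by (intro measurable_sets[OF W_measurable]) auto
qed auto

lemma subalgebra_F: "t \<le> T \<Longrightarrow> subalgebra M (F t)"
  using sets_F_subset by (simp add: subalgebra_def)

lemma measurable_F_M: "Y \<in> measurable (F t) N \<Longrightarrow> t \<le> T \<Longrightarrow> Y \<in> measurable M N"
  using measurable_from_subalg[OF subalgebra_F] by blast

lemma measurable_F_mono: "Y \<in> measurable (F s) N \<Longrightarrow> s \<le> t \<Longrightarrow> Y \<in> measurable (F t) N"
  using sets_F_mono by (simp add: measurable_def) blast

lemma W_measurable_F: "s \<in> {0..t} \<Longrightarrow> W s \<in> borel_measurable (F t)"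
  by (rule measurableI) (auto simp: sets_F intro!: sigma_sets.Basic)

text \<open>The definition of Brownian motion speaks of consecutive increments on one grid. All
  times involved are placed on a common strictly increasing grid containing \<open>0\<close> and
  \<open>t\<close>; increments from \<open>0\<close> and from \<open>t\<close> telescope into grid
  increments before and after \<open>t\<close>, two disjoint blocks of an independent
  family.\<close>

lemma increments_independent_finite:
  assumes t: "t \<in> {0..T}" and S: "finite S" "S \<subseteq> {0..t}" and S': "finite S'" "S' \<subseteq> {t..T}"
  shows "indep_set (sets (increment_sigma M W 0 S)) (sets (increment_sigma M W t S'))"
proof -
  define Q where "Q = S \<union> S' \<union> {0, t}"
  have Q: "finite Q" "Q \<subseteq> {0..T}" "0 \<in> Q" "t \<in> Q" using S S' t by (auto simp: Q_def)
  define xs where "xs = sorted_list_of_set Q"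
  have xs: "set xs = Q" "sorted_wrt (<) xs" using Q(1) by (auto simp: xs_def)
  define n where "n = length xs - 1"
  have len: "length xs = Suc n" using xs(1) Q(3) by (cases xs) (auto simp: n_def)
  define \<tau> where "\<tau> k = xs ! k" for k
  have mono: "\<tau> i < \<tau> j" if "i < j" "j \<le> n" for i j
    using sorted_wrt_nth_less[OF xs(2) that(1)] that(2) len by (simp add: \<tau>_def)
  have in_Q: "\<tau> k \<in> Q" if "k \<le> n" for k using nth_mem[of k xs] xs(1) len that by (simp add: \<tau>_def)
  have idx: "\<exists>k\<le>n. \<tau> k = s" if "s \<in> Q" for s
    using that xs(1) len unfolding \<tau>_def by (metis in_set_conv_nth less_Suc_eq_le)
  have mono_iff: "i \<le> j" if "\<tau> i \<le> \<tau> j" "i \<le> n" "j \<le> n" for i j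
    using mono[of j i] that by fastforce
  obtain m where m: "m \<le> n" "\<tau> m = t" using idx Q(4) by blast
  have \<tau>0: "\<tau> 0 = 0"
  proof -
    obtain k where "k \<le> n" "\<tau> k = 0" using idx Q(3) by blast
    moreover have "0 \<le> \<tau> 0" using in_Q[of 0] Q(2) by auto
    ultimately show ?thesis using mono[of 0 k] by (cases "k = 0") auto
  qed
  define D where "D = (\<lambda>(k, i) w. W (\<tau> (Suc k)) w $ i - W (\<tau> k) w $ i)"
  have "indep_vars (\<lambda>_. borel) D ({..<n} \<times> UNIV)"
  proof -
    have "(\<forall>k\<le>n. \<tau> k \<in> {0..T}) \<and> (\<forall>k<n. \<tau> k < \<tau> (Suc k))"
      using subsetD[OF Q(2) in_Q] mono by simp
    with brownian show ?thesis unfolding brownian_motion_def D_def by blast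
  qed
  then have rv: "\<And>p. p \<in> {..<n} \<times> UNIV \<Longrightarrow> D p \<in> borel_measurable M"
    and ind: "indep_sets (\<lambda>p. {D p -` A \<inter> space M | A. A \<in> sets borel}) ({..<n} \<times> UNIV)"
    by (auto simp: indep_vars_def2)
  define E where "E p = {D p -` A \<inter> space M | A. A \<in> sets borel}" for p
  \<comment> \<open>Index blocks on either side of the grid position \<open>m\<close> of
    \<open>t\<close>: \<open>True\<close> is the past, \<open>False\<close> the future.\<close>
  define I where "I = case_bool ({..<m} \<times> (UNIV :: 'm set)) ({m..<n} \<times> UNIV)"
  have UI: "(\<Union>j\<in>UNIV. I j) = {..<n} \<times> UNIV" using m by (auto simp: I_def UNIV_bool)
  have col: "indep_sets (\<lambda>j. sigma_sets (space M) (\<Union>p\<in>I j. E p)) UNIV"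
  proof (rule indep_sets_collect_sigma)
    show "indep_sets E (\<Union>j\<in>UNIV. I j)" unfolding UI E_def by (rule ind)
    show "Int_stable (E p)" for p
    proof (rule Int_stableI)
      fix a b assume "a \<in> E p" "b \<in> E p"
      then obtain A B where "a = D p -` A \<inter> space M" "A \<in> sets borel" "b = D p -` B \<inter> space M" "B \<in> sets borel"
        by (auto simp: E_def)
      then show "a \<inter> b \<in> E p" unfolding E_def by (intro CollectI exI[of _ "A \<inter> B"]) auto
    qed
    show "disjoint_family_on I UNIV" by (auto simp: disjoint_family_on_def I_def split: bool.splits)
  qed
  define N where "N j = sigma (space M) (\<Union>p\<in>I j. E p)" for j
  have sN: "sets (N j) = sigma_sets (space M) (\<Union>p\<in>I j. E p)" "space (N j) = space M" for j
    by (auto simp: N_def E_def space_measure_of_conv intro!: sets_measure_of)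
  have DN: "D p \<in> borel_measurable (N j)" if "p \<in> I j" for p j
  proof (rule measurableI)
    fix A :: "real set" assume "A \<in> sets borel"
    then have "D p -` A \<inter> space M \<in> (\<Union>p\<in>I j. E p)" using that by (auto simp: E_def)
    then show "D p -` A \<inter> space (N j) \<in> sets (N j)" unfolding sN by (rule sigma_sets.Basic)
  qed simp
  have incN: "(\<lambda>w. W (\<tau> k) w - W (\<tau> l) w) \<in> borel_measurable (N j)"
    if lk: "l \<le> k" and I: "\<And>q i. l \<le> q \<Longrightarrow> q < k \<Longrightarrow> (q, i) \<in> I j" for k l j
  proof (rule borel_measurable_vec_nthI)
    fix i
    have "(\<lambda>w. (W (\<tau> k) w - W (\<tau> l) w) $ i) = (\<lambda>w. \<Sum>q\<in>{l..<k}. D (q, i) w)"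
      using lk by (auto simp: D_def sum_Suc_diff'[of l k "\<lambda>q. W (\<tau> q) _ $ i"])
    also have "\<dots> \<in> borel_measurable (N j)"
      by (intro borel_measurable_sum DN I) auto
    finally show "(\<lambda>w. (W (\<tau> k) w - W (\<tau> l) w) $ i) \<in> borel_measurable (N j)" .
  qed
  have 1: "sets (increment_sigma M W 0 S) \<subseteq> sets (N True)"
  proof (rule increment_sigma_leI[OF _ sN(2)])
    fix s assume s: "s \<in> S"
    then obtain k where k: "k \<le> n" "\<tau> k = s" using idx[of s] by (auto simp: Q_def)
    have "k \<le> m" using mono_iff[of k m] k m s S by auto
    then show "(\<lambda>w. W s w - W 0 w) \<in> borel_measurable (N True)"
      using incN[of 0 k True] k \<tau>0 by (auto simp: I_def)
  qed
  have 2: "sets (increment_sigma M W t S') \<subseteq> sets (N False)"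
  proof (rule increment_sigma_leI[OF _ sN(2)])
    fix s assume s: "s \<in> S'"
    then obtain k where k: "k \<le> n" "\<tau> k = s" using idx[of s] by (auto simp: Q_def)
    have "m \<le> k" using mono_iff[of m k] k m s S' by auto
    then show "(\<lambda>w. W s w - W t w) \<in> borel_measurable (N False)"
      using incN[of m k False] k m by (auto simp: I_def)
  qed
  show ?thesis
    unfolding indep_set_def
    by (rule indep_sets_mono_sets[OF col]) (use 1 2 sN in \<open>auto split: bool.splits\<close>)
qed

text \<open>The union over finite sets of times is stable under intersection, because two finite
  sets lie in their union; so independence passes from finite sets of times to the generated
  sigma-algebras.\<close>

lemma increments_independent:
  assumes t: "t \<in> {0..T}"
  shows "indep_set (sets (increment_sigma M W 0 {0..t})) (sets (increment_sigma M W t {t..T}))"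
proof -
  define P where "P r S = (\<Union>K\<in>{K. finite K \<and> K \<subseteq> S}. sets (increment_sigma M W r K))" for r S
  have stable: "Int_stable (P r S)" for r S
  proof (rule Int_stableI)
    fix a b assume "a \<in> P r S" "b \<in> P r S"
    then obtain K K' where K: "finite K" "K \<subseteq> S" "a \<in> sets (increment_sigma M W r K)"
      "finite K'" "K' \<subseteq> S" "b \<in> sets (increment_sigma M W r K')" by (auto simp: P_def)
    have "a \<inter> b \<in> sets (increment_sigma M W r (K \<union> K'))"
      using K sets_increment_sigma_mono[of K "K \<union> K'" M W r] sets_increment_sigma_mono[of K' "K \<union> K'" M W r] by auto
    then show "a \<inter> b \<in> P r S" using K by (auto simp: P_def)
  qed
  have gen: "sets (increment_sigma M W r S) \<subseteq> sigma_sets (space M) (P r S)" for r S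
    unfolding sets_increment_sigma
  proof (rule sigma_sets_mono, safe)
    fix s A assume s: "s \<in> S" "A \<in> sets (borel :: (real^'m) measure)"
    have "(\<lambda>w. W s w - W r w) -` A \<inter> space M \<in> sets (increment_sigma M W r {s})"
      using s by (auto simp: sets_increment_sigma intro!: sigma_sets.Basic)
    then show "(\<lambda>w. W s w - W r w) -` A \<inter> space M \<in> sigma_sets (space M) (P r S)"
      using s by (intro sigma_sets.Basic) (auto simp: P_def)
  qed
  have "indep_set (P 0 {0..t}) (P t {t..T})"
    unfolding indep_sets2_eq
  proof (intro conjI ballI)
    show "P 0 {0..t} \<subseteq> events"
    proof
      fix a assume "a \<in> P 0 {0..t}"
      then obtain K where "finite K" "K \<subseteq> {0..t}" "a \<in> sets (increment_sigma M W 0 K)" by (auto simp: P_def)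
      then show "a \<in> events"
        using increments_independent_finite[OF t, of K "{}"] unfolding indep_sets2_eq by auto
    qed
    show "P t {t..T} \<subseteq> events"
    proof
      fix a assume "a \<in> P t {t..T}"
      then obtain K where "finite K" "K \<subseteq> {t..T}" "a \<in> sets (increment_sigma M W t K)" by (auto simp: P_def)
      then show "a \<in> events"
        using increments_independent_finite[OF t, of "{}" K] unfolding indep_sets2_eq by auto
    qed
    fix a b assume "a \<in> P 0 {0..t}" "b \<in> P t {t..T}"
    then obtain K K' where "finite K" "K \<subseteq> {0..t}" "a \<in> sets (increment_sigma M W 0 K)"
      "finite K'" "K' \<subseteq> {t..T}" "b \<in> sets (increment_sigma M W t K')" by (auto simp: P_def)
    then show "prob (a \<inter> b) = prob a * prob b"
      using increments_independent_finite[OF t, of K K'] unfolding indep_sets2_eq by blast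
  qed
  from indep_set_sigma_sets[OF this stable stable] show ?thesis
    using gen[of 0 "{0..t}"] gen[of t "{t..T}"] unfolding indep_sets2_eq by blast
qed

lemma X0_independent:
  assumes "A \<in> sets borel" "B \<in> sigma_sets (space M) {W s -` A \<inter> space M | s A. s \<in> {0..T} \<and> A \<in> sets borel}"
  shows "prob ((X0 -` A \<inter> space M) \<inter> B) = prob (X0 -` A \<inter> space M) * prob B"
  using mf_space assms unfolding mf_space_def indep_sets2_eq by blast

text \<open>\<open>X0\<close> is independent of all of \<open>W\<close>, and inside \<open>W\<close>
  past and future increments are independent; together this makes the rectangles \<open>R\<close>
  independent of the future. Null sets and the a.s. condition \<open>W 0 = 0\<close> are absorbed by
  passing from \<open>A\<close> to an a.e. equal set \<open>B\<close> generated by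
  \<open>R\<close>.\<close>

lemma filtration_independent:
  assumes t: "t \<in> {0..T}" and A: "A \<in> sets (F t)" and D: "D \<in> sets (increment_sigma M W t {t..T})"
  shows "prob (A \<inter> D) = prob A * prob D"
proof -
  define WW where "WW = sigma (space M) {W s -` A \<inter> space M | s A. s \<in> {0..T} \<and> A \<in> sets borel}"
  have WW: "space WW = space M"
    "sets WW = sigma_sets (space M) {W s -` A \<inter> space M | s A. s \<in> {0..T} \<and> A \<in> sets borel}"
    unfolding WW_def by (auto simp: space_measure_of_conv intro!: sets_measure_of)
  have WWm: "W s \<in> borel_measurable WW" if "s \<in> {0..T}" for s
    by (rule measurableI) (use that in \<open>auto simp: WW intro!: sigma_sets.Basic\<close>)
  have incWW: "sets (increment_sigma M W r S) \<subseteq> sets WW" if "r \<in> {0..T}" "S \<subseteq> {0..T}" for r S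
    by (rule increment_sigma_leI[OF _ WW(1)]) (use that WWm in \<open>auto intro!: borel_measurable_diff\<close>)
  have WWM: "sets WW \<subseteq> sets M"
    unfolding WW
  proof (rule sets.sigma_sets_subset, safe)
    fix s A assume "s \<in> {0..T}" "A \<in> sets (borel :: (real^'m) measure)"
    from measurable_sets[OF W_measurable[OF this(1)] this(2)] show "W s -` A \<inter> space M \<in> events" .
  qed
  define R where "R = {(X0 -` A \<inter> space M) \<inter> E | A E. A \<in> sets borel \<and> E \<in> sets (increment_sigma M W 0 {0..t})}"
  have sub1: "sets (increment_sigma M W 0 {0..t}) \<subseteq> sets WW" using t by (intro incWW) auto
  have sub2: "sets (increment_sigma M W t {t..T}) \<subseteq> sets WW" using t by (intro incWW) auto
  have X0s: "X0 -` A \<inter> space M \<in> sets M" if "A \<in> sets borel" for A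
    using measurable_sets[OF X0_measurable that] .
  have "indep_set R (sets (increment_sigma M W t {t..T}))"
    unfolding indep_sets2_eq
  proof (intro conjI ballI)
    show "R \<subseteq> events" using sub1 WWM X0s unfolding R_def by blast
    show "sets (increment_sigma M W t {t..T}) \<subseteq> events" using sub2 WWM by blast
    fix a b assume "a \<in> R" and b: "b \<in> sets (increment_sigma M W t {t..T})"
    then obtain A E where a: "a = (X0 -` A \<inter> space M) \<inter> E" "A \<in> sets borel"
      "E \<in> sets (increment_sigma M W 0 {0..t})" by (auto simp: R_def)
    \<comment> \<open>\<open>X0\<close> is separated from \<open>E\<close> and \<open>b\<close>
      jointly before past and future of \<open>W\<close> are separated from each other.\<close>
    have "E \<inter> b \<in> sets WW" using a(3) b sub1 sub2 by blast
    then have "prob ((X0 -` A \<inter> space M) \<inter> (E \<inter> b)) = prob (X0 -` A \<inter> space M) * prob (E \<inter> b)"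
      using X0_independent[OF a(2)] WW by blast
    also have "prob (E \<inter> b) = prob E * prob b"
      using increments_independent[OF t] a(3) b unfolding indep_sets2_eq by blast
    also have "prob (X0 -` A \<inter> space M) * (prob E * prob b) = prob a * prob b"
      using X0_independent[OF a(2), of E] a sub1 WW by auto
    finally show "prob (a \<inter> b) = prob a * prob b" by (simp add: a(1) Int_assoc)
  qed
  moreover have "Int_stable R"
  proof (rule Int_stableI)
    fix a b assume "a \<in> R" "b \<in> R"
    then obtain A E A' E' where "a = (X0 -` A \<inter> space M) \<inter> E" "A \<in> sets borel"
      "E \<in> sets (increment_sigma M W 0 {0..t})" "b = (X0 -` A' \<inter> space M) \<inter> E'" "A' \<in> sets borel"
      "E' \<in> sets (increment_sigma M W 0 {0..t})" by (auto simp: R_def)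
    then show "a \<inter> b \<in> R" unfolding R_def
      by (intro CollectI exI[of _ "A \<inter> A'"] exI[of _ "E \<inter> E'"]) auto
  qed
  moreover have "Int_stable (sets (increment_sigma M W t {t..T}))" by (auto simp: Int_stable_def)
  ultimately have ind: "indep_set (sigma_sets (space M) R) (sigma_sets (space M) (sets (increment_sigma M W t {t..T})))"
    by (rule indep_set_sigma_sets)
  have "R \<subseteq> Pow (space M)" by (auto simp: R_def)
  then have sig: "sigma_algebra (space M) (sigma_sets (space M) R)" by (rule sigma_algebra_sigma_sets)
  have "\<exists>B\<in>sigma_sets (space M) R. AE w in M. w \<in> A \<longleftrightarrow> w \<in> B"
  proof (rule sigma_sets_AE_approx[OF sig _ A[unfolded sets_F]])
    fix C assume "C \<in> {X0 -` A \<inter> space M | A. A \<in> sets borel} \<union>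
      {W s -` A \<inter> space M | s A. s \<in> {0..t} \<and> A \<in> sets borel} \<union> null_sets M"
    then consider (X) A where "C = X0 -` A \<inter> space M" "A \<in> sets borel"
      | (W) s A where "C = W s -` A \<inter> space M" "s \<in> {0..t}" "A \<in> sets borel"
      | (N) "C \<in> null_sets M" by auto
    then show "\<exists>B\<in>sigma_sets (space M) R. AE w in M. w \<in> C \<longleftrightarrow> w \<in> B"
    proof cases
      case X
      have "C = (X0 -` A \<inter> space M) \<inter> space M" using X by auto
      then have "C \<in> R" using X sets.top[of "increment_sigma M W 0 {0..t}"] unfolding R_def by auto
      then show ?thesis by (intro bexI[of _ C] sigma_sets.Basic) auto
    next
      case W
      \<comment> \<open>An event of \<open>W s\<close> is replaced by the event of the increment
        from \<open>0\<close>; the two agree off the null set where \<open>W 0\<close> is not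
        \<open>0\<close>.\<close>
      define C' where "C' = (\<lambda>w. W s w - W 0 w) -` A \<inter> space M"
      have "C' \<in> sets (increment_sigma M W 0 {0..t})"
        using measurable_sets[OF increment_measurable[OF W(2)] W(3)] by (simp add: C'_def)
      then have "(X0 -` UNIV \<inter> space M) \<inter> C' \<in> R" unfolding R_def
        by (intro CollectI exI[of _ UNIV] exI[of _ C']) simp
      moreover have "(X0 -` UNIV \<inter> space M) \<inter> C' = C'" by (auto simp: C'_def)
      ultimately have "C' \<in> R" by simp
      moreover have "AE w in M. w \<in> C \<longleftrightarrow> w \<in> C'"
        using W_zero by eventually_elim (auto simp: W C'_def)
      ultimately show ?thesis by (intro bexI[of _ C'] sigma_sets.Basic) auto
    next
      case N
      then have "AE w in M. w \<in> C \<longleftrightarrow> w \<in> {}" using AE_not_in[OF N] by auto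
      then show ?thesis by (intro bexI[of _ "{}"] sigma_sets.Empty)
    qed
  qed
  then obtain B where B: "B \<in> sigma_sets (space M) R" "AE w in M. w \<in> A \<longleftrightarrow> w \<in> B" by blast
  have ev: "A \<in> events" "B \<in> events" "D \<in> events"
    using A sets_F_subset[of t] t B(1) ind D sub2 WWM unfolding indep_sets2_eq by auto
  have "prob A = prob B" using B(2) ev by (intro finite_measure_eq_AE) auto
  moreover have "prob (A \<inter> D) = prob (B \<inter> D)" using B(2) ev by (intro finite_measure_eq_AE) auto
  moreover have "prob (B \<inter> D) = prob B * prob D"
    using ind B(1) D unfolding indep_sets2_eq by blast
  ultimately show ?thesis by simp
qed

lemma filtration_indep_var:
  assumes t: "t \<in> {0..T}" and U: "U \<in> borel_measurable (F t)" and V: "V \<in> borel_measurable (increment_sigma M W t {t..T})"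
  shows "indep_var borel (U :: 'w \<Rightarrow> real) borel (V :: 'w \<Rightarrow> real)"
proof -
  have sub: "sets (increment_sigma M W t {t..T}) \<subseteq> sets M"
    using increments_independent[OF t] unfolding indep_sets2_eq by blast
  have Um: "U \<in> borel_measurable M" using measurable_F_M[OF U] t by simp
  have Vm: "V \<in> borel_measurable M" using V sub by (auto simp: measurable_def)
  have "sigma_sets (space M) {U -` A \<inter> space M | A. A \<in> sets borel} \<subseteq> sets (F t)"
    using sets.sigma_sets_subset[of "{U -` A \<inter> space M | A. A \<in> sets borel}" "F t"] measurable_sets[OF U] by auto
  moreover have "sigma_sets (space M) {V -` A \<inter> space M | A. A \<in> sets borel} \<subseteq> sets (increment_sigma M W t {t..T})"
    using sets.sigma_sets_subset[of "{V -` A \<inter> space M | A. A \<in> sets borel}" "increment_sigma M W t {t..T}"]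
      measurable_sets[OF V] by auto
  ultimately have gen: "A \<in> sets (F t)" "B \<in> sets (increment_sigma M W t {t..T})"
    if "A \<in> sigma_sets (space M) {U -` A \<inter> space M | A. A \<in> sets borel}"
      "B \<in> sigma_sets (space M) {V -` A \<inter> space M | A. A \<in> sets borel}" for A B
    using that by auto
  show ?thesis
    unfolding indep_var_eq indep_sets2_eq
  proof (intro conjI ballI Um Vm)
    have e: "{} \<in> sigma_sets (space M) G" for G by (rule sigma_sets.Empty)
    show "sigma_sets (space M) {U -` A \<inter> space M | A. A \<in> sets borel} \<subseteq> events"
      using gen(1)[OF _ e] sets_F_subset[of t] t by auto
    show "sigma_sets (space M) {V -` A \<inter> space M | A. A \<in> sets borel} \<subseteq> events"
      using gen(2)[OF e] sub by auto
  qed (rule filtration_independent[OF t gen])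
qed

end

section \<open>The Ito integral\<close>

lemma L2norm_tendsto_0_iff_integral: "(\<lambda>k. L2norm M (Y k)) \<longlonglongrightarrow> 0 \<longleftrightarrow> (\<lambda>k. LINT w|M. (norm (Y k w))\<^sup>2) \<longlonglongrightarrow> 0"
proof
  assume "(\<lambda>k. L2norm M (Y k)) \<longlonglongrightarrow> 0"
  from tendsto_power[OF this, of 2] show "(\<lambda>k. LINT w|M. (norm (Y k w))\<^sup>2) \<longlonglongrightarrow> 0"
    by (simp add: L2norm_power2)
next
  assume "(\<lambda>k. LINT w|M. (norm (Y k w))\<^sup>2) \<longlonglongrightarrow> 0"
  from tendsto_real_sqrt[OF this] show "(\<lambda>k. L2norm M (Y k)) \<longlonglongrightarrow> 0"
    by (simp add: L2norm_def)
qed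

lemma nn_integral_tendsto_L2norm:
  fixes Y :: "nat \<Rightarrow> 'w \<Rightarrow> 'a::euclidean_space"
  assumes [measurable]: "\<And>k. Y k \<in> borel_measurable M"
    and lim: "(\<lambda>k. \<integral>\<^sup>+w. ennreal ((norm (Y k w))\<^sup>2) \<partial>M) \<longlonglongrightarrow> 0"
  shows "(\<lambda>k. L2norm M (Y k)) \<longlonglongrightarrow> 0" "\<exists>k. L2 M (Y k)"
proof -
  have "(\<lambda>k. enn2real (\<integral>\<^sup>+w. ennreal ((norm (Y k w))\<^sup>2) \<partial>M)) \<longlonglongrightarrow> 0"
    using tendsto_enn2real[of _ 0] lim by simp
  then show "(\<lambda>k. L2norm M (Y k)) \<longlonglongrightarrow> 0"
    unfolding L2norm_tendsto_0_iff_integral by (simp add: integral_eq_nn_integral)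
  have "eventually (\<lambda>k. (\<integral>\<^sup>+w. ennreal ((norm (Y k w))\<^sup>2) \<partial>M) < 1) sequentially"
    by (rule order_tendstoD(2)[OF lim]) simp
  then obtain k where "(\<integral>\<^sup>+w. ennreal ((norm (Y k w))\<^sup>2) \<partial>M) < 1"
    by (auto simp: eventually_sequentially)
  then have "(\<integral>\<^sup>+w. ennreal ((norm (Y k w))\<^sup>2) \<partial>M) < \<infinity>" by (rule order.strict_trans) simp
  then have "L2 M (Y k)"
    by (auto simp: sq_integrable_def integrable_iff_bounded)
  then show "\<exists>k. L2 M (Y k)" ..
qed

context mean_field_space
begin

abbreviation lT :: "real measure" where "lT \<equiv> restrict_space lborel {0..T}"

lemma finite_lT: "finite_measure lT"
  by (rule finite_measureI) (simp add: space_restrict_space emeasure_restrict_space emeasure_lborel_Icc_eq)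

lemma pair_dtP: "pair_sigma_finite lT M"
  by (intro pair_sigma_finite.intro finite_measure.axioms(1)[OF finite_lT])
    (unfold_locales)

lemma finite_dtP: "finite_measure (dtP M T)"
  unfolding dtP_def
  by (intro finite_measure_pair_measure finite_lT) unfold_locales

lemma space_dtP: "space (dtP M T) = {0..T} \<times> space M"
  by (simp add: dtP_def space_pair_measure space_restrict_space)

lemma sets_dtP: "sets (dtP M T) = sets (restrict_space borel {0..T} \<Otimes>\<^sub>M M)"
  unfolding dtP_def by (intro sets_pair_measure_cong sets_restrict_space_cong) auto

lemma measurable_dtP_iff: "measurable (dtP M T) N = measurable (restrict_space borel {0..T} \<Otimes>\<^sub>M M) N"
  by (rule measurable_cong_sets[OF sets_dtP refl])

lemmas dtP_integral_fst = pair_sigma_finite.integral_fst[OF pair_dtP, folded dtP_def]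
  and dtP_integral_snd = pair_sigma_finite.integral_snd[OF pair_dtP, folded dtP_def]
  and dtP_integrable_fst = pair_sigma_finite.integrable_fst[OF pair_dtP, folded dtP_def]
  and dtP_integrable_snd = pair_sigma_finite.integrable_snd[OF pair_dtP, folded dtP_def]
  and dtP_AE_integrable_fst = pair_sigma_finite.AE_integrable_fst[OF pair_dtP, folded dtP_def]
  and dtP_AE_integrable_snd = pair_sigma_finite.AE_integrable_snd[OF pair_dtP, folded dtP_def]

lemma measurable_dtP_const:
  assumes "U \<in> measurable M N" shows "(\<lambda>(t, w). U w) \<in> measurable (dtP M T) N"
  unfolding dtP_def case_prod_beta' using measurable_compose[OF measurable_snd assms] .

lemma measurable_dtP_time:
  assumes "h \<in> measurable (restrict_space borel {0..T}) N" shows "(\<lambda>(t, w). h t) \<in> measurable (dtP M T) N"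
  unfolding measurable_dtP_iff case_prod_beta' using measurable_compose[OF measurable_fst assms] .

lemma dtP_nn_integral:
  assumes h: "measurable_dtP h"
  shows "(\<integral>\<^sup>+w. (\<integral>\<^sup>+t\<in>{0..T}. h t w \<partial>lborel) \<partial>M) = (\<integral>\<^sup>+(t, w). h t w \<partial>dtP M T)"
proof -
  interpret pair_sigma_finite lT M by (rule pair_dtP)
  have "(\<integral>\<^sup>+(t, w). h t w \<partial>dtP M T) = (\<integral>\<^sup>+w. (\<integral>\<^sup>+t. h t w \<partial>lT) \<partial>M)"
    using nn_integral_snd[of "\<lambda>(t, w). h t w"] h by (simp add: dtP_def)
  also have "\<dots> = (\<integral>\<^sup>+w. (\<integral>\<^sup>+t\<in>{0..T}. h t w \<partial>lborel) \<partial>M)"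
    by (subst nn_integral_restrict_space) auto
  finally show ?thesis by simp
qed

lemma L2_dtP_bounded:
  assumes "measurable_dtP h"
    and "\<And>t w. t \<in> {0..T} \<Longrightarrow> w \<in> space M \<Longrightarrow> norm (h t w) \<le> C"
  shows "L2_dtP h"
  by (rule finite_measure.L2_bounded[OF finite_dtP assms(1), of C])
    (use assms(2) in \<open>auto simp: space_dtP\<close>)

section \<open>Moments of Brownian increments\<close>

lemma increment_distributed:
  assumes "0 \<le> a" "a < b" "b \<le> T"
  shows "distributed M lborel (\<lambda>w. W b w $ i - W a w $ i) (normal_density 0 (sqrt (b - a)))"
  using brownian assms unfolding brownian_motion_def by blast

lemma increment_square_integrable:
  assumes "0 \<le> a" "a \<le> b" "b \<le> T"
  shows "L2 M (\<lambda>w. W b w $ i - W a w $ i)"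
proof (cases "a = b")
  case False
  then have ab: "0 < sqrt (b - a)" using assms by simp
  note D = increment_distributed[of a b i]
  have "integrable lborel (\<lambda>x. normal_density 0 (sqrt (b - a)) x * x\<^sup>2)"
    using integrable_normal_moment[OF ab, of 0 2] by simp
  then have "integrable M (\<lambda>w. (W b w $ i - W a w $ i)\<^sup>2)"
    using distributed_integrable[OF D, of "\<lambda>x. x\<^sup>2"] assms False by simp
  then show ?thesis using W_measurable[of a] W_measurable[of b] assms
    by (auto simp: sq_integrable_def intro!: borel_measurable_diff borel_measurable_vec_nth)
qed simp

lemma increment_moments:
  assumes ab: "0 \<le> a" "a \<le> b" "b \<le> T"
  shows "(LINT w|M. W b w $ i - W a w $ i) = 0"
    and "integrable M (\<lambda>w. (W b w $ i - W a w $ i) * (W b w $ j - W a w $ j))"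
    and "(LINT w|M. (W b w $ i - W a w $ i) * (W b w $ j - W a w $ j)) = (if i = j then b - a else 0)"
proof -
  have zero: "(LINT w|M. W b w $ i - W a w $ i) = 0" for i
    using normal_distributed_expectation[OF _ increment_distributed[of a b i]] ab by (cases "a = b") auto
  then show "(LINT w|M. W b w $ i - W a w $ i) = 0" .
  show "integrable M (\<lambda>w. (W b w $ i - W a w $ i) * (W b w $ j - W a w $ j))"
    using L2_inner[OF increment_square_integrable[OF ab, of i] increment_square_integrable[OF ab, of j]] by simp
  show "(LINT w|M. (W b w $ i - W a w $ i) * (W b w $ j - W a w $ j)) = (if i = j then b - a else 0)"
  proof (cases "a = b")
    case False
    then have lt: "a < b" using ab by simp
    show ?thesis
    proof (cases "i = j")
      case True
      then show ?thesis
        using normal_distributed_variance[OF _ increment_distributed[OF ab(1) lt ab(3), of i]] zero[of i] lt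
        by (simp add: power2_eq_square)
    next
      case neq: False
      \<comment> \<open>A grid with the single step from \<open>a\<close> to \<open>b\<close>:
        independence of its increments says that the components are independent, which gives
        covariance \<open>0\<close>.\<close>
      define \<tau> where "\<tau> k = (if k = (0::nat) then a else b)" for k
      define D where "D = (\<lambda>(k, i) w. W (\<tau> (Suc k)) w $ i - W (\<tau> k) w $ i)"
      have "(\<forall>k\<le>1. \<tau> k \<in> {0..T}) \<and> (\<forall>k<1. \<tau> k < \<tau> (Suc k))"
        using ab lt by (auto simp: \<tau>_def)
      then have "indep_vars (\<lambda>_. borel) D ({..<1} \<times> UNIV)"
        using brownian unfolding brownian_motion_def D_def by blast
      then have "indep_vars (\<lambda>_. borel) D {(0, i), (0, j)}"
        by (rule indep_vars_subset) auto
      moreover have D0: "D (0, l) = (\<lambda>w. W b w $ l - W a w $ l)" for l by (auto simp: D_def \<tau>_def)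
      moreover have "integrable M (\<lambda>w. W b w $ l - W a w $ l)" for l
        by (rule L2_integrable[OF increment_square_integrable[OF ab]])
      ultimately have "(\<integral>w. (\<Prod>p\<in>{(0, i), (0, j)}. D p w) \<partial>M) = (\<Prod>p\<in>{(0, i), (0, j)}. \<integral>w. D p w \<partial>M)"
        by (intro indep_vars_lebesgue_integral) auto
      then show ?thesis using neq zero D0 by simp
    qed
  qed simp
qed

lemma increment_coordinate_measurable:
  "a \<le> b \<Longrightarrow> b \<le> T \<Longrightarrow> (\<lambda>w. W b w $ i - W a w $ i) \<in> borel_measurable (increment_sigma M W a {a..T})"
  using borel_measurable_vec_nth[OF increment_measurable[of b "{a..T}" W a M], of i] by simp

text \<open>A factor known at time \<open>a\<close> is independent of the increment after
  \<open>a\<close>, so all expectations factor into moments of the increment.\<close>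

lemma adapted_times_increment:
  assumes ab: "0 \<le> a" "a \<le> b" "b \<le> T" and U: "U \<in> borel_measurable (F a)" "integrable M U"
  shows "integrable M (\<lambda>w. U w * (W b w $ i - W a w $ i))"
    and "(LINT w|M. U w * (W b w $ i - W a w $ i)) = 0"
    and "integrable M (\<lambda>w. U w * ((W b w $ i - W a w $ i) * (W b w $ j - W a w $ j)))"
    and "(LINT w|M. U w * ((W b w $ i - W a w $ i) * (W b w $ j - W a w $ j)))
      = (if i = j then (b - a) * expectation U else 0)"
proof -
  have a: "a \<in> {0..T}" using ab by auto
  note m = increment_coordinate_measurable[OF ab(2,3)]
  note int = L2_integrable[OF increment_square_integrable[OF ab]]
  have 1: "indep_var borel U borel (\<lambda>w. W b w $ i - W a w $ i)"
    by (rule filtration_indep_var[OF a U(1) m])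
  have 2: "indep_var borel U borel (\<lambda>w. (W b w $ i - W a w $ i) * (W b w $ j - W a w $ j))"
    by (rule filtration_indep_var[OF a U(1) borel_measurable_times[OF m m]])
  show "integrable M (\<lambda>w. U w * (W b w $ i - W a w $ i))"
    by (rule indep_var_integrable[OF 1 U(2) int])
  show "(LINT w|M. U w * (W b w $ i - W a w $ i)) = 0"
    using indep_var_lebesgue_integral[OF 1 U(2) int] increment_moments(1)[OF ab] by simp
  show "integrable M (\<lambda>w. U w * ((W b w $ i - W a w $ i) * (W b w $ j - W a w $ j)))"
    by (rule indep_var_integrable[OF 2 U(2) increment_moments(2)[OF ab]])
  show "(LINT w|M. U w * ((W b w $ i - W a w $ i) * (W b w $ j - W a w $ j)))
      = (if i = j then (b - a) * expectation U else 0)"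
    using indep_var_lebesgue_integral[OF 2 U(2) increment_moments(2)[OF ab]] increment_moments(3)[OF ab] by simp
qed

section \<open>Elementary integrands and the Ito isometry\<close>

definition bounded_adapted :: "real \<Rightarrow> ('w \<Rightarrow> real^'m^'d) \<Rightarrow> bool" where
  "bounded_adapted a \<xi> \<longleftrightarrow> \<xi> \<in> borel_measurable (F a) \<and> (\<exists>C. \<forall>w\<in>space M. norm (\<xi> w) \<le> C)"

definition elementary_increment :: "real \<Rightarrow> real \<Rightarrow> ('w \<Rightarrow> real^'m^'d) \<Rightarrow> 'w \<Rightarrow> real^'d" where
  "elementary_increment a b \<xi> w = \<xi> w *v (W b w - W a w)"

lemma bounded_adapted_mono: "bounded_adapted a \<xi> \<Longrightarrow> a \<le> c \<Longrightarrow> bounded_adapted c \<xi>"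
  unfolding bounded_adapted_def using measurable_F_mono by blast

lemma increment_L2:
  assumes "0 \<le> a" "a \<le> b" "b \<le> T" shows "L2 M (\<lambda>w. W b w - W a w)"
proof -
  have "integrable M (\<lambda>w. \<Sum>i\<in>UNIV. (W b w $ i - W a w $ i)\<^sup>2)"
    using increment_square_integrable[OF assms] by (intro Bochner_Integration.integrable_sum) (auto simp: sq_integrable_def)
  moreover have "(norm (W b w - W a w))\<^sup>2 = (\<Sum>i\<in>UNIV. (W b w $ i - W a w $ i)\<^sup>2)" for w
    by (simp add: norm_vec_def L2_set_def sum_nonneg)
  moreover have "(\<lambda>w. W b w - W a w) \<in> borel_measurable M"
    using assms by (intro borel_measurable_diff W_measurable) auto
  ultimately show ?thesis by (simp add: sq_integrable_def)
qed

lemma elementary_increment_L2: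
  assumes ab: "0 \<le> a" "a \<le> b" "b \<le> T" and \<xi>: "bounded_adapted a \<xi>"
  shows "L2 M (elementary_increment a b \<xi>)"
proof -
  obtain C where C: "\<And>w. w \<in> space M \<Longrightarrow> norm (\<xi> w) \<le> C" and m: "\<xi> \<in> borel_measurable (F a)"
    using \<xi> by (auto simp: bounded_adapted_def)
  have "\<xi> \<in> borel_measurable M" using measurable_F_M[OF m] ab by simp
  from L2_matrix_mult(1)[OF increment_L2[OF ab] this C] show ?thesis
    by (simp add: elementary_increment_def [abs_def])
qed

lemma elementary_increment_measurable:
  assumes ab: "0 \<le> a" "a \<le> b" "b \<le> T" "b \<le> c" and \<xi>: "bounded_adapted a \<xi>"
  shows "elementary_increment a b \<xi> \<in> borel_measurable (F c)"
proof -
  have [measurable]: "\<xi> \<in> borel_measurable (F c)" "W a \<in> borel_measurable (F c)" "W b \<in> borel_measurable (F c)"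
    using bounded_adapted_mono[OF \<xi>, of c] ab W_measurable_F by (auto simp: bounded_adapted_def)
  show ?thesis unfolding elementary_increment_def[abs_def] by measurable
qed

text \<open>Moving \<open>\<xi>\<close> to the other side as a transpose makes every coefficient of
  a Brownian increment measurable at time \<open>a\<close>; such products have mean
  \<open>0\<close>.\<close>

lemma inner_elementary_increment:
  assumes ab: "0 \<le> a" "a \<le> b" "b \<le> T" and \<xi>: "bounded_adapted a \<xi>"
    and U: "U \<in> borel_measurable (F a)" "L2 M U"
  shows "(LINT w|M. U w \<bullet> elementary_increment a b \<xi> w) = 0"
proof -
  obtain C where C: "\<And>w. w \<in> space M \<Longrightarrow> norm (\<xi> w) \<le> C" and [measurable]: "\<xi> \<in> borel_measurable (F a)"
    using \<xi> by (auto simp: bounded_adapted_def)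
  note [measurable] = U(1)
  have \<xi>M: "\<xi> \<in> borel_measurable M" using measurable_F_M[of \<xi> a borel] ab by simp
  define V where "V w = transpose (\<xi> w) *v U w" for w
  have Vm: "(\<lambda>w. V w $ i) \<in> borel_measurable (F a)" for i
    unfolding V_def by measurable
  have "L2 M V"
    unfolding V_def by (rule L2_matrix_mult(1)[OF U(2), where K = C]) (use \<xi>M C in auto)
  then have Vi: "integrable M (\<lambda>w. V w $ i)" for i
    by (intro L2_integrable L2_component)
  have "U w \<bullet> elementary_increment a b \<xi> w = (\<Sum>i\<in>UNIV. V w $ i * (W b w $ i - W a w $ i))" for w
    by (simp add: elementary_increment_def inner_commute[of "U w"] inner_matrix_transpose V_def[symmetric])
      (simp add: inner_vec_def mult.commute)
  then have "(LINT w|M. U w \<bullet> elementary_increment a b \<xi> w)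
      = (\<Sum>i\<in>UNIV. (LINT w|M. V w $ i * (W b w $ i - W a w $ i)))"
    using adapted_times_increment(1)[OF ab Vm Vi] by (simp add: Bochner_Integration.integral_sum)
  then show ?thesis using adapted_times_increment(2)[OF ab Vm Vi] by simp
qed

text \<open>Of the double sum over coordinates only \<open>i = j\<close> contributes, with variance
  \<open>b - a\<close>; what remains is the Frobenius inner product of \<open>\<xi>\<close> and
  \<open>\<eta>\<close>.\<close>

lemma inner_elementary_increment_same:
  assumes ab: "0 \<le> a" "a \<le> b" "b \<le> T" and \<xi>: "bounded_adapted a \<xi>" and \<eta>: "bounded_adapted a \<eta>"
  shows "(LINT w|M. elementary_increment a b \<xi> w \<bullet> elementary_increment a b \<eta> w)
    = (b - a) * ip \<xi> \<eta>"
proof -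
  obtain C where C: "\<And>w. w \<in> space M \<Longrightarrow> norm (\<xi> w) \<le> C" and [measurable]: "\<xi> \<in> borel_measurable (F a)"
    using \<xi> by (auto simp: bounded_adapted_def)
  obtain C' where C': "\<And>w. w \<in> space M \<Longrightarrow> norm (\<eta> w) \<le> C'" and [measurable]: "\<eta> \<in> borel_measurable (F a)"
    using \<eta> by (auto simp: bounded_adapted_def)
  have m: "\<xi> \<in> borel_measurable M" "\<eta> \<in> borel_measurable M"
    using measurable_F_M[of \<xi> a borel] measurable_F_M[of \<eta> a borel] ab by simp_all
  define V where "V i j w = (\<Sum>l\<in>UNIV. \<xi> w $ l $ i * \<eta> w $ l $ j)" for i j w
  have Vm: "V i j \<in> borel_measurable (F a)" for i j
    unfolding V_def[abs_def] by measurable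
  have sq: "L2 M \<xi>" "L2 M \<eta>"
    using L2_bounded[OF m(1) C] L2_bounded[OF m(2) C'] by auto
  have Vi: "integrable M (V i j)" for i j
  proof -
    have "L2 M (\<lambda>w. \<xi> w $ l $ i)" "L2 M (\<lambda>w. \<eta> w $ l $ j)" for l
    proof -
      have "L2 M (\<lambda>w. \<xi> w $ l)"
        by (rule L2_bound[OF sq(1), of _ 1])
          (auto simp: Finite_Cartesian_Product.norm_nth_le intro!: borel_measurable_vec_nth m)
      then show "L2 M (\<lambda>w. \<xi> w $ l $ i)" by (rule L2_component)
      have "L2 M (\<lambda>w. \<eta> w $ l)"
        by (rule L2_bound[OF sq(2), of _ 1])
          (auto simp: Finite_Cartesian_Product.norm_nth_le intro!: borel_measurable_vec_nth m)
      then show "L2 M (\<lambda>w. \<eta> w $ l $ j)" by (rule L2_component)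
    qed
    then have "integrable M (\<lambda>w. \<xi> w $ l $ i \<bullet> \<eta> w $ l $ j)" for l by (rule L2_inner)
    then show ?thesis unfolding V_def[abs_def] by (intro Bochner_Integration.integrable_sum) simp
  qed
  let ?D = "\<lambda>i w. W b w $ i - W a w $ i"
  have eq: "elementary_increment a b \<xi> w \<bullet> elementary_increment a b \<eta> w
      = (\<Sum>i\<in>UNIV. \<Sum>j\<in>UNIV. V i j w * (?D i w * ?D j w))" for w
  proof -
    have "elementary_increment a b \<xi> w \<bullet> elementary_increment a b \<eta> w
        = (\<Sum>l\<in>UNIV. (\<Sum>i\<in>UNIV. \<xi> w $ l $ i * ?D i w) * (\<Sum>j\<in>UNIV. \<eta> w $ l $ j * ?D j w))"
      by (simp add: elementary_increment_def inner_vec_def matrix_vector_mult_def)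
    also have "\<dots> = (\<Sum>l\<in>UNIV. \<Sum>i\<in>UNIV. \<Sum>j\<in>UNIV. (\<xi> w $ l $ i * \<eta> w $ l $ j) * (?D i w * ?D j w))"
      unfolding sum_product by (intro sum.cong refl) (simp only: mult_ac)
    also have "\<dots> = (\<Sum>i\<in>UNIV. \<Sum>l\<in>UNIV. \<Sum>j\<in>UNIV. (\<xi> w $ l $ i * \<eta> w $ l $ j) * (?D i w * ?D j w))"
      by (rule sum.swap)
    also have "\<dots> = (\<Sum>i\<in>UNIV. \<Sum>j\<in>UNIV. \<Sum>l\<in>UNIV. (\<xi> w $ l $ i * \<eta> w $ l $ j) * (?D i w * ?D j w))"
      by (intro sum.cong refl sum.swap)
    finally show ?thesis by (simp add: V_def sum_distrib_right)
  qed
  have "(LINT w|M. elementary_increment a b \<xi> w \<bullet> elementary_increment a b \<eta> w)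
      = (\<Sum>i\<in>UNIV. \<Sum>j\<in>UNIV. if i = j then (b - a) * expectation (V i j) else 0)"
    unfolding eq
    by (simp add: Bochner_Integration.integral_sum Bochner_Integration.integrable_sum
      adapted_times_increment(3,4)[OF ab Vm Vi])
  also have "\<dots> = (b - a) * (\<Sum>i\<in>UNIV. expectation (V i i))"
    by (simp add: sum_distrib_left)
  also have "(\<Sum>i\<in>UNIV. expectation (V i i)) = expectation (\<lambda>w. \<Sum>i\<in>UNIV. V i i w)"
    using Vi by (simp add: Bochner_Integration.integral_sum)
  also have "(\<lambda>w. \<Sum>i\<in>UNIV. V i i w) = (\<lambda>w. \<xi> w \<bullet> \<eta> w)"
    unfolding V_def by (subst sum.swap) (simp add: inner_vec_def)
  finally show ?thesis .
qed

text \<open>Both intervals are cut at \<open>c\<close> and at \<open>m = min b d\<close>. Only the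
  two pieces over the common part from \<open>c\<close> to \<open>m\<close> are correlated; in every
  other pair of nonempty pieces one starts no earlier than the other ends.\<close>

lemma inner_elementary_increments_le:
  assumes ab: "0 \<le> a" "a \<le> b" "b \<le> T" and cd: "a \<le> c" "c \<le> d" "d \<le> T"
    and \<xi>: "bounded_adapted a \<xi>" and \<eta>: "bounded_adapted c \<eta>"
  shows "(LINT w|M. elementary_increment a b \<xi> w \<bullet> elementary_increment c d \<eta> w)
    = max 0 (min b d - c) * ip \<xi> \<eta>"
proof (cases "b \<le> c")
  case True
  have "(LINT w|M. elementary_increment a b \<xi> w \<bullet> elementary_increment c d \<eta> w) = 0"
    using ab cd True by (intro inner_elementary_increment \<eta> elementary_increment_measurable
      elementary_increment_L2 \<xi>) auto
  then show ?thesis using True by (simp add: max_def min_def)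
next
  case False
  define m where "m = min b d"
  have m: "c \<le> m" "m \<le> b" "m \<le> d" "m = b \<or> m = d" using False cd by (auto simp: m_def)
  note \<xi>' = bounded_adapted_mono[OF \<xi>]
  note \<eta>' = bounded_adapted_mono[OF \<eta>]
  let ?e = elementary_increment
  have split: "?e p r \<zeta> = (\<lambda>w. ?e p q \<zeta> w + ?e q r \<zeta> w)" for p q r \<zeta>
    by (simp add: elementary_increment_def[abs_def] matrix_vector_mult_add_rdistrib[symmetric] flip: matrix_vector_right_distrib)
  have sq: "L2 M (?e a c \<xi>)" "L2 M (?e c m \<xi>)" "L2 M (?e m b \<xi>)"
    "L2 M (?e c m \<eta>)" "L2 M (?e m d \<eta>)" "L2 M (?e c d \<eta>)"
    using ab cd m False by (auto intro!: elementary_increment_L2 \<xi>' \<eta>')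
  have e1: "(LINT w|M. ?e a c \<xi> w \<bullet> ?e c d \<eta> w) = 0"
    using ab cd False by (intro inner_elementary_increment \<eta> elementary_increment_measurable
      elementary_increment_L2 \<xi>) auto
  have e2: "(LINT w|M. ?e c m \<xi> w \<bullet> ?e c m \<eta> w) = (m - c) * ip \<xi> \<eta>"
    using ab cd m False by (intro inner_elementary_increment_same \<xi>' \<eta>) auto
  have e3: "(LINT w|M. ?e c m \<xi> w \<bullet> ?e m d \<eta> w) = 0"
    using ab cd m False by (intro inner_elementary_increment \<eta>' elementary_increment_measurable
      elementary_increment_L2 \<xi>') auto
  have e4: "(LINT w|M. ?e c m \<eta> w \<bullet> ?e m b \<xi> w) = 0"
    using ab cd m False by (intro inner_elementary_increment \<xi>' elementary_increment_measurable
      elementary_increment_L2 \<eta>) auto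
  \<comment> \<open>\<open>m\<close> equals \<open>b\<close> or \<open>d\<close>, so one of the two
    increments is zero.\<close>
  have e5: "(LINT w|M. ?e m b \<xi> w \<bullet> ?e m d \<eta> w) = 0"
    using m(4) by (auto simp: elementary_increment_def)
  have "(\<lambda>w. ?e a b \<xi> w \<bullet> ?e c d \<eta> w) = (\<lambda>w. ?e a c \<xi> w \<bullet> ?e c d \<eta> w + ?e c m \<xi> w \<bullet> ?e c m \<eta> w
      + ?e c m \<xi> w \<bullet> ?e m d \<eta> w + ?e c m \<eta> w \<bullet> ?e m b \<xi> w + ?e m b \<xi> w \<bullet> ?e m d \<eta> w)"
  proof
    fix w
    have "?e a b \<xi> w = ?e a c \<xi> w + (?e c m \<xi> w + ?e m b \<xi> w)"
      using split[of a b \<xi> c] split[of c b \<xi> m] by metis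
    moreover have "?e c d \<eta> w = ?e c m \<eta> w + ?e m d \<eta> w" using split[of c d \<eta> m] by metis
    ultimately show "?e a b \<xi> w \<bullet> ?e c d \<eta> w = ?e a c \<xi> w \<bullet> ?e c d \<eta> w + ?e c m \<xi> w \<bullet> ?e c m \<eta> w
      + ?e c m \<xi> w \<bullet> ?e m d \<eta> w + ?e c m \<eta> w \<bullet> ?e m b \<xi> w + ?e m b \<xi> w \<bullet> ?e m d \<eta> w"
      by (simp add: inner_add_left inner_add_right inner_commute)
  qed
  then have "(LINT w|M. ?e a b \<xi> w \<bullet> ?e c d \<eta> w) = (m - c) * ip \<xi> \<eta>"
    using sq e1 e2 e3 e4 e5 by (simp add: L2_inner)
  then show ?thesis using m by (simp add: m_def max_def)
qed

lemma inner_elementary_increments: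
  assumes ab: "0 \<le> a" "a \<le> b" "b \<le> T" and cd: "0 \<le> c" "c \<le> d" "d \<le> T"
    and \<xi>: "bounded_adapted a \<xi>" and \<eta>: "bounded_adapted c \<eta>"
  shows "(LINT w|M. elementary_increment a b \<xi> w \<bullet> elementary_increment c d \<eta> w)
    = measure lborel ({a<..b} \<inter> {c<..d}) * ip \<xi> \<eta>"
proof -
  have "{a<..b} \<inter> {c<..d} = {max a c<..min b d}" by auto
  then have "measure lborel ({a<..b} \<inter> {c<..d}) = max 0 (min b d - max a c)"
    by (cases "max a c \<le> min b d") auto
  moreover have "(LINT w|M. elementary_increment a b \<xi> w \<bullet> elementary_increment c d \<eta> w)
      = max 0 (min b d - max a c) * ip \<xi> \<eta>"
  proof (cases "a \<le> c")
    case True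
    then show ?thesis using inner_elementary_increments_le[OF ab _ cd(2,3) \<xi> \<eta>] by (simp add: max_def)
  next
    case False
    then show ?thesis using inner_elementary_increments_le[OF cd _ ab(2,3) \<eta> \<xi>]
      by (simp add: max_def inner_commute min.commute)
  qed
  ultimately show ?thesis by simp
qed

text \<open>Integrands together with their integrals. No order between the intervals is imposed, so that sums
  need no common refinement.\<close>

inductive elementary_process :: "(real \<Rightarrow> 'w \<Rightarrow> real^'m^'d) \<Rightarrow> ('w \<Rightarrow> real^'d) \<Rightarrow> bool" where
  zero: "elementary_process (\<lambda>r w. 0) (\<lambda>w. 0)"
| step: "elementary_process \<Phi> J \<Longrightarrow> 0 \<le> a \<Longrightarrow> a \<le> b \<Longrightarrow> b \<le> T \<Longrightarrow> bounded_adapted a \<xi> \<Longrightarrow>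
    elementary_process (\<lambda>r w. \<Phi> r w + indicator {a<..b} r *\<^sub>R \<xi> w) (\<lambda>w. J w + elementary_increment a b \<xi> w)"

lemma elementary_step_L2:
  assumes "bounded_adapted a \<xi>" "a \<le> T"
  shows "L2 (dtP M T) (\<lambda>(r, w). indicator {a<..b} r *\<^sub>R \<xi> w)"
proof -
  obtain C where C: "\<And>w. w \<in> space M \<Longrightarrow> norm (\<xi> w) \<le> C" and "\<xi> \<in> borel_measurable (F a)"
    using assms by (auto simp: bounded_adapted_def)
  then have \<xi>: "\<xi> \<in> borel_measurable M" using measurable_F_M assms by blast
  have ind: "indicator {a<..b} \<in> borel_measurable (restrict_space borel {0..T})"
    by (rule measurable_restrict_space1) simp
  have "(\<lambda>(r, w). indicator {a<..b} r *\<^sub>R \<xi> w) \<in> borel_measurable (dtP M T)"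
    using borel_measurable_scaleR[OF measurable_dtP_time[OF ind] measurable_dtP_const[OF \<xi>]] by (simp add: case_prod_beta')
  then show ?thesis
  proof (rule L2_dtP_bounded)
    fix t w assume "w \<in> space M"
    from C[OF this] show "norm (indicator {a<..b} t *\<^sub>R \<xi> w) \<le> C"
      using norm_ge_zero[of "\<xi> w"] by (auto simp: indicator_def simp del: norm_ge_zero)
  qed
qed

lemma elementary_process_L2:
  assumes "elementary_process \<Phi> J"
  shows "L2 M J" "L2 (dtP M T) (\<lambda>(r, w). \<Phi> r w)"
  using assms
proof (induction)
  case (step \<Phi> J a b \<xi>)
  {
    case 1 from step show ?case by (intro L2_add elementary_increment_L2) auto
  next
    case 2
    from step have "L2 (dtP M T) (\<lambda>z. (case z of (r, w) \<Rightarrow> \<Phi> r w) + (case z of (r, w) \<Rightarrow> indicator {a<..b} r *\<^sub>R \<xi> w))"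
      by (intro L2_add elementary_step_L2) auto
    then show ?case by (simp add: case_prod_beta')
  }
qed (auto simp: case_prod_beta')

text \<open>Induction over the first integrand: both sides are additive in it, and for a single step
  both equal the length of the common interval times \<open>E \<xi> . \<eta>\<close>.\<close>

lemma elementary_process_cross:
  assumes "elementary_process \<Phi> J" and cd: "0 \<le> c" "c \<le> d" "d \<le> T" and \<eta>: "bounded_adapted c \<eta>"
  shows "(LINT w|M. J w \<bullet> elementary_increment c d \<eta> w)
    = (LINT (r, w)|dtP M T. \<Phi> r w \<bullet> (indicator {c<..d} r *\<^sub>R \<eta> w))"
  using assms(1)
proof (induction)
  case zero then show ?case by (simp add: case_prod_beta')
next
  case (step \<Phi> J a b \<xi>)
  note ex = elementary_process_L2[OF step.hyps(1)]
  have s1: "L2 (dtP M T) (\<lambda>(r, w). indicator {a<..b} r *\<^sub>R \<xi> w)"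
    and s2: "L2 (dtP M T) (\<lambda>(r, w). indicator {c<..d} r *\<^sub>R \<eta> w)"
    using step cd \<eta> by (auto intro!: elementary_step_L2)
  have e1: "L2 M (elementary_increment a b \<xi>)" "L2 M (elementary_increment c d \<eta>)"
    using step cd \<eta> by (auto intro!: elementary_increment_L2)
  have "measure lborel ({a<..b} \<inter> {c<..d}) * ip \<xi> \<eta>
      = (LINT (r, w)|dtP M T. (indicator {a<..b} r *\<^sub>R \<xi> w) \<bullet> (indicator {c<..d} r *\<^sub>R \<eta> w))"
  proof -
    have "(LINT (r, w)|dtP M T. (indicator {a<..b} r *\<^sub>R \<xi> w) \<bullet> (indicator {c<..d} r *\<^sub>R \<eta> w))
        = (LINT r|lT. LINT w|M. (indicator {a<..b} r *\<^sub>R \<xi> w) \<bullet> (indicator {c<..d} r *\<^sub>R \<eta> w))"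
      using L2_inner[OF s1 s2] by (intro dtP_integral_fst[symmetric]) (simp add: case_prod_beta')
    also have "\<dots> = (LINT r|lT. indicator ({a<..b} \<inter> {c<..d}) r * ip \<xi> \<eta>)"
      by (intro Bochner_Integration.integral_cong refl) (auto simp: indicator_def)
    also have "\<dots> = (LINT r|lT. indicator ({a<..b} \<inter> {c<..d}) r) * ip \<xi> \<eta>"
      by simp
    also have "(LINT r|lT. indicator ({a<..b} \<inter> {c<..d}) r) = measure lborel ({a<..b} \<inter> {c<..d} :: real set)"
    proof -
      define A :: "real set" where "A = {a<..b} \<inter> {c<..d}"
      have "A \<subseteq> {0..T}" using step cd by (auto simp: A_def)
      then have "(\<lambda>r. indicator {0..T} r *\<^sub>R indicator A r) = (indicator A :: real \<Rightarrow> real)"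
        by (auto simp: fun_eq_iff indicator_def)
      then have "(LINT r|lT. indicator A r) = (LINT r|lborel. indicator A r :: real)"
        by (subst integral_restrict_space) auto
      also have "\<dots> = measure lborel (A \<inter> space lborel)" by (rule Bochner_Integration.integral_indicator)
      finally show ?thesis by (simp add: A_def)
    qed
    finally show ?thesis by simp
  qed
  then have "(LINT w|M. elementary_increment a b \<xi> w \<bullet> elementary_increment c d \<eta> w)
    = (LINT (r, w)|dtP M T. (indicator {a<..b} r *\<^sub>R \<xi> w) \<bullet> (indicator {c<..d} r *\<^sub>R \<eta> w))"
    using inner_elementary_increments[OF step.hyps(2-4) cd step.hyps(5) \<eta>] by simp
  with step.IH show ?case
    using L2_inner[OF ex(2) s2] L2_inner[OF s1 s2]
      L2_inner[OF ex(1) e1(2)] L2_inner[OF e1]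
    by (simp add: inner_add_left distrib_left case_prod_beta')
qed

text \<open>On adding a step the square splits into the old square, twice a cross term, and the
  square of the step; the last two are both instances of
  \<open>elementary_process_cross\<close>.\<close>

lemma elementary_process_isometry:
  assumes "elementary_process \<Phi> J"
  shows "L2norm M J = L2norm (dtP M T) (\<lambda>(r, w). \<Phi> r w)"
proof -
  have "ip J J = (LINT (r, w)|dtP M T. \<Phi> r w \<bullet> \<Phi> r w)"
    using assms
  proof (induction)
    case zero then show ?case by (simp add: case_prod_beta')
  next
    case (step \<Phi> J a b \<xi>)
    let ?e = "elementary_increment a b \<xi>" and ?s = "\<lambda>r w. indicator {a<..b} r *\<^sub>R \<xi> w"
    note ex = elementary_process_L2[OF step.hyps(1)]
    have s: "L2 (dtP M T) (\<lambda>(r, w). ?s r w)"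
      using step by (auto intro!: elementary_step_L2)
    have e: "L2 M ?e" using step by (auto intro!: elementary_increment_L2)
    have single: "elementary_process (\<lambda>r w. 0 + ?s r w) (\<lambda>w. 0 + ?e w)"
      using step by (intro elementary_process.step zero) auto
    have c1: "(LINT w|M. J w \<bullet> ?e w) = (LINT (r, w)|dtP M T. \<Phi> r w \<bullet> ?s r w)"
      by (rule elementary_process_cross) (use step in auto)
    have c2: "(LINT w|M. ?e w \<bullet> ?e w) = (LINT (r, w)|dtP M T. ?s r w \<bullet> ?s r w)"
      using elementary_process_cross[OF single step.hyps(2-5)] by simp
    have "(LINT w|M. (J w + ?e w) \<bullet> (J w + ?e w))
        = (LINT w|M. J w \<bullet> J w + 2 * (J w \<bullet> ?e w) + ?e w \<bullet> ?e w)"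
      by (simp add: inner_add_left inner_add_right inner_commute algebra_simps)
    also have "\<dots> = ip J J + 2 * (LINT w|M. J w \<bullet> ?e w) + (LINT w|M. ?e w \<bullet> ?e w)"
      using L2_inner[OF ex(1) ex(1)] L2_inner[OF ex(1) e] L2_inner[OF e e] by simp
    also have "\<dots> = (LINT (r, w)|dtP M T. \<Phi> r w \<bullet> \<Phi> r w + 2 * (\<Phi> r w \<bullet> ?s r w) + ?s r w \<bullet> ?s r w)"
      unfolding step.IH c1 c2
      using L2_inner[OF ex(2) ex(2)] L2_inner[OF ex(2) s] L2_inner[OF s s]
      by (simp add: case_prod_beta')
    also have "\<dots> = (LINT (r, w)|dtP M T. (\<Phi> r w + ?s r w) \<bullet> (\<Phi> r w + ?s r w))"
      by (intro arg_cong[where f = "integral\<^sup>L (dtP M T)"])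
        (auto simp: fun_eq_iff inner_add_left inner_add_right inner_commute algebra_simps)
    finally show ?case .
  qed
  then show ?thesis by (simp add: L2norm_def power2_norm_eq_inner case_prod_beta')
qed

lemma elementary_process_add:
  assumes "elementary_process \<Phi>' J'" "elementary_process \<Phi> J"
  shows "elementary_process (\<lambda>r w. \<Phi> r w + \<Phi>' r w) (\<lambda>w. J w + J' w)"
  using assms
proof (induction)
  case (step \<Phi>' J' a b \<xi>)
  from elementary_process.step[OF step.IH[OF step.prems] step.hyps(2-5)]
  show ?case by (simp add: add.assoc)
qed simp

lemma elementary_process_uminus:
  assumes "elementary_process \<Phi> J"
  shows "elementary_process (\<lambda>r w. - \<Phi> r w) (\<lambda>w. - J w)"
  using assms
proof (induction)
  case zero from elementary_process.zero show ?case by simp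
next
  case (step \<Phi> J a b \<xi>)
  have "bounded_adapted a (\<lambda>w. - \<xi> w)" using step by (auto simp: bounded_adapted_def)
  from elementary_process.step[OF step.IH step.hyps(2-4) this]
  have "elementary_process (\<lambda>r w. - \<Phi> r w + indicator {a<..b} r *\<^sub>R (- \<xi> w))
     (\<lambda>w. - J w + elementary_increment a b (\<lambda>w. - \<xi> w) w)" .
  moreover have "- A *v x = - (A *v x)" for A :: "real^'m^'d" and x
    by (simp add: vec_eq_iff matrix_vector_mult_def sum_negf)
  ultimately show ?case by (simp add: elementary_increment_def)
qed

lemma elementary_process_diff:
  assumes "elementary_process \<Phi> J" "elementary_process \<Phi>' J'"
  shows "elementary_process (\<lambda>r w. \<Phi> r w - \<Phi>' r w) (\<lambda>w. J w - J' w)"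
  using elementary_process_add[OF elementary_process_uminus[OF assms(2)] assms(1)] by simp

lemma elementary_process_simple:
  assumes "\<And>i. i \<le> n \<Longrightarrow> \<tau> i \<in> {0..T}" "\<And>i. i < n \<Longrightarrow> \<tau> i \<le> \<tau> (Suc i)" "\<And>i. i < n \<Longrightarrow> bounded_adapted (\<tau> i) (\<xi> i)"
  shows "elementary_process (simple_proc n \<tau> \<xi>) (simple_integral W n \<tau> \<xi>)"
  using assms
proof (induction n)
  case 0 then show ?case using zero by (simp add: simple_proc_def[abs_def] simple_integral_def[abs_def])
next
  case (Suc n)
  have ep: "elementary_process (simple_proc n \<tau> \<xi>) (simple_integral W n \<tau> \<xi>)" by (rule Suc.IH) (use Suc.prems in auto)
  have bd: "0 \<le> \<tau> n" "\<tau> n \<le> \<tau> (Suc n)" "\<tau> (Suc n) \<le> T" "bounded_adapted (\<tau> n) (\<xi> n)"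
    using Suc.prems(1)[of n] Suc.prems(1)[of "Suc n"] Suc.prems(2)[of n] Suc.prems(3)[of n] by auto
  from elementary_process.step[OF ep bd]
  show ?case by (simp only: simple_proc_def[abs_def] simple_integral_def[abs_def] elementary_increment_def[abs_def] sum.lessThan_Suc)
qed

end

section \<open>Projections and a Gronwall argument without measurability\<close>

text \<open>The componentwise conditional expectation, used as the orthogonal projection onto the
  \<open>G\<close>-measurable square-integrable vectors. Its version depends on the single variable
  \<open>Z\<close>, so a family indexed by time carries no joint measurability.\<close>

definition L2_projection :: "'w measure \<Rightarrow> 'w measure \<Rightarrow> ('w \<Rightarrow> real^'k) \<Rightarrow> 'w \<Rightarrow> real^'k" where
  "L2_projection M G Z w = (\<chi> i. real_cond_exp M G (\<lambda>w. Z w $ i) w)"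

lemma (in finite_measure) L2_projection:
  fixes Z :: "'a \<Rightarrow> real^'k"
  assumes G: "subalgebra M G" and Z: "L2 M Z"
  shows "L2_projection M G Z \<in> borel_measurable G" "L2 M (L2_projection M G Z)"
    "\<And>U. U \<in> borel_measurable G \<Longrightarrow> L2 M U \<Longrightarrow>
       (LINT w|M. U w \<bullet> Z w) = (LINT w|M. U w \<bullet> L2_projection M G Z w)"
proof -
  interpret finite_measure_subalgebra M G by unfold_locales (rule G)
  define P where "P = L2_projection M G Z"
  note P_def = P_def[unfolded L2_projection_def[abs_def]]
  have Zi: "L2 M (\<lambda>w. Z w $ i)" for i by (rule L2_component[OF Z])
  have PG: "P \<in> borel_measurable G"
    by (rule borel_measurable_vec_nthI) (simp add: P_def)
  have PM: "P \<in> borel_measurable M" by (rule measurable_from_subalg[OF G PG])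
  \<comment> \<open>Square-integrability of the conditional expectation is conditional Jensen for
    the square.\<close>
  have conv: "convex_on UNIV (\<lambda>x::real. x\<^sup>2)" using convex_power2 by simp
  have "integrable M (\<lambda>w. (P w $ i)\<^sup>2)" for i
    using integrable_convex_cond_exp[of "\<lambda>w. Z w $ i" UNIV undefined undefined "\<lambda>x. x\<^sup>2"] Zi[of i]
      L2_integrable[OF Zi[of i]] conv finite_emeasure_space by (simp add: P_def sq_integrable_def)
  then have "integrable M (\<lambda>w. (norm (P w))\<^sup>2)"
    by (simp add: norm_vec_def L2_set_def sum_nonneg)
  then have Psq: "L2 M P" using PM by (simp add: sq_integrable_def)
  show "L2_projection M G Z \<in> borel_measurable G" "L2 M (L2_projection M G Z)"
    using PG Psq by (simp_all add: P_def L2_projection_def[abs_def])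
  show "(LINT w|M. U w \<bullet> Z w) = (LINT w|M. U w \<bullet> L2_projection M G Z w)" if U: "U \<in> borel_measurable G" "L2 M U" for U
  proof -
    have 1: "integrable M (\<lambda>w. U w $ i * Z w $ i)" for i
      using L2_inner[OF L2_component[OF U(2), of i] Zi[of i]] by simp
    have 2: "integrable M (\<lambda>w. U w $ i * P w $ i)" for i
      using L2_inner[OF L2_component[OF U(2), of i] L2_component[OF Psq, of i]] by simp
    have "(LINT w|M. U w \<bullet> Z w) = (\<Sum>i\<in>UNIV. LINT w|M. U w $ i * Z w $ i)"
      using 1 by (simp add: inner_vec_def)
    also have "\<dots> = (\<Sum>i\<in>UNIV. LINT w|M. U w $ i * P w $ i)"
    proof (intro sum.cong refl)
      fix i
      have "(\<lambda>w. Z w $ i) \<in> borel_measurable M" using Zi[of i] by measurable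
      from real_cond_exp_intg(2)[OF 1 borel_measurable_vec_nth[OF U(1)] this]
      show "(LINT w|M. U w $ i * Z w $ i) = (LINT w|M. U w $ i * P w $ i)" by (simp add: P_def)
    qed
    also have "\<dots> = (LINT w|M. U w \<bullet> P w)" using 2 by (simp add: inner_vec_def)
    finally show ?thesis by (simp add: P_def L2_projection_def[abs_def])
  qed
qed

lemma power_fact_tendsto_0: "(\<lambda>n. K * (c::real) ^ n / fact n) \<longlonglongrightarrow> 0"
proof -
  have "(\<lambda>n. c ^ n / fact n) \<longlonglongrightarrow> 0"
    using summable_LIMSEQ_zero[OF summable_exp[of c]] by (simp add: divide_inverse mult.commute)
  from tendsto_mult_left[OF this, of K] show ?thesis by simp
qed

text \<open>The hypothesis is only tested on continuous majorants, so that neither \<open>\<rho>\<close> nor its majorants need be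
  integrated; iterating it gives the bounds \<open>K (C (b - s))\<^sup>n / n!\<close> and \<open>K (C (s - a))\<^sup>n / n!\<close>.\<close>

lemma gronwall_majorant:
  fixes \<rho> :: "real \<Rightarrow> real"
  assumes J: "J = (\<lambda>s. {s..b}) \<or> J = (\<lambda>s. {a..s})"
    and K: "\<And>s. s \<in> {a..b} \<Longrightarrow> \<rho> s \<le> K" "0 \<le> K" and C: "0 \<le> C"
    and step: "\<And>s q. s \<in> {a..b} \<Longrightarrow> continuous_on UNIV q \<Longrightarrow> (\<And>r. r \<in> {a..b} \<Longrightarrow> 0 \<le> q r) \<Longrightarrow>
      (\<And>r. r \<in> J s \<Longrightarrow> \<rho> r \<le> q r) \<Longrightarrow> \<rho> s \<le> C * (LINT r|lborel. indicator (J s) r * q r)"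
    and s: "s \<in> {a..b}"
  shows "\<rho> s \<le> 0"
proof -
  \<comment> \<open>For \<open>s\<close> in \<open>{a..b}\<close> this is the length of
    \<open>J s\<close>: the time left until \<open>b\<close>, or the time elapsed since
    \<open>a\<close>.\<close>
  define d where "d s = (if J = (\<lambda>s. {s..b}) then b - s else s - a)" for s
  define Q where "Q n s = K * (C * d s) ^ n / fact n" for n s
  have d0: "0 \<le> d s" if "s \<in> {a..b}" for s using that by (auto simp: d_def)
  have Jsub: "J s \<subseteq> {a..b}" if "s \<in> {a..b}" for s using J that by auto
  \<comment> \<open>\<open>Q\<close> solves the integral recursion exactly: up to sign the
    derivative of \<open>Q (Suc n)\<close> is \<open>C * Q n\<close>, and \<open>Q (Suc n)\<close>
    vanishes at the endpoint where \<open>d\<close> does.\<close>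
  have int: "C * (LINT r|lborel. indicator (J s) r * Q n r) = Q (Suc n) s" if s: "s \<in> {a..b}" for n s
  proof (cases "J = (\<lambda>s. {s..b})")
    case True
    have "(LINT r|lborel. (C * Q n r) * indicator {s..b} r) = - Q (Suc n) b - (- Q (Suc n) s)"
    proof (rule integral_FTC_Icc_real)
      show "s \<le> b" using s by simp
      show "DERIV (\<lambda>r. - Q (Suc n) r) x :> C * Q n x" for x
      proof -
        have "DERIV (\<lambda>r. (C * (b - r)) ^ Suc n) x :> (1 + of_nat n) * (- C * (C * (b - x)) ^ n)"
          by (rule DERIV_power_Suc) (auto intro!: derivative_eq_intros)
        from DERIV_cmult[OF this, of "- K / fact (Suc n)"]
        have D: "DERIV (\<lambda>r. - K / fact (Suc n) * (C * (b - r)) ^ Suc n) x :>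
            - K / fact (Suc n) * ((1 + of_nat n) * (- C * (C * (b - x)) ^ n))" .
        have N: "(1 + real n) / fact (Suc n) = 1 / fact n"
        proof -
          have "1 + real n \<noteq> 0" by linarith
          then show ?thesis by (simp add: fact_Suc)
        qed
        have "- K / fact (Suc n) * ((1 + of_nat n) * (- C * (C * (b - x)) ^ n)) = C * (K * (C * (b - x)) ^ n * ((1 + real n) / fact (Suc n)))"
          by (simp only: times_divide_eq_left times_divide_eq_right mult_minus_left mult_minus_right minus_divide_left[symmetric] minus_minus mult_ac)
        also have "\<dots> = C * (K * (C * (b - x)) ^ n / fact n)" unfolding N by simp
        finally show ?thesis unfolding Q_def d_def using True D by (simp del: power_Suc fact_Suc)
      qed
      show "isCont (\<lambda>r. C * Q n r) x" for x unfolding Q_def d_def using True by auto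
    qed
    moreover have "Q (Suc n) b = 0" using True by (simp add: Q_def d_def)
    moreover have "(LINT r|lborel. (C * Q n r) * indicator {s..b} r) = C * (LINT r|lborel. indicator (J s) r * Q n r)"
      using True by (simp add: mult_ac)
    ultimately show ?thesis by simp
  next
    case False
    then have J': "J = (\<lambda>s. {a..s})" using J by auto
    have "(LINT r|lborel. (C * Q n r) * indicator {a..s} r) = Q (Suc n) s - Q (Suc n) a"
    proof (rule integral_FTC_Icc_real)
      show "a \<le> s" using s by simp
      show "DERIV (\<lambda>r. Q (Suc n) r) x :> C * Q n x" for x
      proof -
        have "DERIV (\<lambda>r. (C * (r - a)) ^ Suc n) x :> (1 + of_nat n) * (C * (C * (x - a)) ^ n)"
          by (rule DERIV_power_Suc) (auto intro!: derivative_eq_intros)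
        from DERIV_cmult[OF this, of "K / fact (Suc n)"]
        have D: "DERIV (\<lambda>r. K / fact (Suc n) * (C * (r - a)) ^ Suc n) x :>
            K / fact (Suc n) * ((1 + of_nat n) * (C * (C * (x - a)) ^ n))" .
        have N: "(1 + real n) / fact (Suc n) = 1 / fact n"
        proof -
          have "1 + real n \<noteq> 0" by linarith
          then show ?thesis by (simp add: fact_Suc)
        qed
        have "K / fact (Suc n) * ((1 + of_nat n) * (C * (C * (x - a)) ^ n)) = C * (K * (C * (x - a)) ^ n * ((1 + real n) / fact (Suc n)))"
          by (simp only: times_divide_eq_left times_divide_eq_right mult_ac)
        also have "\<dots> = C * (K * (C * (x - a)) ^ n / fact n)" unfolding N by simp
        finally show ?thesis unfolding Q_def d_def using False D by (simp del: power_Suc fact_Suc)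
      qed
      show "isCont (\<lambda>r. C * Q n r) x" for x unfolding Q_def d_def using False by auto
    qed
    moreover have "Q (Suc n) a = 0" using False by (simp add: Q_def d_def)
    moreover have "(LINT r|lborel. (C * Q n r) * indicator {a..s} r) = C * (LINT r|lborel. indicator (J s) r * Q n r)"
      using J' by (simp add: mult_ac)
    ultimately show ?thesis by simp
  qed
  have le: "\<rho> s \<le> Q n s" if "s \<in> {a..b}" for n s
    using that
  proof (induction n arbitrary: s)
    case 0 then show ?case using K by (simp add: Q_def)
  next
    case (Suc n)
    have "\<rho> s \<le> C * (LINT r|lborel. indicator (J s) r * Q n r)"
    proof (rule step[OF Suc.prems])
      show "continuous_on UNIV (Q n)" unfolding Q_def d_def by (cases "J = (\<lambda>s. {s..b})") (auto intro!: continuous_intros)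
      show "0 \<le> Q n r" if "r \<in> {a..b}" for r using d0[OF that] C K(2) by (simp add: Q_def)
      show "\<rho> r \<le> Q n r" if "r \<in> J s" for r using Suc.IH Jsub[OF Suc.prems] that by blast
    qed
    then show ?case using int[OF Suc.prems] by simp
  qed
  have "(\<lambda>n. Q n s) \<longlonglongrightarrow> 0" unfolding Q_def by (rule power_fact_tendsto_0)
  then show ?thesis using le[OF s] by (intro LIMSEQ_le_const) auto
qed

lemma eq_0_if_null_bound:
  fixes c :: real
  assumes "\<And>k. \<bar>c\<bar> \<le> h k" "h \<longlonglongrightarrow> 0" shows "c = 0"
proof -
  have "\<bar>c\<bar> \<le> 0" using assms by (intro LIMSEQ_le_const[OF assms(2)]) auto
  then show ?thesis by simp
qed

context mean_field_space
begin

lemma lT_integral: "(LINT s|lT. h s) = (LINT s:{0..T}|lborel. (h s :: 'e::{banach, second_countable_topology}))"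
  by (simp add: integral_restrict_space set_lebesgue_integral_def)

lemma lT_integral_subset:
  assumes "J \<subseteq> {0..T}"
  shows "(LINT s|lT. indicator J s *\<^sub>R h s) = (LINT s:J|lborel. (h s :: 'e::{banach, second_countable_topology}))"
proof -
  have "indicator {0..T} s *\<^sub>R indicator J s *\<^sub>R h s = indicator J s *\<^sub>R h s" for s
    using assms by (auto simp: indicator_def)
  then show ?thesis
    by (subst integral_restrict_space) (simp_all only: set_lebesgue_integral_def, simp)
qed

text \<open>An upper bound valid even if \<open>h\<close> is not integrable, its integral being \<open>0\<close> then.\<close>

lemma lT_integral_le:
  fixes h q :: "real \<Rightarrow> real"
  assumes J: "J \<subseteq> {0..T}" "J \<in> sets borel" and q: "continuous_on UNIV q" and le: "\<And>s. s \<in> J \<Longrightarrow> \<bar>h s\<bar> \<le> c * q s"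
    and c: "0 \<le> c" and q0: "\<And>s. s \<in> {0..T} \<Longrightarrow> 0 \<le> q s"
  shows "\<bar>LINT s|lT. indicator J s * h s\<bar> \<le> c * (LINT r|lborel. indicator J r * q r)"
proof -
  have qi: "set_integrable lborel {0..T} q"
    by (rule borel_integrable_atLeastAtMost') (rule continuous_on_subset[OF q], simp)
  have qi': "integrable lborel (\<lambda>r. indicator J r * q r)"
    using set_integrable_subset[OF qi _ J(1)] J(2) by (simp add: set_integrable_def)
  have "\<bar>LINT s|lT. indicator J s * h s\<bar> \<le> (LINT s|lT. \<bar>indicator J s * h s\<bar>)"
    by (rule integral_abs_bound)
  also have "\<dots> \<le> (LINT s|lT. c * (indicator J s * q s))"
  proof (cases "integrable lT (\<lambda>s. \<bar>indicator J s * h s\<bar>)")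
    case True
    show ?thesis
    proof (rule integral_mono[OF True])
      have "indicator {0..T} s * (indicator J s * q s) = indicator J s * q s" for s
        using J by (auto simp: indicator_def)
      then show "integrable lT (\<lambda>s. c * (indicator J s * q s))"
        using qi' by (intro integrable_mult_right, subst integrable_restrict_space) (simp_all only: real_scaleR_def, simp)
      show "\<bar>indicator J s * h s\<bar> \<le> c * (indicator J s * q s)" for s
        using le[of s] by (auto simp: indicator_def)
    qed
  next
    case False
    then have "(LINT s|lT. \<bar>indicator J s * h s\<bar>) = 0" by (rule not_integrable_integral_eq)
    also have "0 \<le> (LINT s|lT. c * (indicator J s * q s))"
      using c q0 by (intro integral_nonneg_AE AE_I2) (auto simp: indicator_def space_restrict_space)
    finally show ?thesis .
  qed
  also have "\<dots> = c * (LINT r|lborel. indicator J r * q r)"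
    using lT_integral_subset[OF J(1), of q] by (simp add: set_lebesgue_integral_def)
  finally show ?thesis .
qed

text \<open>Testing the equation with \<open>e s\<close> minus its projection gives a Gronwall inequality for the distance
  of \<open>e s\<close> to \<open>L\<^sup>2(G)\<close>.\<close>

lemma measurable_by_gronwall:
  fixes e :: "real \<Rightarrow> 'w \<Rightarrow> real^'k"
  assumes J: "J = (\<lambda>s. {s..b}) \<or> J = (\<lambda>s. {a..s})" and ab: "0 \<le> a" "b \<le> T"
    and G: "subalgebra M G" "null_sets M \<subseteq> sets G"
    and e: "\<And>s. s \<in> {a..b} \<Longrightarrow> L2 M (e s)" "\<And>s. s \<in> {a..b} \<Longrightarrow> L2norm M (e s) \<le> K" and L: "0 \<le> L"
    and eq: "\<And>s U. s \<in> {a..b} \<Longrightarrow> L2 M U \<Longrightarrow>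
       (\<And>V. V \<in> borel_measurable G \<Longrightarrow> L2 M V \<Longrightarrow> ip U V = 0) \<Longrightarrow>
       ip U (e s) = (LINT r|lT. indicator (J s) r * h U r)"
    and h: "\<And>r U P. r \<in> {a..b} \<Longrightarrow> L2 M U \<Longrightarrow>
       (\<And>V. V \<in> borel_measurable G \<Longrightarrow> L2 M V \<Longrightarrow> ip U V = 0) \<Longrightarrow>
       P \<in> borel_measurable G \<Longrightarrow> L2 M P \<Longrightarrow> \<bar>h U r\<bar> \<le> L * L2norm M U * L2norm M (\<lambda>w. e r w - P w)"
    and s: "s \<in> {a..b}"
  shows "e s \<in> borel_measurable G"
proof -
  define P where "P s = L2_projection M G (e s)" for s
  note P = L2_projection[OF G(1) e(1), folded P_def]
  define U where "U s w = e s w - P s w" for s w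
  define \<rho> where "\<rho> s = L2norm M (U s)" for s
  have U: "L2 M (U s)" if "s \<in> {a..b}" for s
    unfolding U_def using that by (intro L2_diff e P)
  have orth: "ip (U s) V = 0"
    if "s \<in> {a..b}" "V \<in> borel_measurable G" "L2 M V" for s V
  proof -
    have "ip (U s) V = ip V (e s) - ip V (P s)"
      using L2_inner[OF that(3) e(1)[OF that(1)]] L2_inner[OF that(3) P(2)[OF that(1)]]
      by (simp add: U_def inner_diff_right inner_commute[of _ "V _"])
    then show ?thesis using P(3)[OF that] by simp
  qed
  \<comment> \<open>\<open>U s\<close> is orthogonal to \<open>P s\<close>, so its squared norm is
    obtained by testing the equation of \<open>e s\<close> itself.\<close>
  have \<rho>2: "(\<rho> s)\<^sup>2 = ip (U s) (e s)" if "s \<in> {a..b}" for s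
  proof -
    have "(\<rho> s)\<^sup>2 = (LINT w|M. U s w \<bullet> e s w - U s w \<bullet> P s w)"
      unfolding \<rho>_def L2norm_power2_inner by (simp add: U_def inner_diff_right)
    also have "\<dots> = ip (U s) (e s)"
      using orth[OF that P(1,2)[OF that]] L2_inner[OF U[OF that] e(1)[OF that]]
        L2_inner[OF U[OF that] P(2)[OF that]] by simp
    finally show ?thesis .
  qed
  have \<rho>0: "0 \<le> \<rho> s" for s by (simp add: \<rho>_def)
  \<comment> \<open>The distance to a subspace is at most the norm; this uniform bound starts the
    Gronwall iteration.\<close>
  have \<rho>K: "\<rho> s \<le> K" if "s \<in> {a..b}" for s
  proof -
    have "(\<rho> s)\<^sup>2 \<le> \<rho> s * L2norm M (e s)"
      using \<rho>2[OF that] L2_Cauchy_Schwarz[OF U[OF that] e(1)[OF that]] by (simp add: \<rho>_def)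
    also have "\<dots> \<le> \<rho> s * K" using e(2)[OF that] \<rho>0 by (intro mult_left_mono) auto
    finally show ?thesis using \<rho>0[of s] order_trans[OF L2norm_nonneg e(2)[OF that]]
      by (cases "\<rho> s = 0") (auto simp: power2_eq_square)
  qed
  have K0: "0 \<le> K" using \<rho>K[OF s] \<rho>0[of s] by simp
  have "\<rho> s \<le> 0"
  proof (rule gronwall_majorant[OF J \<rho>K K0 L _ s])
    fix s q assume s: "s \<in> {a..b}" and q: "continuous_on UNIV q" "\<And>r. r \<in> {a..b} \<Longrightarrow> 0 \<le> q r"
      and le: "\<And>r. r \<in> J s \<Longrightarrow> \<rho> r \<le> q r"
    \<comment> \<open>Positivity of the majorant is known on \<open>{a..b}\<close>, whereas
      \<open>lT_integral_le\<close> asks for it on all of \<open>[0,T]\<close>; on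
      \<open>J s\<close> nothing changes.\<close>
    define q' where "q' r = max 0 (q r)" for r
    have q': "continuous_on UNIV q'" "\<And>r. 0 \<le> q' r" unfolding q'_def using q(1) by (auto intro!: continuous_intros)
    have Js: "J s \<subseteq> {a..b}" "J s \<in> sets borel" using J s by auto
    have "(\<rho> s)\<^sup>2 = (LINT r|lT. indicator (J s) r * h (U s) r)"
      using \<rho>2[OF s] eq[OF s U[OF s] orth[OF s]] by simp
    also have "\<dots> \<le> (L * \<rho> s) * (LINT r|lborel. indicator (J s) r * q' r)"
    proof (rule order_trans[OF abs_ge_self lT_integral_le])
      show "J s \<subseteq> {0..T}" "J s \<in> sets borel" using Js ab by auto
      show "\<bar>h (U s) r\<bar> \<le> L * \<rho> s * q' r" if "r \<in> J s" for r
      proof -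
        have r: "r \<in> {a..b}" using that Js by auto
        have "\<bar>h (U s) r\<bar> \<le> L * \<rho> s * \<rho> r"
          using h[OF r U[OF s] orth[OF s] P(1,2)[OF r]] by (simp add: \<rho>_def U_def[abs_def])
        also have "\<dots> \<le> L * \<rho> s * q' r"
          using le[OF that] L \<rho>0 by (intro mult_left_mono) (auto simp: q'_def)
        finally show ?thesis .
      qed
    qed (use q' L \<rho>0 in auto)
    also have "(LINT r|lborel. indicator (J s) r * q' r) = (LINT r|lborel. indicator (J s) r * q r)"
      using Js(1) q(2) by (intro Bochner_Integration.integral_cong refl) (auto simp: q'_def indicator_def max_def)
    finally have "\<rho> s * \<rho> s \<le> \<rho> s * (L * (LINT r|lborel. indicator (J s) r * q r))"
      by (simp add: power2_eq_square mult_ac)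
    moreover have "0 \<le> L * (LINT r|lborel. indicator (J s) r * q r)"
    proof (intro mult_nonneg_nonneg[OF L] integral_nonneg_AE AE_I2)
      show "0 \<le> indicator (J s) r * q r" for r
        using q(2)[of r] Js(1) by (cases "r \<in> J s") auto
    qed
    ultimately show "\<rho> s \<le> L * (LINT r|lborel. indicator (J s) r * q r)"
      using \<rho>0[of s] by (cases "\<rho> s = 0") (auto simp: mult_le_cancel_left)
  qed
  then have "L2norm M (U s) = 0" using \<rho>0[of s] unfolding \<rho>_def by linarith
  \<comment> \<open>Equality with the projection holds a.e.; it becomes measurability of
    \<open>e s\<close> itself because \<open>G\<close> contains the null sets.\<close>
  from L2norm_eq_0_AE[OF U[OF s] this] have "AE w in M. P s w = e s w" by (auto simp: U_def)
  then show ?thesis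
    using G e(1)[OF s] P(1)[OF s]
    by (intro measurable_cong_null_sets[of G M "P s" "e s"]) (auto simp: subalgebra_def sq_integrable_def)
qed

text \<open>Gronwall for the norm of the projection of \<open>e t\<close> on the past.\<close>

lemma linear_backward_zero:
  fixes e :: "real \<Rightarrow> 'w \<Rightarrow> real^'d" and A :: "real \<Rightarrow> 'w \<Rightarrow> real^'d^'d" and B :: "real \<Rightarrow> 'w \<Rightarrow> 'w \<Rightarrow> real^'d^'d"
  assumes A: "\<And>s. s \<in> {0..T} \<Longrightarrow> A s \<in> borel_measurable (F s)" "\<And>s w. s \<in> {0..T} \<Longrightarrow> w \<in> space M \<Longrightarrow> norm (A s w) \<le> K"
    and B: "\<And>s w. s \<in> {0..T} \<Longrightarrow> w \<in> space M \<Longrightarrow> (\<lambda>w'. B s w' w) \<in> borel_measurable (F s)"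
      "\<And>s w w'. s \<in> {0..T} \<Longrightarrow> w \<in> space M \<Longrightarrow> w' \<in> space M \<Longrightarrow> norm (B s w' w) \<le> K"
      "\<And>s. s \<in> {0..T} \<Longrightarrow> (\<lambda>w. LINT w'|M. B s w' w *v e s w') \<in> borel_measurable M"
    and e: "\<And>s. s \<in> {0..T} \<Longrightarrow> L2 M (e s)" "\<And>s. s \<in> {0..T} \<Longrightarrow> L2norm M (e s) \<le> C"
    and eq: "\<And>t U. t \<in> {0..T} \<Longrightarrow> U \<in> borel_measurable (F t) \<Longrightarrow> L2 M U \<Longrightarrow>
      ip U (e t) = (LINT s|lT. indicator {t..T} s *
        (LINT w|M. U w \<bullet> (A s w *v e s w + (LINT w'|M. B s w' w *v e s w'))))"
    and t: "t \<in> {0..T}" and U: "U \<in> borel_measurable (F t)" "L2 M U"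
  shows "ip U (e t) = 0"
proof -
  have sub: "subalgebra M (F s)" if "s \<in> {0..T}" for s using subalgebra_F that by simp
  define P where "P s = L2_projection M (F s) (e s)" for s
  have P: "P s \<in> borel_measurable (F s)" "L2 M (P s)"
    "\<And>U. U \<in> borel_measurable (F s) \<Longrightarrow> L2 M U \<Longrightarrow>
       ip U (e s) = ip U (P s)" if "s \<in> {0..T}" for s
    using L2_projection[OF sub[OF that] e(1)[OF that]] by (simp_all add: P_def)
  define \<rho> where "\<rho> s = L2norm M (P s)" for s
  have \<rho>0: "0 \<le> \<rho> s" for s by (simp add: \<rho>_def)
  obtain w0 where w0: "w0 \<in> space M" using not_empty by auto
  have "0 \<le> norm (A 0 w0)" by simp
  also have "\<dots> \<le> K" using A(2)[of 0 w0] w0 T_pos by simp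
  finally have K0: "0 \<le> K" .
  have \<rho>2: "(\<rho> s)\<^sup>2 = ip (P s) (e s)" if "s \<in> {0..T}" for s
    unfolding \<rho>_def L2norm_power2_inner using P(3)[OF that P(1,2)[OF that]] by simp
  have \<rho>C: "\<rho> s \<le> C" if "s \<in> {0..T}" for s
  proof -
    have "(\<rho> s)\<^sup>2 \<le> \<rho> s * L2norm M (e s)"
      using \<rho>2[OF that] L2_Cauchy_Schwarz[OF P(2)[OF that] e(1)[OF that]] by (simp add: \<rho>_def)
    also have "\<dots> \<le> \<rho> s * C" using e(2)[OF that] \<rho>0 by (intro mult_left_mono) auto
    finally show ?thesis using \<rho>0[of s] order_trans[OF L2norm_nonneg e(2)[OF that]]
      by (cases "\<rho> s = 0") (auto simp: power2_eq_square)
  qed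
  have C0: "0 \<le> C" using \<rho>C[OF t] \<rho>0[of t] by simp
  have bound: "\<bar>(LINT w|M. V w \<bullet> (A s w *v e s w + (LINT w'|M. B s w' w *v e s w')))\<bar> \<le> 2 * K * L2norm M V * \<rho> s"
    if s: "s \<in> {0..T}" and V: "V \<in> borel_measurable (F s)" "L2 M V" for s V
  proof -
    have AM: "A s \<in> borel_measurable M" using measurable_F_M[OF A(1)[OF s]] s by simp
    define y where "y w = (LINT w'|M. B s w' w *v e s w')" for w
    \<comment> \<open>For fixed \<open>w\<close> the kernel is past-measurable as a function of the
      copy; after testing with the vector \<open>y w\<close>, the variable \<open>e s\<close> may
      therefore be replaced by its projection.\<close>
    have y_le: "norm (y w) \<le> K * \<rho> s" if w: "w \<in> space M" for w
    proof -
      note Bm = B(1)[OF s w]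
      have BM: "(\<lambda>w'. B s w' w) \<in> borel_measurable M" using measurable_F_M[OF Bm] s by simp
      have Be: "L2 M (\<lambda>w'. B s w' w *v e s w')"
        by (rule L2_matrix_mult(1)[OF e(1)[OF s] BM B(2)[OF s w]])
      have Bt: "(\<lambda>w'. transpose (B s w' w) *v y w) \<in> borel_measurable (F s)"
        using Bm by measurable
      have BtM: "(\<lambda>w'. transpose (B s w' w)) \<in> borel_measurable M" using BM by measurable
      have tb: "L2 M (\<lambda>w'. transpose (B s w' w) *v y w)"
        "L2norm M (\<lambda>w'. transpose (B s w' w) *v y w) \<le> K * L2norm M (\<lambda>_. y w)"
        using L2_matrix_mult[OF L2_const BtM, of K "y w"] B(2)[OF s w] K0 by auto
      have "(norm (y w))\<^sup>2 = y w \<bullet> y w" by (simp add: power2_norm_eq_inner)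
      also have "\<dots> = (LINT w'|M. y w \<bullet> (B s w' w *v e s w'))"
        using L2_integrable[OF Be] by (subst (2) y_def) simp
      also have "\<dots> = (LINT w'|M. (transpose (B s w' w) *v y w) \<bullet> e s w')"
        by (simp add: inner_matrix_transpose)
      also have "\<dots> = (LINT w'|M. (transpose (B s w' w) *v y w) \<bullet> P s w')"
        by (rule P(3)[OF s Bt tb(1)])
      also have "\<dots> \<le> (K * norm (y w)) * \<rho> s"
        using L2_Cauchy_Schwarz[OF tb(1) P(2)[OF s]] mult_right_mono[OF tb(2) \<rho>0[of s]]
        by (simp add: \<rho>_def L2norm_const)
      finally have "norm (y w) * norm (y w) \<le> norm (y w) * (K * \<rho> s)" by (simp add: power2_eq_square mult_ac)
      then show ?thesis using K0 \<rho>0[of s] by (cases "y w = 0") (auto simp: mult_le_cancel_left)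
    qed
    have ym: "y \<in> borel_measurable M" unfolding y_def[abs_def] by (rule B(3)[OF s])
    have ysq: "L2 M y" by (rule L2_bounded[OF ym y_le])
    have yn: "L2norm M y \<le> K * \<rho> s"
      using L2norm_mono[OF L2_const[of "1::real"] ym, of "K * \<rho> s"] y_le K0 \<rho>0[of s] by (simp add: L2norm_const)
    have Ae: "L2 M (\<lambda>w. A s w *v e s w)"
      by (rule L2_matrix_mult(1)[OF e(1)[OF s] AM A(2)[OF s]])
    have At: "(\<lambda>w. transpose (A s w) *v V w) \<in> borel_measurable (F s)"
      using A(1)[OF s] V(1) by measurable
    have AtM: "(\<lambda>w. transpose (A s w)) \<in> borel_measurable M" using AM by measurable
    have AtV: "L2 M (\<lambda>w. transpose (A s w) *v V w)"
       "L2norm M (\<lambda>w. transpose (A s w) *v V w) \<le> K * L2norm M V"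
      using L2_matrix_mult[OF V(2) AtM, of K] A(2)[OF s] K0 by auto
    have "(LINT w|M. V w \<bullet> (A s w *v e s w)) = (LINT w|M. (transpose (A s w) *v V w) \<bullet> P s w)"
    proof -
      have "V w \<bullet> (A s w *v e s w) = (transpose (A s w) *v V w) \<bullet> e s w" for w
        using inner_matrix_transpose[of "A s w" "e s w" "V w"] by (metis inner_commute)
      then show ?thesis using P(3)[OF s At AtV(1)] by simp
    qed
    then have 1: "\<bar>(LINT w|M. V w \<bullet> (A s w *v e s w))\<bar> \<le> K * L2norm M V * \<rho> s"
      using L2_Cauchy_Schwarz[OF AtV(1) P(2)[OF s]] mult_right_mono[OF AtV(2) \<rho>0[of s]] by (simp add: \<rho>_def)
    have 2: "\<bar>ip V y\<bar> \<le> K * L2norm M V * \<rho> s"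
      using L2_Cauchy_Schwarz[OF V(2) ysq] mult_left_mono[OF yn L2norm_nonneg[of M V]] by (simp add: mult_ac)
    have "(LINT w|M. V w \<bullet> (A s w *v e s w + y w)) = (LINT w|M. V w \<bullet> (A s w *v e s w)) + ip V y"
      using L2_inner[OF V(2) Ae] L2_inner[OF V(2) ysq] by (simp add: inner_add_right)
    with 1 2 show ?thesis unfolding y_def by linarith
  qed
  have step: "\<rho> s \<le> 2 * K * (LINT r|lborel. indicator {s..T} r * q r)"
    if s: "s \<in> {0..T}" and q: "continuous_on UNIV q" "\<And>r. r \<in> {0..T} \<Longrightarrow> 0 \<le> q r"
      and le: "\<And>r. r \<in> {s..T} \<Longrightarrow> \<rho> r \<le> q r" for s q
  proof -
    define h where "h r = (LINT w|M. P s w \<bullet> (A r w *v e r w + (LINT w'|M. B r w' w *v e r w')))" for r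
    have "(\<rho> s)\<^sup>2 = (LINT r|lT. indicator {s..T} r * h r)"
      unfolding \<rho>2[OF s] eq[OF s P(1,2)[OF s]] h_def ..
    also have "\<dots> \<le> \<bar>LINT r|lT. indicator {s..T} r * h r\<bar>" by (rule abs_ge_self)
    also have "\<dots> \<le> (2 * K * \<rho> s) * (LINT r|lborel. indicator {s..T} r * q r)"
    proof (rule lT_integral_le)
      show "\<bar>h r\<bar> \<le> 2 * K * \<rho> s * q r"
        if "r \<in> {s..T}" for r
      proof -
        have r: "r \<in> {0..T}" "s \<le> r" using that s by auto
        \<comment> \<open>A variable of the past of \<open>s\<close> belongs to the past of every
          later \<open>r\<close>; this monotonicity closes the inequality in terms of the
          projections alone. The two terms of the drift contribute \<open>K\<close> each.\<close>
        have "\<bar>h r\<bar> \<le> 2 * K * \<rho> s * \<rho> r"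
          unfolding h_def using bound[OF r(1) measurable_F_mono[OF P(1)[OF s] r(2)] P(2)[OF s]] by (simp add: \<rho>_def)
        also have "\<dots> \<le> 2 * K * \<rho> s * q r" using le[OF that] K0 \<rho>0[of s] by (intro mult_left_mono) auto
        finally show ?thesis .
      qed
    qed (use q K0 \<rho>0[of s] s in auto)
    finally have "\<rho> s * \<rho> s \<le> \<rho> s * (2 * K * (LINT r|lborel. indicator {s..T} r * q r))"
      by (simp add: power2_eq_square mult_ac)
    moreover have "0 \<le> 2 * K * (LINT r|lborel. indicator {s..T} r * q r)"
    proof (rule mult_nonneg_nonneg, use K0 in simp, intro integral_nonneg_AE AE_I2)
      show "0 \<le> indicator {s..T} r * q r" for r
        using q(2)[of r] s by (cases "r \<in> {s..T}") auto
    qed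
    ultimately show ?thesis
      using \<rho>0[of s] by (cases "\<rho> s = 0") (auto simp: mult_le_cancel_left)
  qed
  have "\<rho> t \<le> 0"
    by (rule gronwall_majorant[of "\<lambda>s. {s..T}" T 0 \<rho> C "2 * K", OF _ \<rho>C C0 _ step t]) (use K0 in auto)
  then have "L2norm M (P t) = 0" using \<rho>0[of t] unfolding \<rho>_def by linarith
  then have "\<bar>ip U (P t)\<bar> \<le> 0" using L2_Cauchy_Schwarz[OF U(2) P(2)[OF t]] by simp
  then show ?thesis using P(3)[OF t U] by simp
qed

end

section \<open>Orthogonality of Ito integrals\<close>

text \<open>The sets over which \<open>f\<close> integrates to zero are closed under complements,
  the total integral being zero, and under countable disjoint unions; the rest is Dynkin's
  theorem.\<close>

lemma set_integral_zero_sigma_sets: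
  fixes f :: "'w \<Rightarrow> real"
  assumes G: "Int_stable G" "G \<subseteq> sets M" and f: "integrable M f"
    and zero: "\<And>A. A \<in> G \<Longrightarrow> (LINT x:A|M. f x) = 0" "(LINT x|M. f x) = 0"
    and A: "A \<in> sigma_sets (space M) G"
  shows "(LINT x:A|M. f x) = 0"
proof -
  have sub: "sigma_sets (space M) G \<subseteq> sets M" by (rule sets.sigma_sets_subset[OF G(2)])
  have si: "set_integrable M B f" if "B \<in> sets M" for B
    using integrable_mult_indicator[OF that f] by (simp add: set_integrable_def)
  have Gs: "G \<subseteq> Pow (space M)" using G(2) sets.sets_into_space by auto
  show ?thesis
  proof (rule sigma_sets_induct_disjoint[OF G(1) Gs A])
    show "(LINT x:A|M. f x) = 0" if "A \<in> G" for A using zero(1)[OF that] .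
    show "(LINT x:{}|M. f x) = 0" by (simp add: set_lebesgue_integral_def)
    show "(LINT x:space M - A|M. f x) = 0" if A: "A \<in> sigma_sets (space M) G" and IH: "(LINT x:A|M. f x) = 0" for A
    proof -
      have m: "A \<in> sets M" using A sub by auto
      have "(LINT x:(space M - A) \<union> A|M. f x) = (LINT x:space M - A|M. f x) + (LINT x:A|M. f x)"
        using m by (intro set_integral_Un si) auto
      moreover have "(space M - A) \<union> A = space M" using sets.sets_into_space[OF m] by auto
      moreover have "(LINT x:space M|M. f x) = 0" using zero(2) f by (simp add: set_integral_space)
      ultimately show ?thesis using IH by simp
    qed
    show "(LINT x:(\<Union>i. A i)|M. f x) = 0"
      if "disjoint_family A" "range A \<subseteq> sigma_sets (space M) G" "\<And>i. (LINT x:A i|M. f x) = 0" for A :: "nat \<Rightarrow> 'w set"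
    proof -
      have m: "A i \<in> sets M" for i using that(2) sub by auto
      have "(LINT x:(\<Union>i. A i)|M. f x) = (\<Sum>i. LINT x:A i|M. f x)"
        using that(1) m by (intro lebesgue_integral_countable_add si) (auto simp: disjoint_family_on_def)
      then show ?thesis using that(3) by simp
    qed
  qed
qed

text \<open>Vanishing integrals over all sets of \<open>G\<close> say that the conditional
  expectation is zero; its projection property then covers every square-integrable test
  variable.\<close>

lemma (in finite_measure) orthogonal_if_indicators:
  fixes p :: "'a \<Rightarrow> real^'k"
  assumes G: "subalgebra M G" and p: "L2 M p"
    and zero: "\<And>A i. A \<in> sets G \<Longrightarrow> (LINT w:A|M. p w $ i) = 0"
    and U: "U \<in> borel_measurable G" "L2 M U"
  shows "(LINT w|M. U w \<bullet> p w) = 0"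
proof -
  interpret finite_measure_subalgebra M G by unfold_locales (rule G)
  have "AE w in M. real_cond_exp M G (\<lambda>w. p w $ i) w = 0" for i
    using L2_integrable[OF L2_component[OF p, of i]] zero[of _ i]
    by (intro real_cond_exp_charact) (auto simp: set_lebesgue_integral_def)
  then have "AE w in M. \<forall>i. real_cond_exp M G (\<lambda>w. p w $ i) w = 0" by (simp add: AE_all_countable)
  then have "AE w in M. L2_projection M G p w = 0" by (simp add: L2_projection_def vec_eq_iff)
  then have "AE w in M. U w \<bullet> L2_projection M G p w = 0" by eventually_elim simp
  moreover have "(\<lambda>w. U w \<bullet> L2_projection M G p w) \<in> borel_measurable M"
    using L2_inner[OF U(2) L2_projection(2)[OF G p]] by (rule borel_measurable_integrable)
  ultimately have "(LINT w|M. U w \<bullet> L2_projection M G p w) = 0"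
    by (simp add: integral_eq_zero_AE)
  then show ?thesis using L2_projection(3)[OF G p U] by simp
qed

lemma sum_indicator_intervals:
  fixes \<tau> :: "nat \<Rightarrow> real"
  assumes "\<And>i. i < n \<Longrightarrow> \<tau> i \<le> \<tau> (Suc i)"
  shows "(\<Sum>i<n. indicator {\<tau> i<..\<tau> (Suc i)} r) = (indicator {\<tau> 0<..\<tau> n} r :: real)"
  using assms
proof (induction n)
  case (Suc n)
  have "\<tau> 0 \<le> \<tau> n" using Suc.prems by (induction n) (auto intro: order_trans)
  moreover have "\<tau> n \<le> \<tau> (Suc n)" using Suc.prems by simp
  moreover have "(\<Sum>i<n. indicator {\<tau> i<..\<tau> (Suc i)} r) = (indicator {\<tau> 0<..\<tau> n} r :: real)"
    by (rule Suc.IH) (simp add: Suc.prems)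
  ultimately show ?case unfolding sum.lessThan_Suc by (auto simp: indicator_def)
qed simp

context mean_field_space
begin

lemma has_ito_integralE:
  assumes "has_ito_integral M F W s t Z I"
  obtains n \<tau> \<xi> where "I \<in> borel_measurable M"
    "\<And>k i. i \<le> n k \<Longrightarrow> \<tau> k i \<in> {s..t}" "\<And>k i. i < n k \<Longrightarrow> \<tau> k i \<le> \<tau> k (Suc i)"
    "\<And>k i. i < n k \<Longrightarrow> bounded_adapted (\<tau> k i) (\<xi> k i)"
    "(\<lambda>k. \<integral>\<^sup>+w. (\<integral>\<^sup>+r\<in>{s..t}. ennreal ((norm (simple_proc (n k) (\<tau> k) (\<xi> k) r w - Z r w))\<^sup>2) \<partial>lborel) \<partial>M) \<longlonglongrightarrow> 0"
    "(\<lambda>k. \<integral>\<^sup>+w. ennreal ((norm (simple_integral W (n k) (\<tau> k) (\<xi> k) w - I w))\<^sup>2) \<partial>M) \<longlonglongrightarrow> 0"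
proof -
  from assms[unfolded has_ito_integral_def] obtain n \<tau> \<xi> where I: "I \<in> borel_measurable M"
    and c: "\<forall>k::nat. (\<forall>i\<le>n k. \<tau> k i \<in> {s..t}) \<and> (\<forall>i<n k. \<tau> k i \<le> \<tau> k (Suc i)) \<and>
           (\<forall>i<n k. \<xi> k i \<in> borel_measurable (F (\<tau> k i)) \<and>
              (\<exists>C. \<forall>w\<in>space M. norm (\<xi> k i w) \<le> C))"
    and l: "(\<lambda>k. \<integral>\<^sup>+w. (\<integral>\<^sup>+r\<in>{s..t}. ennreal ((norm (simple_proc (n k) (\<tau> k) (\<xi> k) r w - Z r w))\<^sup>2) \<partial>lborel) \<partial>M) \<longlonglongrightarrow> 0"
    "(\<lambda>k. \<integral>\<^sup>+w. ennreal ((norm (simple_integral W (n k) (\<tau> k) (\<xi> k) w - I w))\<^sup>2) \<partial>M) \<longlonglongrightarrow> 0"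
    by blast
  show ?thesis
  proof (rule that[OF I _ _ _ l])
    fix k i
    show "i \<le> n k \<Longrightarrow> \<tau> k i \<in> {s..t}" "i < n k \<Longrightarrow> \<tau> k i \<le> \<tau> k (Suc i)"
      using c by blast+
    show "i < n k \<Longrightarrow> bounded_adapted (\<tau> k i) (\<xi> k i)"
      using c unfolding bounded_adapted_def by blast
  qed
qed

lemma ito_approximation:
  assumes "has_ito_integral M F W s t Z I" "0 \<le> s" "t \<le> T"
  obtains n \<tau> \<xi> where "\<And>k i. i \<le> n k \<Longrightarrow> \<tau> k i \<in> {s..t}" "\<And>k i. i < n k \<Longrightarrow> \<tau> k i \<le> \<tau> k (Suc i)"
    "\<And>k i. i < n k \<Longrightarrow> bounded_adapted (\<tau> k i) (\<xi> k i)"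
    "(\<lambda>k. \<integral>\<^sup>+w. (\<integral>\<^sup>+r\<in>{s..t}. ennreal ((norm (simple_proc (n k) (\<tau> k) (\<xi> k) r w - Z r w))\<^sup>2) \<partial>lborel) \<partial>M) \<longlonglongrightarrow> 0"
    "\<And>k. elementary_process (simple_proc (n k) (\<tau> k) (\<xi> k)) (simple_integral W (n k) (\<tau> k) (\<xi> k))"
    "L2 M I" "(\<lambda>k. L2norm M (\<lambda>w. simple_integral W (n k) (\<tau> k) (\<xi> k) w - I w)) \<longlonglongrightarrow> 0"
proof -
  obtain n \<tau> \<xi> where I: "I \<in> borel_measurable M"
    and a: "\<And>k i. i \<le> n k \<Longrightarrow> \<tau> k i \<in> {s..t}" "\<And>k i. i < n k \<Longrightarrow> \<tau> k i \<le> \<tau> k (Suc i)"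
    "\<And>k i. i < n k \<Longrightarrow> bounded_adapted (\<tau> k i) (\<xi> k i)"
    "(\<lambda>k. \<integral>\<^sup>+w. (\<integral>\<^sup>+r\<in>{s..t}. ennreal ((norm (simple_proc (n k) (\<tau> k) (\<xi> k) r w - Z r w))\<^sup>2) \<partial>lborel) \<partial>M) \<longlonglongrightarrow> 0"
    and l: "(\<lambda>k. \<integral>\<^sup>+w. ennreal ((norm (simple_integral W (n k) (\<tau> k) (\<xi> k) w - I w))\<^sup>2) \<partial>M) \<longlonglongrightarrow> 0"
    by (rule has_ito_integralE[OF assms(1)]) blast
  have el: "elementary_process (simple_proc (n k) (\<tau> k) (\<xi> k)) (simple_integral W (n k) (\<tau> k) (\<xi> k))" for k
  proof (rule elementary_process_simple)
    show "\<tau> k i \<in> {0..T}" if "i \<le> n k" for i using a(1)[OF that] assms(2,3) by auto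
  qed (use a in auto)
  have sq: "L2 M (simple_integral W (n k) (\<tau> k) (\<xi> k))" for k
    by (rule elementary_process_L2(1)[OF el])
  have m: "(\<lambda>w. simple_integral W (n k) (\<tau> k) (\<xi> k) w - I w) \<in> borel_measurable M" for k
    using sq[of k] I by measurable
  \<comment> \<open>Convergence of the squared distances to \<open>0\<close> makes one of them
    finite, and this places the limit \<open>I\<close> in L2.\<close>
  obtain k where "L2 M (\<lambda>w. simple_integral W (n k) (\<tau> k) (\<xi> k) w - I w)"
    using nn_integral_tendsto_L2norm(2)[OF m l] by blast
  from L2_diff[OF sq[of k] this] have "L2 M I" by simp
  with nn_integral_tendsto_L2norm(1)[OF m l] a el show ?thesis using that by blast
qed

text \<open>Each summand of an approximating sum starts at or after \<open>s\<close>, hence is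
  orthogonal to the past of \<open>s\<close>; the L2-limit inherits this.\<close>

lemma has_ito_integral_orthogonal:
  fixes I :: "'w \<Rightarrow> real^'d"
  assumes I: "has_ito_integral M F W s t Z I" and st: "0 \<le> s" "t \<le> T"
    and U: "U \<in> borel_measurable (F s)" "L2 M U"
  shows "ip U I = 0"
proof -
  obtain n \<tau> \<xi> where a: "\<And>k i. i \<le> n k \<Longrightarrow> \<tau> k i \<in> {s..t}" "\<And>k i. i < n k \<Longrightarrow> \<tau> k i \<le> \<tau> k (Suc i)"
    "\<And>k i. i < n k \<Longrightarrow> bounded_adapted (\<tau> k i) (\<xi> k i)"
    and el: "\<And>k. elementary_process (simple_proc (n k) (\<tau> k) (\<xi> k)) (simple_integral W (n k) (\<tau> k) (\<xi> k))"
    and Isq: "L2 M I"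
    and lim: "(\<lambda>k. L2norm M (\<lambda>w. simple_integral W (n k) (\<tau> k) (\<xi> k) w - I w)) \<longlonglongrightarrow> 0"
    by (rule ito_approximation[OF I st]) blast
  have zero: "(LINT w|M. U w \<bullet> simple_integral W (n k) (\<tau> k) (\<xi> k) w) = 0" for k
  proof -
    have b: "0 \<le> \<tau> k i" "s \<le> \<tau> k i" "\<tau> k i \<le> \<tau> k (Suc i)" "\<tau> k (Suc i) \<le> T" "bounded_adapted (\<tau> k i) (\<xi> k i)" if "i < n k" for i
      using a(1)[of i k] a(1)[of "Suc i" k] a(2,3)[OF that] that st by auto
    have "(LINT w|M. U w \<bullet> simple_integral W (n k) (\<tau> k) (\<xi> k) w)
        = (\<Sum>i<n k. (LINT w|M. U w \<bullet> elementary_increment (\<tau> k i) (\<tau> k (Suc i)) (\<xi> k i) w))"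
      unfolding simple_integral_def inner_sum_right elementary_increment_def[symmetric]
      by (intro Bochner_Integration.integral_sum L2_inner[OF U(2)] elementary_increment_L2) (use b in auto)
    also have "\<dots> = 0"
    proof (intro sum.neutral ballI)
      fix i assume "i \<in> {..<n k}"
      then have i: "i < n k" by simp
      show "(LINT w|M. U w \<bullet> elementary_increment (\<tau> k i) (\<tau> k (Suc i)) (\<xi> k i) w) = 0"
        by (rule inner_elementary_increment[OF b(1,3,4,5)[OF i] measurable_F_mono[OF U(1) b(2)[OF i]] U(2)])
    qed
    finally show ?thesis .
  qed
  show ?thesis
  proof (rule eq_0_if_null_bound)
    fix k
    note sq = elementary_process_L2(1)[OF el, of k]
    have "(LINT w|M. U w \<bullet> (simple_integral W (n k) (\<tau> k) (\<xi> k) w - I w)) = - ip U I"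
      using zero[of k] L2_inner[OF U(2) sq] L2_inner[OF U(2) Isq] by (simp add: inner_diff_right)
    then show "\<bar>ip U I\<bar>
        \<le> L2norm M U * L2norm M (\<lambda>w. simple_integral W (n k) (\<tau> k) (\<xi> k) w - I w)"
      using L2_Cauchy_Schwarz[OF U(2) L2_diff[OF sq Isq]] by simp
  next
    show "(\<lambda>k. L2norm M U * L2norm M (\<lambda>w. simple_integral W (n k) (\<tau> k) (\<xi> k) w - I w)) \<longlonglongrightarrow> 0"
      using tendsto_mult_left[OF lim, of "L2norm M U"] by simp
  qed
qed

lemma has_ito_integral_L2:
  fixes I :: "'w \<Rightarrow> real^'d"
  assumes "has_ito_integral M F W s t Z I" "0 \<le> s" "t \<le> T"
  shows "L2 M I"
  by (rule ito_approximation[OF assms])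

context
  fixes \<sigma> :: "real \<Rightarrow> real^'m^'d"
  assumes \<sigma>: "continuous_on {0..T} \<sigma>"
begin

lemma \<sigma>_bounded: obtains C where "\<And>t. t \<in> {0..T} \<Longrightarrow> norm (\<sigma> t) \<le> C" "0 \<le> C"
proof -
  have "compact (\<sigma> ` {0..T})" by (intro compact_continuous_image \<sigma>) simp
  then obtain C where C: "\<And>t. t \<in> {0..T} \<Longrightarrow> norm (\<sigma> t) \<le> C"
    using compact_imp_bounded by (force simp: bounded_iff)
  moreover have "0 \<le> C" using order_trans[OF norm_ge_zero C[of 0]] T_pos by simp
  ultimately show ?thesis using that by blast
qed

lemma \<sigma>_measurable: "\<sigma> \<in> borel_measurable (restrict_space borel {0..T})"
  by (rule borel_measurable_continuous_on_restrict[OF \<sigma>])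

lemma indicator_\<sigma>_L2:
  assumes "J \<in> sets borel"
  shows "L2 (dtP M T) (\<lambda>(r, w). indicator J r *\<^sub>R \<sigma> r)"
proof -
  obtain C where C: "\<And>t. t \<in> {0..T} \<Longrightarrow> norm (\<sigma> t) \<le> C" "0 \<le> C" by (rule \<sigma>_bounded) blast
  have "indicator J \<in> borel_measurable (restrict_space borel {0..T})"
    by (rule measurable_restrict_space1) (use assms in simp)
  then have "(\<lambda>r. indicator J r *\<^sub>R \<sigma> r) \<in> borel_measurable (restrict_space borel {0..T})"
    using \<sigma>_measurable by measurable
  from measurable_dtP_time[OF this] show ?thesis
    by (rule L2_dtP_bounded) (use C in \<open>auto simp: indicator_def\<close>)
qed

text \<open>The approximation is restated on \<open>[0,T] \<times> \<Omega>\<close> with the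
  integrand cut off after \<open>t\<close>, so that integrals up to different times live in one
  Hilbert space and the isometry applies to their differences.\<close>

lemma ito_deterministic:
  assumes I: "has_ito_integral M F W 0 t (\<lambda>r _. \<sigma> r) I" and t: "t \<in> {0..T}"
  obtains \<Phi> J where "\<And>k. elementary_process (\<Phi> k) (J k)"
    "(\<lambda>k. L2norm (dtP M T) (\<lambda>(r, w). \<Phi> k r w - indicator {0..t} r *\<^sub>R \<sigma> r)) \<longlonglongrightarrow> 0"
    "(\<lambda>k. L2norm M (\<lambda>w. J k w - I w)) \<longlonglongrightarrow> 0"
proof -
  have tT: "t \<le> T" using t by simp
  obtain n \<tau> \<xi> where a: "\<And>k i. i \<le> n k \<Longrightarrow> \<tau> k i \<in> {0..t}" "\<And>k i. i < n k \<Longrightarrow> \<tau> k i \<le> \<tau> k (Suc i)"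
    "\<And>k i. i < n k \<Longrightarrow> bounded_adapted (\<tau> k i) (\<xi> k i)"
    and lim1: "(\<lambda>k. \<integral>\<^sup>+w. (\<integral>\<^sup>+r\<in>{0..t}. ennreal ((norm (simple_proc (n k) (\<tau> k) (\<xi> k) r w - \<sigma> r))\<^sup>2) \<partial>lborel) \<partial>M) \<longlonglongrightarrow> 0"
    and el: "\<And>k. elementary_process (simple_proc (n k) (\<tau> k) (\<xi> k)) (simple_integral W (n k) (\<tau> k) (\<xi> k))"
    and Isq: "L2 M I"
    and lim: "(\<lambda>k. L2norm M (\<lambda>w. simple_integral W (n k) (\<tau> k) (\<xi> k) w - I w)) \<longlonglongrightarrow> 0"
    by (rule ito_approximation[OF I order_refl tT]) blast
  let ?\<Phi> = "\<lambda>k. simple_proc (n k) (\<tau> k) (\<xi> k)"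
  have m: "(\<lambda>(r, w). ?\<Phi> k r w - indicator {0..t} r *\<^sub>R \<sigma> r) \<in> borel_measurable (dtP M T)" for k
  proof -
    have "(\<lambda>z. (case z of (r, w) \<Rightarrow> ?\<Phi> k r w) - (case z of (r, w) \<Rightarrow> indicator {0..t} r *\<^sub>R \<sigma> r)) \<in> borel_measurable (dtP M T)"
      using elementary_process_L2(2)[OF el[of k]] indicator_\<sigma>_L2[of "{0..t}"]
      by (intro borel_measurable_diff L2_measurable) auto
    then show ?thesis by (simp add: case_prod_beta')
  qed
  have eq: "(\<integral>\<^sup>+w. (\<integral>\<^sup>+r\<in>{0..t}. ennreal ((norm (?\<Phi> k r w - \<sigma> r))\<^sup>2) \<partial>lborel) \<partial>M)
      = (\<integral>\<^sup>+z. ennreal ((norm (case z of (r, w) \<Rightarrow> ?\<Phi> k r w - indicator {0..t} r *\<^sub>R \<sigma> r))\<^sup>2) \<partial>dtP M T)" for k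
  proof -
    \<comment> \<open>All grid points lie in \<open>{0..t}\<close>, so enlarging the time interval
      to \<open>{0..T}\<close> adds nothing once \<open>\<sigma>\<close> is cut off.\<close>
    have out: "?\<Phi> k r w = 0" if "r \<notin> {0..t}" for r w
      unfolding simple_proc_def
    proof (intro sum.neutral ballI)
      fix i assume "i \<in> {..<n k}"
      then have "r \<notin> {\<tau> k i<..\<tau> k (Suc i)}" using a(1)[of i k] a(1)[of "Suc i" k] that by auto
      then show "indicator {\<tau> k i<..\<tau> k (Suc i)} r *\<^sub>R \<xi> k i w = 0" by simp
    qed
    have "(\<integral>\<^sup>+w. (\<integral>\<^sup>+r\<in>{0..t}. ennreal ((norm (?\<Phi> k r w - \<sigma> r))\<^sup>2) \<partial>lborel) \<partial>M)
        = (\<integral>\<^sup>+w. (\<integral>\<^sup>+r\<in>{0..T}. ennreal ((norm (?\<Phi> k r w - indicator {0..t} r *\<^sub>R \<sigma> r))\<^sup>2) \<partial>lborel) \<partial>M)"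
      using t out by (intro nn_integral_cong) (auto simp: indicator_def)
    also have "\<dots> = (\<integral>\<^sup>+(r, w). ennreal ((norm (?\<Phi> k r w - indicator {0..t} r *\<^sub>R \<sigma> r))\<^sup>2) \<partial>dtP M T)"
      using m[of k] by (intro dtP_nn_integral) (simp add: case_prod_beta')
    finally show ?thesis by (simp add: case_prod_beta')
  qed
  have lim2: "(\<lambda>k. L2norm (dtP M T) (\<lambda>(r, w). ?\<Phi> k r w - indicator {0..t} r *\<^sub>R \<sigma> r)) \<longlonglongrightarrow> 0"
    by (rule nn_integral_tendsto_L2norm(1)[OF m lim1[unfolded eq]])
  show ?thesis by (rule that[OF el lim2 lim])
qed

text \<open>The definition of a state supplies some version of the noise integral at each time. Two
  versions agree a.e., by the isometry, so the noise of two controlled states cancels in their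
  difference.\<close>

lemma ito_unique:
  assumes I: "has_ito_integral M F W 0 t (\<lambda>r _. \<sigma> r) I" and I': "has_ito_integral M F W 0 t (\<lambda>r _. \<sigma> r) I'"
    and t: "t \<in> {0..T}"
  shows "AE w in M. I w = I' w"
proof -
  obtain \<Phi> J where el: "\<And>k. elementary_process (\<Phi> k) (J k)"
    and l: "(\<lambda>k. L2norm (dtP M T) (\<lambda>(r, w). \<Phi> k r w - indicator {0..t} r *\<^sub>R \<sigma> r)) \<longlonglongrightarrow> 0"
    "(\<lambda>k. L2norm M (\<lambda>w. J k w - I w)) \<longlonglongrightarrow> 0" using ito_deterministic[OF I t] by blast
  obtain \<Phi>' J' where el': "\<And>k. elementary_process (\<Phi>' k) (J' k)"
    and l': "(\<lambda>k. L2norm (dtP M T) (\<lambda>(r, w). \<Phi>' k r w - indicator {0..t} r *\<^sub>R \<sigma> r)) \<longlonglongrightarrow> 0"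
    "(\<lambda>k. L2norm M (\<lambda>w. J' k w - I' w)) \<longlonglongrightarrow> 0" using ito_deterministic[OF I' t] by blast
  have Isq: "L2 M I" "L2 M I'"
    using has_ito_integral_L2[OF I] has_ito_integral_L2[OF I'] t by auto
  note e = elementary_process_L2[OF el] and e' = elementary_process_L2[OF el']
  note s = indicator_\<sigma>_L2[of "{0..t}", simplified]
  have "L2norm M (\<lambda>w. I w - I' w) = 0"
  proof (rule eq_0_if_null_bound)
    fix k
    let ?a = "L2norm (dtP M T) (\<lambda>(r, w). \<Phi> k r w - indicator {0..t} r *\<^sub>R \<sigma> r)"
    let ?a' = "L2norm (dtP M T) (\<lambda>(r, w). \<Phi>' k r w - indicator {0..t} r *\<^sub>R \<sigma> r)"
    have "L2norm M (\<lambda>w. J k w - J' k w) = L2norm (dtP M T) (\<lambda>(r, w). \<Phi> k r w - \<Phi>' k r w)"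
      by (rule elementary_process_isometry[OF elementary_process_diff[OF el el']])
    also have "\<dots> \<le> ?a + ?a'"
      using L2norm_triangle[OF L2_diff[OF e(2)[of k] s] L2_uminus[OF L2_diff[OF e'(2)[of k] s]]]
      unfolding L2norm_uminus by (simp add: case_prod_beta')
    finally have 1: "L2norm M (\<lambda>w. J k w - J' k w) \<le> ?a + ?a'" .
    have "L2norm M (\<lambda>w. I w - I' w) = L2norm M (\<lambda>w. - (J k w - I w) + ((J k w - J' k w) + (J' k w - I' w)))"
      by simp
    also have "\<dots> \<le> L2norm M (\<lambda>w. J k w - I w) + (L2norm M (\<lambda>w. J k w - J' k w) + L2norm M (\<lambda>w. J' k w - I' w))"
      by (rule order_trans[OF L2norm_triangle add_mono])
        (auto intro!: L2norm_triangle L2_add L2_diff L2_uminus e(1) e'(1) Isq simp only: L2norm_uminus order_refl)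
    finally show "\<bar>L2norm M (\<lambda>w. I w - I' w)\<bar> \<le> L2norm M (\<lambda>w. J k w - I w) + ((?a + ?a') + L2norm M (\<lambda>w. J' k w - I' w))"
      using 1 by simp
  next
    show "(\<lambda>k. L2norm M (\<lambda>w. J k w - I w) + ((L2norm (dtP M T) (\<lambda>(r, w). \<Phi> k r w - indicator {0..t} r *\<^sub>R \<sigma> r)
        + L2norm (dtP M T) (\<lambda>(r, w). \<Phi>' k r w - indicator {0..t} r *\<^sub>R \<sigma> r)) + L2norm M (\<lambda>w. J' k w - I' w))) \<longlonglongrightarrow> 0"
      by (rule tendsto_eq_rhs[OF tendsto_add[OF l(2) tendsto_add[OF tendsto_add[OF l(1) l'(1)] l'(2)]]]) simp
  qed
  from L2norm_eq_0_AE[OF L2_diff[OF Isq] this] show ?thesis by simp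
qed

text \<open>An arbitrary approximation may have coefficients that depend on the past. Left-endpoint
  sums with the deterministic values of \<open>\<sigma>\<close> are functions of the increments
  after \<open>s\<close> alone; uniform continuity of \<open>\<sigma>\<close> on the compact
  interval gives their convergence.\<close>

lemma riemann_approximation:
  assumes st: "0 \<le> s" "s \<le> t" "t \<le> T"
  obtains \<Phi> J where "\<And>k. elementary_process (\<Phi> k) (J k)"
    "\<And>k. J k \<in> borel_measurable (increment_sigma M W s {s..T})"
    "(\<lambda>k. L2norm (dtP M T) (\<lambda>(r, w). \<Phi> k r w - indicator {s<..t} r *\<^sub>R \<sigma> r)) \<longlonglongrightarrow> 0"
proof -
  define \<tau> where "\<tau> k i = s + (t - s) * real i / real (Suc k)" for k i
  define \<Phi> where "\<Phi> k = simple_proc (Suc k) (\<tau> k) (\<lambda>i (w::'w). \<sigma> (\<tau> k i))" for k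
  define J where "J k = simple_integral W (Suc k) (\<tau> k) (\<lambda>i (w::'w). \<sigma> (\<tau> k i))" for k
  have \<tau>: "\<tau> k i \<in> {s..t}" if "i \<le> Suc k" for k i
  proof -
    have "(t - s) * real i / real (Suc k) \<le> (t - s) * 1"
      using that st by (simp add: divide_le_eq mult_left_mono del: of_nat_Suc)
    then show ?thesis using st by (auto simp: \<tau>_def)
  qed
  have mono: "\<tau> k i \<le> \<tau> k (Suc i)" for k i
    using st by (simp add: \<tau>_def divide_right_mono mult_left_mono)
  have gap: "\<tau> k (Suc i) - \<tau> k i = (t - s) / real (Suc k)" for k i
    unfolding \<tau>_def by (simp add: diff_divide_distrib[symmetric] right_diff_distrib[symmetric] del: of_nat_Suc)
  have ends: "\<tau> k 0 = s" "\<tau> k (Suc k) = t" for k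
  proof -
    show "\<tau> k 0 = s" by (simp add: \<tau>_def)
    have "real (Suc k) \<noteq> 0" by simp
    from nonzero_mult_div_cancel_right[OF this, of "t - s"] show "\<tau> k (Suc k) = t" unfolding \<tau>_def by linarith
  qed
  have el: "elementary_process (\<Phi> k) (J k)" for k
    unfolding \<Phi>_def J_def
  proof (rule elementary_process_simple)
    show "\<tau> k i \<in> {0..T}" if "i \<le> Suc k" for i using \<tau>[OF that] st by auto
    show "bounded_adapted (\<tau> k i) (\<lambda>w. \<sigma> (\<tau> k i))" for i by (auto simp: bounded_adapted_def)
  qed (rule mono)
  have Jm: "J k \<in> borel_measurable (increment_sigma M W s {s..T})" for k
    unfolding J_def simple_integral_def[abs_def]
  proof (rule borel_measurable_sum)
    fix i assume "i \<in> {..<Suc k}"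
    then have i: "\<tau> k i \<in> {s..T}" "\<tau> k (Suc i) \<in> {s..T}" using \<tau>[of i k] \<tau>[of "Suc i" k] st by auto
    have "(\<lambda>w. (W (\<tau> k (Suc i)) w - W s w) - (W (\<tau> k i) w - W s w)) \<in> borel_measurable (increment_sigma M W s {s..T})"
      by (intro borel_measurable_diff increment_measurable i)
    then have "(\<lambda>w. W (\<tau> k (Suc i)) w - W (\<tau> k i) w) \<in> borel_measurable (increment_sigma M W s {s..T})" by simp
    then show "(\<lambda>w. \<sigma> (\<tau> k i) *v (W (\<tau> k (Suc i)) w - W (\<tau> k i) w)) \<in> borel_measurable (increment_sigma M W s {s..T})"
      by measurable
  qed
  have diff: "\<Phi> k r w - indicator {s<..t} r *\<^sub>R \<sigma> r = (\<Sum>i<Suc k. indicator {\<tau> k i<..\<tau> k (Suc i)} r *\<^sub>R (\<sigma> (\<tau> k i) - \<sigma> r))" for k r w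
    using sum_indicator_intervals[of "Suc k" "\<tau> k" r, OF mono]
    by (simp only: \<Phi>_def simple_proc_def scaleR_diff_right sum_subtractf scaleR_sum_left[symmetric] ends)
  have lim: "(\<lambda>k. L2norm (dtP M T) (\<lambda>(r, w). \<Phi> k r w - indicator {s<..t} r *\<^sub>R \<sigma> r)) \<longlonglongrightarrow> 0"
  proof (rule LIMSEQ_I)
    fix e :: real assume e: "0 < e"
    \<comment> \<open>\<open>dtP M T\<close> is finite but in general not a probability measure:
      \<open>c\<close> converts the uniform bound \<open>\<epsilon>\<close> into an L2 bound, and
      \<open>c + 1\<close> keeps the denominator positive.\<close>
    define c where "c = L2norm (dtP M T) (\<lambda>_. 1::real)"
    have c0: "0 \<le> c" by (simp add: c_def)
    define \<epsilon> where "\<epsilon> = e / (c + 1)"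
    have \<epsilon>: "\<epsilon> > 0" using e c0 by (simp add: \<epsilon>_def)
    have "uniformly_continuous_on {0..T} \<sigma>" by (rule compact_uniformly_continuous[OF \<sigma>]) simp
    then obtain \<delta> where \<delta>: "\<delta> > 0" "\<And>x x'. x \<in> {0..T} \<Longrightarrow> x' \<in> {0..T} \<Longrightarrow> dist x' x < \<delta> \<Longrightarrow> dist (\<sigma> x') (\<sigma> x) < \<epsilon>"
      using \<epsilon> unfolding uniformly_continuous_on_def by metis
    obtain k0 where k0: "(t - s + 1) / \<delta> < real k0" using reals_Archimedean2 by blast
    show "\<exists>k0. \<forall>k\<ge>k0. norm (L2norm (dtP M T) (\<lambda>(r, w). \<Phi> k r w - indicator {s<..t} r *\<^sub>R \<sigma> r) - 0) < e"
    proof (intro exI allI impI)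
      fix k assume k: "k \<ge> k0"
      have "(t - s) / real (Suc k) < \<delta>"
      proof -
        have "t - s < \<delta> * real k0" using k0 \<delta>(1) by (simp add: divide_less_eq mult.commute)
        also have "\<dots> \<le> \<delta> * real (Suc k)" using k \<delta>(1) by (intro mult_left_mono) auto
        finally show ?thesis by (simp add: divide_less_eq del: of_nat_Suc)
      qed
      then have b: "norm (\<Phi> k r w - indicator {s<..t} r *\<^sub>R \<sigma> r) \<le> \<epsilon>" if r: "r \<in> {0..T}" for r w
      proof -
        assume small: "(t - s) / real (Suc k) < \<delta>"
        have "norm (\<Phi> k r w - indicator {s<..t} r *\<^sub>R \<sigma> r)
            \<le> (\<Sum>i<Suc k. norm (indicator {\<tau> k i<..\<tau> k (Suc i)} r *\<^sub>R (\<sigma> (\<tau> k i) - \<sigma> r)))"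
          unfolding diff by (rule norm_sum)
        also have "\<dots> \<le> (\<Sum>i<Suc k. \<epsilon> * indicator {\<tau> k i<..\<tau> k (Suc i)} r)"
        proof (rule sum_mono)
          fix i assume "i \<in> {..<Suc k}"
          then have i: "\<tau> k i \<in> {0..T}" using \<tau>[of i k] st by auto
          show "norm (indicator {\<tau> k i<..\<tau> k (Suc i)} r *\<^sub>R (\<sigma> (\<tau> k i) - \<sigma> r)) \<le> \<epsilon> * indicator {\<tau> k i<..\<tau> k (Suc i)} r"
          proof (cases "r \<in> {\<tau> k i<..\<tau> k (Suc i)}")
            case True
            then have "dist (\<tau> k i) r < \<delta>" using gap[of k i] small by (auto simp: dist_real_def)
            from \<delta>(2)[OF r i this] True show ?thesis by (simp add: dist_norm)
          qed simp
        qed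
        also have "\<dots> = \<epsilon> * indicator {s<..t} r"
          using sum_indicator_intervals[of "Suc k" "\<tau> k" r, OF mono] by (simp only: sum_distrib_left[symmetric] ends)
        also have "\<dots> \<le> \<epsilon>" using \<epsilon> by (simp add: indicator_def)
        finally show ?thesis .
      qed
      have "L2norm (dtP M T) (\<lambda>(r, w). \<Phi> k r w - indicator {s<..t} r *\<^sub>R \<sigma> r) \<le> \<epsilon> * c"
        unfolding c_def
      proof (rule L2norm_mono[OF finite_measure.L2_const[OF finite_dtP]])
        have "(\<lambda>z. (case z of (r, w) \<Rightarrow> \<Phi> k r w) - (case z of (r, w) \<Rightarrow> indicator {s<..t} r *\<^sub>R \<sigma> r)) \<in> borel_measurable (dtP M T)"
          using elementary_process_L2(2)[OF el[of k]] indicator_\<sigma>_L2[of "{s<..t}"]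
          by (intro borel_measurable_diff L2_measurable) auto
        then show "(\<lambda>(r, w). \<Phi> k r w - indicator {s<..t} r *\<^sub>R \<sigma> r) \<in> borel_measurable (dtP M T)" by (simp add: case_prod_beta')
      qed (use b \<epsilon> in \<open>auto simp: space_dtP\<close>)
      also have "\<dots> < e" using e c0 by (simp add: \<epsilon>_def field_simps)
      finally show "norm (L2norm (dtP M T) (\<lambda>(r, w). \<Phi> k r w - indicator {s<..t} r *\<^sub>R \<sigma> r) - 0) < e" by simp
    qed
  qed
  show ?thesis by (rule that[OF el Jm lim])
qed

text \<open>The noise between \<open>s\<close> and \<open>t\<close> is the L2-limit of the sums
  \<open>R k\<close>, which are functions of the increments after \<open>s\<close>. By the isometry
  it suffices that the integrands match: \<open>\<sigma>\<close> on \<open>{0..t}\<close> is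
  \<open>\<sigma>\<close> on \<open>{0..s}\<close> plus \<open>\<sigma>\<close> on the half-open
  rest.\<close>

lemma ito_increment_orthogonal:
  assumes I: "has_ito_integral M F W 0 s (\<lambda>r _. \<sigma> r) I" and I': "has_ito_integral M F W 0 t (\<lambda>r _. \<sigma> r) I'"
    and st: "0 \<le> s" "s \<le> t" "t \<le> T"
    and U: "L2 M U"
      "\<And>V. V \<in> borel_measurable (increment_sigma M W s {s..T}) \<Longrightarrow> L2 M V \<Longrightarrow> ip U V = 0"
  shows "(LINT w|M. U w \<bullet> (I' w - I w)) = 0"
proof -
  obtain \<Phi> J where el: "\<And>k. elementary_process (\<Phi> k) (J k)"
    and l: "(\<lambda>k. L2norm (dtP M T) (\<lambda>(r, w). \<Phi> k r w - indicator {0..s} r *\<^sub>R \<sigma> r)) \<longlonglongrightarrow> 0"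
    "(\<lambda>k. L2norm M (\<lambda>w. J k w - I w)) \<longlonglongrightarrow> 0" using ito_deterministic[OF I] st by auto
  obtain \<Phi>' J' where el': "\<And>k. elementary_process (\<Phi>' k) (J' k)"
    and l': "(\<lambda>k. L2norm (dtP M T) (\<lambda>(r, w). \<Phi>' k r w - indicator {0..t} r *\<^sub>R \<sigma> r)) \<longlonglongrightarrow> 0"
    "(\<lambda>k. L2norm M (\<lambda>w. J' k w - I' w)) \<longlonglongrightarrow> 0" using ito_deterministic[OF I'] st by auto
  obtain \<Psi> R where elR: "\<And>k. elementary_process (\<Psi> k) (R k)"
    and Rm: "\<And>k. R k \<in> borel_measurable (increment_sigma M W s {s..T})"
    and lR: "(\<lambda>k. L2norm (dtP M T) (\<lambda>(r, w). \<Psi> k r w - indicator {s<..t} r *\<^sub>R \<sigma> r)) \<longlonglongrightarrow> 0"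
    using riemann_approximation[OF st] by blast
  have Isq: "L2 M I" "L2 M I'"
    using has_ito_integral_L2[OF I] has_ito_integral_L2[OF I'] st by auto
  note e = elementary_process_L2[OF el] and e' = elementary_process_L2[OF el']
    and eR = elementary_process_L2[OF elR]
  note s1 = indicator_\<sigma>_L2[of "{0..s}", simplified]
    and s2 = indicator_\<sigma>_L2[of "{0..t}", simplified]
    and s3 = indicator_\<sigma>_L2[of "{s<..t}", simplified]
  let ?a = "\<lambda>k. L2norm (dtP M T) (\<lambda>(r, w). \<Phi> k r w - indicator {0..s} r *\<^sub>R \<sigma> r)"
  let ?a' = "\<lambda>k. L2norm (dtP M T) (\<lambda>(r, w). \<Phi>' k r w - indicator {0..t} r *\<^sub>R \<sigma> r)"
  let ?aR = "\<lambda>k. L2norm (dtP M T) (\<lambda>(r, w). \<Psi> k r w - indicator {s<..t} r *\<^sub>R \<sigma> r)"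
  show ?thesis
  proof (rule eq_0_if_null_bound)
    fix k
    have ind: "indicator {0..t} r *\<^sub>R \<sigma> r = indicator {0..s} r *\<^sub>R \<sigma> r + indicator {s<..t} r *\<^sub>R \<sigma> r" for r
      using st by (auto simp: indicator_def)
    have "L2norm M (\<lambda>w. J' k w - (J k w + R k w)) = L2norm (dtP M T) (\<lambda>(r, w). \<Phi>' k r w - (\<Phi> k r w + \<Psi> k r w))"
      by (rule elementary_process_isometry[OF elementary_process_diff[OF el' elementary_process_add[OF elR el]]])
    also have "\<dots> = L2norm (dtP M T) (\<lambda>z. ((case z of (r, w) \<Rightarrow> \<Phi>' k r w) - (case z of (r, w) \<Rightarrow> indicator {0..t} r *\<^sub>R \<sigma> r))
        + (- ((case z of (r, w) \<Rightarrow> \<Phi> k r w) - (case z of (r, w) \<Rightarrow> indicator {0..s} r *\<^sub>R \<sigma> r))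
          + - ((case z of (r, w) \<Rightarrow> \<Psi> k r w) - (case z of (r, w) \<Rightarrow> indicator {s<..t} r *\<^sub>R \<sigma> r))))"
      by (intro arg_cong[where f = "L2norm (dtP M T)"]) (auto simp: fun_eq_iff ind)
    also have "\<dots> \<le> ?a' k + (?a k + ?aR k)"
    proof (rule order_trans[OF L2norm_triangle add_mono])
      show "L2norm (dtP M T) (\<lambda>z. - ((case z of (r, w) \<Rightarrow> \<Phi> k r w) - (case z of (r, w) \<Rightarrow> indicator {0..s} r *\<^sub>R \<sigma> r))
          + - ((case z of (r, w) \<Rightarrow> \<Psi> k r w) - (case z of (r, w) \<Rightarrow> indicator {s<..t} r *\<^sub>R \<sigma> r))) \<le> ?a k + ?aR k"
        using L2norm_triangle[OF L2_uminus[OF L2_diff[OF e(2)[of k] s1]] L2_uminus[OF L2_diff[OF eR(2)[of k] s3]]]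
        unfolding L2norm_uminus by (simp add: case_prod_beta')
      show "L2norm (dtP M T) (\<lambda>z. (case z of (r, w) \<Rightarrow> \<Phi>' k r w) - (case z of (r, w) \<Rightarrow> indicator {0..t} r *\<^sub>R \<sigma> r)) \<le> ?a' k"
        by (simp add: case_prod_beta')
    qed (intro L2_diff L2_add L2_uminus e'(2) e(2) eR(2) s1 s2 s3)+
    finally have 1: "L2norm M (\<lambda>w. J' k w - (J k w + R k w)) \<le> ?a' k + (?a k + ?aR k)" .
    have "L2norm M (\<lambda>w. (I' w - I w) - R k w) = L2norm M (\<lambda>w. - (J' k w - I' w) + ((J k w - I w) + (J' k w - (J k w + R k w))))"
      by (simp add: algebra_simps)
    also have "\<dots> \<le> L2norm M (\<lambda>w. J' k w - I' w) + (L2norm M (\<lambda>w. J k w - I w) + L2norm M (\<lambda>w. J' k w - (J k w + R k w)))"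
      by (rule order_trans[OF L2norm_triangle add_mono])
        (auto intro!: L2norm_triangle L2_add L2_diff L2_uminus e(1) e'(1) eR(1) Isq simp only: L2norm_uminus order_refl)
    finally have 2: "L2norm M (\<lambda>w. (I' w - I w) - R k w)
        \<le> L2norm M (\<lambda>w. J' k w - I' w) + (L2norm M (\<lambda>w. J k w - I w) + (?a' k + (?a k + ?aR k)))" using 1 by linarith
    have d: "L2 M (\<lambda>w. I' w - I w)" by (rule L2_diff[OF Isq(2,1)])
    have "(LINT w|M. U w \<bullet> (I' w - I w)) = (LINT w|M. U w \<bullet> ((I' w - I w) - R k w))"
      using U(2)[OF Rm eR(1), of k] L2_inner[OF U(1) d] L2_inner[OF U(1) eR(1), of k]
      by (subst inner_diff_right[of _ "I' _ - I _"]) simp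
    also have "\<bar>\<dots>\<bar> \<le> L2norm M U * L2norm M (\<lambda>w. (I' w - I w) - R k w)"
      by (rule L2_Cauchy_Schwarz[OF U(1) L2_diff[OF d eR(1)]])
    also have "\<dots> \<le> L2norm M U * (L2norm M (\<lambda>w. J' k w - I' w) + (L2norm M (\<lambda>w. J k w - I w) + (?a' k + (?a k + ?aR k))))"
      using 2 by (rule mult_left_mono) simp
    finally show "\<bar>(LINT w|M. U w \<bullet> (I' w - I w))\<bar>
        \<le> L2norm M U * (L2norm M (\<lambda>w. J' k w - I' w) + (L2norm M (\<lambda>w. J k w - I w) + (?a' k + (?a k + ?aR k))))" .
  next
    show "(\<lambda>k. L2norm M U * (L2norm M (\<lambda>w. J' k w - I' w) + (L2norm M (\<lambda>w. J k w - I w) + (?a' k + (?a k + ?aR k))))) \<longlonglongrightarrow> 0"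
      by (rule tendsto_eq_rhs[OF tendsto_mult[OF tendsto_const tendsto_add[OF l'(2) tendsto_add[OF l(2) tendsto_add[OF l'(1) tendsto_add[OF l(1) lR]]]]]]) simp
  qed
qed

end

end

section \<open>State processes\<close>

lemma lipschitz_from_derivative:
  fixes h :: "real^'d \<Rightarrow> real^'k"
  assumes "\<And>x. (h has_derivative (\<lambda>v. D x *v v)) (at x)" "\<And>x. norm (D x) \<le> L"
  shows "norm (h x - h y) \<le> L * norm (x - y)"
proof (rule differentiable_bound[of UNIV])
  show "(h has_derivative (\<lambda>v. D x *v v)) (at x within UNIV)" for x using assms(1) by simp
  have "0 \<le> L" using order_trans[OF norm_ge_zero assms(2)] .
  then show "onorm (\<lambda>v. D x *v v) \<le> L" for x
    by (intro onorm_le order_trans[OF norm_matrix_vector_mult_le] mult_right_mono assms(2)) auto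
qed auto

lemma norm_le_sum_components: "norm (x :: real^'k) \<le> (\<Sum>i\<in>UNIV. \<bar>x $ i\<bar>)"
  by (rule norm_le_l1_cart)

lemma lift_continuous_vec:
  fixes M :: "'w measure" and h :: "'a::euclidean_space measure \<Rightarrow> real^'k"
  assumes "\<And>i. lift_continuous M (\<lambda>\<nu>. h \<nu> $ i)" shows "lift_continuous M h"
  unfolding lift_continuous_def
proof (intro allI impI)
  fix X :: "'w \<Rightarrow> 'a" and Xn assume "L2 M X \<and> (\<forall>n::nat. L2 M (Xn n)) \<and> (\<lambda>n. L2norm M (\<lambda>w. Xn n w - X w)) \<longlonglongrightarrow> 0"
  then show "(\<lambda>n. h (law M (Xn n))) \<longlonglongrightarrow> h (law M X)"
    by (intro vec_tendstoI lift_continuousD[OF assms]) auto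
qed

context mean_field_space
begin

section \<open>Measurability and Fubini on \<open>[0,T] \<times> \<Omega>\<close>\<close>

lemma fst_dtP: "fst \<in> measurable (dtP M T) (restrict_space borel {0..T})"
  unfolding measurable_dtP_iff by simp

lemma snd_dtP: "snd \<in> measurable (dtP M T) M"
  unfolding dtP_def by simp

lemma Pair_dtP:
  assumes "\<phi> \<in> measurable N (restrict_space borel {0..T})" "Y \<in> measurable N M"
  shows "(\<lambda>z. (\<phi> z, Y z)) \<in> measurable N (dtP M T)"
proof -
  have "(\<lambda>z. (\<phi> z, Y z)) \<in> measurable N (restrict_space borel {0..T} \<Otimes>\<^sub>M M)"
    using assms by (rule measurable_Pair)
  then show ?thesis by (simp add: measurable_cong_sets[OF refl sets_dtP])
qed

lemma dtP_compose:
  assumes "(\<lambda>(t, w). A t w) \<in> measurable (dtP M T) K"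
    and "\<phi> \<in> measurable N (restrict_space borel {0..T})" "Y \<in> measurable N M"
  shows "(\<lambda>z. A (\<phi> z) (Y z)) \<in> measurable N K"
  using measurable_compose[OF Pair_dtP[OF assms(2,3)] assms(1)] by simp

lemma dtP_section:
  assumes "(\<lambda>(t, w). A t w) \<in> measurable (dtP M T) K" "t \<in> {0..T}"
  shows "A t \<in> measurable M K"
  using dtP_compose[OF assms(1), of "\<lambda>_. t" M "\<lambda>w. w"] assms(2) by (simp add: space_restrict_space)

lemma dtP_integral_measurable:
  fixes k :: "real \<Rightarrow> 'w \<Rightarrow> 'w \<Rightarrow> 'e::{banach, second_countable_topology}"
  assumes "(\<lambda>(z, w'). k (fst z) (snd z) w') \<in> borel_measurable (dtP M T \<Otimes>\<^sub>M M)"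
  shows "(\<lambda>(t, w). LINT w'|M. k t w w') \<in> borel_measurable (dtP M T)"
proof -
  have "(\<lambda>z. LINT w'|M. k (fst z) (snd z) w') \<in> borel_measurable (dtP M T)"
    using assms by (rule borel_measurable_lebesgue_integral)
  then show ?thesis by (simp add: case_prod_beta')
qed

lemma continuous_process_dtP:
  assumes X: "continuous_process M T X"
  shows "measurable_dtP X"
  unfolding measurable_dtP_iff
  using X by (intro caratheodory_measurable) (auto simp: continuous_process_def sq_integrable_def)

lemma continuous_process_prog:
  assumes X: "continuous_process M T X" and ad: "\<And>t. t \<in> {0..T} \<Longrightarrow> X t \<in> borel_measurable (F t)"
    and t: "t \<in> {0..T}"
  shows "(\<lambda>(s, w). X s w) \<in> borel_measurable (restrict_space borel {0..t} \<Otimes>\<^sub>M F t)"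
proof (rule caratheodory_measurable)
  show "continuous_on {0..t} (\<lambda>s. X s w)" if "w \<in> space (F t)" for w
    using X that t by (auto simp: continuous_process_def intro: continuous_on_subset)
  show "X s \<in> borel_measurable (F t)" if "s \<in> {0..t}" for s
    using measurable_F_mono[OF ad[of s], of t] that t by auto
qed

lemma flow_comp_measurable:
  assumes h: "flow_regular M T h" and X: "continuous_process M T X"
    and "\<phi> \<in> measurable N (restrict_space borel {0..T})" "Y \<in> borel_measurable N"
  shows "(\<lambda>z. h (\<phi> z) (Y z) (law M (X (\<phi> z)))) \<in> borel_measurable N"
  using measurable_compose[OF measurable_Pair[OF assms(3,4)] flow_regular_measurable[OF h X]] by simp

lemma flow_dtP:
  assumes h: "flow_regular M T h" and X: "continuous_process M T X" and Y: "measurable_dtP Y"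
  shows "(\<lambda>(t, w). h t (Y t w) (law M (X t))) \<in> borel_measurable (dtP M T)"
  using flow_comp_measurable[OF h X fst_dtP Y] by (simp add: case_prod_beta')

lemma flow_section:
  assumes h: "flow_regular M T h" and X: "continuous_process M T X" and t: "t \<in> {0..T}" and Y: "Y \<in> borel_measurable N"
  shows "(\<lambda>w. h t (Y w) (law M (X t))) \<in> borel_measurable N"
  using flow_comp_measurable[OF h X _ Y, of "\<lambda>_. t"] t by (simp add: space_restrict_space)

lemma process_L2_dtP:
  fixes A :: "real \<Rightarrow> 'w \<Rightarrow> 'e::euclidean_space"
  assumes m: "measurable_dtP A"
    and A: "\<And>t. t \<in> {0..T} \<Longrightarrow> L2 M (A t)" "\<And>t. t \<in> {0..T} \<Longrightarrow> L2norm M (A t) \<le> C"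
  shows "L2_dtP A"
proof -
  interpret L: finite_measure lT by (rule finite_lT)
  have m2: "(\<lambda>z. ennreal ((norm (case z of (t, w) \<Rightarrow> A t w))\<^sup>2)) \<in> borel_measurable (lT \<Otimes>\<^sub>M M)"
    using m unfolding dtP_def by measurable
  have "(\<integral>\<^sup>+z. ennreal ((norm (case z of (t, w) \<Rightarrow> A t w))\<^sup>2) \<partial>dtP M T)
      = (\<integral>\<^sup>+t. (\<integral>\<^sup>+w. ennreal ((norm (A t w))\<^sup>2) \<partial>M) \<partial>lT)"
    unfolding dtP_def by (subst nn_integral_fst[OF m2, symmetric]) simp
  also have "\<dots> \<le> (\<integral>\<^sup>+t. ennreal (C\<^sup>2) \<partial>lT)"
  proof (rule nn_integral_mono)
    fix t assume "t \<in> space lT"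
    then have t: "t \<in> {0..T}" by (simp add: space_restrict_space)
    have "(\<integral>\<^sup>+w. ennreal ((norm (A t w))\<^sup>2) \<partial>M) = ennreal ((L2norm M (A t))\<^sup>2)"
      unfolding L2norm_power2 by (rule nn_integral_eq_integral) (use A(1)[OF t] in \<open>auto simp: sq_integrable_def\<close>)
    also have "\<dots> \<le> ennreal (C\<^sup>2)"
      using A(2)[OF t] by (intro ennreal_leI power_mono) auto
    finally show "(\<integral>\<^sup>+w. ennreal ((norm (A t w))\<^sup>2) \<partial>M) \<le> ennreal (C\<^sup>2)" .
  qed
  also have "\<dots> < \<infinity>"
  proof -
    have "emeasure lT {0..T} < top"
      using L.emeasure_finite[of "{0..T}"] unfolding infinity_ennreal_def less_top .
    then show ?thesis by (simp add: ennreal_mult_less_top space_restrict_space)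
  qed
  finally show ?thesis using m by (auto simp: sq_integrable_def integrable_iff_bounded)
qed

lemma L2_dtP_const: "L2 M U \<Longrightarrow> L2 (dtP M T) (\<lambda>(t, w). U w)"
  by (rule process_L2_dtP[where C = "L2norm M U"]) (auto intro!: measurable_dtP_const)

lemma L2_dtP_time:
  fixes h :: "real \<Rightarrow> 'e::euclidean_space"
  assumes h: "h \<in> borel_measurable (restrict_space borel {0..T})" and i: "integrable lT (\<lambda>t. (norm (h t))\<^sup>2)"
  shows "L2 (dtP M T) (\<lambda>(t, w). h t)"
proof -
  have m: "(\<lambda>(t, w). h t) \<in> borel_measurable (dtP M T)" by (rule measurable_dtP_time[OF h])
  have m2: "(\<lambda>z. ennreal ((norm (case z of (t, w) \<Rightarrow> h t))\<^sup>2)) \<in> borel_measurable (lT \<Otimes>\<^sub>M M)"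
    using m unfolding dtP_def by measurable
  have "(\<integral>\<^sup>+z. ennreal ((norm (case z of (t, w) \<Rightarrow> h t))\<^sup>2) \<partial>dtP M T)
      = (\<integral>\<^sup>+t. (\<integral>\<^sup>+w. ennreal ((norm (h t))\<^sup>2) \<partial>M) \<partial>lT)"
    unfolding dtP_def by (subst nn_integral_fst[OF m2, symmetric]) simp
  also have "\<dots> = (\<integral>\<^sup>+t. ennreal ((norm (h t))\<^sup>2) \<partial>lT)" by (simp add: emeasure_space_1)
  also have "\<dots> < \<infinity>" using i by (simp add: integrable_iff_bounded)
  finally show ?thesis using m by (auto simp: sq_integrable_def integrable_iff_bounded)
qed

lemma L2_dtP_indicator:
  assumes "L2_dtP A" "J \<in> sets borel"
  shows "L2 (dtP M T) (\<lambda>(t, w). indicator J t *\<^sub>R A t w)"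
proof (rule L2_bound[OF assms(1), of _ 1])
  have "indicator J \<in> borel_measurable (restrict_space borel {0..T})"
    by (rule measurable_restrict_space1) (use assms in simp)
  from borel_measurable_scaleR[OF measurable_dtP_time[OF this] L2_measurable[OF assms(1)]]
  show "(\<lambda>(t, w). indicator J t *\<^sub>R A t w) \<in> borel_measurable (dtP M T)" by (simp add: case_prod_beta')
qed (auto simp: indicator_def)

lemma dtP_AE_L2:
  fixes A :: "real \<Rightarrow> 'w \<Rightarrow> 'e::euclidean_space"
  assumes A: "L2_dtP A"
  shows "AE t in lT. L2 M (A t)"
proof -
  have "integrable (dtP M T) (\<lambda>(t, w). (norm (A t w))\<^sup>2)"
    using L2_norm_sq[OF A] by (simp add: case_prod_beta')
  from dtP_AE_integrable_fst[OF this] show ?thesis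
  proof (rule AE_mp, intro AE_I2 impI)
    fix t assume "t \<in> space lT" and i: "integrable M (\<lambda>w. (norm (A t w))\<^sup>2)"
    then have t: "t \<in> {0..T}" by (simp add: space_restrict_space)
    have "measurable_dtP A" using A by measurable
    from dtP_section[OF this t] i show "L2 M (A t)" by (simp add: sq_integrable_def)
  qed
qed

text \<open>Turns a pathwise time integral into its weak form. The inner product and the time
  integral may be exchanged for almost every \<open>w\<close>, namely where the path is
  integrable.\<close>

lemma Fubini_inner:
  fixes A :: "real \<Rightarrow> 'w \<Rightarrow> 'e::euclidean_space"
  assumes U: "L2 M U" and A: "L2_dtP A" and J: "J \<in> sets borel"
  shows "integrable M (\<lambda>w. U w \<bullet> (LINT r|lT. indicator J r *\<^sub>R A r w))"
    and "(LINT w|M. U w \<bullet> (LINT r|lT. indicator J r *\<^sub>R A r w))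
      = (LINT r|lT. indicator J r * ip U (A r))"
    and "integrable lT (\<lambda>r. ip U (A r))"
proof -
  have JA: "L2 (dtP M T) (\<lambda>(t, w). indicator J t *\<^sub>R A t w)"
    by (rule L2_dtP_indicator[OF A J])
  note U' = L2_dtP_const[OF U]
  have int: "integrable (dtP M T) (\<lambda>(t, w). U w \<bullet> (indicator J t *\<^sub>R A t w))"
    using L2_inner[OF U' JA] by (simp add: case_prod_beta')
  have int': "integrable (dtP M T) (\<lambda>(t, w). U w \<bullet> A t w)"
    using L2_inner[OF U' A] by (simp add: case_prod_beta')
  have "integrable (dtP M T) (\<lambda>(t, w). indicator J t *\<^sub>R A t w)"
    by (rule finite_measure.L2_integrable[OF finite_dtP JA])
  from dtP_AE_integrable_snd[OF this]
  have ae: "AE w in M. (LINT r|lT. U w \<bullet> (indicator J r *\<^sub>R A r w)) = U w \<bullet> (LINT r|lT. indicator J r *\<^sub>R A r w)"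
    by eventually_elim (rule integral_inner_right)
  have m1: "(\<lambda>w. LINT r|lT. U w \<bullet> (indicator J r *\<^sub>R A r w)) \<in> borel_measurable M"
    using dtP_integrable_snd[OF int] by (rule borel_measurable_integrable)
  have m2: "(\<lambda>w. U w \<bullet> (LINT r|lT. indicator J r *\<^sub>R A r w)) \<in> borel_measurable M"
  proof -
    have "(\<lambda>w. LINT r|lT. indicator J r *\<^sub>R A r w) \<in> borel_measurable M"
      using dtP_integrable_snd[OF finite_measure.L2_integrable[OF finite_dtP JA]] by (rule borel_measurable_integrable)
    then show ?thesis using U by measurable
  qed
  show "integrable M (\<lambda>w. U w \<bullet> (LINT r|lT. indicator J r *\<^sub>R A r w))"
    using dtP_integrable_snd[OF int] integrable_cong_AE[OF m1 m2 ae] by simp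
  have "(LINT w|M. U w \<bullet> (LINT r|lT. indicator J r *\<^sub>R A r w)) = expectation (\<lambda>w. LINT r|lT. U w \<bullet> (indicator J r *\<^sub>R A r w))"
    by (rule integral_cong_AE[OF m1 m2 ae, symmetric])
  also have "\<dots> = (LINT r|lT. (LINT w|M. U w \<bullet> (indicator J r *\<^sub>R A r w)))"
    using dtP_integral_snd[OF int] dtP_integral_fst[OF int] by simp
  finally show "(LINT w|M. U w \<bullet> (LINT r|lT. indicator J r *\<^sub>R A r w))
      = (LINT r|lT. indicator J r * ip U (A r))" by simp
  show "integrable lT (\<lambda>r. ip U (A r))"
    by (rule dtP_integrable_fst[OF int'])
qed

lemma lT_integrable_indicator:
  fixes h :: "real \<Rightarrow> 'e::{banach, second_countable_topology}"
  assumes "integrable lT h" "J \<in> sets borel" shows "integrable lT (\<lambda>r. indicator J r *\<^sub>R h r)"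
proof -
  have "J \<inter> {0..T} \<in> sets lT" using assms(2) by (auto simp: sets_restrict_space)
  from integrable_mult_indicator[OF this assms(1)]
  have "integrable lT (\<lambda>r. indicator (J \<inter> {0..T}) r *\<^sub>R h r)" .
  then show ?thesis
    by (rule Bochner_Integration.integrable_cong[THEN iffD1, rotated 2]) (auto simp: space_restrict_space indicator_def)
qed

lemma lT_integral_interval_diff:
  fixes h :: "real \<Rightarrow> real"
  assumes h: "integrable lT h" and st: "0 \<le> s" "s \<le> t" "t \<le> T"
  shows "(LINT r|lT. indicator {0..t} r * h r) - (LINT r|lT. indicator {0..s} r * h r) = (LINT r|lT. indicator {s..t} r * h r)"
proof -
  have i: "integrable lT (\<lambda>r. indicator {a..b} r * h r)" for a b
    using lT_integrable_indicator[OF h, of "{a..b}"] by simp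
  have "(LINT r|lT. indicator {0..t} r * h r) - (LINT r|lT. indicator {0..s} r * h r)
      = (LINT r|lT. indicator {0..t} r * h r - indicator {0..s} r * h r)"
    using i by simp
  also have "\<dots> = (LINT r|lT. indicator {s..t} r * h r)"
  proof (rule integral_cong_AE)
    \<comment> \<open>The closed intervals \<open>{0..s}\<close> and \<open>{s..t}\<close> share the
      point \<open>s\<close>, so the indicators match only off it.\<close>
    have "AE r in lborel. r \<noteq> s" by (rule AE_lborel_singleton)
    then have "AE r in lT. r \<noteq> s" by (subst AE_restrict_space_iff) auto
    then show "AE r in lT. indicator {0..t} r * h r - indicator {0..s} r * h r = indicator {s..t} r * h r"
    proof (rule AE_mp, intro AE_I2 impI)
      fix r assume "r \<in> space lT" "r \<noteq> s"
      then show "indicator {0..t} r * h r - indicator {0..s} r * h r = indicator {s..t} r * h r"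
        using st by (auto simp: indicator_def space_restrict_space)
    qed
  qed (use i in \<open>auto intro: borel_measurable_integrable\<close>)
  finally show ?thesis .
qed

text \<open>Every path is differentiable, so the fundamental theorem holds for the gauge integral;
  this is the Lebesgue integral for almost every \<open>w\<close>, where the path of
  \<open>D\<close> is integrable by Fubini.\<close>

lemma backward_equation_integral:
  fixes a D :: "real \<Rightarrow> 'w \<Rightarrow> real^'k"
  assumes D: "L2_dtP D"
    and a: "\<And>w t. w \<in> space M \<Longrightarrow> t \<in> {0..T} \<Longrightarrow> ((\<lambda>s. a s w) has_vector_derivative (- D t w)) (at t within {0..T})"
    and aT: "L2 M (a T)" and at: "L2 M (a t)"
    and t: "t \<in> {0..T}" and U: "L2 M U"
  shows "ip U (a t) = ip U (a T)
      + (LINT r|lT. indicator {t..T} r * ip U (D r))"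
proof -
  have "AE w in M. integrable lT (\<lambda>r. D r w)"
    using dtP_AE_integrable_snd[OF finite_measure.L2_integrable[OF finite_dtP D]] by simp
  then have "AE w in M. a t w = a T w + (LINT r|lT. indicator {t..T} r *\<^sub>R D r w)"
  proof (rule AE_mp, intro AE_I2 impI)
    fix w assume w: "w \<in> space M" and i: "integrable lT (\<lambda>r. D r w)"
    have "set_integrable lborel {0..T} (\<lambda>r. D r w)"
      using i by (simp add: set_integrable_def integrable_restrict_space)
    then have i': "set_integrable lborel {t..T} (\<lambda>r. D r w)"
      by (rule set_integrable_subset) (use t in auto)
    have "((\<lambda>r. - D r w) has_integral (a T w - a t w)) {t..T}"
    proof (rule fundamental_theorem_of_calculus)
      fix x assume "x \<in> {t..T}"
      then show "((\<lambda>s. a s w) has_vector_derivative - D x w) (at x within {t..T})"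
        using t by (intro has_vector_derivative_within_subset[OF a[OF w]]) auto
    qed (use t in auto)
    from has_integral_neg[OF this] have "((\<lambda>r. D r w) has_integral (a t w - a T w)) {t..T}" by simp
    then have "integral {t..T} (\<lambda>r. D r w) = a t w - a T w" by (rule integral_unique)
    moreover have "(LINT r:{t..T}|lborel. D r w) = integral {t..T} (\<lambda>r. D r w)"
      by (rule set_borel_integral_eq_integral(2)[OF i'])
    moreover have "(LINT r|lT. indicator {t..T} r *\<^sub>R D r w) = (LINT r:{t..T}|lborel. D r w)"
      by (rule lT_integral_subset) (use t in auto)
    ultimately show "a t w = a T w + (LINT r|lT. indicator {t..T} r *\<^sub>R D r w)" by simp
  qed
  then have ae: "AE w in M. U w \<bullet> a t w = U w \<bullet> a T w + U w \<bullet> (LINT r|lT. indicator {t..T} r *\<^sub>R D r w)"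
    by eventually_elim (simp add: inner_add_right)
  note F = Fubini_inner[OF U D, of "{t..T}", simplified]
  have "ip U (a t) = (LINT w|M. U w \<bullet> a T w + U w \<bullet> (LINT r|lT. indicator {t..T} r *\<^sub>R D r w))"
    using L2_inner[OF U at] L2_inner[OF U aT] F(1) ae
    by (intro integral_cong_AE) (auto intro: borel_measurable_integrable)
  also have "\<dots> = ip U (a T) + (LINT w|M. U w \<bullet> (LINT r|lT. indicator {t..T} r *\<^sub>R D r w))"
    using L2_inner[OF U aT] F(1) by simp
  finally show ?thesis using F(2) by simp
qed

lemma X0_L2: "L2 M X0"
proof -
  have "integrable (law M X0) (\<lambda>x. (norm x)\<^sup>2)" using mf_space by (auto simp: mf_space_def P2_def)
  then have "integrable M (\<lambda>w. (norm (X0 w))\<^sup>2)"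
    using X0_measurable by (subst (asm) integrable_distr_eq) auto
  then show ?thesis using X0_measurable by (simp add: sq_integrable_def)
qed

lemma is_stateD:
  assumes "is_state M T W X0 b \<sigma> \<alpha> X"
  shows "continuous_process M T X" "\<And>t. t \<in> {0..T} \<Longrightarrow> X t \<in> borel_measurable (F t)"
    "\<exists>C. \<forall>t\<in>{0..T}. L2norm M (X t) \<le> C"
  using assms unfolding is_state_def continuous_process_def by auto

end

section \<open>Coefficients along the flow of a process\<close>

locale mean_field_problem = mean_field_space M T W X0 \<mu>0
  for M :: "'w measure" and T :: real and W :: "real \<Rightarrow> 'w \<Rightarrow> real^'m"
    and X0 :: "'w \<Rightarrow> real^'d" and \<mu>0 :: "(real^'d) measure" +
  fixes \<sigma> :: "real \<Rightarrow> real^'m^'d"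
    and b :: "('d, real^'d) coeff"
    and bx :: "('d, real^'d^'d) coeff"
    and bm :: "('d, real^'d \<Rightarrow> real^'d^'d) coeff"
    and f :: "('d, real) coeff"
    and fx :: "('d, real^'d) coeff"
    and fm :: "('d, real^'d \<Rightarrow> real^'d) coeff"
    and g :: "real^'d \<Rightarrow> (real^'d) measure \<Rightarrow> real"
    and gx :: "real^'d \<Rightarrow> (real^'d) measure \<Rightarrow> real^'d"
    and gm :: "real^'d \<Rightarrow> (real^'d) measure \<Rightarrow> real^'d \<Rightarrow> real^'d"
  assumes coefficients: "mf_coefficients M T \<sigma> b bx bm f fx fm g gx gm"
begin

lemma \<sigma>_continuous: "continuous_on {0..T} \<sigma>"
  using coefficients by (simp add: mf_coefficients_def)

lemma b_C1: "C1_vec M T b bx bm" and f_C1: "C1_scalar M T f fx fm"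
  and g_C1: "C1_scalar M T (\<lambda>_. g) (\<lambda>_. gx) (\<lambda>_. gm)"
  using coefficients by (simp_all add: mf_coefficients_def)

lemma b_bounded_derivs: obtains K where "0 \<le> K" "bounded_derivs T K K bx bm"
proof -
  obtain Lx Lm where L: "bounded_derivs T Lx Lm bx bm" using coefficients by (auto simp: mf_coefficients_def)
  have "bounded_derivs T (max 0 (max Lx Lm)) (max 0 (max Lx Lm)) bx bm"
    using L unfolding bounded_derivs_def by (meson max.cobounded1 max.cobounded2 order_trans)
  then show ?thesis using that[of "max 0 (max Lx Lm)"] by simp
qed

lemma b_lipschitz: obtains L where "0 \<le> L"
  "\<And>t x x' \<mu> \<mu>'. t \<in> {0..T} \<Longrightarrow> \<mu> \<in> P2 \<Longrightarrow> \<mu>' \<in> P2 \<Longrightarrow> 0 \<le> W2 \<mu> \<mu>' \<Longrightarrow> norm (b t x \<mu> - b t x' \<mu>') \<le> L * (norm (x - x') + W2 \<mu> \<mu>')"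
proof -
  obtain L where L: "\<And>t x x' \<mu> \<mu>'. t \<in> {0..T} \<Longrightarrow> \<mu> \<in> P2 \<Longrightarrow> \<mu>' \<in> P2 \<Longrightarrow> norm (b t x \<mu> - b t x' \<mu>') \<le> L * (norm (x - x') + W2 \<mu> \<mu>')"
    using coefficients unfolding mf_coefficients_def by blast
  show ?thesis
  proof (rule that[of "\<bar>L\<bar>"])
    fix t and x x' :: "real^'d" and \<mu> \<mu>' :: "(real^'d) measure" assume a: "t \<in> {0..T}" "\<mu> \<in> P2" "\<mu>' \<in> P2" "0 \<le> W2 \<mu> \<mu>'"
    have "L * (norm (x - x') + W2 \<mu> \<mu>') \<le> \<bar>L\<bar> * (norm (x - x') + W2 \<mu> \<mu>')"
      using a(4) by (intro mult_right_mono) auto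
    with L[OF a(1-3), of x x'] show "norm (b t x \<mu> - b t x' \<mu>') \<le> \<bar>L\<bar> * (norm (x - x') + W2 \<mu> \<mu>')" by linarith
  qed simp
qed

lemma W2_nonneg: "0 \<le> W2 (law M X) (law M Y)" if "L2 M X" "L2 M (Y :: 'w \<Rightarrow> real^'k)"
proof -
  have "couplings (law M X) (law M Y) \<noteq> {}"
    using joint_law_in_couplings[of X Y] that by (auto simp: sq_integrable_def)
  then show ?thesis unfolding W2_def by (intro real_sqrt_ge_zero cINF_greatest) auto
qed

lemma b_lipschitz_law: obtains L where "0 \<le> L"
  "\<And>t x x' X X'. t \<in> {0..T} \<Longrightarrow> L2 M X \<Longrightarrow> L2 M X' \<Longrightarrow>
     norm (b t x (law M X) - b t x' (law M X')) \<le> L * (norm (x - x') + L2norm M (\<lambda>w. X w - X' w))"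
proof -
  obtain L where L: "0 \<le> L" "\<And>t x x' \<mu> \<mu>'. t \<in> {0..T} \<Longrightarrow> \<mu> \<in> P2 \<Longrightarrow> \<mu>' \<in> P2 \<Longrightarrow> 0 \<le> W2 \<mu> \<mu>' \<Longrightarrow>
      norm (b t x \<mu> - b t x' \<mu>') \<le> L * (norm (x - x') + W2 \<mu> \<mu>')" by (rule b_lipschitz) blast
  show ?thesis
  proof (rule that[OF L(1)])
    fix t x x' and X X' :: "'w \<Rightarrow> real^'d" assume t: "t \<in> {0..T}" and s: "L2 M X" "L2 M X'"
    have "norm (b t x (law M X) - b t x' (law M X')) \<le> L * (norm (x - x') + W2 (law M X) (law M X'))"
      by (rule L(2)[OF t law_in_P2[OF s(1)] law_in_P2[OF s(2)] W2_nonneg[OF s]])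
    also have "\<dots> \<le> L * (norm (x - x') + L2norm M (\<lambda>w. X w - X' w))"
      using W2_law_le[OF s] L(1) by (intro mult_left_mono add_left_mono)
    finally show "norm (b t x (law M X) - b t x' (law M X')) \<le> L * (norm (x - x') + L2norm M (\<lambda>w. X w - X' w))" .
  qed
qed

lemma C1_vec_jointly_continuous:
  assumes "C1_vec M T h hx hm"
  shows "flow_regular M T hx" "flow_regular_pair M T hm"
  using assms by (auto simp: C1_vec_def intro: jointly_continuous_flow_regular)

lemma C1_scalar_jointly_continuous:
  assumes "C1_scalar M T h hx hm"
  shows "flow_regular M T hx" "flow_regular_pair M T hm"
  using assms by (auto simp: C1_scalar_def intro: jointly_continuous_flow_regular)

lemma set_borel_measurable_restrict:
  fixes h :: "real \<Rightarrow> 'e::real_normed_vector"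
  shows "set_borel_measurable lborel {0..T} h \<Longrightarrow> h \<in> borel_measurable (restrict_space borel {0..T})"
  by (simp add: set_borel_measurable_def borel_measurable_restrict_space_iff)

text \<open>Lift continuity comes from Lions differentiability of each component and continuity in
  \<open>x\<close> from differentiability; in time, measurability is what the assumptions
  provide.\<close>

lemma b_flow_regular: "flow_regular M T b"
  unfolding flow_regular_def
proof (intro conjI ballI allI)
  fix t x assume t: "t \<in> {0..T}"
  show "lift_continuous M (b t x)"
  proof (rule lift_continuous_vec)
    show "lift_continuous M (\<lambda>\<nu>. b t x \<nu> $ i)" for i
      using b_C1 t by (intro lions_lift_continuous[where D = "\<lambda>\<mu> y. bm t x \<mu> y $ i"])
        (auto simp: C1_vec_def has_lions_derivative_vec_def)
  qed
next
  fix x and \<mu> :: "(real^'d) measure" assume "\<mu> \<in> P2"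
  then show "(\<lambda>t. b t x \<mu>) \<in> borel_measurable (restrict_space borel {0..T})"
    using coefficients by (intro set_borel_measurable_restrict) (simp add: mf_coefficients_def)
next
  fix t and \<mu> :: "(real^'d) measure" assume "t \<in> {0..T}" "\<mu> \<in> P2"
  then have "\<And>x. ((\<lambda>x. b t x \<mu>) has_derivative (\<lambda>v. bx t x \<mu> *v v)) (at x)"
    using b_C1 by (simp add: C1_vec_def)
  then show "continuous_on UNIV (\<lambda>x. b t x \<mu>)"
    by (intro continuous_at_imp_continuous_on ballI) (rule has_derivative_continuous)
qed

lemma C1_scalar_flow_regular:
  fixes h :: "('d, real) coeff"
  assumes h: "C1_scalar M T h hx hm" and m: "\<And>x \<mu>. \<mu> \<in> P2 \<Longrightarrow> (\<lambda>t. h t x \<mu>) \<in> borel_measurable (restrict_space borel {0..T})"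
  shows "flow_regular M T h"
  unfolding flow_regular_def
proof (intro conjI ballI allI m)
  fix t x assume t: "t \<in> {0..T}"
  show "lift_continuous M (h t x)"
    using h t by (intro lions_lift_continuous[where D = "hm t x"]) (auto simp: C1_scalar_def)
next
  fix t and \<mu> :: "(real^'d) measure" assume "t \<in> {0..T}" "\<mu> \<in> P2"
  then have "\<And>x. GDERIV (\<lambda>x. h t x \<mu>) x :> hx t x \<mu>" using h by (simp add: C1_scalar_def)
  then show "continuous_on UNIV (\<lambda>x. h t x \<mu>)"
    by (intro continuous_at_imp_continuous_on ballI) (auto simp: gderiv_def dest: has_derivative_continuous)
qed auto

lemma f_flow_regular: "flow_regular M T f"
  using coefficients by (intro C1_scalar_flow_regular[OF f_C1] set_borel_measurable_restrict) (simp add: mf_coefficients_def)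

lemma g_flow_regular: "flow_regular M T (\<lambda>_. g)"
  by (rule C1_scalar_flow_regular[OF g_C1]) simp

lemma process_L2:
  assumes X: "continuous_process M T (X :: real \<Rightarrow> 'w \<Rightarrow> real^'k)" and C: "\<And>t. t \<in> {0..T} \<Longrightarrow> L2norm M (X t) \<le> C"
  shows "L2_dtP X"
  by (rule process_L2_dtP[OF continuous_process_dtP[OF X] _ C]) (use X in \<open>auto simp: continuous_process_def\<close>)

text \<open>At a fixed point and measure the drift is square-integrable in time; the Lipschitz bound
  compares its value along \<open>X\<close> with the value \<open>c t\<close> at the origin and the
  Dirac measure there.\<close>

lemma b_L2:
  assumes X: "continuous_process M T X" and C: "\<And>t. t \<in> {0..T} \<Longrightarrow> L2norm M (X t) \<le> C"
  shows "L2 (dtP M T) (\<lambda>(t, w). b t (X t w) (law M (X t)))"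
proof -
  obtain L where L: "0 \<le> L" "\<And>t x x' X X'. t \<in> {0..T} \<Longrightarrow> L2 M X \<Longrightarrow> L2 M X' \<Longrightarrow>
     norm (b t x (law M X) - b t x' (law M X')) \<le> L * (norm (x - x') + L2norm M (\<lambda>w. X w - X' w))"
    by (rule b_lipschitz_law) blast
  have Xs: "L2 M (X t)" if "t \<in> {0..T}" for t using X that by (simp add: continuous_process_def)
  define c where "c t = norm (b t 0 (law M (\<lambda>_. 0)))" for t
  have P0: "law M (\<lambda>_. 0 :: real^'d) \<in> P2" by (rule law_in_P2) simp
  have cm: "c \<in> borel_measurable (restrict_space borel {0..T})"
  proof -
    have "(\<lambda>t. b t 0 (law M (\<lambda>_. 0))) \<in> borel_measurable (restrict_space borel {0..T})"
      using b_flow_regular P0 by (simp add: flow_regular_def del: distr_const)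
    then show ?thesis unfolding c_def[abs_def] by measurable
  qed
  have "set_integrable lborel {0..T} (\<lambda>t. (c t)\<^sup>2)"
    using coefficients P0 by (simp add: mf_coefficients_def c_def del: distr_const)
  then have "integrable lT (\<lambda>t. (c t)\<^sup>2)" by (simp add: set_integrable_def integrable_restrict_space)
  then have c_sq: "L2 (dtP M T) (\<lambda>(t, w). c t)"
    using cm by (intro L2_dtP_time) simp_all
  have X_sq: "L2 (dtP M T) (\<lambda>(t, w). norm (X t w))"
    by (rule L2_bound[OF process_L2[OF X C], of _ 1])
      (use continuous_process_dtP[OF X] in \<open>auto simp: case_prod_beta'\<close>)
  have "L2 (dtP M T) (\<lambda>z. (case z of (t, w) \<Rightarrow> c t) + (L *\<^sub>R (case z of (t, w) \<Rightarrow> norm (X t w)) + L * C))"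
    by (intro L2_add L2_scaleR c_sq X_sq finite_measure.L2_const[OF finite_dtP])
  then show ?thesis
  proof (rule L2_bound[of _ _ _ 1])
    show "(\<lambda>(t, w). b t (X t w) (law M (X t))) \<in> borel_measurable (dtP M T)"
      by (rule flow_dtP[OF b_flow_regular X continuous_process_dtP[OF X]])
    show "AE z in dtP M T. norm (case z of (t, w) \<Rightarrow> b t (X t w) (law M (X t)))
        \<le> 1 * norm ((case z of (t, w) \<Rightarrow> c t) + (L *\<^sub>R (case z of (t, w) \<Rightarrow> norm (X t w)) + L * C))"
    proof (intro AE_I2)
      fix z assume "z \<in> space (dtP M T)"
      then obtain t w where z: "z = (t, w)" "t \<in> {0..T}" by (auto simp: space_dtP)
      have "norm (b t (X t w) (law M (X t)) - b t 0 (law M (\<lambda>_. 0))) \<le> L * (norm (X t w - 0) + L2norm M (\<lambda>w. X t w - 0))"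
        by (rule L(2)[OF z(2) Xs[OF z(2)]]) simp
      also have "\<dots> \<le> L * (norm (X t w) + C)" using C[OF z(2)] L(1) by (intro mult_left_mono) auto
      finally have "norm (b t (X t w) (law M (X t))) \<le> c t + L * (norm (X t w) + C)"
        using norm_triangle_sub[of "b t (X t w) (law M (X t))" "b t 0 (law M (\<lambda>_. 0))"] by (simp add: c_def del: distr_const)
      then show "norm (case z of (t, w) \<Rightarrow> b t (X t w) (law M (X t)))
        \<le> 1 * norm ((case z of (t, w) \<Rightarrow> c t) + (L *\<^sub>R (case z of (t, w) \<Rightarrow> norm (X t w)) + L * C))"
        by (simp add: z distrib_left)
    qed
  qed
qed

lemma \<sigma>_mult_L2:
  assumes \<alpha>: "L2_dtP \<alpha>"
  shows "L2 (dtP M T) (\<lambda>(t, w). \<sigma> t *v (\<alpha> t w :: real^'m))"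
proof -
  obtain C where C: "\<And>t. t \<in> {0..T} \<Longrightarrow> norm (\<sigma> t) \<le> C" "0 \<le> C" by (rule \<sigma>_bounded[OF \<sigma>_continuous]) blast
  have "(\<lambda>(t, w). \<sigma> t) \<in> borel_measurable (dtP M T)" by (rule measurable_dtP_time[OF \<sigma>_measurable[OF \<sigma>_continuous]])
  from L2_matrix_mult(1)[OF \<alpha> this, of C] C(1) show ?thesis by (auto simp: case_prod_beta' space_dtP)
qed

lemma \<sigma>_transpose_mult_L2:
  assumes a: "L2_dtP a"
  shows "L2 (dtP M T) (\<lambda>(t, w). transpose (\<sigma> t) *v (a t w :: real^'d))"
proof -
  obtain C where C: "\<And>t. t \<in> {0..T} \<Longrightarrow> norm (\<sigma> t) \<le> C" "0 \<le> C" by (rule \<sigma>_bounded[OF \<sigma>_continuous]) blast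
  have "(\<lambda>(t, w). \<sigma> t) \<in> borel_measurable (dtP M T)" by (rule measurable_dtP_time[OF \<sigma>_measurable[OF \<sigma>_continuous]])
  then have "(\<lambda>z. transpose (case z of (t, w) \<Rightarrow> \<sigma> t)) \<in> borel_measurable (dtP M T)" by measurable
  from L2_matrix_mult(1)[OF a this, of C] C(1) show ?thesis by (auto simp: case_prod_beta' space_dtP)
qed

lemma drift_L2:
  assumes X: "is_state M T W X0 b \<sigma> \<alpha> X" and \<alpha>: "L2_dtP \<alpha>"
  shows "L2 (dtP M T) (\<lambda>(t, w). b t (X t w) (law M (X t)) + \<sigma> t *v \<alpha> t w)"
proof -
  obtain C where "\<And>t. t \<in> {0..T} \<Longrightarrow> L2norm M (X t) \<le> C" using is_stateD(3)[OF X] by blast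
  from L2_add[OF b_L2[OF is_stateD(1)[OF X] this] \<sigma>_mult_L2[OF \<alpha>]]
  show ?thesis by (simp add: case_prod_beta')
qed

section \<open>Increments and differences of states\<close>

lemma state_integral_form:
  assumes X: "is_state M T W X0 b \<sigma> \<alpha> X" and t: "t \<in> {0..T}"
  obtains I where "has_ito_integral M F W 0 t (\<lambda>r _. \<sigma> r) I"
    "AE w in M. X t w = X0 w + (LINT r|lT. indicator {0..t} r *\<^sub>R (b r (X r w) (law M (X r)) + \<sigma> r *v \<alpha> r w)) + I w"
proof -
  have "{0..t} \<subseteq> {0..T}" using t by auto
  note sub = lT_integral_subset[OF this]
  have "\<exists>I. has_ito_integral M F W 0 t (\<lambda>r _. \<sigma> r) I \<and>
        (AE w in M. X t w = X0 w + (LINT s:{0..t}|lborel. b s (X s w) (law M (X s)) + \<sigma> s *v \<alpha> s w) + I w)"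
    using X t unfolding is_state_def by blast
  then obtain I where "has_ito_integral M F W 0 t (\<lambda>r _. \<sigma> r) I"
    "AE w in M. X t w = X0 w + (LINT s:{0..t}|lborel. b s (X s w) (law M (X s)) + \<sigma> s *v \<alpha> s w) + I w"
    by blast
  then show ?thesis by (intro that) (simp_all add: sub)
qed

text \<open>Testing with a variable orthogonal to the Brownian future of \<open>s\<close> removes
  the noise between \<open>s\<close> and \<open>t\<close> and leaves an ordinary integral
  equation.\<close>

lemma state_increment:
  assumes X: "is_state M T W X0 b \<sigma> \<alpha> X" and \<alpha>: "L2_dtP \<alpha>"
    and st: "0 \<le> s" "s \<le> t" "t \<le> T" and U: "L2 M U"
      "\<And>V. V \<in> borel_measurable (increment_sigma M W s {s..T}) \<Longrightarrow> L2 M V \<Longrightarrow> ip U V = 0"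
  shows "ip U (X t) = ip U (X s)
    + (LINT r|lT. indicator {s..t} r * (LINT w|M. U w \<bullet> (b r (X r w) (law M (X r)) + \<sigma> r *v \<alpha> r w)))"
proof -
  define \<kappa> where "\<kappa> r w = b r (X r w) (law M (X r)) + \<sigma> r *v \<alpha> r w" for r w
  have \<kappa>: "L2_dtP \<kappa>" unfolding \<kappa>_def by (rule drift_L2[OF X \<alpha>])
  obtain I where I: "has_ito_integral M F W 0 s (\<lambda>r _. \<sigma> r) I"
    "AE w in M. X s w = X0 w + (LINT r|lT. indicator {0..s} r *\<^sub>R \<kappa> r w) + I w"
    unfolding \<kappa>_def by (rule state_integral_form[OF X, of s]) (use st in auto)
  obtain I' where I': "has_ito_integral M F W 0 t (\<lambda>r _. \<sigma> r) I'"
    "AE w in M. X t w = X0 w + (LINT r|lT. indicator {0..t} r *\<^sub>R \<kappa> r w) + I' w"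
    unfolding \<kappa>_def by (rule state_integral_form[OF X, of t]) (use st in auto)
  have Isq: "L2 M I" "L2 M I'"
    using has_ito_integral_L2[OF I(1)] has_ito_integral_L2[OF I'(1)] st by auto
  have Xs: "L2 M (X s)" "L2 M (X t)"
    using is_stateD(1)[OF X] st by (auto simp: continuous_process_def)
  note Fs = Fubini_inner[OF U(1) \<kappa>, of "{0..s}", simplified]
  note Ft = Fubini_inner[OF U(1) \<kappa>, of "{0..t}", simplified]
  have e: "ip U Y = (LINT w|M. U w \<bullet> X0 w)
      + (LINT w|M. U w \<bullet> (LINT r|lT. indicator {0..q} r *\<^sub>R \<kappa> r w)) + ip U J"
    if Y: "L2 M Y" and J: "L2 M J"
      and ae: "AE w in M. Y w = X0 w + (LINT r|lT. indicator {0..q} r *\<^sub>R \<kappa> r w) + J w" for Y J q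
  proof -
    note Fq = Fubini_inner(1)[OF U(1) \<kappa>, of "{0..q}", simplified]
    have "ip U Y = (LINT w|M. U w \<bullet> X0 w
      + U w \<bullet> (LINT r|lT. indicator {0..q} r *\<^sub>R \<kappa> r w) + U w \<bullet> J w)"
    proof (rule integral_cong_AE)
      show "AE w in M. U w \<bullet> Y w = U w \<bullet> X0 w + U w \<bullet> (LINT r|lT. indicator {0..q} r *\<^sub>R \<kappa> r w) + U w \<bullet> J w"
        using ae by eventually_elim (simp add: inner_add_right)
    qed (use Fq L2_inner[OF U(1) Y] L2_inner[OF U(1) X0_L2] L2_inner[OF U(1) J]
      in \<open>auto intro!: borel_measurable_integrable\<close>)
    then show ?thesis
      using Fq L2_inner[OF U(1) X0_L2] L2_inner[OF U(1) J] by simp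
  qed
  have "(LINT w|M. U w \<bullet> (I' w - I w)) = 0"
    by (rule ito_increment_orthogonal[OF \<sigma>_continuous I(1) I'(1) st U])
  then have "ip U I' = ip U I"
    using L2_inner[OF U(1) Isq(1)] L2_inner[OF U(1) Isq(2)] by (simp add: inner_diff_right)
  then show ?thesis
    using e[OF Xs(1) Isq(1) I(2)] e[OF Xs(2) Isq(2) I'(2)] Fs(2) Ft(2) lT_integral_interval_diff[OF Fs(3) st]
    unfolding \<kappa>_def by linarith
qed

text \<open>The initial value and the noise are common to both controls, so the difference of the
  states is an ordinary time integral; this is what makes integration by parts against the adjoint
  elementary.\<close>

lemma state_difference:
  assumes X: "is_state M T W X0 b \<sigma> \<alpha> X" and \<alpha>: "L2_dtP \<alpha>"
    and X': "is_state M T W X0 b \<sigma> \<beta> X'" and \<beta>: "L2_dtP \<beta>" and t: "t \<in> {0..T}"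
  shows "AE w in M. X' t w - X t w = (LINT r|lT. indicator {0..t} r *\<^sub>R
    ((b r (X' r w) (law M (X' r)) + \<sigma> r *v \<beta> r w) - (b r (X r w) (law M (X r)) + \<sigma> r *v \<alpha> r w)))"
proof -
  have ae: "AE w in M. integrable lT (\<lambda>r. b r (Y r w) (law M (Y r)) + \<sigma> r *v \<gamma> r w)"
    if Y: "is_state M T W X0 b \<sigma> \<gamma> Y" and \<gamma>: "L2_dtP \<gamma>" for Y \<gamma>
    using dtP_AE_integrable_snd[OF finite_measure.L2_integrable[OF finite_dtP drift_L2[OF Y \<gamma>]]] .
  obtain I where I: "has_ito_integral M F W 0 t (\<lambda>r _. \<sigma> r) I"
    "AE w in M. X t w = X0 w + (LINT r|lT. indicator {0..t} r *\<^sub>R (b r (X r w) (law M (X r)) + \<sigma> r *v \<alpha> r w)) + I w"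
    by (rule state_integral_form[OF X t])
  obtain I' where I': "has_ito_integral M F W 0 t (\<lambda>r _. \<sigma> r) I'"
    "AE w in M. X' t w = X0 w + (LINT r|lT. indicator {0..t} r *\<^sub>R (b r (X' r w) (law M (X' r)) + \<sigma> r *v \<beta> r w)) + I' w"
    by (rule state_integral_form[OF X' t])
  show ?thesis
    using I(2) I'(2) ito_unique[OF \<sigma>_continuous I(1) I'(1) t] ae[OF X \<alpha>] ae[OF X' \<beta>]
  proof eventually_elim
    case (elim w)
    have "(LINT r|lT. indicator {0..t} r *\<^sub>R ((b r (X' r w) (law M (X' r)) + \<sigma> r *v \<beta> r w) - (b r (X r w) (law M (X r)) + \<sigma> r *v \<alpha> r w)))
      = (LINT r|lT. indicator {0..t} r *\<^sub>R (b r (X' r w) (law M (X' r)) + \<sigma> r *v \<beta> r w))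
        - (LINT r|lT. indicator {0..t} r *\<^sub>R (b r (X r w) (law M (X r)) + \<sigma> r *v \<alpha> r w))"
      unfolding scaleR_diff_right
      by (rule Bochner_Integration.integral_diff) (auto intro!: lT_integrable_indicator elim)
    with elim show ?case by simp
  qed
qed

end

section \<open>The adjoint drift\<close>

lemma jointly_continuous_in_time:
  assumes h: "jointly_continuous T h" and \<mu>: "\<mu> \<in> P2"
  shows "continuous_on {0..T} (\<lambda>t. h t p \<mu>)"
  unfolding continuous_on_iff
proof (intro ballI allI impI)
  fix t and e :: real assume t: "t \<in> {0..T}" and e: "e > 0"
  obtain \<delta> where "\<delta> > 0" "\<And>t' p' \<mu>'. t' \<in> {0..T} \<Longrightarrow> \<mu>' \<in> P2 \<Longrightarrow> dist t t' < \<delta> \<Longrightarrow>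
      dist p p' < \<delta> \<Longrightarrow> W2 \<mu> \<mu>' < \<delta> \<Longrightarrow> dist (h t p \<mu>) (h t' p' \<mu>') < e"
    using jointly_continuousE[OF h t \<mu> e] by blast
  then show "\<exists>d>0. \<forall>t'\<in>{0..T}. dist t' t < d \<longrightarrow> dist (h t' p \<mu>) (h t p \<mu>) < e"
    using \<mu> W2_self[OF \<mu>] by (intro exI[of _ \<delta>]) (auto simp: dist_commute)
qed

text \<open>One form for several equations: \<open>(A, B)\<close> is \<open>(bx, bm)\<close> for the
  lean adjoint and for \<open>Y\<close>, \<open>(btx, btm)\<close> for the basic adjoint, and
  \<open>(ux, um)\<close> for the source of their difference, where \<open>y\<close> takes values in
  the control space.\<close>

definition linear_drift ::
    "'w measure \<Rightarrow> (real \<Rightarrow> 'w \<Rightarrow> real^'d) \<Rightarrow> (real \<Rightarrow> real^'d \<Rightarrow> (real^'d) measure \<Rightarrow> real^'d^'k) \<Rightarrow>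
     (real \<Rightarrow> real^'d \<Rightarrow> (real^'d) measure \<Rightarrow> real^'d \<Rightarrow> real^'d^'k) \<Rightarrow> (real \<Rightarrow> 'w \<Rightarrow> real^'k) \<Rightarrow> real \<Rightarrow> 'w \<Rightarrow> real^'d" where
  "linear_drift M X A B y t w = transpose (A t (X t w) (law M (X t))) *v y t w
     + (LINT w'|M. transpose (B t (X t w') (law M (X t)) (X t w)) *v y t w')"

text \<open>With the time-independent coefficients \<open>gx\<close> and \<open>gm\<close> it is
  also the terminal value of the adjoint equations.\<close>

definition source_drift ::
    "'w measure \<Rightarrow> (real \<Rightarrow> 'w \<Rightarrow> real^'d) \<Rightarrow> (real \<Rightarrow> real^'d \<Rightarrow> (real^'d) measure \<Rightarrow> real^'d) \<Rightarrow>
     (real \<Rightarrow> real^'d \<Rightarrow> (real^'d) measure \<Rightarrow> real^'d \<Rightarrow> real^'d) \<Rightarrow> real \<Rightarrow> 'w \<Rightarrow> real^'d" where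
  "source_drift M X k l t w = k t (X t w) (law M (X t)) + (LINT w'|M. l t (X t w') (law M (X t)) (X t w))"

context mean_field_space
begin

lemma flow_pair_section:
  assumes B: "flow_regular_pair M T B" and X: "continuous_process M T X" and t: "t \<in> {0..T}"
    and "Y \<in> borel_measurable N" "Z \<in> borel_measurable N"
  shows "(\<lambda>z. B t (Y z) (law M (X t)) (Z z)) \<in> borel_measurable N"
proof -
  have "(\<lambda>z. (Y z, Z z)) \<in> borel_measurable N" using assms(4,5) by measurable
  from flow_section[OF B X t this] show ?thesis by simp
qed

lemma flow_pair_measurable:
  assumes B: "flow_regular_pair M T B" and X: "continuous_process M T X"
    and Xm: "measurable_dtP X"
  shows "(\<lambda>(z, w'). B (fst z) (X (fst z) w') (law M (X (fst z))) (X (fst z) (snd z))) \<in> borel_measurable (dtP M T \<Otimes>\<^sub>M M)"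
proof -
  have t: "(\<lambda>v. fst (fst v)) \<in> measurable (dtP M T \<Otimes>\<^sub>M M) (restrict_space borel {0..T})"
    by (rule measurable_compose[OF measurable_fst fst_dtP])
  have sm: "(\<lambda>v. snd (fst v)) \<in> measurable (dtP M T \<Otimes>\<^sub>M M) M"
    by (rule measurable_compose[OF measurable_fst snd_dtP])
  have "(\<lambda>v. (X (fst (fst v)) (snd v), X (fst (fst v)) (snd (fst v)))) \<in> borel_measurable (dtP M T \<Otimes>\<^sub>M M)"
    using dtP_compose[OF Xm t measurable_snd] dtP_compose[OF Xm t sm] by (rule borel_measurable_Pair)
  from flow_comp_measurable[OF B X t this] show ?thesis by (simp add: case_prod_beta')
qed

lemma linear_drift_measurable:
  assumes X: "continuous_process M T X"
    and A: "flow_regular M T A" and B: "flow_regular_pair M T B"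
    and y: "measurable_dtP y"
  shows "(\<lambda>(t, w). linear_drift M X A B y t w) \<in> borel_measurable (dtP M T)"
proof -
  note Xm = continuous_process_dtP[OF X]
  note Am = flow_dtP[OF A X Xm]
  have t: "(\<lambda>v. fst (fst v)) \<in> measurable (dtP M T \<Otimes>\<^sub>M M) (restrict_space borel {0..T})"
    by (rule measurable_compose[OF measurable_fst fst_dtP])
  have ym: "(\<lambda>v. y (fst (fst v)) (snd v)) \<in> borel_measurable (dtP M T \<Otimes>\<^sub>M M)"
    by (rule dtP_compose[OF y t measurable_snd])
  have "(\<lambda>v. transpose (B (fst (fst v)) (X (fst (fst v)) (snd v)) (law M (X (fst (fst v)))) (X (fst (fst v)) (snd (fst v)))) *v y (fst (fst v)) (snd v))
      \<in> borel_measurable (dtP M T \<Otimes>\<^sub>M M)"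
    using flow_pair_measurable[OF B X Xm] ym
    by (intro matrix_vector_mult_measurable transpose_measurable) (simp_all add: case_prod_beta')
  then have "(\<lambda>(t, w). LINT w'|M. transpose (B t (X t w') (law M (X t)) (X t w)) *v y t w') \<in> borel_measurable (dtP M T)"
    by (intro dtP_integral_measurable) (simp add: case_prod_beta')
  moreover have "(\<lambda>z. transpose (A (fst z) (X (fst z) (snd z)) (law M (X (fst z)))) *v y (fst z) (snd z)) \<in> borel_measurable (dtP M T)"
    using Am y by (intro matrix_vector_mult_measurable transpose_measurable) (simp_all add: case_prod_beta')
  ultimately show ?thesis
    unfolding linear_drift_def by (simp add: case_prod_beta')
qed

lemma source_drift_measurable:
  assumes X: "continuous_process M T X"
    and k: "flow_regular M T k" and l: "flow_regular_pair M T l"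
  shows "(\<lambda>(t, w). source_drift M X k l t w) \<in> borel_measurable (dtP M T)"
proof -
  note Xm = continuous_process_dtP[OF X]
  have "(\<lambda>(t, w). LINT w'|M. l t (X t w') (law M (X t)) (X t w)) \<in> borel_measurable (dtP M T)"
    using flow_pair_measurable[OF l X Xm] by (rule dtP_integral_measurable)
  with flow_dtP[OF k X Xm] show ?thesis
    unfolding source_drift_def by (simp add: case_prod_beta')
qed

text \<open>The average over the copy is a Borel function of \<open>Z w\<close>. It is measurable
  for every sigma-algebra that makes \<open>Z\<close> measurable, whatever information
  \<open>y\<close> carries.\<close>

lemma copy_average_measurable:
  assumes X: "continuous_process M T X" and t: "t \<in> {0..T}" and B: "flow_regular_pair M T B"
    and y: "y \<in> borel_measurable M" and Z: "Z \<in> borel_measurable N"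
  shows "(\<lambda>w. LINT w'|M. transpose (B t (X t w') (law M (X t)) (Z w)) *v (y w' :: real^'k)) \<in> borel_measurable N"
proof -
  have [measurable]: "X t \<in> borel_measurable M" using X t by (auto simp: continuous_process_def sq_integrable_def)
  note [measurable] = y
  have "(\<lambda>v. B t (X t (snd v)) (law M (X t)) (fst v)) \<in> borel_measurable (borel \<Otimes>\<^sub>M M)"
    by (rule flow_pair_section[OF B X t]) measurable
  then have "(\<lambda>v. transpose (B t (X t (snd v)) (law M (X t)) (fst v)) *v y (snd v)) \<in> borel_measurable (borel \<Otimes>\<^sub>M M)"
    by measurable
  then have "(\<lambda>x. LINT w'|M. transpose (B t (X t w') (law M (X t)) x) *v y w') \<in> borel_measurable borel"
    by (intro borel_measurable_lebesgue_integral) (simp add: case_prod_beta')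
  from measurable_compose[OF Z this] show ?thesis .
qed

lemma copy_average_measurable':
  assumes X: "continuous_process M T X" and t: "t \<in> {0..T}" and l: "flow_regular_pair M T l"
    and Z: "Z \<in> borel_measurable N"
  shows "(\<lambda>w. LINT w'|M. (l t (X t w') (law M (X t)) (Z w) :: real^'k)) \<in> borel_measurable N"
proof -
  have [measurable]: "X t \<in> borel_measurable M" using X t by (auto simp: continuous_process_def sq_integrable_def)
  have "(\<lambda>v. l t (X t (snd v)) (law M (X t)) (fst v)) \<in> borel_measurable (borel \<Otimes>\<^sub>M M)"
    by (rule flow_pair_section[OF l X t]) measurable
  then have "(\<lambda>x. LINT w'|M. l t (X t w') (law M (X t)) x) \<in> borel_measurable borel"
    by (intro borel_measurable_lebesgue_integral) (simp add: case_prod_beta')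
  from measurable_compose[OF Z this] show ?thesis .
qed

text \<open>The local term is bounded pointwise by \<open>K\<close> times the norm of
  \<open>y\<close>, the averaged term uniformly in \<open>w\<close> because the L1 norm is at most
  the L2 norm; each contributes \<open>K\<close>.\<close>

lemma linear_drift_bounds:
  fixes y :: "real \<Rightarrow> 'w \<Rightarrow> real^'k"
  assumes X: "continuous_process M T X" and t: "t \<in> {0..T}"
    and A: "flow_regular M T A" and B: "flow_regular_pair M T B"
    and bd: "bounded_derivs T K K A B" and K: "0 \<le> K" and y: "L2 M (y t)"
  shows "L2 M (\<lambda>w. transpose (A t (X t w) (law M (X t))) *v y t w)"
    and "L2norm M (\<lambda>w. transpose (A t (X t w) (law M (X t))) *v y t w) \<le> K * L2norm M (y t)"
    and "L2 M (\<lambda>w. LINT w'|M. transpose (B t (X t w') (law M (X t)) (X t w)) *v y t w')"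
    and "L2norm M (\<lambda>w. LINT w'|M. transpose (B t (X t w') (law M (X t)) (X t w)) *v y t w') \<le> K * L2norm M (y t)"
    and "L2 M (linear_drift M X A B y t)" and "L2norm M (linear_drift M X A B y t) \<le> 2 * K * L2norm M (y t)"
proof -
  have Xs: "L2 M (X t)" using X t by (auto simp: continuous_process_def)
  have Xm: "X t \<in> borel_measurable M" using Xs by measurable
  have P: "law M (X t) \<in> P2" by (rule law_in_P2[OF Xs])
  have Am: "(\<lambda>w. transpose (A t (X t w) (law M (X t)))) \<in> borel_measurable M"
    by (intro transpose_measurable flow_section[OF A X t Xm])
  have Ab: "norm (transpose (A t (X t w) (law M (X t)))) \<le> K" for w
    using bd t P by (simp add: bounded_derivs_def)
  show 1: "L2 M (\<lambda>w. transpose (A t (X t w) (law M (X t))) *v y t w)"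
    and 2: "L2norm M (\<lambda>w. transpose (A t (X t w) (law M (X t))) *v y t w) \<le> K * L2norm M (y t)"
    using L2_matrix_mult[OF y Am Ab] K by auto
  have ym: "y t \<in> borel_measurable M" using y by measurable
  note m = copy_average_measurable[OF X t B ym Xm]
  have b: "norm (LINT w'|M. transpose (B t (X t w') (law M (X t)) (X t w)) *v y t w') \<le> K * L2norm M (y t)" for w
  proof -
    have "norm (LINT w'|M. transpose (B t (X t w') (law M (X t)) (X t w)) *v y t w') \<le> (LINT w'|M. K * norm (y t w'))"
    proof (rule norm_integral_le)
      show "integrable M (\<lambda>w'. K * norm (y t w'))" using L2_integrable[OF y] by simp
      show "norm (transpose (B t (X t w') (law M (X t)) (X t w)) *v y t w') \<le> K * norm (y t w')" for w'
        using bd t P by (intro order_trans[OF norm_matrix_vector_mult_le] mult_right_mono) (auto simp: bounded_derivs_def)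
    qed
    also have "\<dots> \<le> K * L2norm M (y t)" using integral_norm_le_L2norm[OF y] K by (simp add: mult_left_mono)
    finally show ?thesis .
  qed
  show 3: "L2 M (\<lambda>w. LINT w'|M. transpose (B t (X t w') (law M (X t)) (X t w)) *v y t w')"
    by (rule L2_bounded[OF m b])
  show 4: "L2norm M (\<lambda>w. LINT w'|M. transpose (B t (X t w') (law M (X t)) (X t w)) *v y t w') \<le> K * L2norm M (y t)"
    using L2norm_mono[OF L2_const[of "1::real"] m, of "K * L2norm M (y t)"] b K by (simp add: L2norm_const)
  show "L2 M (linear_drift M X A B y t)"
    unfolding linear_drift_def[abs_def] by (rule L2_add[OF 1 3])
  have "L2norm M (linear_drift M X A B y t) \<le> K * L2norm M (y t) + K * L2norm M (y t)"
    unfolding linear_drift_def[abs_def] by (rule order_trans[OF L2norm_triangle[OF 1 3] add_mono[OF 2 4]])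
  then show "L2norm M (linear_drift M X A B y t) \<le> 2 * K * L2norm M (y t)" by simp
qed

lemma source_drift_bounds:
  fixes X :: "real \<Rightarrow> 'w \<Rightarrow> real^'k"
  assumes X: "continuous_process M T X" and t: "t \<in> {0..T}"
    and k: "flow_regular M T k" and l: "flow_regular_pair M T l"
    and C: "0 \<le> C" "\<And>x. norm (k t x (law M (X t))) \<le> C * (1 + norm x + sqrt (moment2 (law M (X t))))"
      "\<And>x y. norm (l t x (law M (X t)) y) \<le> C * (1 + norm x + sqrt (moment2 (law M (X t))) + norm y)"
  shows "L2 M (source_drift M X k l t)"
    and "L2norm M (source_drift M X k l t) \<le> C * (2 + 5 * L2norm M (X t))"
    and "\<And>w. integrable M (\<lambda>w'. l t (X t w') (law M (X t)) (X t w))"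
proof -
  have Xs: "L2 M (X t)" using X t by (auto simp: continuous_process_def)
  have Xm: "X t \<in> borel_measurable M" using Xs by measurable
  define n where "n = L2norm M (X t)"
  have n0: "0 \<le> n" by (simp add: n_def)
  have m2: "sqrt (moment2 (law M (X t))) = n" using moment2_law[OF Xm] n0 by (simp add: n_def)
  have nX: "L2 M (\<lambda>w. norm (X t w))"
    by (rule L2_bound[OF Xs, of _ 1]) (use Xm in auto)
  have nXn: "L2norm M (\<lambda>w. norm (X t w)) = n" by (simp add: n_def L2norm_def)
  have iX: "integrable M (\<lambda>w'. C * (1 + norm (X t w') + n + norm x))" for x :: "real^'k"
    using L2_integrable[OF nX] by simp
  show li: "integrable M (\<lambda>w'. l t (X t w') (law M (X t)) (X t w))" for w
  proof (rule Bochner_Integration.integrable_bound[OF iX[of "X t w"]])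
    show "(\<lambda>w'. l t (X t w') (law M (X t)) (X t w)) \<in> borel_measurable M"
      by (rule flow_pair_section[OF l X t Xm]) simp
    show "AE w' in M. norm (l t (X t w') (law M (X t)) (X t w)) \<le> norm (C * (1 + norm (X t w') + n + norm (X t w)))"
      using C(3) by (intro AE_I2) (auto simp: m2 intro: order_trans[OF _ abs_ge_self])
  qed
  have lb: "norm (LINT w'|M. l t (X t w') (law M (X t)) (X t w)) \<le> C * (1 + 2 * n + norm (X t w))" for w
  proof -
    have "norm (LINT w'|M. l t (X t w') (law M (X t)) (X t w)) \<le> (LINT w'|M. C * (1 + norm (X t w') + n + norm (X t w)))"
      using C(3) by (intro norm_integral_le iX) (auto simp: m2)
    also have "\<dots> = C * (1 + (LINT w'|M. norm (X t w')) + n + norm (X t w))"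
      using L2_integrable[OF nX] by (simp add: prob_space)
    also have "\<dots> \<le> C * (1 + n + n + norm (X t w))"
      using integral_norm_le_L2norm[OF Xs] C(1) by (intro mult_left_mono) (auto simp: n_def)
    finally show ?thesis by (simp add: algebra_simps)
  qed
  \<comment> \<open>The sum of the local bound \<open>C (1 + |X t| + n)\<close> and the averaged
    bound \<open>C (1 + 2 n + |X t|)\<close>; in the L2 norm \<open>|X t|\<close> becomes
    \<open>n\<close>, which gives \<open>2 + 5 n\<close>.\<close>
  have b: "norm (source_drift M X k l t w) \<le> C * (2 + 3 * n + 2 * norm (X t w))" for w
  proof -
    have "norm (source_drift M X k l t w) \<le> C * (1 + norm (X t w) + n) + C * (1 + 2 * n + norm (X t w))"
      unfolding source_drift_def using C(2)[of "X t w"] by (intro norm_triangle_le add_mono lb) (simp add: m2)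
    then show ?thesis by (simp add: algebra_simps)
  qed
  have m: "source_drift M X k l t \<in> borel_measurable M"
    unfolding source_drift_def[abs_def]
    by (intro borel_measurable_add flow_section[OF k X t Xm] copy_average_measurable'[OF X t l Xm])
  have d: "L2 M (\<lambda>w. (2 + 3 * n) + 2 *\<^sub>R norm (X t w))"
    by (intro L2_add L2_const L2_scaleR nX)
  have b': "AE w in M. norm (source_drift M X k l t w) \<le> C * norm ((2 + 3 * n) + 2 *\<^sub>R norm (X t w))"
    using b n0 by (intro AE_I2) simp
  show "L2 M (source_drift M X k l t)" by (rule L2_bound[OF d m b'])
  have "L2norm M (source_drift M X k l t) \<le> C * L2norm M (\<lambda>w. (2 + 3 * n) + 2 *\<^sub>R norm (X t w))"
    by (rule L2norm_mono[OF d m b' C(1)])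
  also have "\<dots> \<le> C * (L2norm M (\<lambda>w. 2 + 3 * n) + L2norm M (\<lambda>w. 2 *\<^sub>R norm (X t w)))"
    by (intro mult_left_mono L2norm_triangle L2_const L2_scaleR nX C(1))
  also have "\<dots> = C * (2 + 5 * n)" using n0 by (simp only: L2norm_scaleR L2norm_const nXn) simp
  finally show "L2norm M (source_drift M X k l t) \<le> C * (2 + 5 * L2norm M (X t))" by (simp add: n_def)
qed

end

section \<open>The Markov property of the controlled state\<close>

locale mean_field_feedback = mean_field_problem M T W X0 \<mu>0 \<sigma> b bx bm f fx fm g gx gm
  for M :: "'w measure" and T :: real and W :: "real \<Rightarrow> 'w \<Rightarrow> real^'m"
    and X0 :: "'w \<Rightarrow> real^'d" and \<mu>0 :: "(real^'d) measure"
    and \<sigma> :: "real \<Rightarrow> real^'m^'d"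
    and b :: "('d, real^'d) coeff"
    and bx :: "('d, real^'d^'d) coeff"
    and bm :: "('d, real^'d \<Rightarrow> real^'d^'d) coeff"
    and f :: "('d, real) coeff"
    and fx :: "('d, real^'d) coeff"
    and fm :: "('d, real^'d \<Rightarrow> real^'d) coeff"
    and g :: "real^'d \<Rightarrow> (real^'d) measure \<Rightarrow> real"
    and gx :: "real^'d \<Rightarrow> (real^'d) measure \<Rightarrow> real^'d"
    and gm :: "real^'d \<Rightarrow> (real^'d) measure \<Rightarrow> real^'d \<Rightarrow> real^'d" +
  fixes u :: "('d, real^'m) coeff"
    and ux :: "('d, real^'d^'m) coeff"
    and um :: "('d, real^'d \<Rightarrow> real^'d^'m) coeff"
    and Ku :: real and X :: "real \<Rightarrow> 'w \<Rightarrow> real^'d"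
  assumes u_continuous: "jointly_continuous T u" and u_C1: "C1_vec M T u ux um"
    and u_bounded_derivs: "bounded_derivs T Ku Ku ux um"
    and state: "is_state M T W X0 b \<sigma> (feedback_process M u X) X"
begin

abbreviation \<mu> :: "real \<Rightarrow> (real^'d) measure" where "\<mu> t \<equiv> law M (X t)"
abbreviation \<alpha> :: "real \<Rightarrow> 'w \<Rightarrow> real^'m" where "\<alpha> \<equiv> feedback_process M u X"

lemmas X_process = is_stateD(1)[OF state] and X_adapted = is_stateD(2)[OF state]

lemma X_bound: obtains C where "0 \<le> C" "\<And>t. t \<in> {0..T} \<Longrightarrow> L2norm M (X t) \<le> C"
proof -
  obtain C where C: "\<forall>t\<in>{0..T}. L2norm M (X t) \<le> C" using is_stateD(3)[OF state] by blast
  then have "0 \<le> C" using order_trans[OF L2norm_nonneg, of M "X 0" C] T_pos by auto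
  with C show ?thesis using that by blast
qed

lemma X_L2: "t \<in> {0..T} \<Longrightarrow> L2 M (X t)"
  using X_process by (simp add: continuous_process_def)

lemma X_measurable: "t \<in> {0..T} \<Longrightarrow> X t \<in> borel_measurable M"
  using X_L2 by (simp add: sq_integrable_def)

lemma \<mu>_in_P2: "t \<in> {0..T} \<Longrightarrow> \<mu> t \<in> P2"
  by (rule law_in_P2[OF X_L2])

lemma Ku_nonneg: "0 \<le> Ku"
proof -
  have "norm (ux 0 0 (\<mu> 0)) \<le> Ku" using u_bounded_derivs T_pos \<mu>_in_P2[of 0] by (simp add: bounded_derivs_def)
  then show ?thesis using norm_ge_zero order_trans by blast
qed

lemma u_flow_regular: "flow_regular M T u"
  by (rule jointly_continuous_flow_regular[OF u_continuous])

lemma u_lipschitz: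
  assumes "t \<in> {0..T}" "\<nu> \<in> P2" shows "norm (u t x \<nu> - u t y \<nu>) \<le> Ku * norm (x - y)"
  using assms u_C1 u_bounded_derivs
  by (intro lipschitz_from_derivative[where D = "\<lambda>x. ux t x \<nu>"]) (auto simp: C1_vec_def bounded_derivs_def)

text \<open>The dependence on the measure is controlled along the ray from the Dirac measure at
  \<open>0\<close> to \<open>\<mu> t\<close>, componentwise because
  \<open>lions_derivative_bound\<close> is scalar. At the Dirac measure, uniformity in
  \<open>t\<close> is continuity on a compact interval.\<close>

lemma u_growth:
  obtains C where "0 \<le> C" "\<And>t x. t \<in> {0..T} \<Longrightarrow> norm (u t x (\<mu> t)) \<le> C + Ku * norm x"
proof -
  obtain CX where CX: "0 \<le> CX" "\<And>t. t \<in> {0..T} \<Longrightarrow> L2norm M (X t) \<le> CX" by (rule X_bound) blast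
  have P0: "law M (\<lambda>_. 0 :: real^'d) \<in> P2" by (rule law_in_P2) simp
  have "compact ((\<lambda>t. u t 0 (law M (\<lambda>_. 0))) ` {0..T})"
    by (intro compact_continuous_image jointly_continuous_in_time[OF u_continuous P0]) simp
  then obtain C0 where C0: "\<And>t. t \<in> {0..T} \<Longrightarrow> norm (u t 0 (law M (\<lambda>_. 0))) \<le> C0"
    using compact_imp_bounded by (force simp: bounded_iff simp del: distr_const)
  define C where "C = C0 + (\<Sum>i\<in>(UNIV :: 'm set). Ku * CX)"
  have main: "norm (u t x (\<mu> t)) \<le> C + Ku * norm x" if t: "t \<in> {0..T}" for t x
  proof -
    have "\<bar>u t 0 (\<mu> t) $ i - u t 0 (law M (\<lambda>_. 0)) $ i\<bar> \<le> Ku * CX" for i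
    proof -
      have "\<bar>u t 0 (\<mu> t) $ i - u t 0 (law M (\<lambda>_. 0)) $ i\<bar> \<le> Ku * L2norm M (X t)"
      proof (rule lions_derivative_bound[OF X_L2[OF t], where D = "\<lambda>\<nu> y. um t 0 \<nu> y $ i"])
        fix \<nu> :: "(real^'d) measure" and y assume \<nu>: "\<nu> \<in> P2"
        show "has_lions_derivative M (\<lambda>\<nu>. u t 0 \<nu> $ i) (\<lambda>y. um t 0 \<nu> y $ i) \<nu>"
          using u_C1 t \<nu> by (auto simp: C1_vec_def has_lions_derivative_vec_def)
        show "norm (um t 0 \<nu> y $ i) \<le> Ku"
          using u_bounded_derivs t \<nu> by (intro order_trans[OF Finite_Cartesian_Product.norm_nth_le]) (auto simp: bounded_derivs_def)
      qed
      also have "\<dots> \<le> Ku * CX" using CX(2)[OF t] Ku_nonneg by (intro mult_left_mono)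
      finally show ?thesis .
    qed
    then have "norm (u t 0 (\<mu> t) - u t 0 (law M (\<lambda>_. 0))) \<le> (\<Sum>i\<in>(UNIV :: 'm set). Ku * CX)"
      by (intro order_trans[OF norm_le_sum_components] sum_mono) simp
    then have "norm (u t 0 (\<mu> t)) \<le> C"
      using C0[OF t] norm_triangle_sub[of "u t 0 (\<mu> t)" "u t 0 (law M (\<lambda>_. 0))"] unfolding C_def by linarith
    moreover have "norm (u t x (\<mu> t) - u t 0 (\<mu> t)) \<le> Ku * norm x"
      using u_lipschitz[OF t \<mu>_in_P2[OF t], of x 0] by simp
    ultimately show ?thesis using norm_triangle_sub[of "u t x (\<mu> t)" "u t 0 (\<mu> t)"] by linarith
  qed
  moreover have "0 \<le> C"
  proof -
    have "norm (u 0 0 (\<mu> 0)) \<le> C" using main[of 0 0] T_pos by simp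
    then show ?thesis using norm_ge_zero order_trans by blast
  qed
  ultimately show ?thesis using that by blast
qed

lemma \<alpha>_dtP: "measurable_dtP \<alpha>"
  unfolding feedback_process_def by (rule flow_dtP[OF u_flow_regular X_process continuous_process_dtP[OF X_process]])

lemma \<alpha>_bounds: obtains C where "\<And>t. t \<in> {0..T} \<Longrightarrow> L2 M (\<alpha> t)" "\<And>t. t \<in> {0..T} \<Longrightarrow> L2norm M (\<alpha> t) \<le> C"
proof -
  obtain CX where CX: "0 \<le> CX" "\<And>t. t \<in> {0..T} \<Longrightarrow> L2norm M (X t) \<le> CX" by (rule X_bound) blast
  obtain C where C: "0 \<le> C" "\<And>t x. t \<in> {0..T} \<Longrightarrow> norm (u t x (\<mu> t)) \<le> C + Ku * norm x" by (rule u_growth) blast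
  have m: "\<alpha> t \<in> borel_measurable M" if t: "t \<in> {0..T}" for t by (rule dtP_section[OF \<alpha>_dtP t])
  have nX: "L2 M (\<lambda>w. norm (X t w))" "L2norm M (\<lambda>w. norm (X t w)) \<le> CX" if t: "t \<in> {0..T}" for t
    using L2_bound[OF X_L2[OF t], of "\<lambda>w. norm (X t w)" 1] X_measurable[OF t] CX(2)[OF t]
    by (auto simp: L2norm_def)
  have s: "L2 M (\<lambda>w. C + Ku *\<^sub>R norm (X t w))" if t: "t \<in> {0..T}" for t
    by (intro L2_add L2_const L2_scaleR nX t)
  have le: "AE w in M. norm (\<alpha> t w) \<le> 1 * norm (C + Ku *\<^sub>R norm (X t w))" if t: "t \<in> {0..T}" for t
    using C(2)[OF t] C(1) Ku_nonneg by (intro AE_I2) (simp add: feedback_process_def)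
  show ?thesis
  proof (rule that)
    fix t assume t: "t \<in> {0..T}"
    show "L2 M (\<alpha> t)" by (rule L2_bound[OF s[OF t] m[OF t] le[OF t]])
    have "L2norm M (\<alpha> t) \<le> 1 * L2norm M (\<lambda>w. C + Ku *\<^sub>R norm (X t w))"
      by (rule L2norm_mono[OF s[OF t] m[OF t] le[OF t]]) simp
    also have "\<dots> \<le> L2norm M (\<lambda>w. C) + L2norm M (\<lambda>w. Ku *\<^sub>R norm (X t w))"
      unfolding mult_1 by (intro L2norm_triangle L2_const L2_scaleR nX t)
    also have "\<dots> \<le> C + Ku * CX"
      unfolding L2norm_scaleR L2norm_const using nX(2)[OF t] C(1) Ku_nonneg by (simp add: mult_left_mono)
    finally show "L2norm M (\<alpha> t) \<le> C + Ku * CX" .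
  qed
qed

lemma \<alpha>_L2: "t \<in> {0..T} \<Longrightarrow> L2 M (\<alpha> t)"
  by (rule \<alpha>_bounds) blast

lemma \<alpha>_L2_dtP: "L2_dtP \<alpha>"
  by (rule \<alpha>_bounds) (rule process_L2_dtP[OF \<alpha>_dtP])

lemma \<alpha>_prog: "prog_measurable F T \<alpha>"
  unfolding prog_measurable_def
proof
  fix t assume t: "t \<in> {0..T}"
  let ?N = "restrict_space borel {0..t} \<Otimes>\<^sub>M F t"
  have "(\<lambda>s. s) \<in> measurable (restrict_space borel {0..t}) (restrict_space borel {0..T})"
    using t by (intro measurable_restrict_space2 measurable_restrict_space1) (auto simp: space_restrict_space)
  then have \<phi>: "fst \<in> measurable ?N (restrict_space borel {0..T})"
    using measurable_compose[OF measurable_fst] by blast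
  have "(\<lambda>z. X (fst z) (snd z)) \<in> borel_measurable ?N"
    using continuous_process_prog[OF X_process X_adapted t] by (simp add: case_prod_beta')
  from flow_comp_measurable[OF u_flow_regular X_process \<phi> this]
  show "(\<lambda>(s, w). \<alpha> s w) \<in> borel_measurable ?N" by (simp add: feedback_process_def case_prod_beta')
qed

definition \<kappa> :: "real \<Rightarrow> 'w \<Rightarrow> real^'d" where
  "\<kappa> t w = b t (X t w) (\<mu> t) + \<sigma> t *v \<alpha> t w"

text \<open>With the deterministic flow \<open>\<mu> t\<close> frozen, the closed-loop drift is a
  Lipschitz function of the state alone, as for a Markov process with time-dependent
  coefficients.\<close>

lemma drift_lipschitz:
  obtains L where "0 \<le> L" "\<And>t x y. t \<in> {0..T} \<Longrightarrow>
    norm ((b t x (\<mu> t) + \<sigma> t *v u t x (\<mu> t)) - (b t y (\<mu> t) + \<sigma> t *v u t y (\<mu> t))) \<le> L * norm (x - y)"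
proof -
  obtain K where K: "0 \<le> K" "bounded_derivs T K K bx bm" by (rule b_bounded_derivs) blast
  obtain C where C: "\<And>t. t \<in> {0..T} \<Longrightarrow> norm (\<sigma> t) \<le> C" "0 \<le> C" by (rule \<sigma>_bounded[OF \<sigma>_continuous]) blast
  show ?thesis
  proof (rule that[of "K + C * Ku"])
    show "0 \<le> K + C * Ku" using K C Ku_nonneg by simp
    fix t x y assume t: "t \<in> {0..T}"
    have 1: "norm (b t x (\<mu> t) - b t y (\<mu> t)) \<le> K * norm (x - y)"
      using b_C1 K(2) t \<mu>_in_P2[OF t]
      by (intro lipschitz_from_derivative[where D = "\<lambda>x. bx t x (\<mu> t)"]) (auto simp: C1_vec_def bounded_derivs_def)
    have "norm (\<sigma> t *v u t x (\<mu> t) - \<sigma> t *v u t y (\<mu> t)) \<le> C * (Ku * norm (x - y))"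
      unfolding matrix_vector_mult_diff_distrib[symmetric]
      using u_lipschitz[OF t \<mu>_in_P2[OF t], of x y] C(1)[OF t] C(2)
      by (intro order_trans[OF norm_matrix_vector_mult_le] mult_mono) auto
    with 1 norm_triangle_ineq[of "b t x (\<mu> t) - b t y (\<mu> t)" "\<sigma> t *v u t x (\<mu> t) - \<sigma> t *v u t y (\<mu> t)"]
    show "norm ((b t x (\<mu> t) + \<sigma> t *v u t x (\<mu> t)) - (b t y (\<mu> t) + \<sigma> t *v u t y (\<mu> t))) \<le> (K + C * Ku) * norm (x - y)"
      by (simp add: algebra_simps)
  qed
qed

text \<open>The information of the present state and of the Brownian future. The null sets are
  included so that a variable equal a.e. to a \<open>G t\<close>-measurable one is itself
  measurable.\<close>

definition G :: "real \<Rightarrow> 'w measure" where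
  "G t = sigma (space M) ({X t -` A \<inter> space M | A. A \<in> sets borel} \<union>
     sets (increment_sigma M W t {t..T}) \<union> null_sets M)"

lemma space_G [simp]: "space (G t) = space M"
  by (simp add: G_def space_measure_of_conv)

lemma sets_G: "sets (G t) = sigma_sets (space M) ({X t -` A \<inter> space M | A. A \<in> sets borel} \<union>
     sets (increment_sigma M W t {t..T}) \<union> null_sets M)"
  unfolding G_def using sets.sets_into_space[of _ "increment_sigma M W t {t..T}"]
  by (intro sets_measure_of) (auto dest: sets.sets_into_space)

lemma increment_sigma_subset_M: "t \<in> {0..T} \<Longrightarrow> sets (increment_sigma M W t {t..T}) \<subseteq> sets M"
  using increments_independent[of t] unfolding indep_sets2_eq by blast

lemma subalgebra_G: "t \<in> {0..T} \<Longrightarrow> subalgebra M (G t)"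
  unfolding subalgebra_def sets_G space_G
proof (intro conjI refl sets.sigma_sets_subset Un_least)
  assume t: "t \<in> {0..T}"
  show "{X t -` A \<inter> space M | A. A \<in> sets borel} \<subseteq> sets M"
    using measurable_sets[OF X_measurable[OF t]] by auto
  show "sets (increment_sigma M W t {t..T}) \<subseteq> sets M" by (rule increment_sigma_subset_M[OF t])
qed auto

lemma null_sets_G: "null_sets M \<subseteq> sets (G t)"
  unfolding sets_G by (auto intro: sigma_sets.Basic)

lemma X_measurable_G: "X t \<in> borel_measurable (G t)"
  by (rule measurableI) (auto simp: sets_G intro!: sigma_sets.Basic)

lemma measurable_increments_G: "V \<in> measurable (increment_sigma M W t {t..T}) N \<Longrightarrow> V \<in> measurable (G t) N"
  unfolding measurable_def by (auto simp: sets_G intro: sigma_sets.Basic)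

text \<open>Let \<open>U\<close> be orthogonal to L2(\<open>G t\<close>). In the tested equation
  \<open>X t\<close> and the noise after \<open>t\<close> drop out, and so does the drift evaluated
  at any \<open>G t\<close>-measurable \<open>P\<close>. The Lipschitz bound leaves the norm of
  \<open>U\<close> times the distance of \<open>X s\<close> to \<open>P\<close>, the input of the
  forward Gronwall argument.\<close>

lemma X_future_measurable:
  assumes t: "t \<in> {0..T}" and r: "r \<in> {t..T}"
  shows "X r \<in> borel_measurable (G t)"
proof -
  obtain C where C: "0 \<le> C" "\<And>t. t \<in> {0..T} \<Longrightarrow> L2norm M (X t) \<le> C" by (rule X_bound) blast
  obtain L where L: "0 \<le> L" "\<And>t x y. t \<in> {0..T} \<Longrightarrow>
    norm ((b t x (\<mu> t) + \<sigma> t *v u t x (\<mu> t)) - (b t y (\<mu> t) + \<sigma> t *v u t y (\<mu> t))) \<le> L * norm (x - y)" by (rule drift_lipschitz) blast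
  have sub: "s \<in> {0..T}" if "s \<in> {t..T}" for s using that t by auto
  show ?thesis
  proof (rule measurable_by_gronwall[where J = "\<lambda>s. {t..s}" and a = t and b = T and e = X and K = C and L = L
        and h = "\<lambda>U r. ip U (\<kappa> r)", OF _ _ order_refl subalgebra_G[OF t] null_sets_G])
    show "r \<in> {t..T}" by fact
    show "L2 M (X s)" if "s \<in> {t..T}" for s by (rule X_L2[OF sub[OF that]])
    show "L2norm M (X s) \<le> C" if "s \<in> {t..T}" for s by (rule C(2)[OF sub[OF that]])
    fix s and U :: "'w \<Rightarrow> real^'d"
    assume s: "s \<in> {t..T}" and U: "L2 M U"
      and orth: "\<And>V. V \<in> borel_measurable (G t) \<Longrightarrow> L2 M V \<Longrightarrow> ip U V = 0"
    have "ip U (X s) = ip U (X t)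
      + (LINT r|lT. indicator {t..s} r * (LINT w|M. U w \<bullet> (b r (X r w) (\<mu> r) + \<sigma> r *v \<alpha> r w)))"
      using s t by (intro state_increment[OF state \<alpha>_L2_dtP _ _ _ U] orth measurable_increments_G) auto
    then show "ip U (X s) = (LINT r|lT. indicator {t..s} r * ip U (\<kappa> r))"
      using orth[OF X_measurable_G X_L2[OF t]] by (simp add: \<kappa>_def)
    fix P :: "'w \<Rightarrow> real^'d" assume P: "P \<in> borel_measurable (G t)" "L2 M P"
    note s0 = sub[OF s]
    define c where "c x = b s x (\<mu> s) + \<sigma> s *v u s x (\<mu> s)" for x
    have cm: "c \<in> borel_measurable borel"
      unfolding c_def[abs_def]
      by (intro borel_measurable_add matrix_vector_mult_measurable flow_section[OF b_flow_regular X_process s0]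
          flow_section[OF u_flow_regular X_process s0]) auto
    have Pm: "P \<in> borel_measurable M" using P(2) by measurable
    have cP: "(\<lambda>w. c (P w)) \<in> borel_measurable (G t)" "(\<lambda>w. c (P w)) \<in> borel_measurable M"
      using measurable_compose[OF P(1) cm] measurable_compose[OF Pm cm] by auto
    have cX: "(\<lambda>w. c (X s w)) \<in> borel_measurable M"
      using measurable_compose[OF X_measurable[OF s0] cm] .
    have cP_sq: "L2 M (\<lambda>w. c (P w))"
    proof (rule L2_bound[of M "\<lambda>w. norm (c 0) + L *\<^sub>R norm (P w)" _ 1])
      have "L2 M (\<lambda>w. norm (P w))" by (rule L2_bound[OF P(2), of _ 1]) (use Pm in auto)
      then show "L2 M (\<lambda>w. norm (c 0) + L *\<^sub>R norm (P w))"
        by (intro L2_add L2_const L2_scaleR)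
      show "AE w in M. norm (c (P w)) \<le> 1 * norm (norm (c 0) + L *\<^sub>R norm (P w))"
      proof (intro AE_I2)
        fix w
        have "norm (c (P w) - c 0) \<le> L * norm (P w)" using L(2)[OF s0, of "P w" 0] by (simp add: c_def)
        then show "norm (c (P w)) \<le> 1 * norm (norm (c 0) + L *\<^sub>R norm (P w))"
          using norm_triangle_sub[of "c (P w)" "c 0"] by simp
      qed
    qed (rule cP)
    have XP: "L2 M (\<lambda>w. X s w - P w)" by (rule L2_diff[OF X_L2[OF s0] P(2)])
    have le: "AE w in M. norm (c (X s w) - c (P w)) \<le> L * norm (X s w - P w)"
      using L(2)[OF s0] by (intro AE_I2) (simp add: c_def)
    have dm: "(\<lambda>w. c (X s w) - c (P w)) \<in> borel_measurable M" using cX cP(2) by measurable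
    have d: "L2 M (\<lambda>w. c (X s w) - c (P w))" by (rule L2_bound[OF XP dm le])
    have "ip U (\<kappa> s) = (LINT w|M. U w \<bullet> (c (X s w) - c (P w)) + U w \<bullet> c (P w))"
      by (simp add: \<kappa>_def c_def feedback_process_def inner_diff_right)
    also have "\<dots> = (LINT w|M. U w \<bullet> (c (X s w) - c (P w)))"
      using orth[OF cP(1) cP_sq] L2_inner[OF U d] L2_inner[OF U cP_sq] by simp
    also have "\<bar>\<dots>\<bar> \<le> L2norm M U * L2norm M (\<lambda>w. c (X s w) - c (P w))" by (rule L2_Cauchy_Schwarz[OF U d])
    also have "\<dots> \<le> L2norm M U * (L * L2norm M (\<lambda>w. X s w - P w))"
      by (intro mult_left_mono L2norm_mono[OF XP dm le L(1)]) simp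
    finally show "\<bar>ip U (\<kappa> s)\<bar> \<le> L * L2norm M U * L2norm M (\<lambda>w. X s w - P w)" by (simp add: mult_ac)
  qed (use t L in auto)
qed

text \<open>Conditional independence of past and future given the present: for \<open>Z\<close> an indicator of the past,
  \<open>Z\<close> minus its projection on the present is orthogonal to the present and the future.\<close>

lemma orthogonal_to_past:
  fixes p :: "'w \<Rightarrow> real^'k"
  assumes t: "t \<in> {0..T}" and p: "p \<in> borel_measurable (G t)" "L2 M p"
    and zero: "\<And>B i. B \<in> sets borel \<Longrightarrow> (LINT w:X t -` B \<inter> space M|M. p w $ i) = 0"
    and U: "U \<in> borel_measurable (F t)" "L2 M U"
  shows "ip U p = 0"
proof (rule orthogonal_if_indicators[OF _ p(2) _ U])
  have tT: "t \<le> T" using t by simp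
  show "subalgebra M (F t)" by (rule subalgebra_F[OF tT])
  fix A and i :: 'k assume A: "A \<in> sets (F t)"
  have AM: "A \<in> sets M" using A sets_F_subset[OF tT] by auto
  define SX where "SX = vimage_algebra (space M) (X t) borel"
  have SX: "sets SX = {X t -` B \<inter> space M | B. B \<in> sets borel}" "space SX = space M"
    by (auto simp: SX_def sets_vimage_algebra2)
  have subX: "subalgebra M SX"
    using measurable_sets[OF X_measurable[OF t]] by (auto simp: subalgebra_def SX)
  have SXF: "Y \<in> measurable (F t) N" if "Y \<in> measurable SX N" for Y and N :: "'z measure"
    using that measurable_sets[OF X_adapted[OF t]] by (auto simp: measurable_def SX)
  have SXG: "Y \<in> measurable (G t) N" if "Y \<in> measurable SX N" for Y and N :: "'z measure"
    using that measurable_sets[OF X_measurable_G[of t]] by (auto simp: measurable_def SX)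
  \<comment> \<open>The indicator of a past event, placed in coordinate \<open>i\<close> so that
    \<open>p . Z\<close> is the component to be integrated over \<open>A\<close>.\<close>
  define Z :: "'w \<Rightarrow> real^'k" where "Z w = indicator A w *\<^sub>R axis i 1" for w
  have ZF: "Z \<in> borel_measurable (F t)" unfolding Z_def[abs_def] using A by measurable
  have Z: "L2 M Z"
    by (rule L2_bounded[where C = 1]) (use AM in \<open>auto simp: Z_def[abs_def] indicator_def norm_axis_1\<close>)
  define Q where "Q = L2_projection M SX Z"
  note Q = L2_projection[OF subX Z, folded Q_def]
  have ZQ: "L2 M (\<lambda>w. Z w - Q w)" by (rule L2_diff[OF Z Q(2)])
  \<comment> \<open>The roles are exchanged here: \<open>p\<close> is the test variable, and
    \<open>Z - Q\<close> has to integrate to zero over every set of \<open>G t\<close>.\<close>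
  have "(LINT w|M. p w \<bullet> (Z w - Q w)) = 0"
  proof (rule orthogonal_if_indicators[OF subalgebra_G[OF t] ZQ _ p])
    fix C and j :: 'k assume C: "C \<in> sets (G t)"
    define \<phi> where "\<phi> w = (Z w - Q w) $ j" for w
    have \<phi>: "integrable M \<phi>" unfolding \<phi>_def[abs_def]
      by (rule L2_integrable[OF L2_component[OF ZQ]])
    have \<phi>F: "\<phi> \<in> borel_measurable (F t)" unfolding \<phi>_def[abs_def]
      by (intro borel_measurable_vec_nth borel_measurable_diff ZF SXF Q)
    have B0: "(LINT w|M. indicator (X t -` B \<inter> space M) w * \<phi> w) = 0" if B: "B \<in> sets borel" for B
    proof -
      define Y :: "'w \<Rightarrow> real^'k" where "Y w = indicator (X t -` B \<inter> space M) w *\<^sub>R axis j 1" for w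
      have "X t -` B \<inter> space M \<in> sets SX" using B by (auto simp: SX)
      then have Y: "Y \<in> borel_measurable SX" unfolding Y_def[abs_def] by measurable
      have Ys: "L2 M Y"
        by (rule L2_bounded[where C = 1])
          (use measurable_from_subalg[OF subX Y] in \<open>auto simp: Y_def[abs_def] indicator_def norm_axis_1\<close>)
      have "(LINT w|M. indicator (X t -` B \<inter> space M) w * \<phi> w) = (LINT w|M. Y w \<bullet> Z w - Y w \<bullet> Q w)"
        by (simp add: Y_def \<phi>_def inner_axis' algebra_simps)
      then show ?thesis using Q(3)[OF Y Ys] L2_inner[OF Ys Z] L2_inner[OF Ys Q(2)] by simp
    qed
    \<comment> \<open>An intersection-stable generator of \<open>G t\<close>: events of the present
      intersected with events of the Brownian future, and the null sets.\<close>
    define R where "R = {(X t -` B \<inter> space M) \<inter> D | B D. B \<in> sets borel \<and> D \<in> sets (increment_sigma M W t {t..T})} \<union> null_sets M"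
    have "(LINT w:C|M. \<phi> w) = 0"
    proof (rule set_integral_zero_sigma_sets[where G = R, OF _ _ \<phi>])
      show "Int_stable R"
      proof (rule Int_stableI)
        fix a b assume ab: "a \<in> R" "b \<in> R"
        show "a \<inter> b \<in> R"
        proof (cases "a \<in> null_sets M \<or> b \<in> null_sets M")
          case True
          have "a \<in> sets M" "b \<in> sets M"
            using ab measurable_sets[OF X_measurable[OF t]] increment_sigma_subset_M[OF t] by (auto simp: R_def)
          then have "a \<inter> b \<in> null_sets M" using True null_set_Int1 null_set_Int2 by blast
          then show ?thesis by (simp add: R_def)
        next
          case False
          then obtain B D B' D' where "a = (X t -` B \<inter> space M) \<inter> D" "B \<in> sets borel" "D \<in> sets (increment_sigma M W t {t..T})"
            "b = (X t -` B' \<inter> space M) \<inter> D'" "B' \<in> sets borel" "D' \<in> sets (increment_sigma M W t {t..T})"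
            using ab by (auto simp: R_def)
          then show ?thesis unfolding R_def
            by (intro UnI1 CollectI exI[of _ "B \<inter> B'"] exI[of _ "D \<inter> D'"]) auto
        qed
      qed
      show "R \<subseteq> sets M"
        using measurable_sets[OF X_measurable[OF t]] increment_sigma_subset_M[OF t] by (auto simp: R_def)
      show "(LINT w:S|M. \<phi> w) = 0" if SR: "S \<in> R" for S
      proof (cases "S \<in> null_sets M")
        case True
        have "AE w in M. indicator S w *\<^sub>R \<phi> w = 0"
          using AE_not_in[OF True] by eventually_elim simp
        then show ?thesis unfolding set_lebesgue_integral_def by (rule integral_eq_zero_AE)
      next
        case False
        then obtain B D where S: "S = (X t -` B \<inter> space M) \<inter> D" "B \<in> sets borel" "D \<in> sets (increment_sigma M W t {t..T})"
          using SR False by (auto simp: R_def)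
        define \<psi> where "\<psi> w = indicator (X t -` B \<inter> space M) w * \<phi> w" for w
        have BF: "X t -` B \<inter> space M \<in> sets (F t)" using measurable_sets[OF X_adapted[OF t] S(2)] by simp
        have BM: "X t -` B \<inter> space M \<in> sets M" using measurable_sets[OF X_measurable[OF t] S(2)] .
        have \<psi>: "\<psi> \<in> borel_measurable (F t)" "integrable M \<psi>"
          using BF \<phi>F integrable_mult_indicator[OF BM \<phi>] unfolding \<psi>_def[abs_def] by auto
        have D: "(indicator D :: 'w \<Rightarrow> real) \<in> borel_measurable (increment_sigma M W t {t..T})" using S(3) by simp
        have Dm: "D \<in> sets M" using S(3) increment_sigma_subset_M[OF t] by auto
        then have Di: "integrable M (indicator D :: 'w \<Rightarrow> real)"
          by (intro integrable_const_bound[where B = 1]) (auto simp: indicator_def)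
        \<comment> \<open>\<open>\<psi>\<close> belongs to the past of \<open>t\<close> and
          \<open>D\<close> to the Brownian future, so the expectation factorises; the factor of
          \<open>\<psi>\<close> vanishes because \<open>Q\<close> is the projection of
          \<open>Z\<close> on the present.\<close>
        have "(LINT w|M. \<psi> w * indicator D w) = expectation \<psi> * expectation (indicator D)"
          by (rule indep_var_lebesgue_integral[OF filtration_indep_var[OF t \<psi>(1) D] \<psi>(2) Di])
        also have "expectation \<psi> = 0" unfolding \<psi>_def[abs_def] by (rule B0[OF S(2)])
        finally show ?thesis
          by (simp add: set_lebesgue_integral_def S(1) indicator_inter_arith \<psi>_def mult_ac)
      qed
      show "(LINT w|M. \<phi> w) = 0"
      proof -
        have "(LINT w|M. \<phi> w) = (LINT w|M. indicator (X t -` UNIV \<inter> space M) w * \<phi> w)"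
          by (intro Bochner_Integration.integral_cong) auto
        then show ?thesis using B0[of UNIV] by simp
      qed
      have "sigma_sets (space M) ({X t -` A \<inter> space M | A. A \<in> sets borel} \<union>
         sets (increment_sigma M W t {t..T}) \<union> null_sets M) \<subseteq> sigma_sets (space M) R"
      proof (rule sigma_sets_mono', intro Un_least)
        show "{X t -` A \<inter> space M | A. A \<in> sets borel} \<subseteq> R"
        proof safe
          fix B assume "B \<in> sets (borel :: (real^'d) measure)"
          moreover have "space M \<in> sets (increment_sigma M W t {t..T})" using sets.top[of "increment_sigma M W t {t..T}"] by simp
          ultimately have "(X t -` B \<inter> space M) \<inter> space M \<in> R"
            unfolding R_def by (intro UnI1 CollectI exI[of _ B] exI[of _ "space M"]) auto
          then show "X t -` B \<inter> space M \<in> R" by (simp add: Int_assoc)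
        qed
        show "sets (increment_sigma M W t {t..T}) \<subseteq> R"
        proof
          fix D assume D: "D \<in> sets (increment_sigma M W t {t..T})"
          then have "D \<subseteq> space M" using sets.sets_into_space by fastforce
          then have "(X t -` UNIV \<inter> space M) \<inter> D = D" by auto
          moreover have "(X t -` UNIV \<inter> space M) \<inter> D \<in> R"
            unfolding R_def by (intro UnI1 CollectI exI[of _ UNIV] exI[of _ D]) (simp_all add: D)
          ultimately show "D \<in> R" by simp
        qed
      qed (auto simp: R_def)
      then show "C \<in> sigma_sets (space M) R" using C unfolding sets_G by blast
    qed
    then show "(LINT w:C|M. (Z w - Q w) $ j) = 0" by (simp add: \<phi>_def)
  qed
  \<comment> \<open>\<open>Q\<close> is a function of the present state; this is where the
    hypothesis \<open>zero\<close> enters.\<close>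
  moreover have "ip Q p = 0"
    by (rule orthogonal_if_indicators[OF subX p(2) _ Q(1,2)]) (auto simp: SX zero)
  ultimately have "ip p Z = 0"
    using L2_inner[OF p(2) Z] L2_inner[OF p(2) Q(2)]
    by (simp add: inner_diff_right inner_commute[of "Q _"])
  moreover have "p w \<bullet> Z w = indicator A w *\<^sub>R p w $ i" for w
    by (simp add: Z_def inner_axis)
  ultimately show "(LINT w:A|M. p w $ i) = 0" by (simp add: set_lebesgue_integral_def)
qed

end

section \<open>Criticality and the two adjoints\<close>

text \<open>Criticality gives, for each Borel set separately, an identity at almost every time. A
  countable generator yields one exceptional set of times for all Borel sets; closing a countable
  basis under finite intersections keeps it countable.\<close>

lemma borel_countable_pi_system:
  obtains B :: "'a::second_countable_topology set set" where
    "countable B" "Int_stable B" "UNIV \<in> B" "sets borel = sigma_sets UNIV B"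
proof -
  obtain D :: "'a set set" where D: "countable D" "topological_basis D"
    using ex_countable_basis by blast
  define B where "B = Inter ` {K. finite K \<and> K \<subseteq> D}"
  have "countable {K. finite K \<and> K \<subseteq> D}" using countable_Collect_finite_subset[OF D(1)] by simp
  then have c: "countable B" by (simp add: B_def)
  have DB: "D \<subseteq> B" unfolding B_def by (auto intro!: image_eqI[of _ Inter "{_}"])
  have "Int_stable B"
  proof (rule Int_stableI)
    fix a b assume "a \<in> B" "b \<in> B"
    then obtain K K' where "a = \<Inter>K" "finite K" "K \<subseteq> D" "b = \<Inter>K'" "finite K'" "K' \<subseteq> D" by (auto simp: B_def)
    then show "a \<inter> b \<in> B" unfolding B_def by (intro image_eqI[of _ Inter "K \<union> K'"]) auto
  qed
  moreover have "UNIV \<in> B" unfolding B_def by (rule image_eqI[of _ Inter "{}"]) auto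
  moreover have "sets borel = sigma_sets UNIV B"
  proof
    have "sets borel = sigma_sets UNIV D"
      by (rule trans[OF arg_cong[where f = sets, OF borel_eq_countable_basis[OF D]] sets_measure_of]) simp
    then show "sets borel \<subseteq> sigma_sets UNIV B" using sigma_sets_mono'[OF DB] by auto
    have "B \<subseteq> sets borel"
    proof
      fix a assume "a \<in> B"
      then obtain K where K: "a = \<Inter>K" "finite K" "K \<subseteq> D" by (auto simp: B_def)
      have "open d" if "d \<in> K" for d using K(3) that topological_basis_open[OF D(2)] by auto
      then have "open a" using K by (auto intro: open_Inter)
      then show "a \<in> sets borel" by simp
    qed
    then show "sigma_sets UNIV B \<subseteq> sets borel" using sets.sigma_sets_subset[of B borel] by simp
  qed
  ultimately show ?thesis using that c by blast
qed

context mean_field_space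
begin

lemma is_adjointD:
  assumes a: "is_adjoint M T X A B k l gx gm a"
  shows "continuous_process M T a" "\<exists>C. \<forall>t\<in>{0..T}. L2norm M (a t) \<le> C"
    "\<And>t. t \<in> {0..T} \<Longrightarrow> L2 M (a t)"
    "\<And>w. w \<in> space M \<Longrightarrow> a T w = source_drift M X (\<lambda>_. gx) (\<lambda>_. gm) T w"
    "\<And>w t. w \<in> space M \<Longrightarrow> t \<in> {0..T} \<Longrightarrow>
      ((\<lambda>s. a s w) has_vector_derivative (- (linear_drift M X A B a t w + source_drift M X k l t w))) (at t within {0..T})"
proof -
  show 1: "L2 M (a t)" if "t \<in> {0..T}" for t using a that unfolding is_adjoint_def by blast
  show "\<exists>C. \<forall>t\<in>{0..T}. L2norm M (a t) \<le> C" using a unfolding is_adjoint_def by blast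
  show "a T w = source_drift M X (\<lambda>_. gx) (\<lambda>_. gm) T w" if "w \<in> space M" for w
    using a that unfolding is_adjoint_def source_drift_def by blast
  show d: "((\<lambda>s. a s w) has_vector_derivative (- (linear_drift M X A B a t w + source_drift M X k l t w))) (at t within {0..T})"
    if "w \<in> space M" "t \<in> {0..T}" for w t
  proof -
    have "((\<lambda>s. a s w) has_vector_derivative
            (- (transpose (A t (X t w) (law M (X t))) *v a t w)
             - k t (X t w) (law M (X t))
             - (LINT w'|M. transpose (B t (X t w') (law M (X t)) (X t w)) *v a t w')
             - (LINT w'|M. l t (X t w') (law M (X t)) (X t w)))) (at t within {0..T})"
      using a that unfolding is_adjoint_def by blast
    moreover have "- (transpose (A t (X t w) (law M (X t))) *v a t w)
             - k t (X t w) (law M (X t))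
             - (LINT w'|M. transpose (B t (X t w') (law M (X t)) (X t w)) *v a t w')
             - (LINT w'|M. l t (X t w') (law M (X t)) (X t w)) = - (linear_drift M X A B a t w + source_drift M X k l t w)"
      by (simp add: linear_drift_def source_drift_def)
    ultimately show ?thesis by simp
  qed
  have "continuous_on {0..T} (\<lambda>t. a t w)" if "w \<in> space M" for w
    by (intro continuous_on_eq_continuous_within[THEN iffD2] ballI has_vector_derivative_continuous[OF d[OF that]])
  with 1 show "continuous_process M T a" by (simp add: continuous_process_def)
qed

end

context mean_field_feedback
begin

text \<open>The local coefficient is adapted and can be moved onto the test variable. The average
  over the copy is identically zero: for fixed \<open>x\<close> its kernel is a past-measurable
  function of the copy, so testing the average with itself gives \<open>0\<close>.\<close>

lemma linear_drift_orthogonal: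
  fixes y :: "real \<Rightarrow> 'w \<Rightarrow> real^'k"
  assumes t: "t \<in> {0..T}"
    and A: "flow_regular M T A" and B: "flow_regular_pair M T B"
    and bd: "bounded_derivs T K K A B" and K: "0 \<le> K" and y: "L2 M (y t)"
    and orth: "\<And>V. V \<in> borel_measurable (F t) \<Longrightarrow> L2 M V \<Longrightarrow> ip V (y t) = 0"
    and U: "U \<in> borel_measurable (F t)" "L2 M U"
  shows "(LINT w|M. U w \<bullet> linear_drift M X A B y t w) = 0"
proof -
  have P: "\<mu> t \<in> P2" by (rule \<mu>_in_P2[OF t])
  have AF: "(\<lambda>w. A t (X t w) (\<mu> t)) \<in> borel_measurable (F t)" by (rule flow_section[OF A X_process t X_adapted[OF t]])
  have AM: "(\<lambda>w. A t (X t w) (\<mu> t)) \<in> borel_measurable M" by (rule flow_section[OF A X_process t X_measurable[OF t]])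
  have "(\<lambda>w. A t (X t w) (\<mu> t) *v U w) \<in> borel_measurable (F t)" using AF U(1) by measurable
  moreover have "L2 M (\<lambda>w. A t (X t w) (\<mu> t) *v U w)"
    by (rule L2_matrix_mult(1)[OF U(2) AM, of K]) (use bd t P in \<open>simp add: bounded_derivs_def\<close>)
  ultimately have 1: "(LINT w|M. U w \<bullet> (transpose (A t (X t w) (\<mu> t)) *v y t w)) = 0"
    using orth by (simp add: inner_matrix_transpose[symmetric])
  have 2: "(LINT w'|M. transpose (B t (X t w') (\<mu> t) x) *v y t w') = 0" for x
  proof -
    define c where "c = (LINT w'|M. transpose (B t (X t w') (\<mu> t) x) *v y t w')"
    have BF: "(\<lambda>w'. B t (X t w') (\<mu> t) x) \<in> borel_measurable (F t)"
      by (rule flow_pair_section[OF B X_process t X_adapted[OF t]]) simp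
    have BM: "(\<lambda>w'. B t (X t w') (\<mu> t) x) \<in> borel_measurable M"
      by (rule flow_pair_section[OF B X_process t X_measurable[OF t]]) simp
    have Bb: "norm (B t (X t w') (\<mu> t) x) \<le> K" for w' using bd t P by (simp add: bounded_derivs_def)
    have cF: "(\<lambda>w'. B t (X t w') (\<mu> t) x *v c) \<in> borel_measurable (F t)" using BF by measurable
    have cs: "L2 M (\<lambda>w'. B t (X t w') (\<mu> t) x *v c)"
      by (rule L2_matrix_mult(1)[OF L2_const BM Bb])
    have BtM: "(\<lambda>w'. transpose (B t (X t w') (\<mu> t) x)) \<in> borel_measurable M" using BM by measurable
    have i: "integrable M (\<lambda>w'. transpose (B t (X t w') (\<mu> t) x) *v y t w')"
      using Bb by (intro L2_integrable L2_matrix_mult(1)[OF y BtM, of K]) simp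
    have "c \<bullet> c = (LINT w'|M. c \<bullet> (transpose (B t (X t w') (\<mu> t) x) *v y t w'))"
      using i by (subst (2) c_def) simp
    also have "\<dots> = (LINT w'|M. (B t (X t w') (\<mu> t) x *v c) \<bullet> y t w')"
      by (simp add: inner_matrix_transpose)
    also have "\<dots> = 0" by (rule orth[OF cF cs])
    finally show ?thesis by (simp add: c_def)
  qed
  have "(LINT w|M. U w \<bullet> linear_drift M X A B y t w) = (LINT w|M. U w \<bullet> (transpose (A t (X t w) (\<mu> t)) *v y t w))"
    unfolding linear_drift_def 2 by simp
  then show ?thesis using 1 by simp
qed

lemma direction_measurable:
  assumes v: "(\<lambda>(t, x). v t x) \<in> borel_measurable (borel \<Otimes>\<^sub>M borel)"
  shows "(\<lambda>(t, w). v t (X t w)) \<in> borel_measurable (dtP M T)"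
proof -
  have "fst \<in> borel_measurable (dtP M T)"
    using measurable_compose[OF fst_dtP measurable_restrict_space1[OF measurable_ident]] by (simp add: id_def)
  then have "(\<lambda>z. (fst z, X (fst z) (snd z))) \<in> measurable (dtP M T) (borel \<Otimes>\<^sub>M borel)"
    using continuous_process_dtP[OF X_process] by (intro measurable_Pair) (simp_all add: case_prod_beta')
  from measurable_compose[OF this v] show ?thesis by (simp add: case_prod_beta')
qed

lemma direction_L2_iff:
  assumes v: "(\<lambda>(t, x). v t x) \<in> borel_measurable (borel \<Otimes>\<^sub>M borel)"
  shows "L2 (dtP M T) (\<lambda>(t, w). v t (X t w)) \<longleftrightarrow>
    (\<integral>\<^sup>+w. (\<integral>\<^sup>+t\<in>{0..T}. ennreal ((norm (v t (X t w) :: real^'m))\<^sup>2) \<partial>lborel) \<partial>M) < \<infinity>"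
proof -
  note m = direction_measurable[OF v]
  have "(\<lambda>(t, w). ennreal ((norm (v t (X t w)))\<^sup>2)) \<in> borel_measurable (dtP M T)"
    using m by (simp add: case_prod_beta')
  from dtP_nn_integral[OF this] show ?thesis
    using m by (auto simp: sq_integrable_def integrable_iff_bounded case_prod_beta')
qed

text \<open>The expected loss is a quadratic polynomial in \<open>e\<close>.\<close>

lemma loss_derivative:
  fixes v :: "real \<Rightarrow> real^'d \<Rightarrow> real^'m"
  assumes a: "L2_dtP a"
    and v: "L2 (dtP M T) (\<lambda>(t, w). v t (X t w))"
  shows "((\<lambda>e. LINT w|M. mfam_loss M T \<sigma> X a (\<lambda>t x \<mu>. u t x \<mu> + e *\<^sub>R v t x) w) has_real_derivative
    (LINT (t, w)|dtP M T. (\<alpha> t w + transpose (\<sigma> t) *v a t w) \<bullet> v t (X t w))) (at 0)"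
proof -
  define p where "p t w = \<alpha> t w + transpose (\<sigma> t) *v a t w" for t w
  have p: "L2_dtP p"
    using L2_add[OF \<alpha>_L2_dtP \<sigma>_transpose_mult_L2[OF a]] by (simp add: p_def case_prod_beta')
  define I where "I q r = (LINT (t, w)|dtP M T. (q t w :: real^'m) \<bullet> r t w)" for q r :: "real \<Rightarrow> 'w \<Rightarrow> real^'m"
  define vX where "vX t w = v t (X t w)" for t w
  have eq: "(LINT w|M. mfam_loss M T \<sigma> X a (\<lambda>t x \<mu>. u t x \<mu> + e *\<^sub>R v t x) w) = (I p p + 2 * e * I p vX + e\<^sup>2 * I vX vX) / 2" for e
  proof -
    have s: "L2 (dtP M T) (\<lambda>z. (case z of (t, w) \<Rightarrow> p t w) + e *\<^sub>R (case z of (t, w) \<Rightarrow> v t (X t w)))"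
      by (intro L2_add L2_scaleR p v)
    have i: "integrable (dtP M T) (\<lambda>(t, w). (norm (p t w + e *\<^sub>R vX t w))\<^sup>2)"
      using L2_norm_sq[OF s] by (simp add: vX_def case_prod_beta')
    have L: "mfam_loss M T \<sigma> X a (\<lambda>t x \<mu>. u t x \<mu> + e *\<^sub>R v t x) w = (LINT t|lT. (norm (p t w + e *\<^sub>R vX t w))\<^sup>2) / 2" for w
      unfolding mfam_loss_def lT_integral p_def vX_def feedback_process_def by (simp add: add_ac)
    have "(LINT w|M. mfam_loss M T \<sigma> X a (\<lambda>t x \<mu>. u t x \<mu> + e *\<^sub>R v t x) w) = (LINT w|M. LINT t|lT. (norm (p t w + e *\<^sub>R vX t w))\<^sup>2) / 2"
      unfolding L by simp
    also have "(LINT w|M. LINT t|lT. (norm (p t w + e *\<^sub>R vX t w))\<^sup>2) = (LINT (t, w)|dtP M T. (norm (p t w + e *\<^sub>R vX t w))\<^sup>2)"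
      by (rule dtP_integral_snd[OF i])
    also have "\<dots> = (LINT (t, w)|dtP M T. p t w \<bullet> p t w + 2 * e * (p t w \<bullet> vX t w) + e\<^sup>2 * (vX t w \<bullet> vX t w))"
    proof -
      have "(norm (P + e *\<^sub>R Q))\<^sup>2 = P \<bullet> P + 2 * e * (P \<bullet> Q) + e\<^sup>2 * (Q \<bullet> Q)" for P Q :: "real^'m"
        unfolding power2_norm_eq_inner by (simp add: inner_add_left inner_add_right inner_commute algebra_simps)
          (simp add: power2_eq_square)
      then show ?thesis by simp
    qed
    also have "\<dots> = I p p + 2 * e * I p vX + e\<^sup>2 * I vX vX"
      unfolding I_def vX_def
      using L2_inner[OF p p] L2_inner[OF p v] L2_inner[OF v v] by (simp add: case_prod_beta')
    finally show ?thesis .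
  qed
  have "((\<lambda>e. (I p p + 2 * e * I p vX + e\<^sup>2 * I vX vX) / 2) has_real_derivative I p vX) (at 0)"
    by (auto intro!: derivative_eq_intros)
  then show ?thesis unfolding eq by (simp add: I_def p_def vX_def)
qed

text \<open>The function \<open>\<phi> B i\<close> itself serves as time profile of the direction,
  with the indicator of \<open>B\<close> in space: the vanishing derivative of the loss then says
  that the time integral of its square is zero.\<close>

lemma critical_orthogonal:
  fixes a :: "real \<Rightarrow> 'w \<Rightarrow> real^'d"
  assumes a: "continuous_process M T a" "\<And>t. t \<in> {0..T} \<Longrightarrow> L2norm M (a t) \<le> Ca"
    and crit: "stop_gradient_critical M T \<sigma> X a u"
  shows "AE t in lT. \<forall>B i. B \<in> sets borel \<longrightarrow> (LINT w:X t -` B \<inter> space M|M. (\<alpha> t w + transpose (\<sigma> t) *v a t w) $ i) = 0"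
proof -
  define p where "p t w = \<alpha> t w + transpose (\<sigma> t) *v a t w" for t w
  note a_sq = process_L2[OF a]
  have p: "L2_dtP p"
    using L2_add[OF \<alpha>_L2_dtP \<sigma>_transpose_mult_L2[OF a_sq]] by (simp add: p_def case_prod_beta')
  obtain Cs where Cs: "\<And>t. t \<in> {0..T} \<Longrightarrow> norm (\<sigma> t) \<le> Cs" "0 \<le> Cs" by (rule \<sigma>_bounded[OF \<sigma>_continuous]) blast
  obtain C where C: "\<And>t. t \<in> {0..T} \<Longrightarrow> L2norm M (\<alpha> t) \<le> C" by (rule \<alpha>_bounds) blast
  have as: "L2 M (a t)" if "t \<in> {0..T}" for t using a(1) that by (simp add: continuous_process_def)
  have ps: "L2 M (p t)" "L2norm M (p t) \<le> C + Cs * Ca" if t: "t \<in> {0..T}" for t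
  proof -
    note s = L2_matrix_mult[OF as[OF t], of "\<lambda>_. transpose (\<sigma> t)" Cs]
    have s': "L2 M (\<lambda>w. transpose (\<sigma> t) *v a t w)" "L2norm M (\<lambda>w. transpose (\<sigma> t) *v a t w) \<le> Cs * L2norm M (a t)"
      using s Cs(1)[OF t] Cs(2) by auto
    show "L2 M (p t)" unfolding p_def[abs_def] by (rule L2_add[OF \<alpha>_L2[OF t] s'(1)])
    have "L2norm M (p t) \<le> L2norm M (\<alpha> t) + L2norm M (\<lambda>w. transpose (\<sigma> t) *v a t w)"
      unfolding p_def[abs_def] by (rule L2norm_triangle[OF \<alpha>_L2[OF t] s'(1)])
    also have "\<dots> \<le> C + Cs * Ca" using C[OF t] s'(2) mult_left_mono[OF a(2)[OF t] Cs(2)] by linarith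
    finally show "L2norm M (p t) \<le> C + Cs * Ca" .
  qed
  define \<phi> where "\<phi> B i t = (LINT w|M. indicator B (X t w) * p t w $ i)" for B i t
  have main: "AE t in lT. \<phi> B i t = 0" if B: "B \<in> sets borel" for B and i :: 'm
  proof -
    have Bsq: "L2 M (\<lambda>w. indicator B (X t w) :: real)" if "t \<in> {0..T}" for t
      by (rule L2_bounded[where C = 1]) (use X_measurable[OF that] B in \<open>auto simp: indicator_def\<close>)
    have pi: "L2 M (\<lambda>w. p t w $ i)" if "t \<in> {0..T}" for t by (rule L2_component[OF ps(1)[OF that]])
    have \<phi>_bd: "\<bar>\<phi> B i t\<bar> \<le> C + Cs * Ca" if t: "t \<in> {0..T}" for t
    proof -
      have "\<bar>\<phi> B i t\<bar> \<le> (LINT w|M. \<bar>indicator B (X t w) * p t w $ i\<bar>)" unfolding \<phi>_def by (rule integral_abs_bound)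
      also have "\<dots> \<le> (LINT w|M. norm (p t w))"
      proof (rule integral_mono)
        show "integrable M (\<lambda>w. \<bar>indicator B (X t w) * p t w $ i\<bar>)"
          using L2_inner[OF Bsq[OF t] pi[OF t]] by (simp add: integrable_abs)
        show "integrable M (\<lambda>w. norm (p t w))" using L2_integrable[OF ps(1)[OF t]] by simp
        show "\<bar>indicator B (X t w) * p t w $ i\<bar> \<le> norm (p t w)" for w
          using component_le_norm_cart[of "p t w" i] by (auto simp: indicator_def)
      qed
      also have "\<dots> \<le> L2norm M (p t)" by (rule integral_norm_le_L2norm[OF ps(1)[OF t]])
      finally show ?thesis using ps(2)[OF t] by linarith
    qed
    have BX: "(\<lambda>(t, w). indicator B (X t w) :: real) \<in> borel_measurable (dtP M T)"
      using measurable_compose[OF continuous_process_dtP[OF X_process] borel_measurable_indicator[OF B]] by (simp add: case_prod_beta')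
    have BXsq: "L2 (dtP M T) (\<lambda>(t, w). indicator B (X t w) :: real)"
      by (rule L2_dtP_bounded[OF BX, of 1]) (simp add: indicator_def)
    have pisq: "L2 (dtP M T) (\<lambda>(t, w). p t w $ i)"
      using L2_component[OF p, of i] by (simp add: case_prod_beta')
    have int: "integrable (dtP M T) (\<lambda>(t, w). indicator B (X t w) * p t w $ i)"
      using L2_inner[OF BXsq pisq] by (simp add: case_prod_beta')
    have \<phi>i: "integrable lT (\<phi> B i)" unfolding \<phi>_def[abs_def] by (rule dtP_integrable_fst[OF int])
    \<comment> \<open>Directions must be Borel on the whole line, whereas \<open>\<phi> B i\<close>
      is known to be measurable on the horizon only.\<close>
    define \<psi> where "\<psi> t = (if t \<in> {0..T} then \<phi> B i t else 0)" for t
    have "\<phi> B i \<in> borel_measurable (restrict_space borel {0..T})"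
      using borel_measurable_integrable[OF \<phi>i] measurable_cong_sets[OF sets_restrict_space_cong[OF sets_lborel, of "{0..T}"] refl] by auto
    then have "(\<lambda>t. indicator {0..T} t *\<^sub>R \<phi> B i t) \<in> borel_measurable borel"
      by (subst (asm) borel_measurable_restrict_space_iff) auto
    moreover have "\<psi> = (\<lambda>t. indicator {0..T} t *\<^sub>R \<phi> B i t)" by (auto simp: \<psi>_def indicator_def)
    ultimately have \<psi>m: "\<psi> \<in> borel_measurable borel" by simp
    have \<psi>b: "\<bar>\<psi> t\<bar> \<le> C + Cs * Ca" for t
      using \<phi>_bd[of t] \<phi>_bd[of 0] T_pos by (auto simp: \<psi>_def)
    define v :: "real \<Rightarrow> real^'d \<Rightarrow> real^'m" where "v t x = (\<psi> t * indicator B x) *\<^sub>R axis i 1" for t x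
    have vm: "(\<lambda>(t, x). v t x) \<in> borel_measurable (borel \<Otimes>\<^sub>M borel)"
      unfolding v_def case_prod_beta' using \<psi>m B by measurable
    have vsq: "L2 (dtP M T) (\<lambda>(t, w). v t (X t w))"
      by (rule L2_dtP_bounded[OF direction_measurable[OF vm], of "C + Cs * Ca"])
        (use \<psi>b order_trans[OF abs_ge_zero \<psi>b] in \<open>auto simp: v_def norm_axis_1 indicator_def\<close>)
    have "((\<lambda>e. LINT w|M. mfam_loss M T \<sigma> X a (\<lambda>t x \<mu>. u t x \<mu> + e *\<^sub>R v t x) w) has_real_derivative 0) (at 0)"
      using crit vm vsq direction_L2_iff[OF vm] unfolding stop_gradient_critical_def by blast
    from DERIV_unique[OF loss_derivative[OF a_sq vsq] this]
    have 0: "(LINT (t, w)|dtP M T. p t w \<bullet> v t (X t w)) = 0" by (simp add: p_def)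
    have "(LINT (t, w)|dtP M T. p t w \<bullet> v t (X t w)) = (LINT t|lT. LINT w|M. p t w \<bullet> v t (X t w))"
      using L2_inner[OF p vsq] by (intro dtP_integral_fst[symmetric]) (simp add: case_prod_beta')
    also have "\<dots> = (LINT t|lT. \<psi> t * \<phi> B i t)"
      by (intro Bochner_Integration.integral_cong refl) (simp add: v_def inner_axis \<phi>_def mult_ac flip: integral_mult_right_zero)
    also have "\<dots> = (LINT t|lT. (\<phi> B i t)\<^sup>2)"
      by (intro Bochner_Integration.integral_cong refl) (auto simp: \<psi>_def space_restrict_space power2_eq_square)
    finally have z: "(LINT t|lT. (\<phi> B i t)\<^sup>2) = 0" using 0 by simp
    have "integrable lT (\<lambda>t. (\<phi> B i t)\<^sup>2)"
    proof (rule Bochner_Integration.integrable_bound)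
      show "integrable lT (\<lambda>t. (C + Cs * Ca) * \<phi> B i t)" using \<phi>i by simp
      show "(\<lambda>t. (\<phi> B i t)\<^sup>2) \<in> borel_measurable lT" using borel_measurable_integrable[OF \<phi>i] by simp
      show "AE t in lT. norm ((\<phi> B i t)\<^sup>2) \<le> norm ((C + Cs * Ca) * \<phi> B i t)"
      proof (intro AE_I2)
        fix t assume "t \<in> space lT"
        then have "\<bar>\<phi> B i t\<bar> \<le> C + Cs * Ca" using \<phi>_bd by (simp add: space_restrict_space)
        then have "\<bar>\<phi> B i t\<bar> * \<bar>\<phi> B i t\<bar> \<le> \<bar>C + Cs * Ca\<bar> * \<bar>\<phi> B i t\<bar>" by (intro mult_right_mono) auto
        then show "norm ((\<phi> B i t)\<^sup>2) \<le> norm ((C + Cs * Ca) * \<phi> B i t)" by (simp add: power2_eq_square abs_mult)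
      qed
    qed
    from integral_nonneg_eq_0_iff_AE[OF this] z show ?thesis by simp
  qed
  obtain \<B> :: "(real^'d) set set" where \<B>: "countable \<B>" "Int_stable \<B>" "UNIV \<in> \<B>" "sets borel = sigma_sets UNIV \<B>"
    using borel_countable_pi_system .
  have \<B>_sub: "\<B> \<subseteq> sets borel" unfolding \<B>(4) by auto
  have "AE t in lT. \<forall>B\<in>\<B>. \<forall>i. \<phi> B i t = 0"
    unfolding AE_ball_countable[OF \<B>(1)] AE_all_countable using main \<B>_sub by blast
  then show ?thesis
  proof (rule AE_mp, intro AE_I2 impI allI)
    fix t B and i :: 'm assume "t \<in> space lT" and z: "\<forall>B\<in>\<B>. \<forall>i. \<phi> B i t = 0" and B: "B \<in> sets (borel :: (real^'d) measure)"
    then have t: "t \<in> {0..T}" by (simp add: space_restrict_space)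
    have X_fun: "X t \<in> space M \<rightarrow> UNIV" by simp
    have ind: "(LINT w:X t -` S \<inter> space M|M. p t w $ i) = \<phi> S i t" for S
      unfolding set_lebesgue_integral_def \<phi>_def
      by (intro Bochner_Integration.integral_cong refl) (auto simp: indicator_def)
    have "(LINT w:X t -` B \<inter> space M|M. p t w $ i) = 0"
    proof (rule set_integral_zero_sigma_sets[where G = "{X t -` A \<inter> space M | A. A \<in> \<B>}"])
      show "Int_stable {X t -` A \<inter> space M | A. A \<in> \<B>}"
      proof (rule Int_stableI)
        fix a b assume "a \<in> {X t -` A \<inter> space M | A. A \<in> \<B>}" "b \<in> {X t -` A \<inter> space M | A. A \<in> \<B>}"
        then obtain A A' where "a = X t -` A \<inter> space M" "A \<in> \<B>" "b = X t -` A' \<inter> space M" "A' \<in> \<B>" by auto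
        moreover have "A \<inter> A' \<in> \<B>" using Int_stableD[OF \<B>(2)] calculation by blast
        ultimately show "a \<inter> b \<in> {X t -` A \<inter> space M | A. A \<in> \<B>}" by (intro CollectI exI[of _ "A \<inter> A'"]) auto
      qed
      show "{X t -` A \<inter> space M | A. A \<in> \<B>} \<subseteq> sets M"
        using measurable_sets[OF X_measurable[OF t]] \<B>_sub by auto
      show "integrable M (\<lambda>w. p t w $ i)" by (rule L2_integrable[OF L2_component[OF ps(1)[OF t]]])
      show "(LINT w:A|M. p t w $ i) = 0" if "A \<in> {X t -` A \<inter> space M | A. A \<in> \<B>}" for A
        using that z ind by auto
      have "\<phi> UNIV i t = 0" using z \<B>(3) by blast
      then show "(LINT w|M. p t w $ i) = 0" by (simp add: \<phi>_def)
      show "X t -` B \<inter> space M \<in> sigma_sets (space M) {X t -` A \<inter> space M | A. A \<in> \<B>}"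
        using sigma_sets_vimage_commute[OF X_fun, of \<B>] B unfolding \<B>(4) by blast
    qed
    then show "(LINT w:X t -` B \<inter> space M|M. (\<alpha> t w + transpose (\<sigma> t) *v a t w) $ i) = 0" by (simp add: p_def)
  qed
qed

text \<open>A direction evaluated along the state is past-measurable at every time and
  square-integrable at almost every time, hence an eligible test variable under the time
  integral.\<close>

lemma critical_if_orthogonal:
  fixes a :: "real \<Rightarrow> 'w \<Rightarrow> real^'d"
  assumes a: "continuous_process M T a" "\<And>t. t \<in> {0..T} \<Longrightarrow> L2norm M (a t) \<le> Ca"
    and orth: "AE t in lT. \<forall>V. V \<in> borel_measurable (F t) \<longrightarrow> L2 M V \<longrightarrow>
      (LINT w|M. V w \<bullet> (\<alpha> t w + transpose (\<sigma> t) *v a t w)) = 0"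
  shows "stop_gradient_critical M T \<sigma> X a u"
  unfolding stop_gradient_critical_def
proof (intro allI impI)
  fix v :: "real \<Rightarrow> real^'d \<Rightarrow> real^'m"
  assume vm: "(\<lambda>(t, x). v t x) \<in> borel_measurable (borel \<Otimes>\<^sub>M borel)"
    and "(\<integral>\<^sup>+w. (\<integral>\<^sup>+t\<in>{0..T}. ennreal ((norm (v t (X t w)))\<^sup>2) \<partial>lborel) \<partial>M) < \<infinity>"
  then have v: "L2 (dtP M T) (\<lambda>(t, w). v t (X t w))" using direction_L2_iff[OF vm] by simp
  note a_sq = process_L2[OF a]
  have p: "L2 (dtP M T) (\<lambda>(t, w). \<alpha> t w + transpose (\<sigma> t) *v a t w)"
    using L2_add[OF \<alpha>_L2_dtP \<sigma>_transpose_mult_L2[OF a_sq]] by (simp add: case_prod_beta')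
  have "(LINT (t, w)|dtP M T. (\<alpha> t w + transpose (\<sigma> t) *v a t w) \<bullet> v t (X t w))
      = (LINT t|lT. LINT w|M. (\<alpha> t w + transpose (\<sigma> t) *v a t w) \<bullet> v t (X t w))"
    using L2_inner[OF p v] by (intro dtP_integral_fst[symmetric]) (simp add: case_prod_beta')
  also have "\<dots> = 0"
  proof (rule integral_eq_zero_AE)
    show "AE t in lT. (LINT w|M. (\<alpha> t w + transpose (\<sigma> t) *v a t w) \<bullet> v t (X t w)) = 0"
      using orth dtP_AE_L2[OF v] AE_space
    proof eventually_elim
      case (elim t)
      then have t: "t \<in> {0..T}" by (simp add: space_restrict_space)
      have "v t \<in> borel_measurable borel" using measurable_Pair2[OF vm, of t] by simp
      from measurable_compose[OF X_adapted[OF t] this] elim show ?case by (simp add: inner_commute)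
    qed
  qed
  finally show "((\<lambda>e. LINT w|M. mfam_loss M T \<sigma> X a (\<lambda>t x \<mu>. u t x \<mu> + e *\<^sub>R v t x) w) has_real_derivative 0) (at 0)"
    using loss_derivative[OF a_sq v] by simp
qed

text \<open>If \<open>\<alpha> + \<sigma>\<^sup>T a\<close> is orthogonal to the past then in particular \<open>\<alpha>\<close> is the negative projection of \<open>\<sigma>\<^sup>T a\<close>
  on the present state.\<close>

lemma feedback_eq_cond_exp:
  fixes a :: "'w \<Rightarrow> real^'d"
  assumes t: "t \<in> {0..T}" and a: "L2 M a"
    and orth: "\<And>V. V \<in> borel_measurable (F t) \<Longrightarrow> L2 M V \<Longrightarrow>
      (LINT w|M. V w \<bullet> (\<alpha> t w + transpose (\<sigma> t) *v a w)) = 0"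
  shows "AE w in M. u t (X t w) (\<mu> t) = - (transpose (\<sigma> t) *v cond_exp_given M (X t) a w)"
proof -
  define SX where "SX = vimage_algebra (space M) (X t) borel"
  have SX: "sets SX = {X t -` B \<inter> space M | B. B \<in> sets borel}" "space SX = space M"
    by (auto simp: SX_def sets_vimage_algebra2)
  have subX: "subalgebra M SX"
    using measurable_sets[OF X_measurable[OF t]] by (auto simp: subalgebra_def SX)
  have SXF: "Y \<in> measurable (F t) N" if "Y \<in> measurable SX N" for Y and N :: "'z measure"
    using that measurable_sets[OF X_adapted[OF t]] by (auto simp: measurable_def SX)
  have XS: "X t \<in> borel_measurable SX" unfolding SX_def by (rule measurable_vimage_algebra1) simp
  define P where "P = L2_projection M SX a"
  note P = L2_projection[OF subX a, folded P_def]
  have ce: "cond_exp_given M (X t) a = P"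
    unfolding P_def SX_def L2_projection_def[abs_def] cond_exp_given_def[abs_def] ..
  \<comment> \<open>The residual is a function of \<open>X t\<close>, hence itself an eligible test
    variable; testing with it yields its squared norm.\<close>
  define R where "R w = \<alpha> t w + transpose (\<sigma> t) *v P w" for w
  have \<alpha>S: "\<alpha> t \<in> borel_measurable SX"
    unfolding feedback_process_def[abs_def] by (rule flow_section[OF u_flow_regular X_process t XS])
  have sP: "L2 M (\<lambda>w. transpose (\<sigma> t) *v Q w)" if "L2 M Q" for Q :: "'w \<Rightarrow> real^'d"
    by (rule L2_matrix_mult(1)[OF that]) auto
  have Rs: "L2 M R" unfolding R_def[abs_def] by (rule L2_add[OF \<alpha>_L2[OF t] sP[OF P(2)]])
  have RS: "R \<in> borel_measurable SX" unfolding R_def[abs_def] using \<alpha>S P(1) by measurable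
  have sRS: "(\<lambda>w. \<sigma> t *v R w) \<in> borel_measurable SX" using RS by measurable
  have sR: "L2 M (\<lambda>w. \<sigma> t *v R w)" by (rule L2_matrix_mult(1)[OF Rs]) auto
  have adj: "R w \<bullet> (transpose (\<sigma> t) *v q) = (\<sigma> t *v R w) \<bullet> q" for w q
    by (simp add: inner_matrix_transpose)
  have "(L2norm M R)\<^sup>2 = (LINT w|M. R w \<bullet> \<alpha> t w + (\<sigma> t *v R w) \<bullet> P w)"
    unfolding L2norm_power2_inner adj[symmetric] by (subst (2) R_def) (simp add: inner_add_right)
  also have "\<dots> = ip R (\<alpha> t) + (LINT w|M. (\<sigma> t *v R w) \<bullet> P w)"
    using L2_inner[OF Rs \<alpha>_L2[OF t]] L2_inner[OF sR P(2)] by simp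
  also have "(LINT w|M. (\<sigma> t *v R w) \<bullet> P w) = (LINT w|M. (\<sigma> t *v R w) \<bullet> a w)"
    using P(3)[OF sRS sR] by simp
  also have "ip R (\<alpha> t) + (LINT w|M. (\<sigma> t *v R w) \<bullet> a w)
      = (LINT w|M. R w \<bullet> (\<alpha> t w + transpose (\<sigma> t) *v a w))"
    using L2_inner[OF Rs \<alpha>_L2[OF t]] L2_inner[OF sR a] by (simp add: inner_add_right adj)
  also have "\<dots> = 0" by (rule orth[OF SXF[OF RS] Rs])
  finally have "L2norm M R = 0" by simp
  from L2norm_eq_0_AE[OF Rs this] show ?thesis
    unfolding ce by eventually_elim (simp add: R_def feedback_process_def eq_neg_iff_add_eq_0)
qed

end

section \<open>Conditional expectations of the adjoints given the past\<close>

lemma gderiv_unique: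
  fixes h :: "real^'d \<Rightarrow> real"
  assumes "GDERIV h x :> D" "GDERIV h x :> D'" shows "D = D'"
proof -
  have "(\<lambda>v. v \<bullet> D) = (\<lambda>v. v \<bullet> D')"
    using assms unfolding gderiv_def by (rule has_derivative_unique)
  then show ?thesis by (metis vector_eq_ldot)
qed

context mean_field_feedback
begin

lemma copy_integrable:
  fixes y :: "'w \<Rightarrow> real^'k"
  assumes t: "t \<in> {0..T}" and B: "flow_regular_pair M T B"
    and bd: "bounded_derivs T K K A B" and y: "L2 M y"
  shows "integrable M (\<lambda>w'. transpose (B t (X t w') (\<mu> t) x) *v y w')"
proof -
  have "(\<lambda>w'. B t (X t w') (\<mu> t) x) \<in> borel_measurable M"
    by (rule flow_pair_section[OF B X_process t X_measurable[OF t]]) simp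
  then have m: "(\<lambda>w'. transpose (B t (X t w') (\<mu> t) x)) \<in> borel_measurable M" by measurable
  show ?thesis
    by (rule L2_integrable[OF L2_matrix_mult(1)[OF y m, of K]])
      (use bd t \<mu>_in_P2[OF t] in \<open>simp add: bounded_derivs_def\<close>)
qed

lemma linear_drift_diff:
  fixes y z :: "real \<Rightarrow> 'w \<Rightarrow> real^'k"
  assumes t: "t \<in> {0..T}" and B: "flow_regular_pair M T B"
    and bd: "bounded_derivs T K K A B" and y: "L2 M (y t)" and z: "L2 M (z t)"
  shows "linear_drift M X A B (\<lambda>t w. y t w - z t w) t w = linear_drift M X A B y t w - linear_drift M X A B z t w"
  using copy_integrable[OF t B bd y] copy_integrable[OF t B bd z]
  by (simp add: linear_drift_def matrix_vector_mult_diff_distrib)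

lemma linear_drift_zero:
  fixes e :: "real \<Rightarrow> 'w \<Rightarrow> real^'d"
  assumes A: "flow_regular M T A" and B: "flow_regular_pair M T B"
    and bd: "bounded_derivs T K K A B"
    and e: "\<And>s. s \<in> {0..T} \<Longrightarrow> L2 M (e s)" "\<And>s. s \<in> {0..T} \<Longrightarrow> L2norm M (e s) \<le> C"
    and eq: "\<And>t U. t \<in> {0..T} \<Longrightarrow> U \<in> borel_measurable (F t) \<Longrightarrow> L2 M U \<Longrightarrow>
      ip U (e t) = (LINT s|lT. indicator {t..T} s * (LINT w|M. U w \<bullet> linear_drift M X A B e s w))"
    and t: "t \<in> {0..T}" and U: "U \<in> borel_measurable (F t)" "L2 M U"
  shows "ip U (e t) = 0"
proof (rule linear_backward_zero[where A = "\<lambda>s w. transpose (A s (X s w) (\<mu> s))" and K = K and C = C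
      and B = "\<lambda>s w' w. transpose (B s (X s w') (\<mu> s) (X s w))", OF _ _ _ _ _ e _ t U])
  show "(\<lambda>w. transpose (A s (X s w) (\<mu> s))) \<in> borel_measurable (F s)" if "s \<in> {0..T}" for s
    by (intro transpose_measurable flow_section[OF A X_process that X_adapted[OF that]])
  show "norm (transpose (A s (X s w) (\<mu> s))) \<le> K" if "s \<in> {0..T}" for s w
    using bd that \<mu>_in_P2[OF that] by (simp add: bounded_derivs_def)
  show "(\<lambda>w'. transpose (B s (X s w') (\<mu> s) (X s w))) \<in> borel_measurable (F s)" if "s \<in> {0..T}" for s w
    by (intro transpose_measurable flow_pair_section[OF B X_process that X_adapted[OF that]]) simp
  show "norm (transpose (B s (X s w') (\<mu> s) (X s w))) \<le> K" if "s \<in> {0..T}" for s w w'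
    using bd that \<mu>_in_P2[OF that] by (simp add: bounded_derivs_def)
  show "(\<lambda>w. LINT w'|M. transpose (B s (X s w') (\<mu> s) (X s w)) *v e s w') \<in> borel_measurable M" if "s \<in> {0..T}" for s
    by (rule copy_average_measurable[OF X_process that B L2_measurable[OF e(1)[OF that]] X_measurable[OF that]])
qed (use eq in \<open>simp_all add: linear_drift_def\<close>)

lemma growth_along_flow:
  assumes "linear_growth_derivs T k l"
  obtains C where "0 \<le> C" "\<And>t x. t \<in> {0..T} \<Longrightarrow> norm (k t x (\<mu> t)) \<le> C * (1 + norm x + sqrt (moment2 (\<mu> t)))"
    "\<And>t x y. t \<in> {0..T} \<Longrightarrow> norm (l t x (\<mu> t) y) \<le> C * (1 + norm x + sqrt (moment2 (\<mu> t)) + norm y)"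
proof -
  obtain C where C: "\<And>t x \<nu>. t \<in> {0..T} \<Longrightarrow> \<nu> \<in> P2 \<Longrightarrow> norm (k t x \<nu>) \<le> C * (1 + norm x + sqrt (moment2 \<nu>))"
    "\<And>t x \<nu> y. t \<in> {0..T} \<Longrightarrow> \<nu> \<in> P2 \<Longrightarrow> norm (l t x \<nu> y) \<le> C * (1 + norm x + sqrt (moment2 \<nu>) + norm y)"
    using assms unfolding linear_growth_derivs_def by blast
  have m0: "0 \<le> sqrt (moment2 (\<mu> t))" for t by (simp add: moment2_def)
  show ?thesis
  proof (rule that[of "\<bar>C\<bar>"])
    fix t x y assume t: "t \<in> {0..T}"
    show "norm (k t x (\<mu> t)) \<le> \<bar>C\<bar> * (1 + norm x + sqrt (moment2 (\<mu> t)))"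
      by (rule order_trans[OF C(1)[OF t \<mu>_in_P2[OF t]] mult_right_mono[OF abs_ge_self]]) (intro add_nonneg_nonneg m0; simp)
    show "norm (l t x (\<mu> t) y) \<le> \<bar>C\<bar> * (1 + norm x + sqrt (moment2 (\<mu> t)) + norm y)"
      by (rule order_trans[OF C(2)[OF t \<mu>_in_P2[OF t]] mult_right_mono[OF abs_ge_self]]) (intro add_nonneg_nonneg m0; simp)
  qed simp
qed

lemma source_bounds:
  assumes k: "flow_regular M T k" and l: "flow_regular_pair M T l" and gr: "linear_growth_derivs T k l"
  obtains C where "\<And>t. t \<in> {0..T} \<Longrightarrow> L2 M (source_drift M X k l t)"
    "\<And>t. t \<in> {0..T} \<Longrightarrow> L2norm M (source_drift M X k l t) \<le> C"
    "\<And>t w. t \<in> {0..T} \<Longrightarrow> integrable M (\<lambda>w'. l t (X t w') (\<mu> t) (X t w))"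
proof -
  obtain C where C: "0 \<le> C" "\<And>t x. t \<in> {0..T} \<Longrightarrow> norm (k t x (\<mu> t)) \<le> C * (1 + norm x + sqrt (moment2 (\<mu> t)))"
    "\<And>t x y. t \<in> {0..T} \<Longrightarrow> norm (l t x (\<mu> t) y) \<le> C * (1 + norm x + sqrt (moment2 (\<mu> t)) + norm y)"
    by (rule growth_along_flow[OF gr]) blast
  obtain CX where CX: "0 \<le> CX" "\<And>t. t \<in> {0..T} \<Longrightarrow> L2norm M (X t) \<le> CX" by (rule X_bound) blast
  show ?thesis
  proof (rule that[of "C * (2 + 5 * CX)"])
    fix t assume t: "t \<in> {0..T}"
    note sb = source_drift_bounds[OF X_process t k l C(1) C(2)[OF t] C(3)[OF t]]
    show "L2 M (source_drift M X k l t)" by (rule sb(1))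
    show "integrable M (\<lambda>w'. l t (X t w') (\<mu> t) (X t w))" for w by (rule sb(3))
    show "L2norm M (source_drift M X k l t) \<le> C * (2 + 5 * CX)"
      using CX(2)[OF t] C(1) by (intro order_trans[OF sb(2)] mult_left_mono) auto
  qed
qed

lemma prog_measurable_dtP:
  assumes "prog_measurable F T A" shows "measurable_dtP A"
proof -
  have m: "(\<lambda>(t, w). A t w) \<in> borel_measurable (restrict_space borel {0..T} \<Otimes>\<^sub>M F T)"
    using assms T_pos by (simp add: prog_measurable_def)
  have FT: "(\<lambda>w. w) \<in> measurable M (F T)"
    using subalgebra_F[OF order_refl] by (auto simp: measurable_def subalgebra_def)
  have "(\<lambda>z. (fst z, snd z)) \<in> measurable (restrict_space borel {0..T} \<Otimes>\<^sub>M M) (restrict_space borel {0..T} \<Otimes>\<^sub>M F T)"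
    by (rule measurable_Pair[OF measurable_fst measurable_compose[OF measurable_snd FT]])
  from measurable_compose[OF this m] show ?thesis unfolding measurable_dtP_iff by (simp add: case_prod_beta')
qed

lemma prog_measurable_section:
  assumes "prog_measurable F T A" "t \<in> {0..T}" shows "A t \<in> borel_measurable (F t)"
proof -
  have m: "(\<lambda>(s, w). A s w) \<in> borel_measurable (restrict_space borel {0..t} \<Otimes>\<^sub>M F t)"
    using assms by (simp add: prog_measurable_def)
  have "(\<lambda>w. (t, w)) \<in> measurable (F t) (restrict_space borel {0..t} \<Otimes>\<^sub>M F t)"
    using assms(2) by (intro measurable_Pair) (auto simp: space_restrict_space)
  from measurable_compose[OF this m] show ?thesis by simp
qed

lemma prog_sq_integrable_dtP:
  assumes "prog_sq_integrable M F T A" shows "L2_dtP A"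
proof -
  have m: "measurable_dtP A"
    by (rule prog_measurable_dtP) (use assms in \<open>simp add: prog_sq_integrable_def\<close>)
  then have m2: "(\<lambda>(t, w). ennreal ((norm (A t w))\<^sup>2)) \<in> borel_measurable (dtP M T)"
    by (simp add: case_prod_beta')
  have "(\<integral>\<^sup>+(t, w). ennreal ((norm (A t w))\<^sup>2) \<partial>dtP M T) < \<infinity>"
    using assms dtP_nn_integral[OF m2] by (simp add: prog_sq_integrable_def)
  then show ?thesis using m by (simp add: sq_integrable_def integrable_iff_bounded case_prod_beta')
qed

lemma growth_f: "linear_growth_derivs T fx fm" and growth_g: "linear_growth_derivs T (\<lambda>_. gx) (\<lambda>_. gm)"
  using coefficients by (simp_all add: mf_coefficients_def)

lemmas flow_b = C1_vec_jointly_continuous[OF b_C1] and flow_u = C1_vec_jointly_continuous[OF u_C1]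
  and flow_f = C1_scalar_jointly_continuous[OF f_C1] and flow_g = C1_scalar_jointly_continuous[OF g_C1]

lemma full_drift_L2:
  fixes y :: "real \<Rightarrow> 'w \<Rightarrow> real^'d"
  assumes y: "measurable_dtP y"
      "\<And>t. t \<in> {0..T} \<Longrightarrow> L2 M (y t)" "\<And>t. t \<in> {0..T} \<Longrightarrow> L2norm M (y t) \<le> C"
  obtains C' where "\<And>t. t \<in> {0..T} \<Longrightarrow> L2 M (\<lambda>w. linear_drift M X bx bm y t w + source_drift M X fx fm t w)"
    "\<And>t. t \<in> {0..T} \<Longrightarrow> L2norm M (\<lambda>w. linear_drift M X bx bm y t w + source_drift M X fx fm t w) \<le> C'"
    "L2 (dtP M T) (\<lambda>(t, w). linear_drift M X bx bm y t w + source_drift M X fx fm t w)"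
proof -
  obtain K where K: "0 \<le> K" "bounded_derivs T K K bx bm" by (rule b_bounded_derivs) blast
  obtain Cs where Cs: "\<And>t. t \<in> {0..T} \<Longrightarrow> L2 M (source_drift M X fx fm t)"
    "\<And>t. t \<in> {0..T} \<Longrightarrow> L2norm M (source_drift M X fx fm t) \<le> Cs"
    by (rule source_bounds[OF flow_f growth_f]) blast
  have lb: "L2 M (linear_drift M X bx bm y t)" "L2norm M (linear_drift M X bx bm y t) \<le> 2 * K * L2norm M (y t)"
    if t: "t \<in> {0..T}" for t
    using linear_drift_bounds(5,6)[OF X_process t flow_b K(2,1), of y] y(2)[OF t] by auto
  have 1: "L2 M (\<lambda>w. linear_drift M X bx bm y t w + source_drift M X fx fm t w)" if "t \<in> {0..T}" for t
    by (rule L2_add[OF lb(1)[OF that] Cs(1)[OF that]])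
  have 2: "L2norm M (\<lambda>w. linear_drift M X bx bm y t w + source_drift M X fx fm t w) \<le> 2 * K * C + Cs" if t: "t \<in> {0..T}" for t
  proof -
    have "2 * K * L2norm M (y t) \<le> 2 * K * C" using y(3)[OF t] K(1) by (intro mult_left_mono) auto
    with L2norm_triangle[OF lb(1)[OF t] Cs(1)[OF t]] lb(2)[OF t] Cs(2)[OF t] show ?thesis by linarith
  qed
  have "(\<lambda>z. (case z of (t, w) \<Rightarrow> linear_drift M X bx bm y t w) + (case z of (t, w) \<Rightarrow> source_drift M X fx fm t w)) \<in> borel_measurable (dtP M T)"
    by (intro borel_measurable_add linear_drift_measurable[OF X_process flow_b y(1)] source_drift_measurable[OF X_process flow_f])
  then have "(\<lambda>(t, w). linear_drift M X bx bm y t w + source_drift M X fx fm t w) \<in> borel_measurable (dtP M T)"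
    by (simp add: case_prod_beta')
  from process_L2_dtP[OF this 1 2] 1 2 show ?thesis using that by blast
qed

end

section \<open>The critical control and its lean adjoint\<close>

locale mean_field_critical = mean_field_feedback M T W X0 \<mu>0 \<sigma> b bx bm f fx fm g gx gm u ux um Ku X
  for M :: "'w measure" and T :: real and W :: "real \<Rightarrow> 'w \<Rightarrow> real^'m"
    and X0 :: "'w \<Rightarrow> real^'d" and \<mu>0 :: "(real^'d) measure"
    and \<sigma> :: "real \<Rightarrow> real^'m^'d"
    and b :: "('d, real^'d) coeff"
    and bx :: "('d, real^'d^'d) coeff"
    and bm :: "('d, real^'d \<Rightarrow> real^'d^'d) coeff"
    and f :: "('d, real) coeff"
    and fx :: "('d, real^'d) coeff"
    and fm :: "('d, real^'d \<Rightarrow> real^'d) coeff"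
    and g :: "real^'d \<Rightarrow> (real^'d) measure \<Rightarrow> real"
    and gx :: "real^'d \<Rightarrow> (real^'d) measure \<Rightarrow> real^'d"
    and gm :: "real^'d \<Rightarrow> (real^'d) measure \<Rightarrow> real^'d \<Rightarrow> real^'d"
    and u :: "('d, real^'m) coeff"
    and ux :: "('d, real^'d^'m) coeff"
    and um :: "('d, real^'d \<Rightarrow> real^'d^'m) coeff"
    and Ku :: real and X :: "real \<Rightarrow> 'w \<Rightarrow> real^'d" +
  fixes a :: "real \<Rightarrow> 'w \<Rightarrow> real^'d"
  assumes lean_adjoint: "is_adjoint M T X bx bm fx fm gx gm a"
    and critical: "stop_gradient_critical M T \<sigma> X a u"
begin

lemmas a_process = is_adjointD(1)[OF lean_adjoint] and a_L2 = is_adjointD(3)[OF lean_adjoint]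
  and a_terminal = is_adjointD(4)[OF lean_adjoint]

lemma a_bound: obtains C where "0 \<le> C" "\<And>t. t \<in> {0..T} \<Longrightarrow> L2norm M (a t) \<le> C"
proof -
  obtain C where C: "\<forall>t\<in>{0..T}. L2norm M (a t) \<le> C" using is_adjointD(2)[OF lean_adjoint] by blast
  then have "0 \<le> C" using order_trans[OF L2norm_nonneg, of M "a 0" C] T_pos by auto
  with C show ?thesis using that by blast
qed

lemmas a_dtP = continuous_process_dtP[OF a_process]

lemma a_L2_dtP: "L2_dtP a"
  by (rule a_bound) (rule process_L2[OF a_process])

text \<open>Minus the time derivative of the lean adjoint \<open>a\<close>.\<close>

definition D :: "real \<Rightarrow> 'w \<Rightarrow> real^'d" where
  "D t w = linear_drift M X bx bm a t w + source_drift M X fx fm t w"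

lemma D_bounds: obtains C where "\<And>t. t \<in> {0..T} \<Longrightarrow> L2 M (D t)" "\<And>t. t \<in> {0..T} \<Longrightarrow> L2norm M (D t) \<le> C"
    "L2_dtP D"
proof -
  obtain Ca where Ca: "0 \<le> Ca" "\<And>t. t \<in> {0..T} \<Longrightarrow> L2norm M (a t) \<le> Ca" by (rule a_bound) blast
  show ?thesis
    using full_drift_L2[OF a_dtP a_L2 Ca(2)] that unfolding D_def[abs_def] by blast
qed

lemma D_L2: "t \<in> {0..T} \<Longrightarrow> L2 M (D t)" by (rule D_bounds) blast
lemma D_L2_dtP: "L2_dtP D" by (rule D_bounds) blast

lemma a_backward: "w \<in> space M \<Longrightarrow> t \<in> {0..T} \<Longrightarrow> ((\<lambda>s. a s w) has_vector_derivative (- D t w)) (at t within {0..T})"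
  unfolding D_def by (rule is_adjointD(5)[OF lean_adjoint])

lemma a_equation:
  assumes t: "t \<in> {0..T}" and U: "L2 M U"
  shows "ip U (a t) = ip U (a T)
      + (LINT r|lT. indicator {t..T} r * ip U (D r))"
  using T_pos by (intro backward_equation_integral[OF D_L2_dtP a_backward _ _ t U] a_L2 t) auto

text \<open>The terminal value is a function of \<open>X T\<close>, and all of \<open>D s\<close>
  except the local term \<open>A a\<close> is a function of \<open>X s\<close>, the averaged term
  included; these are \<open>G t\<close>-measurable by \<open>X_future_measurable\<close>. Only the
  local linear term feeds the backward Gronwall argument.\<close>

lemma a_future_measurable:
  assumes t: "t \<in> {0..T}"
  shows "a t \<in> borel_measurable (G t)"
proof -
  obtain Ca where Ca: "0 \<le> Ca" "\<And>t. t \<in> {0..T} \<Longrightarrow> L2norm M (a t) \<le> Ca" by (rule a_bound) blast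
  obtain K where K: "0 \<le> K" "bounded_derivs T K K bx bm" by (rule b_bounded_derivs) blast
  have sub: "s \<in> {0..T}" if "s \<in> {t..T}" for s using that t by auto
  have T: "T \<in> {0..T}" using T_pos by simp
  have aT: "a T \<in> borel_measurable (G t)"
  proof -
    note XT = X_future_measurable[OF t, of T]
    have "source_drift M X (\<lambda>_. gx) (\<lambda>_. gm) T \<in> borel_measurable (G t)"
      unfolding source_drift_def[abs_def] using t
      by (intro borel_measurable_add flow_section[OF flow_g(1) X_process T XT] copy_average_measurable'[OF X_process T flow_g(2) XT]) auto
    then show ?thesis
      using a_terminal by (subst measurable_cong[of "G t" _ "source_drift M X (\<lambda>_. gx) (\<lambda>_. gm) T"]) auto
  qed
  show ?thesis
  proof (rule measurable_by_gronwall[where J = "\<lambda>s. {s..T}" and a = t and b = T and e = a and K = Ca and L = K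
        and h = "\<lambda>U r. ip U (D r)", OF _ _ order_refl subalgebra_G[OF t] null_sets_G])
    show "t \<in> {t..T}" using t by simp
    show "L2 M (a s)" if "s \<in> {t..T}" for s by (rule a_L2[OF sub[OF that]])
    show "L2norm M (a s) \<le> Ca" if "s \<in> {t..T}" for s by (rule Ca(2)[OF sub[OF that]])
    fix s and U :: "'w \<Rightarrow> real^'d"
    assume s: "s \<in> {t..T}" and U: "L2 M U"
      and orth: "\<And>V. V \<in> borel_measurable (G t) \<Longrightarrow> L2 M V \<Longrightarrow> ip U V = 0"
    note s0 = sub[OF s]
    show "ip U (a s) = (LINT r|lT. indicator {s..T} r * ip U (D r))"
      using a_equation[OF s0 U] orth[OF aT a_L2[OF T]] by simp
    fix P :: "'w \<Rightarrow> real^'d" assume P: "P \<in> borel_measurable (G t)" "L2 M P"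
    note XG = X_future_measurable[OF t s]
    define A where "A w = transpose (bx s (X s w) (\<mu> s))" for w
    have AG: "A \<in> borel_measurable (G t)" unfolding A_def[abs_def]
      by (intro transpose_measurable flow_section[OF flow_b(1) X_process s0 XG])
    have AM: "A \<in> borel_measurable M" by (rule measurable_from_subalg[OF subalgebra_G[OF t] AG])
    have Ab: "norm (A w) \<le> K" for w using K(2) s0 \<mu>_in_P2[OF s0] by (simp add: A_def bounded_derivs_def)
    define R where "R w = D s w - A w *v a s w" for w
    have aM: "a s \<in> borel_measurable M" using a_L2[OF s0] by measurable
    have R_eq: "R = (\<lambda>w. (LINT w'|M. transpose (bm s (X s w') (\<mu> s) (X s w)) *v a s w') + source_drift M X fx fm s w)"
      by (simp add: R_def[abs_def] D_def linear_drift_def A_def)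
    have RG: "R \<in> borel_measurable (G t)"
      unfolding R_eq source_drift_def[abs_def]
      by (intro borel_measurable_add copy_average_measurable[OF X_process s0 flow_b(2) aM XG]
          flow_section[OF flow_f(1) X_process s0 XG] copy_average_measurable'[OF X_process s0 flow_f(2) XG])
    have Aa: "L2 M (\<lambda>w. A w *v a s w)" by (rule L2_matrix_mult(1)[OF a_L2[OF s0] AM Ab])
    have Rs: "L2 M R" unfolding R_def[abs_def] by (rule L2_diff[OF D_L2[OF s0] Aa])
    have AP: "(\<lambda>w. A w *v P w) \<in> borel_measurable (G t)" using AG P(1) by measurable
    have APs: "L2 M (\<lambda>w. A w *v P w)" by (rule L2_matrix_mult(1)[OF P(2) AM Ab])
    have d: "L2 M (\<lambda>w. a s w - P w)" by (rule L2_diff[OF a_L2[OF s0] P(2)])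
    note Ad = L2_matrix_mult[OF d AM Ab]
    have "ip U (D s) = (LINT w|M. U w \<bullet> (A w *v (a s w - P w)) + U w \<bullet> (A w *v P w) + U w \<bullet> R w)"
      by (simp add: R_def inner_diff_right matrix_vector_mult_diff_distrib)
    also have "\<dots> = (LINT w|M. U w \<bullet> (A w *v (a s w - P w)))"
      using orth[OF AP APs] orth[OF RG Rs] L2_inner[OF U Ad(1)] L2_inner[OF U APs] L2_inner[OF U Rs] by simp
    also have "\<bar>\<dots>\<bar> \<le> L2norm M U * L2norm M (\<lambda>w. A w *v (a s w - P w))" by (rule L2_Cauchy_Schwarz[OF U Ad(1)])
    also have "\<dots> \<le> L2norm M U * (K * L2norm M (\<lambda>w. a s w - P w))" by (intro mult_left_mono Ad(2) K(1)) simp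
    finally show "\<bar>ip U (D s)\<bar> \<le> K * L2norm M U * L2norm M (\<lambda>w. a s w - P w)" by (simp add: mult_ac)
  qed (use t K in auto)
qed

definition p :: "real \<Rightarrow> 'w \<Rightarrow> real^'m" where "p t w = \<alpha> t w + transpose (\<sigma> t) *v a t w"

lemma \<sigma>a_L2: "L2 M Q \<Longrightarrow> L2 M (\<lambda>w. transpose (\<sigma> t) *v Q w)"
  by (rule L2_matrix_mult(1)) auto

lemma p_L2: "t \<in> {0..T} \<Longrightarrow> L2 M (p t)"
  unfolding p_def[abs_def] by (intro L2_add \<alpha>_L2 \<sigma>a_L2 a_L2)

lemma p_bound: obtains C where "\<And>t. t \<in> {0..T} \<Longrightarrow> L2norm M (p t) \<le> C"
proof -
  obtain Ca where Ca: "0 \<le> Ca" "\<And>t. t \<in> {0..T} \<Longrightarrow> L2norm M (a t) \<le> Ca" by (rule a_bound) blast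
  obtain Cs where Cs: "\<And>t. t \<in> {0..T} \<Longrightarrow> norm (\<sigma> t) \<le> Cs" "0 \<le> Cs" by (rule \<sigma>_bounded[OF \<sigma>_continuous]) blast
  obtain C where C: "\<And>t. t \<in> {0..T} \<Longrightarrow> L2norm M (\<alpha> t) \<le> C" by (rule \<alpha>_bounds) blast
  show ?thesis
  proof (rule that[of "C + Cs * Ca"])
    fix t assume t: "t \<in> {0..T}"
    have "L2norm M (\<lambda>w. transpose (\<sigma> t) *v a t w) \<le> Cs * L2norm M (a t)"
      using L2_matrix_mult(2)[OF a_L2[OF t], of "\<lambda>_. transpose (\<sigma> t)" Cs] Cs(1)[OF t] Cs(2) by simp
    with L2norm_triangle[OF \<alpha>_L2[OF t] \<sigma>a_L2[OF a_L2[OF t]], of t]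
      C[OF t] mult_left_mono[OF Ca(2)[OF t] Cs(2)]
    show "L2norm M (p t) \<le> C + Cs * Ca" unfolding p_def[abs_def] by linarith
  qed
qed

text \<open>The exceptional null set of times is the one of \<open>critical_orthogonal\<close>; it
  does not depend on the test variable \<open>V\<close>.\<close>

lemma p_orthogonal:
  "AE t in lT. \<forall>V. V \<in> borel_measurable (F t) \<longrightarrow> L2 M V \<longrightarrow> ip V (p t) = 0"
proof -
  obtain Ca where Ca: "0 \<le> Ca" "\<And>t. t \<in> {0..T} \<Longrightarrow> L2norm M (a t) \<le> Ca" by (rule a_bound) blast
  have "AE t in lT. \<forall>B i. B \<in> sets borel \<longrightarrow> (LINT w:X t -` B \<inter> space M|M. (\<alpha> t w + transpose (\<sigma> t) *v a t w) $ i) = 0"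
    by (rule critical_orthogonal[OF a_process _ critical]) (rule Ca(2))
  from this AE_space show ?thesis
  proof eventually_elim
    case (elim t)
    then have t: "t \<in> {0..T}" by (simp add: space_restrict_space)
    have \<alpha>G: "\<alpha> t \<in> borel_measurable (G t)"
      unfolding feedback_process_def[abs_def] by (rule flow_section[OF u_flow_regular X_process t X_measurable_G])
    have pG: "p t \<in> borel_measurable (G t)"
      unfolding p_def[abs_def] using \<alpha>G a_future_measurable[OF t] by measurable
    show ?case
      using orthogonal_to_past[OF t pG p_L2[OF t]] elim(1) unfolding p_def by blast
  qed
qed

text \<open>The chain rule identifies the Lions derivatives of \<open>btilde\<close> and \<open>ftilde\<close> only almost everywhere.\<close>

context
  fixes btx :: "('d, real^'d^'d) coeff"
    and btm :: "('d, real^'d \<Rightarrow> real^'d^'d) coeff"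
    and ftx :: "('d, real^'d) coeff"
    and ftm :: "('d, real^'d \<Rightarrow> real^'d) coeff"
    and c :: "real \<Rightarrow> 'w \<Rightarrow> real^'d" and Lx Lm :: real
  assumes bt: "C1_vec M T (btilde b \<sigma> u) btx btm" and bt_bounded: "bounded_derivs T Lx Lm btx btm"
    and ft: "C1_scalar M T (ftilde f u) ftx ftm"
    and basic_adjoint: "is_adjoint M T X btx btm ftx ftm gx gm c"
begin

lemma btx_eq:
  assumes t: "t \<in> {0..T}" shows "btx t x (\<mu> t) = bx t x (\<mu> t) + \<sigma> t ** ux t x (\<mu> t)"
proof -
  note P = \<mu>_in_P2[OF t]
  have b': "((\<lambda>x. b t x (\<mu> t)) has_derivative (\<lambda>v. bx t x (\<mu> t) *v v)) (at x)"
    and u': "((\<lambda>x. u t x (\<mu> t)) has_derivative (\<lambda>v. ux t x (\<mu> t) *v v)) (at x)"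
    and bt': "((\<lambda>x. btilde b \<sigma> u t x (\<mu> t)) has_derivative (\<lambda>v. btx t x (\<mu> t) *v v)) (at x)"
    using b_C1 u_C1 bt t P by (auto simp: C1_vec_def)
  have "((\<lambda>x. b t x (\<mu> t) + \<sigma> t *v u t x (\<mu> t)) has_derivative (\<lambda>v. bx t x (\<mu> t) *v v + \<sigma> t *v (ux t x (\<mu> t) *v v))) (at x)"
    by (rule has_derivative_add[OF b' bounded_linear.has_derivative[OF matrix_vector_mul_bounded_linear u']])
  from has_derivative_unique[OF bt'[unfolded btilde_def] this]
  have "btx t x (\<mu> t) *v v = (bx t x (\<mu> t) + \<sigma> t ** ux t x (\<mu> t)) *v v" for v
    by (simp add: fun_eq_iff matrix_vector_mult_add_rdistrib matrix_vector_mul_assoc)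
  then show ?thesis by (simp add: matrix_eq)
qed

lemma ftx_eq:
  assumes t: "t \<in> {0..T}" shows "ftx t x (\<mu> t) = fx t x (\<mu> t) + transpose (ux t x (\<mu> t)) *v u t x (\<mu> t)"
proof -
  note P = \<mu>_in_P2[OF t]
  have f': "((\<lambda>x. f t x (\<mu> t)) has_derivative (\<lambda>v. v \<bullet> fx t x (\<mu> t))) (at x)"
    using f_C1 t P by (auto simp: C1_scalar_def gderiv_def)
  have u': "((\<lambda>x. u t x (\<mu> t)) has_derivative (\<lambda>v. ux t x (\<mu> t) *v v)) (at x)"
    using u_C1 t P by (auto simp: C1_vec_def)
  have "((\<lambda>x. f t x (\<mu> t) + (1 / 2) *\<^sub>R (u t x (\<mu> t) \<bullet> u t x (\<mu> t))) has_derivative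
     (\<lambda>v. v \<bullet> fx t x (\<mu> t) + (1 / 2) *\<^sub>R (u t x (\<mu> t) \<bullet> (ux t x (\<mu> t) *v v) + (ux t x (\<mu> t) *v v) \<bullet> u t x (\<mu> t)))) (at x)"
    by (rule has_derivative_add[OF f' has_derivative_scaleR_right[OF has_derivative_inner[OF u' u']]])
  moreover have "v \<bullet> fx t x (\<mu> t) + (1 / 2) *\<^sub>R (u t x (\<mu> t) \<bullet> (ux t x (\<mu> t) *v v) + (ux t x (\<mu> t) *v v) \<bullet> u t x (\<mu> t))
     = v \<bullet> (fx t x (\<mu> t) + transpose (ux t x (\<mu> t)) *v u t x (\<mu> t))" for v
    by (simp add: inner_commute[of "u t x (\<mu> t)"] inner_matrix_transpose inner_add_right)
  ultimately have "GDERIV (\<lambda>x. ftilde f u t x (\<mu> t)) x :> fx t x (\<mu> t) + transpose (ux t x (\<mu> t)) *v u t x (\<mu> t)"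
    by (simp add: gderiv_def ftilde_def power2_norm_eq_inner)
  moreover have "GDERIV (\<lambda>x. ftilde f u t x (\<mu> t)) x :> ftx t x (\<mu> t)" using ft t P by (auto simp: C1_scalar_def)
  ultimately show ?thesis using gderiv_unique by blast
qed

lemma btm_eq:
  assumes t: "t \<in> {0..T}"
  shows "AE w in M. btm t x (\<mu> t) (X t w) = bm t x (\<mu> t) (X t w) + \<sigma> t ** um t x (\<mu> t) (X t w)"
proof (rule lions_derivative_vec_unique[OF X_L2[OF t]])
  note P = \<mu>_in_P2[OF t]
  show "has_lions_derivative_vec M (btilde b \<sigma> u t x) (btm t x (\<mu> t)) (\<mu> t)" using bt t P by (auto simp: C1_vec_def)
  have "has_lions_derivative_vec M (b t x) (bm t x (\<mu> t)) (\<mu> t)" "has_lions_derivative_vec M (u t x) (um t x (\<mu> t)) (\<mu> t)"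
    using b_C1 u_C1 t P by (auto simp: C1_vec_def)
  from has_lions_derivative_vec_add[OF this(1) has_lions_derivative_vec_matrix_mult[OF this(2), of "\<sigma> t"]]
  show "has_lions_derivative_vec M (btilde b \<sigma> u t x) (\<lambda>y. bm t x (\<mu> t) y + \<sigma> t ** um t x (\<mu> t) y) (\<mu> t)"
    by (simp add: btilde_def[abs_def])
qed

lemma ftm_eq:
  assumes t: "t \<in> {0..T}"
  shows "AE w in M. ftm t x (\<mu> t) (X t w) = fm t x (\<mu> t) (X t w) + transpose (um t x (\<mu> t) (X t w)) *v u t x (\<mu> t)"
proof (rule lions_derivative_unique[OF X_L2[OF t]])
  note P = \<mu>_in_P2[OF t]
  show "has_lions_derivative M (ftilde f u t x) (ftm t x (\<mu> t)) (\<mu> t)" using ft t P by (auto simp: C1_scalar_def)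
  have "has_lions_derivative M (f t x) (fm t x (\<mu> t)) (\<mu> t)" "has_lions_derivative_vec M (u t x) (um t x (\<mu> t)) (\<mu> t)"
    using f_C1 u_C1 t P by (auto simp: C1_vec_def C1_scalar_def)
  from has_lions_derivative_add[OF this(1) has_lions_derivative_norm_square[OF this(2)]]
  show "has_lions_derivative M (ftilde f u t x) (\<lambda>y. fm t x (\<mu> t) y + transpose (um t x (\<mu> t) y) *v u t x (\<mu> t)) (\<mu> t)"
    by (simp add: ftilde_def[abs_def])
qed

lemmas flow_bt = C1_vec_jointly_continuous[OF bt] and flow_ft = C1_scalar_jointly_continuous[OF ft]

text \<open>For a fixed first argument a Lions derivative is determined only a.e. in its second
  argument \<open>X t w\<close>, whereas the adjoint averages over the first argument
  \<open>X t w'\<close> at fixed \<open>w\<close>. Fubini for null sets exchanges the two.\<close>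

lemma AE_swap_copies:
  fixes h h' :: "'w \<Rightarrow> 'w \<Rightarrow> 'e::euclidean_space"
  assumes "\<And>w'. w' \<in> space M \<Longrightarrow> AE w in M. h w' w = h' w' w"
    and "(\<lambda>(w', w). h w' w) \<in> borel_measurable (M \<Otimes>\<^sub>M M)" "(\<lambda>(w', w). h' w' w) \<in> borel_measurable (M \<Otimes>\<^sub>M M)"
  shows "AE w in M. AE w' in M. h w' w = h' w' w"
proof -
  interpret pair_sigma_finite M M by unfold_locales
  have "(\<lambda>z. h (fst z) (snd z) - h' (fst z) (snd z)) \<in> borel_measurable (M \<Otimes>\<^sub>M M)"
    using assms(2,3) by (intro borel_measurable_diff) (simp_all add: case_prod_beta')
  from measurable_sets[OF this, of "{0}"]
  have "{z \<in> space (M \<Otimes>\<^sub>M M). h (fst z) (snd z) = h' (fst z) (snd z)} \<in> sets (M \<Otimes>\<^sub>M M)"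
    by (rule back_subst[of "\<lambda>S. S \<in> sets (M \<Otimes>\<^sub>M M)"]) auto
  from AE_commute[OF this] show ?thesis using assms(1) by (simp add: AE_I2)
qed

text \<open>By the chain rule, applied to \<open>a\<close>, the local basic terms exceed the lean
  ones by \<open>ux^T \<sigma>^T a\<close> from the drift and by \<open>ux^T u\<close> from the
  running cost, together \<open>ux^T p\<close>. The averaged terms behave alike, with
  \<open>um\<close> in place of \<open>ux\<close>; linearity in \<open>c - a\<close> does the
  rest.\<close>

lemma basic_drift_eq:
  assumes t: "t \<in> {0..T}"
  shows "AE w in M. linear_drift M X btx btm c t w + source_drift M X ftx ftm t w
    = linear_drift M X btx btm (\<lambda>t w. c t w - a t w) t w + D t w + linear_drift M X ux um p t w"
proof -
  define Kb where "Kb = max Lx Lm"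
  have bd: "bounded_derivs T Kb Kb btx btm"
    using bt_bounded unfolding bounded_derivs_def Kb_def by (meson max.coboundedI1 max.coboundedI2)
  obtain K where K: "0 \<le> K" "bounded_derivs T K K bx bm" by (rule b_bounded_derivs) blast
  note XM = X_measurable[OF t]
  have cs: "L2 M (c t)" by (rule is_adjointD(3)[OF basic_adjoint t])
  note as = a_L2[OF t]
  obtain Cs where fi: "\<And>w. integrable M (\<lambda>w'. fm t (X t w') (\<mu> t) (X t w))"
    by (rule source_bounds[OF flow_f growth_f]) (use t in blast)
  have pm: "(\<lambda>(w', w). B t (X t w') (\<mu> t) (X t w)) \<in> borel_measurable (M \<Otimes>\<^sub>M M)"
    if "flow_regular_pair M T B" for B :: "('d, real^'d \<Rightarrow> 'e::euclidean_space) coeff"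
    using flow_pair_section[OF that X_process t, of "\<lambda>z. X t (fst z)" "M \<Otimes>\<^sub>M M" "\<lambda>z. X t (snd z)"] XM
    by (simp add: case_prod_beta')
  note pm1 = pm[OF flow_b(2)] pm[OF flow_u(2)] pm[OF flow_f(2)] pm[OF flow_bt(2)] pm[OF flow_ft(2)]
  have um': "(\<lambda>(w', w). bm t (X t w') (\<mu> t) (X t w) + \<sigma> t ** um t (X t w') (\<mu> t) (X t w)) \<in> borel_measurable (M \<Otimes>\<^sub>M M)"
  proof -
    have "(\<lambda>A::real^'d^'m. \<sigma> t ** A) \<in> borel_measurable borel"
      unfolding matrix_matrix_mult_def
      by (intro borel_measurable_vec_nthI) (auto intro!: borel_measurable_sum borel_measurable_times borel_measurable_vec_nth)
    from measurable_compose[OF pm1(2) this] show ?thesis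
      using pm1(1) by (simp add: case_prod_beta')
  qed
  have uM: "(\<lambda>z. u t (X t (fst z)) (\<mu> t)) \<in> borel_measurable (M \<Otimes>\<^sub>M M)"
    by (rule flow_section[OF u_flow_regular X_process t measurable_compose[OF measurable_fst XM]])
  have fm': "(\<lambda>(w', w). fm t (X t w') (\<mu> t) (X t w) + transpose (um t (X t w') (\<mu> t) (X t w)) *v u t (X t w') (\<mu> t)) \<in> borel_measurable (M \<Otimes>\<^sub>M M)"
    using pm1(2,3) uM unfolding case_prod_beta' by measurable
  have 1: "AE w in M. AE w' in M. btm t (X t w') (\<mu> t) (X t w) = bm t (X t w') (\<mu> t) (X t w) + \<sigma> t ** um t (X t w') (\<mu> t) (X t w)"
    by (rule AE_swap_copies[OF btm_eq[OF t] pm1(4) um'])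
  have 2: "AE w in M. AE w' in M. ftm t (X t w') (\<mu> t) (X t w)
      = fm t (X t w') (\<mu> t) (X t w) + transpose (um t (X t w') (\<mu> t) (X t w)) *v u t (X t w') (\<mu> t)"
    by (rule AE_swap_copies[OF ftm_eq[OF t] pm1(5) fm'])
  show ?thesis
    using 1 2 AE_space
  proof eventually_elim
    case (elim w)
    let ?um = "\<lambda>w'. transpose (um t (X t w') (\<mu> t) (X t w))"
    let ?bm = "\<lambda>w'. transpose (bm t (X t w') (\<mu> t) (X t w))"
    let ?btm = "\<lambda>w'. transpose (btm t (X t w') (\<mu> t) (X t w))"
    have i_a: "integrable M (\<lambda>w'. ?bm w' *v a t w')" by (rule copy_integrable[OF t flow_b(2) K(2) as])
    have i_ua: "integrable M (\<lambda>w'. ?um w' *v (transpose (\<sigma> t) *v a t w'))"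
      by (rule copy_integrable[OF t flow_u(2) u_bounded_derivs \<sigma>a_L2[OF as]])
    have i_u\<alpha>: "integrable M (\<lambda>w'. ?um w' *v \<alpha> t w')"
      by (rule copy_integrable[OF t flow_u(2) u_bounded_derivs \<alpha>_L2[OF t]])
    have i_bta: "integrable M (\<lambda>w'. ?btm w' *v a t w')" by (rule copy_integrable[OF t flow_bt(2) bd as])
    have tr: "transpose (B + \<sigma> t ** U) *v q = transpose B *v q + transpose U *v (transpose (\<sigma> t) *v q)"
      for B :: "real^'d^'d" and U :: "real^'d^'m" and q
    proof -
      have "transpose (B + C) = transpose B + transpose C" for C :: "real^'d^'d" by (simp add: transpose_def vec_eq_iff)
      then show ?thesis by (simp add: matrix_transpose_mul matrix_vector_mult_add_rdistrib matrix_vector_mul_assoc)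
    qed
    have e1: "(LINT w'|M. ?btm w' *v a t w') = (LINT w'|M. ?bm w' *v a t w') + (LINT w'|M. ?um w' *v (transpose (\<sigma> t) *v a t w'))"
    proof -
      have "(LINT w'|M. ?btm w' *v a t w') = (LINT w'|M. ?bm w' *v a t w' + ?um w' *v (transpose (\<sigma> t) *v a t w'))"
      proof (rule integral_cong_AE)
        show "AE w' in M. ?btm w' *v a t w' = ?bm w' *v a t w' + ?um w' *v (transpose (\<sigma> t) *v a t w')"
          using elim(1) by eventually_elim (simp add: tr)
      qed (use i_a i_ua i_bta in \<open>auto intro: borel_measurable_integrable\<close>)
      then show ?thesis using i_a i_ua by simp
    qed
    have ftmM: "(\<lambda>w'. ftm t (X t w') (\<mu> t) (X t w)) \<in> borel_measurable M"
      by (rule flow_pair_section[OF flow_ft(2) X_process t XM]) simp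
    have e2: "(LINT w'|M. ftm t (X t w') (\<mu> t) (X t w)) = (LINT w'|M. fm t (X t w') (\<mu> t) (X t w)) + (LINT w'|M. ?um w' *v \<alpha> t w')"
    proof -
      have "(LINT w'|M. ftm t (X t w') (\<mu> t) (X t w)) = (LINT w'|M. fm t (X t w') (\<mu> t) (X t w) + ?um w' *v \<alpha> t w')"
        using elim(2) fi i_u\<alpha> ftmM by (intro integral_cong_AE) (auto simp: feedback_process_def intro!: borel_measurable_integrable)
      then show ?thesis using fi i_u\<alpha> by simp
    qed
    have e3: "(LINT w'|M. ?um w' *v p t w') = (LINT w'|M. ?um w' *v \<alpha> t w') + (LINT w'|M. ?um w' *v (transpose (\<sigma> t) *v a t w'))"
      using i_ua i_u\<alpha> by (simp add: p_def matrix_vector_right_distrib)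
    have e4: "transpose (btx t (X t w) (\<mu> t)) *v a t w + ftx t (X t w) (\<mu> t)
        = transpose (bx t (X t w) (\<mu> t)) *v a t w + fx t (X t w) (\<mu> t) + transpose (ux t (X t w) (\<mu> t)) *v p t w"
      unfolding btx_eq[OF t] ftx_eq[OF t] tr p_def feedback_process_def by (simp add: matrix_vector_right_distrib)
    have e5: "linear_drift M X btx btm (\<lambda>t w. c t w - a t w) t w = linear_drift M X btx btm c t w - linear_drift M X btx btm a t w"
      by (rule linear_drift_diff[where y = c and z = a and K = Kb, OF t flow_bt(2) bd cs as])
    have "linear_drift M X btx btm a t w + source_drift M X ftx ftm t w = D t w + linear_drift M X ux um p t w"
      unfolding linear_drift_def source_drift_def D_def using e1 e2 e3 e4 by (simp add: algebra_simps)
    then have "linear_drift M X btx btm c t w + source_drift M X ftx ftm t w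
        = linear_drift M X btx btm c t w - linear_drift M X btx btm a t w + (D t w + linear_drift M X ux um p t w)"
      by (metis (no_types, lifting) add.assoc diff_add_cancel)
    then show ?case unfolding e5 by (simp only: add.assoc)
  qed
qed

lemma basic_minus_lean_orthogonal:
  assumes t: "t \<in> {0..T}" and U: "U \<in> borel_measurable (F t)" "L2 M U"
  shows "(LINT w|M. U w \<bullet> (c t w - a t w)) = 0"
proof -
  define Kb where "Kb = max 0 (max Lx Lm)"
  have bd: "bounded_derivs T Kb Kb btx btm"
    using bt_bounded unfolding bounded_derivs_def Kb_def by (meson max.coboundedI1 max.coboundedI2)
  have Kb: "0 \<le> Kb" by (simp add: Kb_def)
  have T: "T \<in> {0..T}" using T_pos by simp
  obtain Ca where Ca: "0 \<le> Ca" "\<And>t. t \<in> {0..T} \<Longrightarrow> L2norm M (a t) \<le> Ca" by (rule a_bound) blast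
  obtain Cc where Cc: "\<And>t. t \<in> {0..T} \<Longrightarrow> L2norm M (c t) \<le> Cc" using is_adjointD(2)[OF basic_adjoint] by blast
  obtain CD where CD: "\<And>t. t \<in> {0..T} \<Longrightarrow> L2norm M (D t) \<le> CD" by (rule D_bounds) blast
  obtain Cp where Cp: "\<And>t. t \<in> {0..T} \<Longrightarrow> L2norm M (p t) \<le> Cp" by (rule p_bound) blast
  note cs = is_adjointD(3)[OF basic_adjoint] and cp = is_adjointD(1)[OF basic_adjoint]
  define e where "e t w = c t w - a t w" for t w
  have es: "L2 M (e t)" if "t \<in> {0..T}" for t
    unfolding e_def by (rule L2_diff[OF cs[OF that] a_L2[OF that]])
  have eC: "L2norm M (e t) \<le> Cc + Ca" if "t \<in> {0..T}" for t
    using L2norm_triangle[OF cs[OF that] L2_uminus[OF a_L2[OF that]]] Cc[OF that] Ca(2)[OF that]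
    by (simp add: e_def[abs_def])
  define Dc where "Dc t w = linear_drift M X btx btm c t w + source_drift M X ftx ftm t w" for t w
  \<comment> \<open>\<open>ftx\<close> and \<open>ftm\<close> come without a growth bound, so
    square-integrability of the basic drift \<open>Dc\<close> is read off this a.e. equal
    expression; joint measurability is proved for \<open>Dc\<close> itself.\<close>
  define S where "S t w = linear_drift M X btx btm e t w + D t w + linear_drift M X ux um p t w" for t w
  have l1: "L2 M (linear_drift M X btx btm e t)" "L2norm M (linear_drift M X btx btm e t) \<le> 2 * Kb * L2norm M (e t)"
    if t: "t \<in> {0..T}" for t
    using linear_drift_bounds(5,6)[OF X_process t flow_bt bd Kb, of e] es[OF t] by auto
  have l2: "L2 M (linear_drift M X ux um p t)" "L2norm M (linear_drift M X ux um p t) \<le> 2 * Ku * L2norm M (p t)"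
    if t: "t \<in> {0..T}" for t
    using linear_drift_bounds(5,6)[OF X_process t flow_u u_bounded_derivs Ku_nonneg, of p] p_L2[OF t] by auto
  have S_sq: "L2 M (S t)" if "t \<in> {0..T}" for t
    unfolding S_def[abs_def] by (intro L2_add l1(1)[OF that] D_L2[OF that] l2(1)[OF that])
  have S_bd: "L2norm M (S t) \<le> 2 * Kb * (Cc + Ca) + CD + 2 * Ku * Cp" if t: "t \<in> {0..T}" for t
  proof -
    have "L2norm M (S t) \<le> L2norm M (linear_drift M X btx btm e t) + L2norm M (D t) + L2norm M (linear_drift M X ux um p t)"
      unfolding S_def[abs_def]
      by (intro order_trans[OF L2norm_triangle add_right_mono[OF L2norm_triangle]] L2_add l1(1)[OF t] D_L2[OF t] l2(1)[OF t])
    moreover have "2 * Kb * L2norm M (e t) \<le> 2 * Kb * (Cc + Ca)" using eC[OF t] Kb by (intro mult_left_mono) auto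
    moreover have "2 * Ku * L2norm M (p t) \<le> 2 * Ku * Cp" using Cp[OF t] Ku_nonneg by (intro mult_left_mono) auto
    ultimately show ?thesis using l1(2)[OF t] l2(2)[OF t] CD[OF t] by linarith
  qed
  have Dc_dtP: "measurable_dtP Dc"
  proof -
    have "(\<lambda>z. (case z of (t, w) \<Rightarrow> linear_drift M X btx btm c t w) + (case z of (t, w) \<Rightarrow> source_drift M X ftx ftm t w)) \<in> borel_measurable (dtP M T)"
      by (intro borel_measurable_add linear_drift_measurable[OF X_process flow_bt continuous_process_dtP[OF cp]] source_drift_measurable[OF X_process flow_ft])
    then show ?thesis by (simp add: Dc_def case_prod_beta')
  qed
  have Dc_m: "Dc t \<in> borel_measurable M" if "t \<in> {0..T}" for t by (rule dtP_section[OF Dc_dtP that])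
  have eq: "AE w in M. S t w = Dc t w" if "t \<in> {0..T}" for t
    using basic_drift_eq[OF that] unfolding S_def Dc_def e_def by eventually_elim simp
  have Dc_sq: "L2 M (Dc t)" if "t \<in> {0..T}" for t
    by (rule L2_cong_AE[OF S_sq[OF that] Dc_m[OF that] eq[OF that]])
  have Dc_bd: "L2norm M (Dc t) \<le> 2 * Kb * (Cc + Ca) + CD + 2 * Ku * Cp" if "t \<in> {0..T}" for t
    using L2norm_cong_AE[OF eq[OF that] L2_measurable[OF S_sq[OF that]] Dc_m[OF that]] S_bd[OF that] by simp
  note Dc_sq_dtP = process_L2_dtP[OF Dc_dtP Dc_sq Dc_bd]
  have cd: "((\<lambda>s. c s w) has_vector_derivative (- Dc t w)) (at t within {0..T})" if "w \<in> space M" "t \<in> {0..T}" for t w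
    unfolding Dc_def by (rule is_adjointD(5)[OF basic_adjoint that])
  have "ip U (e t) = 0"
  proof (rule linear_drift_zero[OF flow_bt bd es eC _ t U])
    fix t and U :: "'w \<Rightarrow> real^'d" assume t: "t \<in> {0..T}" and U: "U \<in> borel_measurable (F t)" "L2 M U"
    note F1 = Fubini_inner(3)[OF U(2) D_L2_dtP, of "{}", simplified]
    note F2 = Fubini_inner(3)[OF U(2) Dc_sq_dtP, of "{}", simplified]
    have i1: "integrable lT (\<lambda>r. indicator {t..T} r * ip U (D r))"
      using lT_integrable_indicator[OF F1, of "{t..T}"] by simp
    have i2: "integrable lT (\<lambda>r. indicator {t..T} r * ip U (Dc r))"
      using lT_integrable_indicator[OF F2, of "{t..T}"] by simp
    have "ip U (c t) = ip U (c T)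
      + (LINT r|lT. indicator {t..T} r * ip U (Dc r))"
      by (rule backward_equation_integral[OF Dc_sq_dtP cd cs[OF T] cs[OF t] t U(2)])
    moreover have "ip U (c T) = ip U (a T)"
      using is_adjointD(4)[OF basic_adjoint] a_terminal by (intro Bochner_Integration.integral_cong) auto
    ultimately have "ip U (e t) = (LINT r|lT. indicator {t..T} r * ip U (Dc r))
        - (LINT r|lT. indicator {t..T} r * ip U (D r))"
      using a_equation[OF t U(2)] L2_inner[OF U(2) cs[OF t]] L2_inner[OF U(2) a_L2[OF t]]
      by (simp add: e_def inner_diff_right)
    also have "\<dots> = (LINT r|lT. indicator {t..T} r * ip U (Dc r) - indicator {t..T} r * ip U (D r))"
      using i1 i2 by simp
    also have "\<dots> = (LINT r|lT. indicator {t..T} r * (LINT w|M. U w \<bullet> linear_drift M X btx btm e r w))"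
    proof (rule integral_cong_AE)
      have e_dtP: "measurable_dtP e"
        using continuous_process_dtP[OF cp] a_dtP by (simp add: e_def case_prod_beta')
      have l_bd: "L2norm M (linear_drift M X btx btm e t) \<le> 2 * Kb * (Cc + Ca)" if "t \<in> {0..T}" for t
        using l1(2)[OF that] mult_left_mono[OF eC[OF that], of "2 * Kb"] Kb by linarith
      have "L2 (dtP M T) (\<lambda>(t, w). linear_drift M X btx btm e t w)"
        by (rule process_L2_dtP[OF linear_drift_measurable[OF X_process flow_bt e_dtP] l1(1) l_bd])
      from lT_integrable_indicator[OF Fubini_inner(3)[OF U(2) this, of "{}", simplified], of "{t..T}"]
      show "(\<lambda>r. indicator {t..T} r * (LINT w|M. U w \<bullet> linear_drift M X btx btm e r w)) \<in> borel_measurable lT"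
        by (auto intro: borel_measurable_integrable)
      \<comment> \<open>Criticality removes the source at almost every time only; under the time
        integral this is enough. It applies for \<open>r \<ge> t\<close> because \<open>U\<close>
        then belongs to the past of \<open>r\<close>.\<close>
      show "AE r in lT. indicator {t..T} r * ip U (Dc r) - indicator {t..T} r * ip U (D r)
          = indicator {t..T} r * (LINT w|M. U w \<bullet> linear_drift M X btx btm e r w)"
        using p_orthogonal AE_space
      proof eventually_elim
        case (elim r)
        then have r: "r \<in> {0..T}" by (simp add: space_restrict_space)
        show ?case
        proof (cases "r \<in> {t..T}")
          case True
          have z: "(LINT w|M. U w \<bullet> linear_drift M X ux um p r w) = 0"
            by (rule linear_drift_orthogonal[where K = Ku and t = r and y = p, OF r flow_u u_bounded_derivs Ku_nonneg p_L2[OF r] _ _ U(2)])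
              (use elim True measurable_F_mono[OF U(1), of r] in auto)
          have "ip U (Dc r) = ip U (S r)"
          proof (rule integral_cong_AE)
            show "AE w in M. U w \<bullet> Dc r w = U w \<bullet> S r w" using eq[OF r] by eventually_elim simp
          qed (use L2_inner[OF U(2) Dc_sq[OF r]] L2_inner[OF U(2) S_sq[OF r]] in \<open>auto intro: borel_measurable_integrable\<close>)
          also have "\<dots> = (LINT w|M. U w \<bullet> linear_drift M X btx btm e r w) + ip U (D r)"
            using z L2_inner[OF U(2) l1(1)[OF r]] L2_inner[OF U(2) D_L2[OF r]] L2_inner[OF U(2) l2(1)[OF r]]
            by (simp add: S_def inner_add_right)
          finally show ?thesis by (simp add: algebra_simps)
        qed simp
      qed
    qed (use i1 i2 in \<open>auto intro: borel_measurable_integrable\<close>)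
    finally show "ip U (e t) = (LINT r|lT. indicator {t..T} r * (LINT w|M. U w \<bullet> linear_drift M X btx btm e r w))" .
  qed
  then show ?thesis by (simp add: e_def)
qed

text \<open>Both parts of \<open>\<alpha> + \<sigma>^T c = p + \<sigma>^T (c - a)\<close> are
  orthogonal to the past.\<close>

lemma basic_orthogonal:
  "AE t in lT. \<forall>V. V \<in> borel_measurable (F t) \<longrightarrow> L2 M V \<longrightarrow>
     (LINT w|M. V w \<bullet> (\<alpha> t w + transpose (\<sigma> t) *v c t w)) = 0"
  using p_orthogonal AE_space
proof eventually_elim
  case (elim t)
  then have t: "t \<in> {0..T}" by (simp add: space_restrict_space)
  note cs = is_adjointD(3)[OF basic_adjoint t]
  show ?case
  proof (intro allI impI)
    fix V :: "'w \<Rightarrow> real^'m" assume V: "V \<in> borel_measurable (F t)" "L2 M V"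
    have sV: "(\<lambda>w. \<sigma> t *v V w) \<in> borel_measurable (F t)" "L2 M (\<lambda>w. \<sigma> t *v V w)"
      using V(1) L2_matrix_mult(1)[OF V(2), of "\<lambda>_. \<sigma> t" "norm (\<sigma> t)"] by auto
    note d = L2_diff[OF cs a_L2[OF t]]
    have "(LINT w|M. V w \<bullet> (\<alpha> t w + transpose (\<sigma> t) *v c t w)) = (LINT w|M. V w \<bullet> p t w + (\<sigma> t *v V w) \<bullet> (c t w - a t w))"
      by (simp add: p_def inner_matrix_transpose inner_add_right matrix_vector_mult_diff_distrib inner_diff_right)
    also have "\<dots> = ip V (p t) + (LINT w|M. (\<sigma> t *v V w) \<bullet> (c t w - a t w))"
      using L2_inner[OF V(2) p_L2[OF t]] L2_inner[OF sV(2) d] by simp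
    also have "\<dots> = 0" using elim(1) V basic_minus_lean_orthogonal[OF t sV] by simp
    finally show "(LINT w|M. V w \<bullet> (\<alpha> t w + transpose (\<sigma> t) *v c t w)) = 0" .
  qed
qed

lemma basic_critical: "stop_gradient_critical M T \<sigma> X c u"
proof -
  obtain Cc where Cc: "\<And>t. t \<in> {0..T} \<Longrightarrow> L2norm M (c t) \<le> Cc" using is_adjointD(2)[OF basic_adjoint] by blast
  show ?thesis by (rule critical_if_orthogonal[OF is_adjointD(1)[OF basic_adjoint] Cc basic_orthogonal])
qed

lemma basic_cond_exp:
  "AE t in lT. AE w in M. u t (X t w) (\<mu> t) = - (transpose (\<sigma> t) *v cond_exp_given M (X t) (c t) w)"
  using basic_orthogonal AE_space
proof eventually_elim
  case (elim t)
  then have t: "t \<in> {0..T}" by (simp add: space_restrict_space)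
  show ?case by (rule feedback_eq_cond_exp[OF t is_adjointD(3)[OF basic_adjoint t]]) (use elim in blast)
qed

end

section \<open>The adjoint processes compared with the lean adjoint\<close>

context
  fixes Y :: "real \<Rightarrow> 'w \<Rightarrow> real^'d" and Z :: "real \<Rightarrow> 'w \<Rightarrow> real^'m^'d"
  assumes YZ: "adjoint_processes M T W X0 X bx bm fx fm gx gm Y Z"
begin

lemma Y_L2: "t \<in> {0..T} \<Longrightarrow> L2 M (Y t)"
  and Y_bound: "\<exists>C. \<forall>t\<in>{0..T}. L2norm M (Y t) \<le> C"
  using YZ unfolding adjoint_processes_def by blast+

lemma Y_dtP: "measurable_dtP Y"
  by (rule prog_measurable_dtP) (use YZ in \<open>simp add: adjoint_processes_def\<close>)

text \<open>A test variable of the past of \<open>t\<close> is orthogonal to the stochastic integral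
  over \<open>[t,T]\<close>. The two equations share coefficients and terminal value, so the tested
  difference solves a homogeneous equation.\<close>

lemma Y_minus_lean_orthogonal:
  assumes t: "t \<in> {0..T}" and U: "U \<in> borel_measurable (F t)" "L2 M U"
  shows "(LINT w|M. U w \<bullet> (Y t w - a t w)) = 0"
proof -
  obtain K where K: "0 \<le> K" "bounded_derivs T K K bx bm" by (rule b_bounded_derivs) blast
  have T: "T \<in> {0..T}" using T_pos by simp
  obtain Ca where Ca: "0 \<le> Ca" "\<And>t. t \<in> {0..T} \<Longrightarrow> L2norm M (a t) \<le> Ca" by (rule a_bound) blast
  obtain Cy where Cy: "\<And>t. t \<in> {0..T} \<Longrightarrow> L2norm M (Y t) \<le> Cy" using Y_bound by blast
  obtain Cs where fi: "\<And>t w. t \<in> {0..T} \<Longrightarrow> integrable M (\<lambda>w'. fm t (X t w') (\<mu> t) (X t w))"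
    by (rule source_bounds[OF flow_f growth_f]) blast
  define e where "e t w = Y t w - a t w" for t w
  have es: "L2 M (e t)" if "t \<in> {0..T}" for t
    unfolding e_def by (rule L2_diff[OF Y_L2[OF that] a_L2[OF that]])
  have eC: "L2norm M (e t) \<le> Cy + Ca" if "t \<in> {0..T}" for t
    using L2norm_triangle[OF Y_L2[OF that] L2_uminus[OF a_L2[OF that]]] Cy[OF that] Ca(2)[OF that]
    by (simp add: e_def[abs_def])
  define DY where "DY t w = linear_drift M X bx bm Y t w + source_drift M X fx fm t w" for t w
  have DY: "L2_dtP DY" and DYs: "\<And>t. t \<in> {0..T} \<Longrightarrow> L2 M (DY t)"
    using full_drift_L2[OF Y_dtP Y_L2 Cy] unfolding DY_def[abs_def] by blast+
  have diff: "DY r w - D r w = linear_drift M X bx bm e r w" if r: "r \<in> {0..T}" for r w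
    using linear_drift_diff[where y = Y and z = a and K = K, OF r flow_b(2) K(2) Y_L2[OF r] a_L2[OF r]]
    by (simp add: DY_def D_def e_def[abs_def])
  have "ip U (e t) = 0"
  proof (rule linear_drift_zero[OF flow_b K(2) es eC _ t U])
    fix t and U :: "'w \<Rightarrow> real^'d" assume t: "t \<in> {0..T}" and U: "U \<in> borel_measurable (F t)" "L2 M U"
    have i1: "integrable lT (\<lambda>r. indicator {t..T} r * ip U (D r))"
      using lT_integrable_indicator[OF Fubini_inner(3)[OF U(2) D_L2_dtP, of "{}", simplified], of "{t..T}"] by simp
    have i2: "integrable lT (\<lambda>r. indicator {t..T} r * ip U (DY r))"
      using lT_integrable_indicator[OF Fubini_inner(3)[OF U(2) DY, of "{}", simplified], of "{t..T}"] by simp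
    obtain I where I: "has_ito_integral M F W t T Z I"
      and Yt: "AE w in M. Y t w = gx (X T w) (\<mu> T) + (LINT w'|M. gm (X T w') (\<mu> T) (X T w))
           + (LINT s:{t..T}|lborel.
                transpose (bx s (X s w) (\<mu> s)) *v Y s w + fx s (X s w) (\<mu> s)
                + (LINT w'|M. transpose (bm s (X s w') (\<mu> s) (X s w)) *v Y s w'
                     + fm s (X s w') (\<mu> s) (X s w)))
           - I w"
      using YZ t unfolding adjoint_processes_def by blast
    have Is: "L2 M I" by (rule has_ito_integral_L2[OF I]) (use t in auto)
    have I0: "ip U I = 0"
      by (rule has_ito_integral_orthogonal[OF I _ _ U]) (use t in auto)
    \<comment> \<open>The driver averages both copy terms under one integral sign; each is
      integrable on its own, so they separate into linear and source part.\<close>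
    have driver: "(LINT s:{t..T}|lborel. transpose (bx s (X s w) (\<mu> s)) *v Y s w + fx s (X s w) (\<mu> s)
          + (LINT w'|M. transpose (bm s (X s w') (\<mu> s) (X s w)) *v Y s w' + fm s (X s w') (\<mu> s) (X s w)))
        = (LINT r|lT. indicator {t..T} r *\<^sub>R DY r w)" (is "?L = _") for w
    proof -
      have "?L = (LINT s:{t..T}|lborel. DY s w)"
      proof (rule set_lebesgue_integral_cong)
        show "\<forall>s. s \<in> {t..T} \<longrightarrow> transpose (bx s (X s w) (\<mu> s)) *v Y s w + fx s (X s w) (\<mu> s)
          + (LINT w'|M. transpose (bm s (X s w') (\<mu> s) (X s w)) *v Y s w' + fm s (X s w') (\<mu> s) (X s w)) = DY s w"
        proof (intro allI impI)
          fix s assume "s \<in> {t..T}"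
          then have s: "s \<in> {0..T}" using t by auto
          show "transpose (bx s (X s w) (\<mu> s)) *v Y s w + fx s (X s w) (\<mu> s)
            + (LINT w'|M. transpose (bm s (X s w') (\<mu> s) (X s w)) *v Y s w' + fm s (X s w') (\<mu> s) (X s w)) = DY s w"
            using copy_integrable[OF s flow_b(2) K(2) Y_L2[OF s]] fi[OF s]
            by (simp add: DY_def linear_drift_def source_drift_def)
        qed
      qed simp
      also have "\<dots> = (LINT r|lT. indicator {t..T} r *\<^sub>R DY r w)" by (rule lT_integral_subset[symmetric]) (use t in auto)
      finally show ?thesis .
    qed
    have Yt': "AE w in M. (LINT r|lT. indicator {t..T} r *\<^sub>R DY r w) = Y t w - a T w + I w"
      using Yt AE_space
    proof eventually_elim
      case (elim w)
      then show ?case unfolding driver a_terminal[OF elim(2)] source_drift_def by simp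
    qed
    have "(LINT r|lT. indicator {t..T} r * ip U (DY r)) = (LINT w|M. U w \<bullet> (LINT r|lT. indicator {t..T} r *\<^sub>R DY r w))"
      by (rule Fubini_inner(2)[OF U(2) DY, symmetric]) simp
    also have "\<dots> = (LINT w|M. U w \<bullet> (Y t w - a T w + I w))"
    proof (rule integral_cong_AE)
      show "AE w in M. U w \<bullet> (LINT r|lT. indicator {t..T} r *\<^sub>R DY r w) = U w \<bullet> (Y t w - a T w + I w)"
        using Yt' by eventually_elim simp
      show "(\<lambda>w. U w \<bullet> (LINT r|lT. indicator {t..T} r *\<^sub>R DY r w)) \<in> borel_measurable M"
        using Fubini_inner(1)[OF U(2) DY, of "{t..T}"] by simp
      show "(\<lambda>w. U w \<bullet> (Y t w - a T w + I w)) \<in> borel_measurable M"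
        by (intro borel_measurable_integrable L2_inner[OF U(2)] L2_add L2_diff
            Y_L2[OF t] a_L2[OF T] Is)
    qed
    also have "\<dots> = ip U (Y t) - ip U (a T)"
      using L2_inner[OF U(2) Y_L2[OF t]] L2_inner[OF U(2) a_L2[OF T]] L2_inner[OF U(2) Is] I0
      by (simp add: inner_add_right inner_diff_right)
    finally have Yeq: "(LINT r|lT. indicator {t..T} r * ip U (DY r))
        = ip U (Y t) - ip U (a T)" .
    have "ip U (e t) = (LINT r|lT. indicator {t..T} r * ip U (DY r))
        - (LINT r|lT. indicator {t..T} r * ip U (D r))"
      unfolding Yeq using a_equation[OF t U(2)] L2_inner[OF U(2) Y_L2[OF t]] L2_inner[OF U(2) a_L2[OF t]]
      by (simp add: e_def inner_diff_right)
    also have "\<dots> = (LINT r|lT. indicator {t..T} r * ip U (DY r) - indicator {t..T} r * ip U (D r))"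
      using i1 i2 by simp
    also have "\<dots> = (LINT r|lT. indicator {t..T} r * (LINT w|M. U w \<bullet> linear_drift M X bx bm e r w))"
    proof (rule Bochner_Integration.integral_cong[OF refl])
      fix r assume "r \<in> space lT"
      then have r: "r \<in> {0..T}" by (simp add: space_restrict_space)
      have "(LINT w|M. U w \<bullet> linear_drift M X bx bm e r w) = ip U (DY r) - ip U (D r)"
        using L2_inner[OF U(2) DYs[OF r]] L2_inner[OF U(2) D_L2[OF r]]
        by (simp add: diff[OF r, symmetric] inner_diff_right)
      then show "indicator {t..T} r * ip U (DY r) - indicator {t..T} r * ip U (D r)
          = indicator {t..T} r * (LINT w|M. U w \<bullet> linear_drift M X bx bm e r w)" by (simp add: right_diff_distrib)
    qed
    finally show "ip U (e t) = (LINT r|lT. indicator {t..T} r * (LINT w|M. U w \<bullet> linear_drift M X bx bm e r w))" .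
  qed
  then show ?thesis by (simp add: e_def)
qed

end

end

section \<open>Sufficiency\<close>

text \<open>L-convexity quantifies over pairs of variables on the product type;
  \<open>(\<xi>, \<xi>')\<close> is realised there by the two coordinates under its joint
  law.\<close>

lemma (in prob_space) joint_law:
  fixes \<xi> \<xi>' :: "'a \<Rightarrow> real^'d" and h :: "real^'d \<Rightarrow> real^'d"
  assumes \<xi>: "L2 M \<xi>" and \<xi>': "L2 M \<xi>'" and h: "h \<in> borel_measurable borel"
  defines "N \<equiv> law M (\<lambda>w. (\<xi> w, \<xi>' w))"
  shows "prob_space N" "L2 N fst" "L2 N snd" "law N fst = law M \<xi>" "law N snd = law M \<xi>'"
    "(LINT z|N. h (fst z) \<bullet> (snd z - fst z)) = (LINT w|M. h (\<xi> w) \<bullet> (\<xi>' w - \<xi> w))"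
proof -
  have [measurable]: "\<xi> \<in> borel_measurable M" "\<xi>' \<in> borel_measurable M" "h \<in> borel_measurable borel" using \<xi> \<xi>' h by auto
  have m: "(\<lambda>w. (\<xi> w, \<xi>' w)) \<in> borel_measurable M" by measurable
  have fs: "fst \<in> borel_measurable (borel :: ((real^'d) \<times> (real^'d)) measure)" "snd \<in> borel_measurable (borel :: ((real^'d) \<times> (real^'d)) measure)"
    by (intro borel_measurable_continuous_onI continuous_intros)+
  show "prob_space N" unfolding N_def by (rule prob_space_distr[OF m])
  show "L2 N fst" "L2 N snd"
    using \<xi> \<xi>' m fs by (auto simp: N_def sq_integrable_def integrable_distr_eq)
  show "law N fst = law M \<xi>" "law N snd = law M \<xi>'"
    unfolding N_def using m fs by (simp_all add: distr_distr comp_def)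
  show "(LINT z|N. h (fst z) \<bullet> (snd z - fst z)) = (LINT w|M. h (\<xi> w) \<bullet> (\<xi>' w - \<xi> w))"
    unfolding N_def by (subst integral_distr[OF m]) (use fs in \<open>auto intro!: measurable_compose[OF fs(1) h]\<close>)
qed

text \<open>Fubini on the product of two copies: the majorant \<open>q w + r w'\<close> places
  \<open>A\<close> in L2 of the product, so its inner product with \<open>V w'\<close> is
  integrable.\<close>

lemma (in prob_space) copy_swap:
  fixes A :: "'a \<Rightarrow> 'a \<Rightarrow> 'e::euclidean_space"
  assumes A: "(\<lambda>(w, w'). A w w') \<in> borel_measurable (M \<Otimes>\<^sub>M M)"
    and bd: "\<And>w w'. norm (A w w') \<le> q w + r w'"
    and q: "L2 M (q :: 'a \<Rightarrow> real)" and r: "L2 M (r :: 'a \<Rightarrow> real)" and V: "L2 M V"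
  shows "integrable M (\<lambda>w. LINT w'|M. A w w' \<bullet> V w')"
    and "(LINT w|M. LINT w'|M. A w w' \<bullet> V w') = (LINT w'|M. V w' \<bullet> (LINT w|M. A w w'))"
proof -
  interpret P: pair_prob_space M M ..
  have fst': "L2 (M \<Otimes>\<^sub>M M) (\<lambda>z. Q (fst z))" and snd': "L2 (M \<Otimes>\<^sub>M M) (\<lambda>z. Q (snd z))"
    if Q: "L2 M Q" for Q :: "'a \<Rightarrow> 'b::euclidean_space"
  proof -
    have [measurable]: "Q \<in> borel_measurable M" using Q by measurable
    have "integrable (distr (M \<Otimes>\<^sub>M M) M fst) (\<lambda>x. (norm (Q x))\<^sup>2)"
      using Q by (simp add: distr_pair_fst sq_integrable_def)
    then show 1: "L2 (M \<Otimes>\<^sub>M M) (\<lambda>z. Q (fst z))" by (simp add: sq_integrable_def integrable_distr_eq)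
    then have "integrable (M \<Otimes>\<^sub>M M) (\<lambda>(x, y). (norm (Q x))\<^sup>2)" by (simp add: sq_integrable_def case_prod_beta')
    from P.integrable_product_swap[OF this] show "L2 (M \<Otimes>\<^sub>M M) (\<lambda>z. Q (snd z))"
      by (simp add: sq_integrable_def case_prod_beta')
  qed
  have "L2 (M \<Otimes>\<^sub>M M) (\<lambda>z. A (fst z) (snd z))"
  proof (rule L2_bound[OF L2_add[OF fst'[OF q] snd'[OF r]], of _ 1])
    show "AE z in M \<Otimes>\<^sub>M M. norm (A (fst z) (snd z)) \<le> 1 * norm (q (fst z) + r (snd z))"
      using bd by (intro AE_I2) (simp add: order_trans[OF bd abs_ge_self])
  qed (use A in \<open>simp add: case_prod_beta'\<close>)
  from L2_inner[OF this snd'[OF V]]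
  have i: "integrable (M \<Otimes>\<^sub>M M) (\<lambda>(w, w'). A w w' \<bullet> V w')" by (simp add: case_prod_beta')
  show "integrable M (\<lambda>w. LINT w'|M. A w w' \<bullet> V w')" using P.integrable_fst'[OF i] by simp
  have "(LINT w|M. A w w' \<bullet> V w') = V w' \<bullet> (LINT w|M. A w w')" if w: "w' \<in> space M" for w'
  proof -
    have "(\<lambda>w. (w, w')) \<in> measurable M (M \<Otimes>\<^sub>M M)" using w by measurable
    from measurable_compose[OF this A] have m: "(\<lambda>w. A w w') \<in> borel_measurable M" by simp
    have "integrable M (\<lambda>w. A w w')"
    proof (rule Bochner_Integration.integrable_bound[OF _ m])
      show "integrable M (\<lambda>w. q w + r w')" using L2_integrable[OF q] by simp
      show "AE w in M. norm (A w w') \<le> norm (q w + r w')"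
        by (intro AE_I2) (simp add: order_trans[OF bd abs_ge_self])
    qed
    then show ?thesis by (simp add: inner_commute[of "V _"])
  qed
  then show "(LINT w|M. LINT w'|M. A w w' \<bullet> V w') = (LINT w'|M. V w' \<bullet> (LINT w|M. A w w'))"
    using P.Fubini_integral[OF i] by (simp cong: Bochner_Integration.integral_cong)
qed

context mean_field_feedback
begin

lemma \<alpha>_prog_sq_integrable: "prog_sq_integrable M F T \<alpha>"
proof -
  have m: "(\<lambda>(t, w). ennreal ((norm (\<alpha> t w))\<^sup>2)) \<in> borel_measurable (dtP M T)"
    using L2_measurable[OF \<alpha>_L2_dtP] by (simp add: case_prod_beta')
  have "(\<integral>\<^sup>+(t, w). ennreal ((norm (\<alpha> t w))\<^sup>2) \<partial>dtP M T) < \<infinity>"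
    using \<alpha>_L2_dtP by (simp add: sq_integrable_def integrable_iff_bounded case_prod_beta')
  then show ?thesis unfolding prog_sq_integrable_def using \<alpha>_prog dtP_nn_integral[OF m] by simp
qed

lemma quadratic_growth_integrable:
  assumes h: "flow_regular M T h" and gr: "quadratic_growth T h"
    and Y: "continuous_process M T Y" and C: "\<And>t. t \<in> {0..T} \<Longrightarrow> L2norm M (Y t) \<le> C"
  shows "integrable (dtP M T) (\<lambda>(t, w). h t (Y t w) (law M (Y t)))"
    and "t \<in> {0..T} \<Longrightarrow> integrable M (\<lambda>w. h t (Y t w) (law M (Y t)))"
proof -
  obtain Ch where Ch: "\<And>t x \<nu>. t \<in> {0..T} \<Longrightarrow> \<nu> \<in> P2 \<Longrightarrow> \<bar>h t x \<nu>\<bar> \<le> Ch * (1 + (norm x)\<^sup>2 + moment2 \<nu>)"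
    using gr unfolding quadratic_growth_def by blast
  have Ys: "L2 M (Y t)" if "t \<in> {0..T}" for t using Y that by (simp add: continuous_process_def)
  have bd: "norm (h t (Y t w) (law M (Y t))) \<le> norm (\<bar>Ch\<bar> * (1 + (norm (Y t w))\<^sup>2 + C\<^sup>2))" if t: "t \<in> {0..T}" for t w
  proof -
    have Ym: "Y t \<in> borel_measurable M" using Ys[OF t] by measurable
    have "\<bar>h t (Y t w) (law M (Y t))\<bar> \<le> Ch * (1 + (norm (Y t w))\<^sup>2 + moment2 (law M (Y t)))"
      by (rule Ch[OF t law_in_P2[OF Ys[OF t]]])
    also have "\<dots> \<le> \<bar>Ch\<bar> * (1 + (norm (Y t w))\<^sup>2 + C\<^sup>2)"
      unfolding moment2_law[OF Ym] using power_mono[OF C[OF t] L2norm_nonneg, of 2] by (intro mult_mono) auto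
    finally show ?thesis by simp
  qed
  show "integrable (dtP M T) (\<lambda>(t, w). h t (Y t w) (law M (Y t)))"
  proof (rule Bochner_Integration.integrable_bound)
    interpret D: finite_measure "dtP M T" by (rule finite_dtP)
    have "integrable (dtP M T) (\<lambda>(t, w). (norm (Y t w))\<^sup>2)"
      using L2_norm_sq[OF process_L2[OF Y C]] by (simp add: case_prod_beta')
    then show "integrable (dtP M T) (\<lambda>(t, w). \<bar>Ch\<bar> * (1 + (norm (Y t w))\<^sup>2 + C\<^sup>2))"
      by (simp add: case_prod_beta')
    show "(\<lambda>(t, w). h t (Y t w) (law M (Y t))) \<in> borel_measurable (dtP M T)"
      by (rule flow_dtP[OF h Y continuous_process_dtP[OF Y]])
    show "AE z in dtP M T. norm (case z of (t, w) \<Rightarrow> h t (Y t w) (law M (Y t))) \<le> norm (case z of (t, w) \<Rightarrow> \<bar>Ch\<bar> * (1 + (norm (Y t w))\<^sup>2 + C\<^sup>2))"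
      by (intro AE_I2) (use bd in \<open>auto simp: space_dtP\<close>)
  qed
  show "integrable M (\<lambda>w. h t (Y t w) (law M (Y t)))" if t: "t \<in> {0..T}"
  proof (rule Bochner_Integration.integrable_bound)
    show "integrable M (\<lambda>w. \<bar>Ch\<bar> * (1 + (norm (Y t w))\<^sup>2 + C\<^sup>2))"
      using L2_norm_sq[OF Ys[OF t]] by simp
    show "(\<lambda>w. h t (Y t w) (law M (Y t))) \<in> borel_measurable M"
      by (rule flow_section[OF h Y t L2_measurable[OF Ys[OF t]]])
  qed (use bd[OF t] in auto)
qed

lemma norm_L2: "L2 M Q \<Longrightarrow> L2 M (\<lambda>w. norm (Q w))"
  by (rule L2_bound[of M Q _ 1]) auto

lemma source_L2:
  assumes t: "t \<in> {0..T}" and k: "flow_regular M T k" and gr: "linear_growth_derivs T k l"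
  shows "L2 M (\<lambda>w. k t (X t w) (\<mu> t))"
proof -
  obtain C where C: "0 \<le> C" "\<And>t x. t \<in> {0..T} \<Longrightarrow> norm (k t x (\<mu> t)) \<le> C * (1 + norm x + sqrt (moment2 (\<mu> t)))"
    by (rule growth_along_flow[OF gr]) blast
  have "L2 M (\<lambda>w. C *\<^sub>R (1 + norm (X t w) + sqrt (moment2 (\<mu> t))))"
    by (intro L2_scaleR L2_add L2_const norm_L2 X_L2[OF t])
  then show ?thesis
    by (rule L2_bound[of _ _ _ 1])
      (use C(2)[OF t] in \<open>auto intro!: flow_section[OF k X_process t X_measurable[OF t]] intro: order_trans[OF _ abs_ge_self]\<close>)
qed

text \<open>Exchanging the two copies turns the Lions derivative terms of the convexity inequality into the
  mean-field terms of the adjoint equation.\<close>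

lemma drift_swap:
  assumes t: "t \<in> {0..T}" and A: "flow_regular M T A" and B: "flow_regular_pair M T B"
    and bd: "bounded_derivs T K K A B" and K: "0 \<le> K"
    and k: "flow_regular M T k" and l: "flow_regular_pair M T l" and gr: "linear_growth_derivs T k l"
    and y: "L2 M (y t :: 'w \<Rightarrow> real^'k)" and V: "L2 M V"
  shows "integrable M (\<lambda>w. (k t (X t w) (\<mu> t) + transpose (A t (X t w) (\<mu> t)) *v y t w) \<bullet> V w
      + (LINT w'|M. (l t (X t w) (\<mu> t) (X t w') + transpose (B t (X t w) (\<mu> t) (X t w')) *v y t w) \<bullet> V w'))"
    and "(LINT w|M. (k t (X t w) (\<mu> t) + transpose (A t (X t w) (\<mu> t)) *v y t w) \<bullet> V w
      + (LINT w'|M. (l t (X t w) (\<mu> t) (X t w') + transpose (B t (X t w) (\<mu> t) (X t w')) *v y t w) \<bullet> V w'))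
      = (LINT w|M. V w \<bullet> (linear_drift M X A B y t w + source_drift M X k l t w))"
proof -
  obtain C where C: "0 \<le> C" "\<And>t x. t \<in> {0..T} \<Longrightarrow> norm (k t x (\<mu> t)) \<le> C * (1 + norm x + sqrt (moment2 (\<mu> t)))"
    "\<And>t x y. t \<in> {0..T} \<Longrightarrow> norm (l t x (\<mu> t) y) \<le> C * (1 + norm x + sqrt (moment2 (\<mu> t)) + norm y)"
    by (rule growth_along_flow[OF gr]) blast
  obtain Cs where Ds: "L2 M (source_drift M X k l t)" and li: "\<And>w. integrable M (\<lambda>w'. l t (X t w') (\<mu> t) (X t w))"
    by (rule source_bounds[OF k l gr]) (use t in blast)
  note XM = X_measurable[OF t] and XS = norm_L2[OF X_L2[OF t]]
  note yi = copy_integrable[OF t B bd y]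
  define m where "m = sqrt (moment2 (\<mu> t))"
  define L where "L w w' = l t (X t w) (\<mu> t) (X t w') + transpose (B t (X t w) (\<mu> t) (X t w')) *v y t w" for w w'
  define S where "S w = k t (X t w) (\<mu> t) + transpose (A t (X t w) (\<mu> t)) *v y t w" for w
  have Ss: "L2 M S" unfolding S_def[abs_def]
    by (intro L2_add source_L2[OF t k gr] linear_drift_bounds(1)[where y = y and K = K, OF X_process t A B bd K y])
  have ld: "L2 M (linear_drift M X A B y t)"
    using linear_drift_bounds(5)[OF X_process t A B bd K, of y] y .
  have Lm: "(\<lambda>(w, w'). L w w') \<in> borel_measurable (M \<Otimes>\<^sub>M M)"
  proof -
    note X1 = measurable_compose[OF measurable_fst XM] and X2 = measurable_compose[OF measurable_snd XM]
    have ym: "y t \<in> borel_measurable M" using y by measurable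
    have "(\<lambda>z. L (fst z) (snd z)) \<in> borel_measurable (M \<Otimes>\<^sub>M M)"
      unfolding L_def
      by (intro borel_measurable_add matrix_vector_mult_measurable transpose_measurable flow_pair_section[OF l X_process t X1 X2]
          flow_pair_section[OF B X_process t X1 X2] measurable_compose[OF measurable_fst ym])
    then show ?thesis by (simp add: case_prod_beta')
  qed
  have Lb: "norm (L w w') \<le> (C *\<^sub>R (1 + norm (X t w) + m) + K *\<^sub>R norm (y t w)) + C *\<^sub>R norm (X t w')" for w w'
  proof -
    have "norm (transpose (B t (X t w) (\<mu> t) (X t w')) *v y t w) \<le> K * norm (y t w)"
      using bd t \<mu>_in_P2[OF t] by (intro order_trans[OF norm_matrix_vector_mult_le] mult_right_mono) (auto simp: bounded_derivs_def)
    then show ?thesis unfolding L_def m_def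
      using norm_triangle_ineq[of "l t (X t w) (\<mu> t) (X t w')" "transpose (B t (X t w) (\<mu> t) (X t w')) *v y t w"]
        C(3)[OF t, of "X t w" "X t w'"] by (simp add: algebra_simps)
  qed
  have q: "L2 M (\<lambda>w. C *\<^sub>R (1 + norm (X t w) + m) + K *\<^sub>R norm (y t w))" "L2 M (\<lambda>w. C *\<^sub>R norm (X t w))"
    by (intro L2_add L2_scaleR L2_const XS norm_L2[OF y])+
  note sw = copy_swap[OF Lm Lb q V]
  have SV: "integrable M (\<lambda>w. S w \<bullet> V w)" by (rule L2_inner[OF Ss V])
  show "integrable M (\<lambda>w. (k t (X t w) (\<mu> t) + transpose (A t (X t w) (\<mu> t)) *v y t w) \<bullet> V w
      + (LINT w'|M. (l t (X t w) (\<mu> t) (X t w') + transpose (B t (X t w) (\<mu> t) (X t w')) *v y t w) \<bullet> V w'))"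
    unfolding L_def[symmetric] S_def[symmetric] by (rule Bochner_Integration.integrable_add[OF SV sw(1)])
  \<comment> \<open>Averaging over the copy that carries the coefficients produces the mean-field
    terms of the adjoint drift; the local terms are those collected in \<open>S\<close>.\<close>
  have hat: "(LINT w|M. L w w') = linear_drift M X A B y t w' + source_drift M X k l t w' - S w'" for w'
    unfolding L_def linear_drift_def source_drift_def S_def using li yi by simp
  have "(LINT w|M. S w \<bullet> V w + (LINT w'|M. L w w' \<bullet> V w'))
      = ip S V + (LINT w|M. V w \<bullet> (linear_drift M X A B y t w + source_drift M X k l t w - S w))"
    unfolding Bochner_Integration.integral_add[OF SV sw(1)] sw(2) hat ..
  also have "\<dots> = (LINT w|M. V w \<bullet> (linear_drift M X A B y t w + source_drift M X k l t w))"
    unfolding inner_diff_right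
    using L2_inner[OF V Ss] L2_inner[OF V L2_add[OF ld Ds]]
    by (simp add: inner_commute[of "S _"])
  finally show "(LINT w|M. (k t (X t w) (\<mu> t) + transpose (A t (X t w) (\<mu> t)) *v y t w) \<bullet> V w
      + (LINT w'|M. (l t (X t w) (\<mu> t) (X t w') + transpose (B t (X t w) (\<mu> t) (X t w')) *v y t w) \<bullet> V w'))
      = (LINT w|M. V w \<bullet> (linear_drift M X A B y t w + source_drift M X k l t w))"
    unfolding L_def S_def .
qed

text \<open>Convexity comes with derivatives \<open>hx\<close>, \<open>hm\<close> of its own.
  Gradients are unique, and \<open>hm\<close> agrees with \<open>km\<close> a.e. under the law of
  \<open>X t\<close>, which is all that the integral sees.\<close>

lemma L_convexity_copies:
  fixes h :: "real^'d \<Rightarrow> (real^'d) measure \<Rightarrow> real"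
  assumes t: "t \<in> {0..T}" and \<xi>: "L2 M \<xi>"
    and hx: "GDERIV (\<lambda>x. h x (\<mu> t)) x :> hx" and hm: "has_lions_derivative M (h x) hm (\<mu> t)"
    and kx: "GDERIV (\<lambda>x. h x (\<mu> t)) x :> kx" and km: "has_lions_derivative M (h x) km (\<mu> t)"
    and cv: "\<And>(N :: ((real^'d) \<times> (real^'d)) measure) V V'. prob_space N \<Longrightarrow> L2 N V \<Longrightarrow> L2 N V' \<Longrightarrow>
      law N V = \<mu> t \<Longrightarrow> law N V' = law M \<xi> \<Longrightarrow>
      h x (\<mu> t) + hx \<bullet> (x' - x) + (LINT z|N. hm (V z) \<bullet> (V' z - V z)) \<le> h x' (law M \<xi>)"
  shows "h x (\<mu> t) + (kx \<bullet> (x' - x) + (LINT w|M. km (X t w) \<bullet> (\<xi> w - X t w))) \<le> h x' (law M \<xi>)"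
proof -
  have eq: "hx = kx" by (rule gderiv_unique[OF hx kx])
  have meas: "D \<in> borel_measurable borel" if "has_lions_derivative M h D (\<mu> t)" for h D
    using L2_measurable[OF has_lions_derivative_sq[OF that]] by simp
  note J = joint_law[OF X_L2[OF t] \<xi> meas[OF hm]]
  have "(LINT w|M. hm (X t w) \<bullet> (\<xi> w - X t w)) = (LINT w|M. km (X t w) \<bullet> (\<xi> w - X t w))"
  proof (rule integral_cong_AE)
    have [measurable]: "\<xi> \<in> borel_measurable M" "X t \<in> borel_measurable M" using \<xi> X_measurable[OF t] by auto
    show "(\<lambda>w. hm (X t w) \<bullet> (\<xi> w - X t w)) \<in> borel_measurable M" "(\<lambda>w. km (X t w) \<bullet> (\<xi> w - X t w)) \<in> borel_measurable M"
      by (intro borel_measurable_inner measurable_compose[OF _ meas[OF hm]] measurable_compose[OF _ meas[OF km]]; simp)+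
    show "AE w in M. hm (X t w) \<bullet> (\<xi> w - X t w) = km (X t w) \<bullet> (\<xi> w - X t w)"
      using lions_derivative_unique[OF X_L2[OF t] hm km] by eventually_elim simp
  qed
  then show ?thesis using cv[OF J(1-5)] unfolding J(6) eq by simp
qed

text \<open>The inequality is taken at controls \<open>a = a' = 0\<close>: the control terms vanish
  and the trace is the same constant on both sides. The control cost is left out on purpose, as its
  exact expansion in \<open>running_cost_le\<close> yields more than convexity does.\<close>

lemma hamiltonian_convexity:
  assumes t: "t \<in> {0..T}" and \<xi>: "L2 M \<xi>"
    and cv: "L_convex M (\<lambda>x \<nu>. hamiltonian b \<sigma> f t x \<nu> y z)"
  shows "f t x (\<mu> t) + b t x (\<mu> t) \<bullet> y + ((fx t x (\<mu> t) + transpose (bx t x (\<mu> t)) *v y) \<bullet> (x' - x)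
      + (LINT w|M. (fm t x (\<mu> t) (X t w) + transpose (bm t x (\<mu> t) (X t w)) *v y) \<bullet> (\<xi> w - X t w)))
    \<le> f t x' (law M \<xi>) + b t x' (law M \<xi>) \<bullet> y"
proof -
  note P = \<mu>_in_P2[OF t]
  let ?h = "\<lambda>x \<nu>. hamiltonian b \<sigma> f t x \<nu> y z" and ?c = "trace (transpose (\<sigma> t) ** z)"
  have h0: "?h x \<nu> 0 = f t x \<nu> + b t x \<nu> \<bullet> y + ?c" for x \<nu> by (simp add: hamiltonian_def)
  from cv[unfolded L_convex_def] obtain hx hm ha where
    d: "\<forall>x. \<forall>\<nu>\<in>P2. \<forall>a. GDERIV (\<lambda>x'. ?h x' \<nu> a) x :> hx x \<nu> a \<and>
           GDERIV (\<lambda>a'. ?h x \<nu> a') a :> ha x \<nu> a \<and> has_lions_derivative M (\<lambda>\<nu>. ?h x \<nu> a) (hm x \<nu> a) \<nu>"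
    and c: "\<forall>x x' a a'. \<forall>\<nu>\<in>P2. \<forall>\<nu>'\<in>P2. \<forall>(N :: ((real^'d) \<times> (real^'d)) measure) V V'.
           prob_space N \<and> L2 N V \<and> L2 N V' \<and> law N V = \<nu> \<and> law N V' = \<nu>' \<longrightarrow>
           ?h x' \<nu>' a' \<ge> ?h x \<nu> a + hx x \<nu> a \<bullet> (x' - x) + ha x \<nu> a \<bullet> (a' - a) + (LINT z|N. hm x \<nu> a (V z) \<bullet> (V' z - V z))"
    by (elim exE conjE) (rule that)
  have "((\<lambda>x. f t x (\<mu> t)) has_derivative (\<lambda>v. v \<bullet> fx t x (\<mu> t))) (at x)" "((\<lambda>x. b t x (\<mu> t)) has_derivative (\<lambda>v. bx t x (\<mu> t) *v v)) (at x)"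
    and fm: "has_lions_derivative M (f t x) (fm t x (\<mu> t)) (\<mu> t)" and bm: "has_lions_derivative_vec M (b t x) (bm t x (\<mu> t)) (\<mu> t)"
    using f_C1 b_C1 t P by (auto simp: C1_scalar_def C1_vec_def gderiv_def)
  from has_derivative_add[OF has_derivative_add[OF this(1) has_derivative_inner_left[OF this(2), of y]] has_derivative_const[of ?c]]
  have kx: "GDERIV (\<lambda>x'. ?h x' (\<mu> t) 0) x :> fx t x (\<mu> t) + transpose (bx t x (\<mu> t)) *v y"
    by (simp add: gderiv_def h0 inner_matrix_transpose inner_add_right)
  from has_lions_derivative_add[OF has_lions_derivative_add[OF fm has_lions_derivative_inner[OF bm, of y]] has_lions_derivative_const[of M ?c]]
  have km: "has_lions_derivative M (\<lambda>\<nu>. ?h x \<nu> 0) (\<lambda>v. fm t x (\<mu> t) v + transpose (bm t x (\<mu> t) v) *v y) (\<mu> t)"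
    by (simp add: h0)
  have "?h x (\<mu> t) 0 + hx x (\<mu> t) 0 \<bullet> (x' - x) + (LINT z|N. hm x (\<mu> t) 0 (V z) \<bullet> (V' z - V z)) \<le> ?h x' (law M \<xi>) 0"
    if "prob_space N" "L2 N V" "L2 N V'" "law N V = \<mu> t" "law N V' = law M \<xi>" for N :: "((real^'d) \<times> (real^'d)) measure" and V V'
  proof -
    have "?h x (\<mu> t) 0 + hx x (\<mu> t) 0 \<bullet> (x' - x) + ha x (\<mu> t) 0 \<bullet> (0 - 0) + (LINT z|N. hm x (\<mu> t) 0 (V z) \<bullet> (V' z - V z)) \<le> ?h x' (law M \<xi>) 0"
      by (rule c[rule_format, OF P law_in_P2[OF \<xi>]]) (use that in simp)
    then show ?thesis by simp
  qed
  note cv' = this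
  have "GDERIV (\<lambda>x'. ?h x' (\<mu> t) 0) x :> hx x (\<mu> t) 0" "has_lions_derivative M (\<lambda>\<nu>. ?h x \<nu> 0) (hm x (\<mu> t) 0) (\<mu> t)"
    using d P by blast+
  from L_convexity_copies[where h = "\<lambda>x \<nu>. ?h x \<nu> 0", OF t \<xi> this kx km cv'] show ?thesis unfolding h0 by linarith
qed

lemma terminal_convexity:
  assumes t: "t \<in> {0..T}" and \<xi>: "L2 M \<xi>" and cv: "L_convex_terminal M g"
  shows "g x (\<mu> t) + (gx x (\<mu> t) \<bullet> (x' - x) + (LINT w|M. gm x (\<mu> t) (X t w) \<bullet> (\<xi> w - X t w))) \<le> g x' (law M \<xi>)"
proof -
  note P = \<mu>_in_P2[OF t]
  from cv[unfolded L_convex_terminal_def] obtain hx hm where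
    d: "\<forall>x. \<forall>\<nu>\<in>P2. GDERIV (\<lambda>x'. g x' \<nu>) x :> hx x \<nu> \<and> has_lions_derivative M (g x) (hm x \<nu>) \<nu>"
    and c: "\<forall>x x'. \<forall>\<nu>\<in>P2. \<forall>\<nu>'\<in>P2. \<forall>(N :: ((real^'d) \<times> (real^'d)) measure) V V'.
           prob_space N \<and> L2 N V \<and> L2 N V' \<and> law N V = \<nu> \<and> law N V' = \<nu>' \<longrightarrow>
           g x' \<nu>' \<ge> g x \<nu> + hx x \<nu> \<bullet> (x' - x) + (LINT z|N. hm x \<nu> (V z) \<bullet> (V' z - V z))"
    by (elim exE conjE) (rule that)
  have kx: "GDERIV (\<lambda>x'. g x' (\<mu> t)) x :> gx x (\<mu> t)" and km: "has_lions_derivative M (g x) (gm x (\<mu> t)) (\<mu> t)"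
    using g_C1 t P by (auto simp: C1_scalar_def)
  show ?thesis
    by (rule L_convexity_copies[OF t \<xi> _ _ kx km, of "hx x (\<mu> t)" "hm x (\<mu> t)"]) (use c d P law_in_P2[OF \<xi>] in blast)+
qed

text \<open>The cost is rewritten with the expectation inside the time integral, the order in which
  the running inequality is available.\<close>

lemma cost_integral:
  assumes \<gamma>: "L2_dtP \<gamma>"
    and Y: "continuous_process M T Y" and C: "\<forall>t\<in>{0..T}. L2norm M (Y t) \<le> C"
  shows "integrable lT (\<lambda>t. (LINT w|M. f t (Y t w) (law M (Y t)) + (norm (\<gamma> t w))\<^sup>2 / 2))"
    and "cost M T f g \<gamma> Y = (LINT t|lT. (LINT w|M. f t (Y t w) (law M (Y t)) + (norm (\<gamma> t w))\<^sup>2 / 2))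
      + (LINT w|M. g (Y T w) (law M (Y T)))"
proof -
  have "quadratic_growth T f" "quadratic_growth T (\<lambda>_. g)" using coefficients by (simp_all add: mf_coefficients_def)
  note fI = quadratic_growth_integrable(1)[OF f_flow_regular this(1) Y bspec[OF C]]
    and gI = quadratic_growth_integrable(2)[OF g_flow_regular this(2) Y bspec[OF C]]
  have gT: "integrable M (\<lambda>w. g (Y T w) (law M (Y T)))" using gI[of T] T_pos by simp
  have i: "integrable (dtP M T) (\<lambda>(t, w). f t (Y t w) (law M (Y t)) + (norm (\<gamma> t w))\<^sup>2 / 2)"
    using fI L2_norm_sq[OF \<gamma>] by (simp add: case_prod_beta')
  show "integrable lT (\<lambda>t. (LINT w|M. f t (Y t w) (law M (Y t)) + (norm (\<gamma> t w))\<^sup>2 / 2))"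
    by (rule dtP_integrable_fst[OF i])
  show "cost M T f g \<gamma> Y = (LINT t|lT. (LINT w|M. f t (Y t w) (law M (Y t)) + (norm (\<gamma> t w))\<^sup>2 / 2))
      + (LINT w|M. g (Y T w) (law M (Y T)))"
    unfolding cost_def lT_integral[symmetric] Bochner_Integration.integral_add[OF dtP_integrable_snd[OF i] gT]
      dtP_integral_snd[OF i] dtP_integral_fst[OF i] ..
qed

end

context mean_field_critical
begin

text \<open>Integration by parts, in expectation.\<close>

lemma adjoint_duality:
  fixes \<kappa> \<Delta> :: "real \<Rightarrow> 'w \<Rightarrow> real^'d"
  assumes \<kappa>: "L2_dtP \<kappa>"
    and \<Delta>: "\<forall>t\<in>{0..T}. AE w in M. \<Delta> t w = (LINT r|lT. indicator {0..t} r *\<^sub>R \<kappa> r w)"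
    and \<Delta>s: "\<forall>t\<in>{0..T}. L2 M (\<Delta> t)"
  shows "integrable lT (\<lambda>t. ip (\<kappa> t) (a t))" "integrable lT (\<lambda>t. (LINT w|M. D t w \<bullet> \<Delta> t w))"
    and "(LINT w|M. a T w \<bullet> \<Delta> T w)
      = (LINT t|lT. ip (\<kappa> t) (a t)) - (LINT t|lT. (LINT w|M. D t w \<bullet> \<Delta> t w))"
proof -
  interpret L: finite_measure lT by (rule finite_lT)
  interpret LL: pair_sigma_finite lT lT ..
  have T: "T \<in> {0..T}" using T_pos by simp
  obtain CD where CD: "\<And>t. t \<in> {0..T} \<Longrightarrow> L2norm M (D t) \<le> CD" by (rule D_bounds) blast
  have CD0: "0 \<le> CD" using order_trans[OF L2norm_nonneg CD[of 0]] T_pos by simp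
  have i1: "integrable (dtP M T) (\<lambda>(t, w). \<kappa> t w \<bullet> a t w)"
    using L2_inner[OF \<kappa> a_L2_dtP] by (simp add: case_prod_beta')
  show I1: "integrable lT (\<lambda>t. ip (\<kappa> t) (a t))" by (rule dtP_integrable_fst[OF i1])
  have \<Delta>_inner: "(LINT w|M. U w \<bullet> \<Delta> t w) = (LINT s|lT. indicator {0..t} s * ip U (\<kappa> s))"
    if t: "t \<in> {0..T}" and U: "L2 M U" for t U
  proof -
    have "(LINT w|M. U w \<bullet> \<Delta> t w) = (LINT w|M. U w \<bullet> (LINT r|lT. indicator {0..t} r *\<^sub>R \<kappa> r w))"
    proof (rule integral_cong_AE)
      show "AE w in M. U w \<bullet> \<Delta> t w = U w \<bullet> (LINT r|lT. indicator {0..t} r *\<^sub>R \<kappa> r w)" using bspec[OF \<Delta> t] by eventually_elim simp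
    qed (use L2_inner[OF U bspec[OF \<Delta>s t]] Fubini_inner(1)[OF U \<kappa>, of "{0..t}"] in \<open>auto intro: borel_measurable_integrable\<close>)
    also have "\<dots> = (LINT s|lT. indicator {0..t} s * ip U (\<kappa> s))" by (rule Fubini_inner(2)[OF U \<kappa>]) simp
    finally show ?thesis .
  qed
  \<comment> \<open>The integrand on the triangle \<open>s \<le> r\<close>: integrated in
    \<open>s\<close> it gives \<open>E D r . \<Delta> r\<close>, integrated in \<open>r\<close> it
    gives \<open>E \<kappa> s . (a s - a T)\<close> by the adjoint equation.\<close>
  define k where "k s r = (if s \<le> r then ip (\<kappa> s) (D r) else 0)" for s r
  \<comment> \<open>A majorant of \<open>|k s r|\<close> for almost every \<open>s\<close>,
    integrable in time; it uses that a number is at most one plus its square for the L2 norm of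
    \<open>\<kappa> s\<close>.\<close>
  define c where "c s = CD * (1 + (LINT w|M. (norm (\<kappa> s w))\<^sup>2))" for s
  have c_int: "integrable lT c"
  proof -
    have "integrable (dtP M T) (\<lambda>(t, w). (norm (\<kappa> t w))\<^sup>2)"
      using L2_norm_sq[OF \<kappa>] by (simp add: case_prod_beta')
    from dtP_integrable_fst[OF this] show ?thesis unfolding c_def[abs_def] by simp
  qed
  have id: "(\<lambda>x. x) \<in> measurable lT (restrict_space borel {0..T})"
    by (rule measurable_ident_sets) (simp add: sets_restrict_space)
  have id': "(\<lambda>x. x) \<in> measurable lT borel" by (rule measurable_restrict_space1) simp
  have km: "(\<lambda>(s, r). k s r) \<in> borel_measurable (lT \<Otimes>\<^sub>M lT)"
  proof -
    have "(\<lambda>(z, w). \<kappa> (fst z) w \<bullet> D (snd z) w) \<in> borel_measurable ((lT \<Otimes>\<^sub>M lT) \<Otimes>\<^sub>M M)"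
      unfolding case_prod_beta'
      by (intro borel_measurable_inner dtP_compose[OF L2_measurable[OF \<kappa>]] dtP_compose[OF L2_measurable[OF D_L2_dtP]]
          measurable_compose[OF _ id] measurable_compose[OF measurable_fst measurable_fst] measurable_compose[OF measurable_fst measurable_snd] measurable_snd)
    then have m: "(\<lambda>z. (LINT w|M. \<kappa> (fst z) w \<bullet> D (snd z) w)) \<in> borel_measurable (lT \<Otimes>\<^sub>M lT)"
      by (rule borel_measurable_lebesgue_integral)
    have [measurable]: "fst \<in> borel_measurable (lT \<Otimes>\<^sub>M lT)" "snd \<in> borel_measurable (lT \<Otimes>\<^sub>M lT)"
      using measurable_compose[OF measurable_fst id'] measurable_compose[OF measurable_snd id'] by auto
    have "(\<lambda>z. if fst z \<le> snd z then (LINT w|M. \<kappa> (fst z) w \<bullet> D (snd z) w) else 0) \<in> borel_measurable (lT \<Otimes>\<^sub>M lT)"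
      using m by (intro measurable_If) auto
    then show ?thesis by (simp add: k_def case_prod_beta')
  qed
  have kb: "AE s in lT. \<forall>r\<in>{0..T}. norm (k s r) \<le> c s"
    using dtP_AE_L2[OF \<kappa>]
  proof eventually_elim
    case (elim s)
    show ?case
    proof
      fix r assume r: "r \<in> {0..T}"
      have "\<bar>ip (\<kappa> s) (D r)\<bar> \<le> L2norm M (\<kappa> s) * CD"
        by (rule order_trans[OF L2_Cauchy_Schwarz[OF elim D_L2[OF r]] mult_left_mono[OF CD[OF r]]]) simp
      also have "L2norm M (\<kappa> s) * CD \<le> c s"
      proof -
        have "2 * L2norm M (\<kappa> s) \<le> 1 + (L2norm M (\<kappa> s))\<^sup>2"
          using zero_le_power2[of "L2norm M (\<kappa> s) - 1"] by (simp add: power2_diff)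
        then have "L2norm M (\<kappa> s) \<le> 1 + (L2norm M (\<kappa> s))\<^sup>2" using L2norm_nonneg[of M "\<kappa> s"] by linarith
        from mult_left_mono[OF this CD0] show ?thesis by (simp add: c_def L2norm_power2 mult.commute)
      qed
      finally show "norm (k s r) \<le> c s" using CD0 by (auto simp: k_def c_def)
    qed
  qed
  have k_int: "integrable (lT \<Otimes>\<^sub>M lT) (\<lambda>(s, r). k s r)"
  proof (rule LL.Fubini_integrable[OF km])
    have m: "(\<lambda>s. LINT r|lT. norm (case (s, r) of (s, r) \<Rightarrow> k s r)) \<in> borel_measurable lT"
    proof -
      have "(\<lambda>(s, r). norm (k s r)) \<in> borel_measurable (lT \<Otimes>\<^sub>M lT)" using km by (simp add: case_prod_beta')
      from L.borel_measurable_lebesgue_integral[OF this] show ?thesis by simp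
    qed
    have ci: "integrable lT (\<lambda>s. measure lT (space lT) * c s)" using c_int by simp
    show "integrable lT (\<lambda>s. LINT r|lT. norm (case (s, r) of (s, r) \<Rightarrow> k s r))"
    proof (rule Bochner_Integration.integrable_bound[OF ci m])
      show "AE s in lT. norm (LINT r|lT. norm (case (s, r) of (s, r) \<Rightarrow> k s r)) \<le> norm (measure lT (space lT) * c s)"
        using kb
      proof eventually_elim
        case (elim s)
        have "norm (LINT r|lT. norm (k s r)) \<le> (LINT r|lT. c s)"
          by (rule norm_integral_le) (use elim in \<open>auto simp: space_restrict_space\<close>)
        then show ?case by (simp add: abs_if split: if_splits)
      qed
    qed
    show "AE s in lT. integrable lT (\<lambda>r. case (s, r) of (s, r) \<Rightarrow> k s r)"
      using kb AE_space
    proof eventually_elim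
      case (elim s)
      have "(\<lambda>r. k s r) \<in> borel_measurable lT"
        using measurable_compose[OF measurable_Pair1'[OF elim(2)] km] by simp
      then show ?case using elim(1) by (auto intro!: L.integrable_const_bound[where B = "c s"] simp: space_restrict_space)
    qed
  qed
  have D\<Delta>: "(LINT w|M. D r w \<bullet> \<Delta> r w) = (LINT s|lT. k s r)" if r: "r \<in> {0..T}" for r
    unfolding \<Delta>_inner[OF r D_L2[OF r]]
    by (rule Bochner_Integration.integral_cong) (auto simp: k_def space_restrict_space indicator_def inner_commute)
  show "integrable lT (\<lambda>t. (LINT w|M. D t w \<bullet> \<Delta> t w))"
    using LL.integrable_snd[OF k_int] D\<Delta> by (subst Bochner_Integration.integrable_cong[OF refl]) (auto simp: space_restrict_space)
  have I2: "integrable lT (\<lambda>s. ip (a T) (\<kappa> s))"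
    by (rule Fubini_inner(3)[OF a_L2[OF T] \<kappa>, of "{}"]) simp
  have "(LINT r|lT. (LINT w|M. D r w \<bullet> \<Delta> r w)) = (LINT r|lT. LINT s|lT. k s r)"
    by (rule Bochner_Integration.integral_cong) (auto simp: D\<Delta> space_restrict_space)
  also have "\<dots> = (LINT s|lT. LINT r|lT. k s r)" by (rule LL.Fubini_integral[OF k_int])
  also have "\<dots> = (LINT s|lT. ip (\<kappa> s) (a s) - ip (a T) (\<kappa> s))"
  proof (rule integral_cong_AE)
    show "(\<lambda>s. LINT r|lT. k s r) \<in> borel_measurable lT" using LL.integrable_fst[OF k_int] by auto
    show "(\<lambda>s. ip (\<kappa> s) (a s) - ip (a T) (\<kappa> s)) \<in> borel_measurable lT"
      using I1 I2 by auto
    show "AE s in lT. (LINT r|lT. k s r) = ip (\<kappa> s) (a s) - ip (a T) (\<kappa> s)"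
      using dtP_AE_L2[OF \<kappa>] AE_space
    proof eventually_elim
      case (elim s)
      then have s: "s \<in> {0..T}" by (simp add: space_restrict_space)
      have "(LINT r|lT. k s r) = (LINT r|lT. indicator {s..T} r * ip (\<kappa> s) (D r))"
        by (rule Bochner_Integration.integral_cong) (auto simp: k_def space_restrict_space indicator_def)
      then show ?case using a_equation[OF s elim(1)] by (simp add: inner_commute[of "a T _"])
    qed
  qed
  also have "\<dots> = (LINT s|lT. ip (\<kappa> s) (a s)) - (LINT s|lT. ip (a T) (\<kappa> s))"
    using I1 I2 by simp
  also have "(LINT s|lT. ip (a T) (\<kappa> s)) = (LINT w|M. a T w \<bullet> \<Delta> T w)"
    unfolding \<Delta>_inner[OF T a_L2[OF T]]
    by (rule Bochner_Integration.integral_cong) (auto simp: space_restrict_space)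
  finally show "(LINT w|M. a T w \<bullet> \<Delta> T w)
      = (LINT t|lT. ip (\<kappa> t) (a t)) - (LINT t|lT. (LINT w|M. D t w \<bullet> \<Delta> t w))" by simp
qed

text \<open>The convexity inequality of \<open>g\<close> is integrated and its copies are exchanged
  by \<open>drift_swap\<close> at time \<open>T\<close>, with \<open>y = 0\<close> so that only the
  source built from \<open>gx\<close> and \<open>gm\<close> remains; this source is
  \<open>a T\<close>.\<close>

lemma terminal_cost_le:
  assumes cv: "L_convex_terminal M g" and \<xi>: "L2 M \<xi>" and g': "integrable M (\<lambda>w. g (\<xi> w) (law M \<xi>))"
    and g0: "integrable M (\<lambda>w. g (X T w) (\<mu> T))"
  shows "(LINT w|M. g (X T w) (\<mu> T)) + (LINT w|M. a T w \<bullet> (\<xi> w - X T w)) \<le> (LINT w|M. g (\<xi> w) (law M \<xi>))"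
proof -
  obtain K where K: "0 \<le> K" "bounded_derivs T K K bx bm" by (rule b_bounded_derivs) blast
  have T: "T \<in> {0..T}" using T_pos by simp
  have V: "L2 M (\<lambda>w. \<xi> w - X T w)" by (rule L2_diff[OF \<xi> X_L2[OF T]])
  note sw = drift_swap[OF T flow_b K(2,1) flow_g growth_g _ V, where y = "\<lambda>_ _. 0 :: real^'d", simplified]
  have "linear_drift M X bx bm (\<lambda>_ _. 0) T w + source_drift M X (\<lambda>_. gx) (\<lambda>_. gm) T w = a T w" if "w \<in> space M" for w
    using a_terminal[OF that] by (simp add: linear_drift_def source_drift_def)
  then have "(LINT w|M. (\<xi> w - X T w) \<bullet> (linear_drift M X bx bm (\<lambda>_ _. 0) T w + source_drift M X (\<lambda>_. gx) (\<lambda>_. gm) T w))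
      = (LINT w|M. a T w \<bullet> (\<xi> w - X T w))"
    by (intro Bochner_Integration.integral_cong) (simp_all add: inner_commute)
  with sw(2) have eq: "(LINT w|M. gx (X T w) (\<mu> T) \<bullet> (\<xi> w - X T w) + (LINT w'|M. gm (X T w) (\<mu> T) (X T w') \<bullet> (\<xi> w' - X T w')))
      = (LINT w|M. a T w \<bullet> (\<xi> w - X T w))" by simp
  have "(LINT w|M. g (X T w) (\<mu> T) + (gx (X T w) (\<mu> T) \<bullet> (\<xi> w - X T w) + (LINT w'|M. gm (X T w) (\<mu> T) (X T w') \<bullet> (\<xi> w' - X T w'))))
      \<le> (LINT w|M. g (\<xi> w) (law M \<xi>))"
    by (rule integral_mono[OF Bochner_Integration.integrable_add[OF g0 sw(1)] g' terminal_convexity[OF T \<xi> cv]])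
  then show ?thesis unfolding Bochner_Integration.integral_add[OF g0 sw(1)] eq .
qed

section \<open>Comparison with another admissible control\<close>

context
  fixes Y :: "real \<Rightarrow> 'w \<Rightarrow> real^'d" and Z :: "real \<Rightarrow> 'w \<Rightarrow> real^'m^'d"
    and \<beta> :: "real \<Rightarrow> 'w \<Rightarrow> real^'m" and X' :: "real \<Rightarrow> 'w \<Rightarrow> real^'d"
  assumes YZ: "adjoint_processes M T W X0 X bx bm fx fm gx gm Y Z"
    and cv: "AE (t, w) in dtP M T. L_convex M (\<lambda>x \<nu>. hamiltonian b \<sigma> f t x \<nu> (Y t w) (Z t w))"
    and cvg: "L_convex_terminal M g"
    and \<beta>: "prog_sq_integrable M F T \<beta>" and X': "is_state M T W X0 b \<sigma> \<beta> X'"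
begin

lemma X'_L2: "t \<in> {0..T} \<Longrightarrow> L2 M (X' t)"
  using is_stateD(1)[OF X'] by (simp add: continuous_process_def)

text \<open>Exchanging \<open>Y\<close> for \<open>a\<close> rests on \<open>X' - X\<close> and the
  difference of the drifts \<open>b\<close> being adapted. The control part of the drift pairs with
  \<open>a\<close> as \<open>(\<beta> - \<alpha>) . (p - \<alpha>)\<close>: the \<open>p\<close>
  part has mean zero, and the rest cancels the cross term in the expansion of
  \<open>|\<beta>|^2 / 2\<close> around \<open>\<alpha>\<close>, so that exactly
  \<open>|\<beta> - \<alpha>|^2 / 2\<close> is gained.\<close>

lemma running_cost_le:
  "AE t in lT. (LINT w|M. f t (X t w) (\<mu> t) + (norm (\<alpha> t w))\<^sup>2 / 2) + (LINT w|M. (norm (\<beta> t w - \<alpha> t w))\<^sup>2) / 2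
      + (LINT w|M. D t w \<bullet> (X' t w - X t w))
    \<le> (LINT w|M. f t (X' t w) (law M (X' t)) + (norm (\<beta> t w))\<^sup>2 / 2)
      + (LINT w|M. ((b t (X' t w) (law M (X' t)) + \<sigma> t *v \<beta> t w) - (b t (X t w) (\<mu> t) + \<sigma> t *v \<alpha> t w)) \<bullet> a t w)"
proof -
  obtain K where K: "0 \<le> K" "bounded_derivs T K K bx bm" by (rule b_bounded_derivs) blast
  obtain C where C: "\<And>t. t \<in> {0..T} \<Longrightarrow> L2norm M (X t) \<le> C" using is_stateD(3)[OF state] by blast
  obtain C' where C': "\<And>t. t \<in> {0..T} \<Longrightarrow> L2norm M (X' t) \<le> C'" using is_stateD(3)[OF X'] by blast
  note X'p = is_stateD(1)[OF X']
  have gr: "quadratic_growth T f" using coefficients by (simp add: mf_coefficients_def)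
  have fI: "integrable M (\<lambda>w. f t (X t w) (\<mu> t))" if "t \<in> {0..T}" for t
    by (rule quadratic_growth_integrable(2)[OF f_flow_regular gr X_process C that])
  have fI': "integrable M (\<lambda>w. f t (X' t w) (law M (X' t)))" if "t \<in> {0..T}" for t
    by (rule quadratic_growth_integrable(2)[OF f_flow_regular gr X'p C' that])
  have bs: "L2 (dtP M T) (\<lambda>(t, w). b t (X t w) (\<mu> t))" by (rule b_L2[OF X_process C])
  have bs': "L2 (dtP M T) (\<lambda>(t, w). b t (X' t w) (law M (X' t)))" by (rule b_L2[OF X'p C'])
  \<comment> \<open>Convexity is used in iterated form: at almost every \<open>t\<close>, for almost
    every \<open>w\<close>, with \<open>Y t w\<close> and \<open>Z t w\<close> frozen as
    constants.\<close>
  have cv': "AE t in lT. AE w in M. L_convex M (\<lambda>x \<nu>. hamiltonian b \<sigma> f t x \<nu> (Y t w) (Z t w))"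
    using pair_sigma_finite.AE_pair[OF pair_dtP, folded dtP_def, OF cv] by simp
  show ?thesis
    using cv' p_orthogonal dtP_AE_L2[OF prog_sq_integrable_dtP[OF \<beta>]] dtP_AE_L2[OF bs]
      dtP_AE_L2[OF bs'] AE_space
  proof eventually_elim
    case (elim t)
    then have t: "t \<in> {0..T}" by (simp add: space_restrict_space)
    note Xs = X_L2[OF t] and Xs' = X'_L2[OF t] and as = a_L2[OF t]
      and \<alpha>s = \<alpha>_L2[OF t] and \<beta>s = elim(3) and Ys = Y_L2[OF YZ t] and Ds = D_L2[OF t]
    define V where "V w = X' t w - X t w" for w
    define B where "B w = b t (X' t w) (law M (X' t)) - b t (X t w) (\<mu> t)" for w
    define R where "R w = (fx t (X t w) (\<mu> t) + transpose (bx t (X t w) (\<mu> t)) *v Y t w) \<bullet> V w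
      + (LINT w'|M. (fm t (X t w) (\<mu> t) (X t w') + transpose (bm t (X t w) (\<mu> t) (X t w')) *v Y t w) \<bullet> V w')" for w
    have Vs: "L2 M V" unfolding V_def[abs_def] by (rule L2_diff[OF Xs' Xs])
    have VF: "V \<in> borel_measurable (F t)" unfolding V_def[abs_def]
      by (rule borel_measurable_diff[OF is_stateD(2)[OF X' t] X_adapted[OF t]])
    have Bs: "L2 M B" unfolding B_def[abs_def] by (rule L2_diff[OF elim(5,4)])
    have BF: "B \<in> borel_measurable (F t)" unfolding B_def[abs_def]
      by (intro borel_measurable_diff flow_section[OF b_flow_regular X'p t is_stateD(2)[OF X' t]] flow_section[OF b_flow_regular X_process t X_adapted[OF t]])
    have dF: "(\<lambda>w. \<beta> t w - \<alpha> t w) \<in> borel_measurable (F t)"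
    proof -
      have "prog_measurable F T \<beta>" using \<beta> by (simp add: prog_sq_integrable_def)
      from prog_measurable_section[OF this t] prog_measurable_section[OF \<alpha>_prog t] show ?thesis by measurable
    qed
    have ds: "L2 M (\<lambda>w. \<beta> t w - \<alpha> t w)" by (rule L2_diff[OF \<beta>s \<alpha>s])
    note sw = drift_swap[where y = Y and A = bx and B = bm and k = fx and l = fm, OF t flow_b K(2,1) flow_f growth_f Ys Vs, folded R_def]
    have "AE w in M. 0 \<le> f t (X' t w) (law M (X' t)) - f t (X t w) (\<mu> t) + B w \<bullet> Y t w - R w"
      using elim(1)
    proof eventually_elim
      case (elim w)
      from hamiltonian_convexity[OF t Xs' elim, of "X t w" "X' t w"]
      show ?case unfolding R_def V_def B_def inner_diff_left by linarith
    qed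
    then have "0 \<le> (LINT w|M. f t (X' t w) (law M (X' t)) - f t (X t w) (\<mu> t) + B w \<bullet> Y t w - R w)"
      by (rule integral_nonneg_AE)
    also have "\<dots> = (LINT w|M. f t (X' t w) (law M (X' t))) - (LINT w|M. f t (X t w) (\<mu> t))
        + ip B (Y t) - expectation R"
      using fI[OF t] fI'[OF t] L2_inner[OF Bs Ys] sw(1) by simp
    finally have ineq: "0 \<le> (LINT w|M. f t (X' t w) (law M (X' t))) - (LINT w|M. f t (X t w) (\<mu> t))
        + ip B (Y t) - expectation R" .
    have BY: "ip B (Y t) = ip B (a t)"
      using Y_minus_lean_orthogonal[OF YZ t BF Bs] L2_inner[OF Bs Ys] L2_inner[OF Bs as] by (simp add: inner_diff_right)
    have R: "expectation R = ip (D t) V"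
    proof -
      have es: "L2 M (\<lambda>w. Y t w - a t w)" by (rule L2_diff[OF Ys as])
      have ls: "L2 M (linear_drift M X bx bm (\<lambda>t w. Y t w - a t w) t)"
        by (rule linear_drift_bounds(5)[where y = "\<lambda>t w. Y t w - a t w", OF X_process t flow_b K(2,1) es])
      have "linear_drift M X bx bm (\<lambda>t w. Y t w - a t w) t w = linear_drift M X bx bm Y t w - linear_drift M X bx bm a t w" for w
        by (rule linear_drift_diff[where y = Y and z = a and K = K, OF t flow_b(2) K(2) Ys as])
      then have "V w \<bullet> (linear_drift M X bx bm Y t w + source_drift M X fx fm t w)
          = V w \<bullet> linear_drift M X bx bm (\<lambda>t w. Y t w - a t w) t w + V w \<bullet> D t w" for w
        by (simp add: D_def inner_add_right[symmetric])
      then have "expectation R = (LINT w|M. V w \<bullet> linear_drift M X bx bm (\<lambda>t w. Y t w - a t w) t w) + ip V (D t)"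
        using sw(2) L2_inner[OF Vs ls] L2_inner[OF Vs Ds] by simp
      \<comment> \<open>\<open>V = X' - X\<close> is adapted, so the linear drift of
        \<open>Y - a\<close>, averaged term included, is invisible to it.\<close>
      moreover have "(LINT w|M. V w \<bullet> linear_drift M X bx bm (\<lambda>t w. Y t w - a t w) t w) = 0"
        by (rule linear_drift_orthogonal[where y = "\<lambda>t w. Y t w - a t w" and K = K, OF t flow_b K(2,1) es Y_minus_lean_orthogonal[OF YZ t] VF Vs])
      ultimately show ?thesis by (simp add: inner_commute[of "D t _"])
    qed
    have "((b t (X' t w) (law M (X' t)) + \<sigma> t *v \<beta> t w) - (b t (X t w) (\<mu> t) + \<sigma> t *v \<alpha> t w)) \<bullet> a t w
        = B w \<bullet> a t w + (\<beta> t w - \<alpha> t w) \<bullet> p t w - (\<beta> t w - \<alpha> t w) \<bullet> \<alpha> t w" for w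
    proof -
      have "(\<sigma> t *v (\<beta> t w - \<alpha> t w)) \<bullet> a t w = (\<beta> t w - \<alpha> t w) \<bullet> (p t w - \<alpha> t w)"
        by (simp add: inner_matrix_transpose p_def)
      then show ?thesis by (simp add: B_def matrix_vector_mult_diff_distrib inner_diff_left inner_diff_right inner_add_left)
    qed
    then have \<kappa>: "(LINT w|M. ((b t (X' t w) (law M (X' t)) + \<sigma> t *v \<beta> t w) - (b t (X t w) (\<mu> t) + \<sigma> t *v \<alpha> t w)) \<bullet> a t w)
        = ip B (a t) - (LINT w|M. (\<beta> t w - \<alpha> t w) \<bullet> \<alpha> t w)"
      using elim(2) dF ds L2_inner[OF Bs as] L2_inner[OF ds p_L2[OF t]] L2_inner[OF ds \<alpha>s] by simp
    have "(norm (\<beta> t w))\<^sup>2 / 2 = (norm (\<alpha> t w))\<^sup>2 / 2 + (norm (\<beta> t w - \<alpha> t w))\<^sup>2 / 2 + (\<beta> t w - \<alpha> t w) \<bullet> \<alpha> t w" for w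
      unfolding power2_norm_eq_inner by (simp add: inner_diff_left inner_diff_right inner_commute[of "\<alpha> t w" "\<beta> t w"] field_simps)
    then have sq: "(LINT w|M. f t (X' t w) (law M (X' t)) + (norm (\<beta> t w))\<^sup>2 / 2) = (LINT w|M. f t (X' t w) (law M (X' t)))
        + (LINT w|M. (norm (\<alpha> t w))\<^sup>2) / 2 + (LINT w|M. (norm (\<beta> t w - \<alpha> t w))\<^sup>2) / 2 + (LINT w|M. (\<beta> t w - \<alpha> t w) \<bullet> \<alpha> t w)"
      using fI'[OF t] L2_norm_sq[OF \<alpha>s] L2_norm_sq[OF ds] L2_inner[OF ds \<alpha>s] by simp
    have "(LINT w|M. f t (X t w) (\<mu> t) + (norm (\<alpha> t w))\<^sup>2 / 2)
        = (LINT w|M. f t (X t w) (\<mu> t)) + (LINT w|M. (norm (\<alpha> t w))\<^sup>2) / 2"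
      using fI[OF t] L2_norm_sq[OF \<alpha>s] by simp
    then show ?case using ineq unfolding BY R \<kappa> sq V_def by linarith
  qed
qed

text \<open>After integration in time, the terms with \<open>D\<close> and with the drift difference
  combine through \<open>adjoint_duality\<close> into \<open>E a T . (X' T - X T)\<close>, which the
  terminal inequality absorbs.\<close>

lemma cost_gap: "cost M T f g \<alpha> X + (LINT t|lT. (LINT w|M. (norm (\<beta> t w - \<alpha> t w))\<^sup>2)) / 2 \<le> cost M T f g \<beta> X'"
proof -
  obtain C where C: "\<forall>t\<in>{0..T}. L2norm M (X t) \<le> C" using is_stateD(3)[OF state] by blast
  obtain C' where C': "\<forall>t\<in>{0..T}. L2norm M (X' t) \<le> C'" using is_stateD(3)[OF X'] by blast
  note X'p = is_stateD(1)[OF X'] and \<beta>s = prog_sq_integrable_dtP[OF \<beta>]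
  have T: "T \<in> {0..T}" using T_pos by simp
  have gr: "quadratic_growth T (\<lambda>_. g)" using coefficients by (simp add: mf_coefficients_def)
  define \<kappa> where "\<kappa> t w = (b t (X' t w) (law M (X' t)) + \<sigma> t *v \<beta> t w) - (b t (X t w) (\<mu> t) + \<sigma> t *v \<alpha> t w)" for t w
  have \<kappa>: "L2_dtP \<kappa>"
    using L2_diff[OF drift_L2[OF X' \<beta>s] drift_L2[OF state \<alpha>_L2_dtP]]
    by (simp add: \<kappa>_def case_prod_beta')
  have \<Delta>: "\<forall>t\<in>{0..T}. AE w in M. X' t w - X t w = (LINT r|lT. indicator {0..t} r *\<^sub>R \<kappa> r w)"
    unfolding \<kappa>_def by (intro ballI state_difference[OF state \<alpha>_L2_dtP X' \<beta>s])
  have \<Delta>s: "\<forall>t\<in>{0..T}. L2 M (\<lambda>w. X' t w - X t w)"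
    by (intro ballI L2_diff X'_L2 X_L2)
  note dual = adjoint_duality[where \<Delta> = "\<lambda>t w. X' t w - X t w", OF \<kappa> \<Delta> \<Delta>s]
  note c0 = cost_integral[OF \<alpha>_L2_dtP X_process C] and c1 = cost_integral[OF \<beta>s X'p C']
  have terminal: "(LINT w|M. g (X T w) (\<mu> T)) + (LINT w|M. a T w \<bullet> (X' T w - X T w)) \<le> (LINT w|M. g (X' T w) (law M (X' T)))"
    by (rule terminal_cost_le[OF cvg X'_L2[OF T] quadratic_growth_integrable(2)[OF g_flow_regular gr X'p bspec[OF C']]
        quadratic_growth_integrable(2)[OF g_flow_regular gr X_process bspec[OF C]]]) (use T in auto)
  have "integrable (dtP M T) (\<lambda>(t, w). (norm (\<beta> t w - \<alpha> t w))\<^sup>2)"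
    using L2_norm_sq[OF L2_diff[OF \<beta>s \<alpha>_L2_dtP]] by (simp add: case_prod_beta')
  note di = dtP_integrable_fst[OF this]
  have "(LINT t|lT. (LINT w|M. f t (X t w) (\<mu> t) + (norm (\<alpha> t w))\<^sup>2 / 2) + (LINT w|M. (norm (\<beta> t w - \<alpha> t w))\<^sup>2) / 2
      + (LINT w|M. D t w \<bullet> (X' t w - X t w)))
    \<le> (LINT t|lT. (LINT w|M. f t (X' t w) (law M (X' t)) + (norm (\<beta> t w))\<^sup>2 / 2) + ip (\<kappa> t) (a t))"
    using running_cost_le c0(1) c1(1) dual(1,2) di unfolding \<kappa>_def
    by (intro integral_mono_AE Bochner_Integration.integrable_add) auto
  then have "(LINT t|lT. (LINT w|M. f t (X t w) (\<mu> t) + (norm (\<alpha> t w))\<^sup>2 / 2)) + (LINT t|lT. (LINT w|M. (norm (\<beta> t w - \<alpha> t w))\<^sup>2)) / 2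
      + (LINT t|lT. (LINT w|M. D t w \<bullet> (X' t w - X t w)))
    \<le> (LINT t|lT. (LINT w|M. f t (X' t w) (law M (X' t)) + (norm (\<beta> t w))\<^sup>2 / 2)) + (LINT t|lT. ip (\<kappa> t) (a t))"
    using c0(1) c1(1) dual(1,2) di by simp
  then show ?thesis unfolding c0(2) c1(2) using terminal dual(3) by linarith
qed

lemma cost_minimal:
  "cost M T f g \<alpha> X \<le> cost M T f g \<beta> X'"
  "cost M T f g \<beta> X' = cost M T f g \<alpha> X \<Longrightarrow> AE (t, w) in dtP M T. \<beta> t w = \<alpha> t w"
proof -
  note ds = L2_diff[OF prog_sq_integrable_dtP[OF \<beta>] \<alpha>_L2_dtP]
  have i: "integrable (dtP M T) (\<lambda>(t, w). (norm (\<beta> t w - \<alpha> t w))\<^sup>2)"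
    using L2_norm_sq[OF ds] by (simp add: case_prod_beta')
  have eq: "(LINT t|lT. (LINT w|M. (norm (\<beta> t w - \<alpha> t w))\<^sup>2)) = (L2norm (dtP M T) (\<lambda>z. (case z of (t, w) \<Rightarrow> \<beta> t w) - (case z of (t, w) \<Rightarrow> \<alpha> t w)))\<^sup>2"
    unfolding dtP_integral_fst[OF i] L2norm_power2 by (simp add: case_prod_beta')
  show "cost M T f g \<alpha> X \<le> cost M T f g \<beta> X'" using cost_gap unfolding eq by (smt (verit) zero_le_power2 field_sum_of_halves)
  assume "cost M T f g \<beta> X' = cost M T f g \<alpha> X"
  then have "L2norm (dtP M T) (\<lambda>z. (case z of (t, w) \<Rightarrow> \<beta> t w) - (case z of (t, w) \<Rightarrow> \<alpha> t w)) = 0"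
    using cost_gap unfolding eq by simp
  from L2norm_eq_0_AE[OF ds this] show "AE (t, w) in dtP M T. \<beta> t w = \<alpha> t w"
    by (simp add: case_prod_beta')
qed

end

end

theorem proposition2p6:
  fixes M :: "'w measure" and T Lx Lm :: real
    and W :: "real \<Rightarrow> 'w \<Rightarrow> real^'m" and X0 :: "'w \<Rightarrow> real^'d" and \<mu>0 :: "(real^'d) measure"
    and \<sigma> :: "real \<Rightarrow> real^'m^'d"
    and b :: "real \<Rightarrow> real^'d \<Rightarrow> (real^'d) measure \<Rightarrow> real^'d"
    and f :: "real \<Rightarrow> real^'d \<Rightarrow> (real^'d) measure \<Rightarrow> real"
    and g :: "real^'d \<Rightarrow> (real^'d) measure \<Rightarrow> real"
    and bx btx :: "real \<Rightarrow> real^'d \<Rightarrow> (real^'d) measure \<Rightarrow> real^'d^'d"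
    and bm btm :: "real \<Rightarrow> real^'d \<Rightarrow> (real^'d) measure \<Rightarrow> real^'d \<Rightarrow> real^'d^'d"
    and fx ftx :: "real \<Rightarrow> real^'d \<Rightarrow> (real^'d) measure \<Rightarrow> real^'d"
    and fm ftm :: "real \<Rightarrow> real^'d \<Rightarrow> (real^'d) measure \<Rightarrow> real^'d \<Rightarrow> real^'d"
    and gx :: "real^'d \<Rightarrow> (real^'d) measure \<Rightarrow> real^'d"
    and gm :: "real^'d \<Rightarrow> (real^'d) measure \<Rightarrow> real^'d \<Rightarrow> real^'d"
    and u :: "real \<Rightarrow> real^'d \<Rightarrow> (real^'d) measure \<Rightarrow> real^'m"
    and X a_basic a_lean :: "real \<Rightarrow> 'w \<Rightarrow> real^'d"
  assumes "mf_space M T W X0 \<mu>0"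
    and "mf_coefficients M T \<sigma> b bx bm f fx fm g gx gm"
    and "regular_feedback M T u"
    and "is_state M T W X0 b \<sigma> (feedback_process M u X) X"
    and "C1_vec M T (btilde b \<sigma> u) btx btm" and "bounded_derivs T Lx Lm btx btm"
    and "C1_scalar M T (ftilde f u) ftx ftm"
    and "is_adjoint M T X btx btm ftx ftm gx gm a_basic"
    and "is_adjoint M T X bx bm fx fm gx gm a_lean"
    and "stop_gradient_critical M T \<sigma> X a_lean u"
  shows "stop_gradient_critical M T \<sigma> X a_basic u \<and>
    (AE t in restrict_space lborel {0..T}. AE \<omega> in M.
       u t (X t \<omega>) (law M (X t)) = - (transpose (\<sigma> t) *v cond_exp_given M (X t) (a_basic t) \<omega>)) \<and>
    (\<forall>Y Z. adjoint_processes M T W X0 X bx bm fx fm gx gm Y Z \<and>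
       L_convex_terminal M g \<and>
       (AE (t, \<omega>) in dtP M T. L_convex M (\<lambda>x \<mu>. hamiltonian b \<sigma> f t x \<mu> (Y t \<omega>) (Z t \<omega>))) \<longrightarrow>
       unique_minimizer M T W X0 b \<sigma> f g (feedback_process M u X) X)"
proof -
  interpret prob_space M using assms(1) by (simp add: mf_space_def)
  interpret mean_field_problem M T W X0 \<mu>0 \<sigma> b bx bm f fx fm g gx gm
    by unfold_locales (rule assms(1,2))+
  obtain ux um Kx Km where u: "jointly_continuous T u" "C1_vec M T u ux um" "bounded_derivs T Kx Km ux um"
    using assms(3) unfolding regular_feedback_def by blast
  \<comment> \<open>The locale carries a single constant for both derivatives of
    \<open>u\<close>.\<close>
  have "bounded_derivs T (max Kx Km) (max Kx Km) ux um"
    using u(3) unfolding bounded_derivs_def by (meson max.coboundedI1 max.coboundedI2)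
  then interpret mean_field_critical M T W X0 \<mu>0 \<sigma> b bx bm f fx fm g gx gm u ux um "max Kx Km" X a_lean
    by unfold_locales (rule u assms(4,9,10) | assumption)+
  note basic = assms(5,6,7,8)
  have "unique_minimizer M T W X0 b \<sigma> f g (feedback_process M u X) X"
    if "adjoint_processes M T W X0 X bx bm fx fm gx gm Y Z" "L_convex_terminal M g"
      "AE (t, w) in dtP M T. L_convex M (\<lambda>x \<mu>. hamiltonian b \<sigma> f t x \<mu> (Y t w) (Z t w))" for Y Z
    unfolding unique_minimizer_def using \<alpha>_prog_sq_integrable state cost_minimal[OF that(1,3,2)] by blast
  then show ?thesis using basic_critical[OF basic] basic_cond_exp[OF basic] by blast
qed

end
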